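(* Assume $R\in\mathbb S^m_{++}$, $Q-S^\top R^{-1}S\in\mathbb S^n_{++}$, $Q+\bar Q-S^\top R^{-1}S\in\mathbb S^n_{++}$, and that the systems $[A+\bar A,\Gamma+\bar\Gamma;B]$ and $[A,C,\Gamma;B,D]$ are $L^2$-stabilizable (defined in the context). Let $\mu_0\in\mathcal P_4(\mathbb R^n)$, let $\xi,\bar\xi\in L^4_{\mathcal F_0}$ both have law $\mu_0$ and be independent of $W$ and $W^0$. For $T>0$ let $(X_T,u_T)$ be the optimal pair of the finite-horizon mean field control problem on $[0,T]$ with initial state $\xi$, and let $(\bar X,\bar u)$ be the optimal pair of the ergodic mean field control problem with initial state $\bar\xi$ (both written out in the context). Then there exist constants $K,\lambda>0$, independent of $T$, such that for all $T>0$ $$\mathbb E\big[|X_T(t)-\bar X(t)|^2+|u_T(t)-\bar u(t)|^2\big]\le K\big(e^{-\lambda t}+e^{-\lambda(T-t)}\big),\quad\forall t\in[0,T].$$ Moreover, if $\xi=\bar\xi$, then $$\mathbb E\big[|X_T(t)-\bar X(t)|^2+|u_T(t)-\bar u(t)|^2\big]\le Ke^{-\lambda(T-t)},\quad\forall t\in[0,T].$$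
   Context: Notation. $\mathbb S^k,\mathbb S^k_+,\mathbb S^k_{++}$: real symmetric, positive semidefinite, positive definite $k\times k$ matrices; $\mathcal P_4(\mathbb R^n)$: probability measures with finite fourth moment. Fix $n,m\in\mathbb N^+$, $A,\bar A,C,\bar C,\Gamma,\bar\Gamma\in\mathbb R^{n\times n}$, $B,D\in\mathbb R^{n\times m}$, $Q,\bar Q\in\mathbb S^n$, $S\in\mathbb R^{m\times n}$, $R\in\mathbb S^m$, $b,\sigma,\gamma,q\in\mathbb R^n$, $r\in\mathbb R^m$. Probability space. $(\Omega,\mathcal F,\mathbb P)$ is complete and carries independent one-dimensional standard Brownian motions $W,W^0$ and an initial $\sigma$-algebra $\mathcal F_0$, independent of $(W,W^0)$, on which $\mathbb P$ is atomless; $\{\mathcal F_t^0\}$ is the augmented filtration of $W^0$; $\mathbb F$ is the complete right-continuous augmentation of the filtration generated by $W,W^0,\mathcal F_0$. $L^4_{\mathcal F_0}$: $\mathcal F_0$-measurable $\mathbb R^n$-valued $\xi$ with $\mathbb E|\xi|^4<\infty$. $L^2$-stabilizability. $[A+\bar A,\Gamma+\bar\Gamma;B]$ is $L^2$-stabilizable if there is $\bar\Theta\in\mathbb R^{m\times n}$ such that for every $y\in\mathbb R^n$ the solution of $dY=(A+\bar A+B\bar\Theta)Y\,dt+(\Gamma+\bar\Gamma)Y\,dW^0$, $Y(0)=y$, satisfies $\mathbb E\int_0^\infty|Y|^2dt<\infty$. $[A,C,\Gamma;B,D]$ is $L^2$-stabilizable if there is $\Theta\in\mathbb R^{m\times n}$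 such that for every $\xi\in L^4_{\mathcal F_0}$ the solution of $dX=(A+B\Theta)X\,dt+(C+D\Theta)X\,dW+\Gamma X\,dW^0$, $X(0)=\xi$, satisfies $\mathbb E\int_0^\infty|X|^2dt<\infty$. Maps. $\hat A=A+\bar A$, $\hat C=C+\bar C$, $\hat\Gamma=\Gamma+\bar\Gamma$, $\hat Q=Q+\bar Q$. For $P,\bar\Pi\in\mathbb S^n$, $p\in\mathbb R^n$: $\mathcal Q(P)=PA+A^\top P+C^\top PC+\Gamma^\top P\Gamma+Q$; $\hat{\mathcal Q}(P,\bar\Pi)=\bar\Pi\hat A+\hat A^\top\bar\Pi+\hat C^\top P\hat C+\hat\Gamma^\top\bar\Pi\hat\Gamma+\hat Q$; $\mathcal S(P)=B^\top P+D^\top PC+S$; $\hat{\mathcal S}(P,\bar\Pi)=B^\top\bar\Pi+D^\top P\hat C+S$; $\mathcal R(P)=R+D^\top PD$; $\Theta(P)=-\mathcal R(P)^{-1}\mathcal S(P)$; $\bar\Theta(P,\bar\Pi)=-\mathcal R(P)^{-1}\hat{\mathcal S}(P,\bar\Pi)$; $\theta(p,P)=-\mathcal R(P)^{-1}(B^\top p+D^\top P\sigma+r)$; $\Psi_1(P)=\mathcal Q(P)-\mathcal S(P)^\top\mathcal R(P)^{-1}\mathcal S(P)$; $\bar\Psi_2(P,\bar\Pi)=\hat{\mathcal Q}(P,\bar\Pi)-\hat{\mathcal S}(P,\bar\Pi)^\top\mathcal R(P)^{-1}\hat{\mathcal S}(P,\bar\Pi)$; $\bar\Psi_3(P,\bar\Pi,p)=(\hat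 A+B\bar\Theta(P,\bar\Pi))^\top p+(\hat C+D\bar\Theta(P,\bar\Pi))^\top P\sigma+\bar\Theta(P,\bar\Pi)^\top r+\bar\Pi b+\hat\Gamma^\top\bar\Pi\gamma+q$. Finite-horizon problem: minimize $\mathbb E\int_0^Tf(X,\mathbb E[X|\mathcal F_t^0],u)dt$, $f(x,\bar x,u)=\langle Qx,x\rangle+2\langle Sx,u\rangle+\langle Ru,u\rangle+2\langle q,x\rangle+2\langle r,u\rangle+\langle\bar Q\bar x,\bar x\rangle$, over $\mathbb F$-progressively measurable square-integrable $u$, subject to $X(0)=\xi$ and $$dX=\{AX+\bar A\mathbb E[X|\mathcal F_t^0]+Bu+b\}dt+\{CX+\bar C\mathbb E[X|\mathcal F_t^0]+Du+\sigma\}dW+\{\Gamma X+\bar\Gamma\mathbb E[X|\mathcal F_t^0]+\gamma\}dW^0.\quad(\ast)$$ Its unique optimal pair $(X_T,u_T)$ is the solution of $(\ast)$ with $X_T(0)=\xi$ under the feedback $u_T(t)=\Theta_T^*(t)(X_T-\mathbb E[X_T|\mathcal F_t^0])+\bar\Theta_T^*(t)\mathbb E[X_T|\mathcal F_t^0]+\theta_T^*(t)$, where $\Theta_T^*=\Theta(P_T)$, $\bar\Theta_T^*=\bar\Theta(P_T,\bar\Pi_T)$, $\theta_T^*=\theta(p_T,P_T)$ and $(P_T,\bar\Pi_T,p_T)$ is the unique solution on $[0,T]$ with $P_T,\bar\Pi_T\in\mathbb S^n_+$ of $\dot P_T+\Psi_1(P_T)=0$, $\dot{\bar\Pi}_T+\bar\Psi_2(P_T,\bar\Pi_T)=0$,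 $\dot p_T+\bar\Psi_3(P_T,\bar\Pi_T,p_T)=0$ with zero terminal values at $T$. Ergodic problem: its optimal pair $(\bar X,\bar u)$ is the solution of $(\ast)$ on $[0,\infty)$ with $\bar X(0)=\bar\xi$ under the feedback $\bar u(t)=\Theta^*(\bar X-\mathbb E[\bar X|\mathcal F_t^0])+\bar\Theta^*\mathbb E[\bar X|\mathcal F_t^0]+\theta^*$, where $\Theta^*=\Theta(P)$, $\bar\Theta^*=\bar\Theta(P,\bar\Pi)$, $\theta^*=\theta(p,P)$ and $(P,\bar\Pi,p)\in\mathbb S^n_{++}\times\mathbb S^n_{++}\times\mathbb R^n$ is the unique solution of $\Psi_1(P)=0$, $\bar\Psi_2(P,\bar\Pi)=0$, $\bar\Psi_3(P,\bar\Pi,p)=0$. *)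

theory Defs
  imports "HOL-Probability.Probability"
begin

section \<open>Matrices and coefficients\<close>

definition symmetric_mat :: "real^'k^'k \<Rightarrow> bool" where
  "symmetric_mat P \<longleftrightarrow> transpose P = P"

definition psd_mat :: "real^'k^'k \<Rightarrow> bool" where
  "psd_mat P \<longleftrightarrow> symmetric_mat P \<and> (\<forall>x. 0 \<le> x \<bullet> (P *v x))"

definition pd_mat :: "real^'k^'k \<Rightarrow> bool" where
  "pd_mat P \<longleftrightarrow> symmetric_mat P \<and> (\<forall>x. x \<noteq> 0 \<longrightarrow> 0 < x \<bullet> (P *v x))"

text \<open>
  The data of the problem.  A field name \<open>cX\<close> stands for the coefficient X, \<open>cXb\<close> for X with a bar;
  \<open>G\<close> is the capital gamma.  A matrix with k rows and l columns has type \<open>real^'l^'k\<close>.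
\<close>

record ('n, 'm) lq_data =
  cA :: "real^'n^'n"
  cAb :: "real^'n^'n"
  cB :: "real^'m^'n"
  cC :: "real^'n^'n"
  cCb :: "real^'n^'n"
  cD :: "real^'m^'n"
  cG :: "real^'n^'n"
  cGb :: "real^'n^'n"
  cQ :: "real^'n^'n"
  cQb :: "real^'n^'n"
  cS :: "real^'n^'m"
  cR :: "real^'m^'m"
  cb :: "real^'n"
  csigma :: "real^'n"
  cgamma :: "real^'n"
  cq :: "real^'n"
  cr :: "real^'m"

definition hatA :: "('n::finite, 'm::finite) lq_data \<Rightarrow> real^'n^'n" where
  "hatA d = cA d + cAb d"

definition hatC :: "('n::finite, 'm::finite) lq_data \<Rightarrow> real^'n^'n" where
  "hatC d = cC d + cCb d"

definition hatG :: "('n::finite, 'm::finite) lq_data \<Rightarrow> real^'n^'n" where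
  "hatG d = cG d + cGb d"

definition hatQ :: "('n::finite, 'm::finite) lq_data \<Rightarrow> real^'n^'n" where
  "hatQ d = cQ d + cQb d"

section \<open>The Riccati maps\<close>

definition mapQ :: "('n::finite, 'm::finite) lq_data \<Rightarrow> real^'n^'n \<Rightarrow> real^'n^'n" where
  "mapQ d P = P ** cA d + transpose (cA d) ** P + transpose (cC d) ** P ** cC d
     + transpose (cG d) ** P ** cG d + cQ d"

definition mapQ_hat ::
    "('n::finite, 'm::finite) lq_data \<Rightarrow> real^'n^'n \<Rightarrow> real^'n^'n \<Rightarrow> real^'n^'n" where
  "mapQ_hat d P Pib = Pib ** hatA d + transpose (hatA d) ** Pib + transpose (hatC d) ** P ** hatC d
     + transpose (hatG d) ** Pib ** hatG d + hatQ d"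

definition mapS :: "('n::finite, 'm::finite) lq_data \<Rightarrow> real^'n^'n \<Rightarrow> real^'n^'m" where
  "mapS d P = transpose (cB d) ** P + transpose (cD d) ** P ** cC d + cS d"

definition mapS_hat ::
    "('n::finite, 'm::finite) lq_data \<Rightarrow> real^'n^'n \<Rightarrow> real^'n^'n \<Rightarrow> real^'n^'m" where
  "mapS_hat d P Pib = transpose (cB d) ** Pib + transpose (cD d) ** P ** hatC d + cS d"

definition mapR :: "('n::finite, 'm::finite) lq_data \<Rightarrow> real^'n^'n \<Rightarrow> real^'m^'m" where
  "mapR d P = cR d + transpose (cD d) ** P ** cD d"

definition Theta :: "('n::finite, 'm::finite) lq_data \<Rightarrow> real^'n^'n \<Rightarrow> real^'n^'m" where
  "Theta d P = - (matrix_inv (mapR d P) ** mapS d P)"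

definition Theta_bar ::
    "('n::finite, 'm::finite) lq_data \<Rightarrow> real^'n^'n \<Rightarrow> real^'n^'n \<Rightarrow> real^'n^'m" where
  "Theta_bar d P Pib = - (matrix_inv (mapR d P) ** mapS_hat d P Pib)"

definition theta ::
    "('n::finite, 'm::finite) lq_data \<Rightarrow> real^'n \<Rightarrow> real^'n^'n \<Rightarrow> real^'m" where
  "theta d p P = - (matrix_inv (mapR d P) *v
     (transpose (cB d) *v p + transpose (cD d) *v (P *v csigma d) + cr d))"

definition Psi1 :: "('n::finite, 'm::finite) lq_data \<Rightarrow> real^'n^'n \<Rightarrow> real^'n^'n" where
  "Psi1 d P = mapQ d P - transpose (mapS d P) ** matrix_inv (mapR d P) ** mapS d P"

definition Psi2 ::
    "('n::finite, 'm::finite) lq_data \<Rightarrow> real^'n^'n \<Rightarrow> real^'n^'n \<Rightarrow> real^'n^'n" where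
  "Psi2 d P Pib = mapQ_hat d P Pib
     - transpose (mapS_hat d P Pib) ** matrix_inv (mapR d P) ** mapS_hat d P Pib"

definition Psi3 ::
    "('n::finite, 'm::finite) lq_data \<Rightarrow> real^'n^'n \<Rightarrow> real^'n^'n \<Rightarrow> real^'n \<Rightarrow> real^'n" where
  "Psi3 d P Pib p = transpose (hatA d + cB d ** Theta_bar d P Pib) *v p
     + transpose (hatC d + cD d ** Theta_bar d P Pib) *v (P *v csigma d)
     + transpose (Theta_bar d P Pib) *v cr d
     + Pib *v cb d + transpose (hatG d) *v (Pib *v cgamma d) + cq d"

definition riccati_system ::
    "('n::finite, 'm::finite) lq_data \<Rightarrow> real \<Rightarrow> (real \<Rightarrow> real^'n^'n) \<Rightarrow> (real \<Rightarrow> real^'n^'n)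
      \<Rightarrow> (real \<Rightarrow> real^'n) \<Rightarrow> bool" where
  "riccati_system d T P Pib p \<longleftrightarrow>
     (\<forall>t\<in>{0..T}. psd_mat (P t) \<and> psd_mat (Pib t)
        \<and> (P has_vector_derivative - Psi1 d (P t)) (at t within {0..T})
        \<and> (Pib has_vector_derivative - Psi2 d (P t) (Pib t)) (at t within {0..T})
        \<and> (p has_vector_derivative - Psi3 d (P t) (Pib t) (p t)) (at t within {0..T}))
     \<and> P T = 0 \<and> Pib T = 0 \<and> p T = 0"

definition algebraic_riccati_system ::
    "('n::finite, 'm::finite) lq_data \<Rightarrow> real^'n^'n \<Rightarrow> real^'n^'n \<Rightarrow> real^'n \<Rightarrow> bool" where
  "algebraic_riccati_system d P Pib p \<longleftrightarrow>
     pd_mat P \<and> pd_mat Pib \<and> Psi1 d P = 0 \<and> Psi2 d P Pib = 0 \<and> Psi3 d P Pib p = 0"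

section \<open>Brownian motion and the stochastic basis\<close>

text \<open>
  All processes are indexed by \<open>real\<close>; only their values at nonnegative times matter.
  A sub-sigma-algebra is represented, as in the library, by a measure of which only \<open>space\<close> and
  \<open>sets\<close> are used.
\<close>

definition (in prob_space) path_algebra ::
    "(real \<Rightarrow> 'a \<Rightarrow> 'b::topological_space) \<Rightarrow> real set \<Rightarrow> 'a measure" where
  "path_algebra W I = sigma (space M) (\<Union>s\<in>I. {W s -` B \<inter> space M | B. B \<in> sets borel})"

definition (in prob_space) standard_brownian_motion :: "(real \<Rightarrow> 'a \<Rightarrow> real) \<Rightarrow> bool" where
  "standard_brownian_motion W \<longleftrightarrow>
     (\<forall>t\<ge>0. random_variable borel (W t))
     \<and> (AE \<omega> in M. W 0 \<omega> = 0)
     \<and> (AE \<omega> in M. continuous_on {0..} (\<lambda>t. W t \<omega>))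
     \<and> (\<forall>s\<ge>0. \<forall>t>s.
          distributed M lborel (\<lambda>\<omega>. W t \<omega> - W s \<omega>) (normal_density 0 (sqrt (t - s)))
          \<and> indep_set (sets (path_algebra W {0..s}))
              (sets (vimage_algebra (space M) (\<lambda>\<omega>. W t \<omega> - W s \<omega>) borel)))"

locale brownian_basis = prob_space M for M :: "'w measure" +
  fixes W W0 :: "real \<Rightarrow> 'w \<Rightarrow> real" and F0 :: "'w measure"
  assumes complete: "complete_measure M"
    and subalg_F0: "subalgebra M F0"
    and atomless_F0: "\<And>E. E \<in> sets F0 \<Longrightarrow> 0 < prob E \<Longrightarrow>
          \<exists>E'\<in>sets F0. E' \<subseteq> E \<and> 0 < prob E' \<and> prob E' < prob E"
    and brownian_W: "standard_brownian_motion W"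
    and brownian_W0: "standard_brownian_motion W0"
    and indep_W_W0: "indep_set (sets (path_algebra W {0..})) (sets (path_algebra W0 {0..}))"
    and indep_F0: "indep_set (sets F0) (sets (path_algebra (\<lambda>s \<omega>. (W s \<omega>, W0 s \<omega>)) {0..}))"
begin

definition flt0 :: "real \<Rightarrow> 'w measure" where
  "flt0 t = sigma (space M) (sets (path_algebra W0 {0..t}) \<union> null_sets M)"

definition raw_flt :: "real \<Rightarrow> 'w measure" where
  "raw_flt t = sigma (space M)
     (sets F0 \<union> sets (path_algebra W {0..t}) \<union> sets (path_algebra W0 {0..t}) \<union> null_sets M)"

definition flt :: "real \<Rightarrow> 'w measure" where
  "flt t = sigma (space M) (\<Inter>s\<in>{t<..}. sets (raw_flt s))"

definition L4_F0 :: "('w \<Rightarrow> real^'n) \<Rightarrow> bool" where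
  "L4_F0 \<xi> \<longleftrightarrow> \<xi> \<in> borel_measurable F0 \<and> (\<integral>\<^sup>+\<omega>. ennreal (norm (\<xi> \<omega>) ^ 4) \<partial>M) < \<infinity>"

definition independent_of_noise :: "('w \<Rightarrow> real^'n) \<Rightarrow> bool" where
  "independent_of_noise \<xi> \<longleftrightarrow>
     indep_set (sets (vimage_algebra (space M) \<xi> borel))
       (sets (path_algebra (\<lambda>s \<omega>. (W s \<omega>, W0 s \<omega>)) {0..}))"

section \<open>Processes and the Ito integral\<close>

text \<open>Time sets \<open>I\<close> are \<open>{0..T}\<close> or \<open>{0..}\<close>.\<close>

definition progressive ::
    "(real \<Rightarrow> 'w measure) \<Rightarrow> real set \<Rightarrow> (real \<Rightarrow> 'w \<Rightarrow> 'b::euclidean_space) \<Rightarrow> bool" where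
  "progressive F I H \<longleftrightarrow>
     (\<forall>t\<in>I. (\<lambda>(s, \<omega>). H s \<omega>) \<in> borel_measurable (restrict_space borel {0..t} \<Otimes>\<^sub>M F t))"

definition sq_integral :: "real set \<Rightarrow> (real \<Rightarrow> 'w \<Rightarrow> 'b::euclidean_space) \<Rightarrow> ennreal" where
  "sq_integral J H = (\<integral>\<^sup>+\<omega>. (\<integral>\<^sup>+s\<in>J. ennreal ((norm (H s \<omega>))\<^sup>2) \<partial>lborel) \<partial>M)"

definition locally_sq_integrable ::
    "real set \<Rightarrow> (real \<Rightarrow> 'w \<Rightarrow> 'b::euclidean_space) \<Rightarrow> bool" where
  "locally_sq_integrable I H \<longleftrightarrow> (\<forall>t\<in>I. sq_integral {0..t} H < \<infinity>)"

definition step_data :: "nat \<Rightarrow> (nat \<Rightarrow> real) \<Rightarrow> (nat \<Rightarrow> 'w \<Rightarrow> 'b::euclidean_space) \<Rightarrow> bool" where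
  "step_data k \<tau> \<eta> \<longleftrightarrow> 0 \<le> \<tau> 0 \<and>
     (\<forall>i<k. \<tau> i \<le> \<tau> (Suc i) \<and> \<eta> i \<in> borel_measurable (flt (\<tau> i)) \<and> bounded (\<eta> i ` space M))"

definition step_process ::
    "nat \<Rightarrow> (nat \<Rightarrow> real) \<Rightarrow> (nat \<Rightarrow> 'w \<Rightarrow> 'b::euclidean_space) \<Rightarrow> real \<Rightarrow> 'w \<Rightarrow> 'b" where
  "step_process k \<tau> \<eta> s \<omega> = (\<Sum>i<k. indicator {\<tau> i<..\<tau> (Suc i)} s *\<^sub>R \<eta> i \<omega>)"

definition step_integral ::
    "(real \<Rightarrow> 'w \<Rightarrow> real) \<Rightarrow> nat \<Rightarrow> (nat \<Rightarrow> real) \<Rightarrow> (nat \<Rightarrow> 'w \<Rightarrow> 'b::euclidean_space)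
      \<Rightarrow> real \<Rightarrow> 'w \<Rightarrow> 'b" where
  "step_integral V k \<tau> \<eta> t \<omega> =
     (\<Sum>i<k. (V (min (\<tau> (Suc i)) t) \<omega> - V (min (\<tau> i) t) \<omega>) *\<^sub>R \<eta> i \<omega>)"

text \<open>
  \<open>has_ito_integral V H t J\<close>: the random variable \<open>J\<close> is (a version of) the integral over
  \<open>[0, t]\<close> of \<open>H\<close> against \<open>V\<close> (which is \<open>W\<close> or \<open>W0\<close>), as the mean square limit of integrals of
  step processes approximating \<open>H\<close> in mean square.
\<close>

definition has_ito_integral ::
    "(real \<Rightarrow> 'w \<Rightarrow> real) \<Rightarrow> (real \<Rightarrow> 'w \<Rightarrow> 'b::euclidean_space) \<Rightarrow> real \<Rightarrow> ('w \<Rightarrow> 'b) \<Rightarrow> bool" where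
  "has_ito_integral V H t J \<longleftrightarrow>
     progressive flt {0..t} H \<and> J \<in> borel_measurable M \<and>
     (\<exists>k \<tau> \<eta>. (\<forall>j. step_data (k j) (\<tau> j) (\<eta> j)) \<and>
        (\<lambda>j. sq_integral {0..t} (\<lambda>s \<omega>. H s \<omega> - step_process (k j) (\<tau> j) (\<eta> j) s \<omega>))
          \<longlonglongrightarrow> 0 \<and>
        (\<lambda>j. \<integral>\<^sup>+\<omega>. ennreal ((norm (J \<omega> - step_integral V (k j) (\<tau> j) (\<eta> j) t \<omega>))\<^sup>2) \<partial>M)
          \<longlonglongrightarrow> 0)"

text \<open>
  \<open>ito_process I \<xi> \<beta> \<alpha> \<alpha>0 X\<close>: on the time set \<open>I\<close>, \<open>X\<close> is a continuous square integrable adapted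
  process with \<open>dX = \<beta> dt + \<alpha> dW + \<alpha>0 dW0\<close> and \<open>X(0) = \<xi>\<close>.  A stochastic differential equation is
  obtained by letting the coefficient processes depend on \<open>X\<close>.
\<close>

definition ito_process ::
    "real set \<Rightarrow> ('w \<Rightarrow> real^'n) \<Rightarrow> (real \<Rightarrow> 'w \<Rightarrow> real^'n) \<Rightarrow> (real \<Rightarrow> 'w \<Rightarrow> real^'n)
      \<Rightarrow> (real \<Rightarrow> 'w \<Rightarrow> real^'n) \<Rightarrow> (real \<Rightarrow> 'w \<Rightarrow> real^'n) \<Rightarrow> bool" where
  "ito_process I \<xi> \<beta> \<alpha> \<alpha>0 X \<longleftrightarrow>
     progressive flt I X \<and> locally_sq_integrable I X
     \<and> (AE \<omega> in M. continuous_on I (\<lambda>t. X t \<omega>))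
     \<and> (\<forall>t\<in>I. \<exists>J J0. has_ito_integral W \<alpha> t J \<and> has_ito_integral W0 \<alpha>0 t J0 \<and>
          (AE \<omega> in M. set_integrable lborel {0..t} (\<lambda>s. \<beta> s \<omega>) \<and>
             X t \<omega> = \<xi> \<omega> + (LBINT s:{0..t}. \<beta> s \<omega>) + J \<omega> + J0 \<omega>))"

section \<open>Stabilizability\<close>

text \<open>
  The linear equations below have a unique solution, so that the existential quantifier over it
  expresses a property of ``the'' solution.
\<close>

definition L2_stabilizable0 :: "real^'n^'n \<Rightarrow> real^'n^'n \<Rightarrow> real^'m^'n \<Rightarrow> bool" where
  "L2_stabilizable0 A G B \<longleftrightarrow>
     (\<exists>\<Theta> :: real^'n^'m. \<forall>y. \<exists>Y.
        ito_process {0..} (\<lambda>\<omega>. y)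
          (\<lambda>t \<omega>. (A + B ** \<Theta>) *v Y t \<omega>) (\<lambda>t \<omega>. 0) (\<lambda>t \<omega>. G *v Y t \<omega>) Y
        \<and> sq_integral {0..} Y < \<infinity>)"

definition L2_stabilizable ::
    "real^'n^'n \<Rightarrow> real^'n^'n \<Rightarrow> real^'n^'n \<Rightarrow> real^'m^'n \<Rightarrow> real^'m^'n \<Rightarrow> bool" where
  "L2_stabilizable A C G B D \<longleftrightarrow>
     (\<exists>\<Theta> :: real^'n^'m. \<forall>\<xi>. L4_F0 \<xi> \<longrightarrow> (\<exists>X.
        ito_process {0..} \<xi>
          (\<lambda>t \<omega>. (A + B ** \<Theta>) *v X t \<omega>) (\<lambda>t \<omega>. (C + D ** \<Theta>) *v X t \<omega>) (\<lambda>t \<omega>. G *v X t \<omega>) X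
        \<and> sq_integral {0..} X < \<infinity>))"

section \<open>The optimal pairs\<close>

text \<open>
  \<open>conditional_mean I X Z\<close>: \<open>Z\<close> is a version of the process \<open>E[X(t) | flt0 t]\<close>, \<open>t \<in> I\<close>.
  A jointly measurable version has to be chosen, because \<open>real_cond_exp\<close> selects its values
  separately for each \<open>t\<close>.
\<close>

definition conditional_mean ::
    "real set \<Rightarrow> (real \<Rightarrow> 'w \<Rightarrow> real^'n) \<Rightarrow> (real \<Rightarrow> 'w \<Rightarrow> real^'n) \<Rightarrow> bool" where
  "conditional_mean I X Z \<longleftrightarrow> progressive flt0 I Z \<and>
     (\<forall>t\<in>I. AE \<omega> in M. Z t \<omega> = (\<chi> i. real_cond_exp M (flt0 t) (\<lambda>\<omega>'. X t \<omega>' $ i) \<omega>))"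

text \<open>
  The mean field state equation on \<open>I\<close> with control \<open>u\<close>, where \<open>Z\<close> is the conditional mean of \<open>X\<close>.
\<close>

definition mf_state_equation ::
    "('n::finite, 'm::finite) lq_data \<Rightarrow> real set \<Rightarrow> ('w \<Rightarrow> real^'n) \<Rightarrow> (real \<Rightarrow> 'w \<Rightarrow> real^'n)
      \<Rightarrow> (real \<Rightarrow> 'w \<Rightarrow> real^'n) \<Rightarrow> (real \<Rightarrow> 'w \<Rightarrow> real^'m) \<Rightarrow> bool" where
  "mf_state_equation d I \<xi> X Z u \<longleftrightarrow>
     conditional_mean I X Z \<and>
     ito_process I \<xi>
       (\<lambda>t \<omega>. cA d *v X t \<omega> + cAb d *v Z t \<omega> + cB d *v u t \<omega> + cb d)
       (\<lambda>t \<omega>. cC d *v X t \<omega> + cCb d *v Z t \<omega> + cD d *v u t \<omega> + csigma d)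
       (\<lambda>t \<omega>. cG d *v X t \<omega> + cGb d *v Z t \<omega> + cgamma d)
       X"

definition closed_loop_pair ::
    "('n::finite, 'm::finite) lq_data \<Rightarrow> real set \<Rightarrow> ('w \<Rightarrow> real^'n)
      \<Rightarrow> (real \<Rightarrow> real^'n^'m) \<Rightarrow> (real \<Rightarrow> real^'n^'m) \<Rightarrow> (real \<Rightarrow> real^'m)
      \<Rightarrow> (real \<Rightarrow> 'w \<Rightarrow> real^'n) \<Rightarrow> (real \<Rightarrow> 'w \<Rightarrow> real^'m) \<Rightarrow> bool" where
  "closed_loop_pair d I \<xi> \<Theta> \<Theta>b \<theta> X u \<longleftrightarrow>
     progressive flt I u \<and> locally_sq_integrable I u \<and>
     (\<exists>Z. mf_state_equation d I \<xi> X Z u \<and>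
        (\<forall>t\<in>I. AE \<omega> in M.
           u t \<omega> = \<Theta> t *v (X t \<omega> - Z t \<omega>) + \<Theta>b t *v Z t \<omega> + \<theta> t))"

text \<open>
  The optimal pairs are given by their feedback form.  This fixes the control at every time:
  a minimizer of the cost functional alone is determined only up to null sets of times.
\<close>

definition finite_horizon_optimal_pair ::
    "('n::finite, 'm::finite) lq_data \<Rightarrow> real \<Rightarrow> ('w \<Rightarrow> real^'n)
      \<Rightarrow> (real \<Rightarrow> 'w \<Rightarrow> real^'n) \<Rightarrow> (real \<Rightarrow> 'w \<Rightarrow> real^'m) \<Rightarrow> bool" where
  "finite_horizon_optimal_pair d T \<xi> X u \<longleftrightarrow>
     (\<exists>P Pib p. riccati_system d T P Pib p \<and>
        closed_loop_pair d {0..T} \<xi> (\<lambda>t. Theta d (P t)) (\<lambda>t. Theta_bar d (P t) (Pib t))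
          (\<lambda>t. theta d (p t) (P t)) X u)"

definition ergodic_optimal_pair ::
    "('n::finite, 'm::finite) lq_data \<Rightarrow> ('w \<Rightarrow> real^'n)
      \<Rightarrow> (real \<Rightarrow> 'w \<Rightarrow> real^'n) \<Rightarrow> (real \<Rightarrow> 'w \<Rightarrow> real^'m) \<Rightarrow> bool" where
  "ergodic_optimal_pair d \<xi> X u \<longleftrightarrow>
     (\<exists>P Pib p. algebraic_riccati_system d P Pib p \<and>
        closed_loop_pair d {0..} \<xi> (\<lambda>t. Theta d P) (\<lambda>t. Theta_bar d P Pib)
          (\<lambda>t. theta d p P) X u)"

definition sq_deviation ::
    "(real \<Rightarrow> 'w \<Rightarrow> real^'n) \<Rightarrow> (real \<Rightarrow> 'w \<Rightarrow> real^'n) \<Rightarrow>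
     (real \<Rightarrow> 'w \<Rightarrow> real^'m) \<Rightarrow> (real \<Rightarrow> 'w \<Rightarrow> real^'m) \<Rightarrow> real \<Rightarrow> ennreal" where
  "sq_deviation X X' u u' t =
     (\<integral>\<^sup>+\<omega>. ennreal ((norm (X t \<omega> - X' t \<omega>))\<^sup>2 + (norm (u t \<omega> - u' t \<omega>))\<^sup>2) \<partial>M)"

end

definition P4 :: "(real^'n) measure \<Rightarrow> bool" where
  "P4 \<mu> \<longleftrightarrow> prob_space \<mu> \<and> sets \<mu> = sets borel \<and> (\<integral>\<^sup>+x. ennreal (norm x ^ 4) \<partial>\<mu>) < \<infinity>"

end

theory Submission imports Defs begin

text \<open>
  The Riccati equations describe the minimum over the control of a Hamiltonian that is affine in the
  unknown matrices, so a matrix version of the comparison principle sandwiches the finite-horizon solution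
  between \<open>(1 - exp (- c (T - t))) P\<close> and \<open>P\<close>.  Hence the finite-horizon feedback gains
  differ from the ergodic ones by \<open>O (exp (- c (T - t)))\<close>.

  Split the difference of the two closed-loop states into its conditional mean \<open>Z\<close> and the fluctuation
  \<open>Y\<close>, which is orthogonal to everything known to the common noise.  The algebraic Riccati equations make
  \<open>E \<langle>P Y, Y\<rangle> + E \<langle>Pib Z, Z\<rangle>\<close> dissipate at an exponential rate, up to a forcing
  by the difference of the gains, which is only felt close to \<open>T\<close>.  Since only this expectation is needed, the
  Ito formula is replaced by a product rule in mean, which follows from the isometry and the martingale property.
\<close>

section \<open>Symmetric matrices and the Hamiltonian\<close>

text \<open>The rate \<open>c\<close> of the sandwich is any number for which the running cost,
  minimised over the control, dominates \<open>c\<close> times the Riccati form. The probabilistic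
  obstacle is measurability. \<open>flt\<close> is right-continuous and sees the immediate future,
  so increments are centred only after moving their left end slightly to the right, and the
  conditional mean becomes an Ito process only because the state at \<open>t\<close> is a left
  limit. The projection itself rests on one fact: adding \<open>F0\<close> and all of
  \<open>W\<close> to the information of the common noise up to \<open>s\<close> leaves conditional
  expectations of common-noise variables unchanged. The gain error multiplies the finite-horizon
  state, for which no bound uniform in \<open>T\<close> is at hand. That state is written as the
  difference plus the ergodic state, whose energy is bounded for all times. The forcing is thus of
  order \<open>exp (- 2 * c * (T - t))\<close> times one plus the energy of the difference, and a
  Gronwall factor with bounded exponent keeps the constants independent of \<open>T\<close>. The
  part decaying in \<open>t\<close> is proportional to the initial energy of the difference, which
  vanishes when the initial states agree.\<close>

lemma bounded_bilinear_matrix_vector_mult: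
  "bounded_bilinear (\<lambda>(A::real^'a^'b) x. A *v x)"
  unfolding bilinear_conv_bounded_bilinear[symmetric] bilinear_def
  by (auto intro!: linearI simp: algebra_simps scaleR_matrix_vector_assoc)

lemma matrix_vector_mult_minus: "(- A) *v x = - (A *v x)" for A :: "real^'a^'b"
  by (simp add: vec_eq_iff matrix_vector_mult_def sum_negf)

lemma matrix_vector_mult_minus_right: "A *v (- x) = - (A *v x)" for A :: "real^'a^'b"
  by (simp add: vec_eq_iff matrix_vector_mult_def sum_negf)

text \<open>The simp rule \<open>transpose_matrix_vector\<close> would turn
  \<open>transpose A *v y\<close> into \<open>y v* A\<close>; it is disabled in later simp calls
  that need transposes in this form.\<close>

lemma inner_transpose_mult: "x \<bullet> (transpose A *v y) = (A *v x) \<bullet> y" for A :: "real^'a^'b"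
  by (metis dot_lmul_matrix inner_commute transpose_matrix_vector)

lemma symmetric_mat_inner: "symmetric_mat P \<Longrightarrow> (P *v x) \<bullet> y = x \<bullet> (P *v y)"
  by (metis inner_transpose_mult symmetric_mat_def)

lemma psd_mat_symmetric [dest]: "psd_mat P \<Longrightarrow> symmetric_mat P"
  and psd_mat_nonneg: "psd_mat P \<Longrightarrow> 0 \<le> x \<bullet> (P *v x)"
  and pd_mat_symmetric [dest]: "pd_mat P \<Longrightarrow> symmetric_mat P"
  by (auto simp: psd_mat_def pd_mat_def)

lemma pd_mat_imp_psd [dest]: "pd_mat P \<Longrightarrow> psd_mat P"
  unfolding pd_mat_def psd_mat_def by (metis inner_zero_left less_eq_real_def)

text \<open>The constant is the minimum of the form on the compact unit sphere; homogeneity extends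
  the bound to all vectors.\<close>

lemma pd_mat_coercive:
  fixes P :: "real^'k^'k"
  assumes "pd_mat P"
  obtains c where "c > 0" "\<And>x. c * (norm x)\<^sup>2 \<le> x \<bullet> (P *v x)"
proof -
  let ?f = "\<lambda>x. x \<bullet> (P *v x)"
  have "continuous_on (sphere 0 1) ?f"
    by (intro continuous_intros linear_continuous_on) auto
  moreover have "sphere (0::real^'k) 1 \<noteq> {}" by simp
  ultimately obtain y where y: "y \<in> sphere 0 1" "\<forall>x\<in>sphere 0 1. ?f y \<le> ?f x"
    using continuous_attains_inf[of "sphere 0 1" ?f] by auto
  have "y \<noteq> 0" using y(1) by auto
  then have "?f y > 0" using assms by (simp add: pd_mat_def)
  moreover have "?f y * (norm x)\<^sup>2 \<le> ?f x" for x
  proof (cases "x = 0")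
    case False
    then have "x /\<^sub>R norm x \<in> sphere 0 1" by simp
    then have "?f y \<le> ?f (x /\<^sub>R norm x)" using y(2) by blast
    also have "\<dots> = ?f x / (norm x)\<^sup>2"
      by (simp add: matrix_vector_mult_scaleR power2_eq_square divide_simps)
    finally show ?thesis using False by (simp add: field_simps)
  qed simp
  ultimately show ?thesis using that by blast
qed

lemma matrix_bound:
  fixes A :: "real^'a^'b"
  obtains k where "k > 0" "\<And>x. norm (A *v x) \<le> k * norm x"
  using bounded_linear.pos_bounded[OF matrix_vector_mul_bounded_linear[of A]]
  by (metis mult.commute)

lemma pd_mat_invertible: "pd_mat P \<Longrightarrow> invertible P"
  unfolding pd_mat_def
  by (metis inner_zero_right less_irrefl invertible_left_inverse matrix_left_invertible_ker)

lemma matrix_mult_inv: "invertible P \<Longrightarrow> P *v (matrix_inv P *v x) = x"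
  for P :: "real^'k^'k"
  unfolding matrix_inv_def invertible_def
  by (metis (mono_tags, lifting) matrix_vector_mul_assoc matrix_vector_mul_lid someI_ex)

lemma symmetric_matI:
  assumes "\<And>x y. (P *v x) \<bullet> y = x \<bullet> (P *v y)"
  shows "symmetric_mat P"
  unfolding symmetric_mat_def
  by (rule matrix_eq[THEN iffD2], intro allI, rule vector_eq_ldot[THEN iffD1])
     (simp add: inner_transpose_mult assms del: transpose_matrix_vector)

lemma mapR_inner: "w \<bullet> (mapR d P *v v) = w \<bullet> (cR d *v v) + (cD d *v w) \<bullet> (P *v (cD d *v v))"
  by (simp add: mapR_def matrix_vector_mult_add_rdistrib inner_add_right
      inner_transpose_mult[symmetric] matrix_vector_mul_assoc matrix_mul_assoc del: transpose_matrix_vector)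

lemma symmetric_mapR:
  assumes "symmetric_mat (cR d)" "symmetric_mat P"
  shows "symmetric_mat (mapR d P)"
proof (rule symmetric_matI)
  fix x y
  have "(mapR d P *v x) \<bullet> y = (cR d *v x) \<bullet> y + (P *v (cD d *v x)) \<bullet> (cD d *v y)"
    using mapR_inner[of y d P x] by (simp add: inner_commute)
  then show "(mapR d P *v x) \<bullet> y = x \<bullet> (mapR d P *v y)"
    by (simp only: mapR_inner symmetric_mat_inner[OF assms(1)] symmetric_mat_inner[OF assms(2)])
qed

text \<open>The common core of two Cauchy-Schwarz inequalities: for semidefinite matrices and for
  expectations of inner products.\<close>

lemma nonneg_form_discriminant:
  fixes a b c :: real
  assumes pos: "\<And>r s. 0 \<le> r * r * a + 2 * r * s * b + s * s * c"
  shows "b\<^sup>2 \<le> a * c"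
proof -
  have "c \<ge> 0" using pos[of 0 1] by simp
  show ?thesis
  proof (cases "c = 0")
    case True
    have "b = 0"
    proof (rule ccontr)
      assume "b \<noteq> 0"
      \<comment> \<open>For \<open>c = 0\<close> the form is linear in the second variable, and this
        choice gives it the value -1.\<close>
      then show False using pos[of 1 "- (a + 1) / (2 * b)"] True by (simp add: field_simps)
    qed
    then show ?thesis using True by simp
  next
    case False
    \<comment> \<open>The minimising direction \<open>(c, - b)\<close> turns the form into
      \<open>c\<close> times the discriminant.\<close>
    have "0 \<le> c * (a * c - b\<^sup>2)"
      using pos[of c "- b"] by (simp add: power2_eq_square algebra_simps)
    then show ?thesis using False \<open>c \<ge> 0\<close> by (simp add: zero_le_mult_iff)
  qed
qed

lemma psd_mat_Cauchy_Schwarz: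
  assumes "psd_mat V"
  shows "(x \<bullet> (V *v y))\<^sup>2 \<le> (x \<bullet> (V *v x)) * (y \<bullet> (V *v y))"
proof (rule nonneg_form_discriminant)
  fix r s :: real
  define a b c where "a = x \<bullet> (V *v x)" and "b = x \<bullet> (V *v y)" and "c = y \<bullet> (V *v y)"
  have "y \<bullet> (V *v x) = b"
    using assms by (metis b_def inner_commute psd_mat_symmetric symmetric_mat_inner)
  then show "0 \<le> r * r * (x \<bullet> (V *v x)) + 2 * r * s * (x \<bullet> (V *v y)) + s * s * (y \<bullet> (V *v y))"
    using psd_mat_nonneg[OF assms, of "r *\<^sub>R x + s *\<^sub>R y"]
    by (simp add: a_def[symmetric] b_def[symmetric] c_def[symmetric] algebra_simps inner_add_left inner_add_right
        matrix_vector_right_distrib)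
qed

text \<open>Cauchy-Schwarz for the form of \<open>V\<close>, applied to \<open>V *v x\<close> and
  \<open>x\<close>. It converts an ordering of semidefinite matrices into a norm estimate without
  spectral theory.\<close>

lemma psd_mat_norm_bound:
  assumes "psd_mat V" and le: "\<And>x. x \<bullet> (V *v x) \<le> k * (norm x)\<^sup>2"
  shows "norm (V *v x) \<le> k * norm x"
proof -
  have "0 \<le> k * (norm x)\<^sup>2"
    by (rule order_trans[OF psd_mat_nonneg[OF assms(1)] le])
  then have k: "0 \<le> k * norm x" by (cases "x = 0") (auto simp: zero_le_mult_iff)
  show ?thesis
  proof (cases "V *v x = 0")
    case True
    then show ?thesis using k by simp
  next
    case False
    define y where "y = V *v x"
    have pos: "0 < (norm y)\<^sup>2" using False by (simp add: y_def)
    have "((norm y)\<^sup>2)\<^sup>2 = (y \<bullet> (V *v x))\<^sup>2" by (simp add: dot_square_norm y_def[symmetric])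
    also have "\<dots> \<le> (y \<bullet> (V *v y)) * (x \<bullet> (V *v x))" by (rule psd_mat_Cauchy_Schwarz[OF assms(1)])
    also have "\<dots> \<le> (k * (norm y)\<^sup>2) * (k * (norm x)\<^sup>2)"
      using le[of y] le[of x] psd_mat_nonneg[OF assms(1), of y] psd_mat_nonneg[OF assms(1), of x]
      by (meson mult_mono order_trans)
    finally have "(norm y)\<^sup>2 * (norm y)\<^sup>2 \<le> (norm y)\<^sup>2 * (k * norm x)\<^sup>2"
      by (simp add: power2_eq_square mult_ac)
    then have "(norm y)\<^sup>2 \<le> (k * norm x)\<^sup>2"
      using mult_le_cancel_left_pos[OF pos] by blast
    then have "norm y \<le> k * norm x" using k by (rule power2_le_imp_le)
    then show ?thesis by (simp add: y_def)
  qed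
qed

text \<open>
  A matrix-valued function dominated from above by a linear Lyapunov operator stays positive
  semidefinite backwards from the final time: after adding a small multiple of the identity, at the
  last time where positivity fails the kernel vector has a strictly negative right derivative.
\<close>

lemma lyapunov_comparison:
  fixes U U' :: "real \<Rightarrow> real^'n^'n"
  assumes der: "\<And>t. t \<in> {0..T} \<Longrightarrow> (U has_vector_derivative U' t) (at t within {0..T})"
    and sym: "\<And>t. t \<in> {0..T} \<Longrightarrow> symmetric_mat (U t)"
    and UT: "psd_mat (U T)" and M: "M \<ge> 0"
    and ineq: "\<And>t x. t \<in> {0..T} \<Longrightarrow> \<exists>a b c. norm a \<le> M * norm x \<and> norm b \<le> M * norm x \<and> norm c \<le> M * norm x
        \<and> x \<bullet> (U' t *v x) \<le> - (2 * ((U t *v x) \<bullet> a) + b \<bullet> (U t *v b) + c \<bullet> (U t *v c))"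
    and t: "t \<in> {0..T}"
  shows "psd_mat (U t)"
proof -
  \<comment> \<open>The added multiple of the identity decays at rate \<open>k\<close>:
    \<open>2 * M\<close> pays for the term with \<open>a\<close>, twice \<open>M\<^sup>2\<close> for
    those with \<open>b\<close> and \<open>c\<close>, and the surplus 1 makes the derivative
    strictly negative.\<close>
  define k where "k = 2 * M + 2 * M\<^sup>2 + 1"
  have main: "0 < x \<bullet> (U t *v x) + \<delta> * exp (k * (T - t))"
    if "\<delta> > 0" "t \<in> {0..T}" "norm x = 1" for \<delta> t x
  proof (rule ccontr)
    assume neg: "\<not> ?thesis"
    define e where "e t = \<delta> * exp (k * (T - t))" for t
    have e: "e t > 0" for t using that by (simp add: e_def)
    define q where "q t x = x \<bullet> (U t *v x) + e t" for t and x :: "real^'n"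
    have contU: "continuous_on {0..T} U"
      using der by (meson continuous_on_eq_continuous_within has_vector_derivative_continuous)
    have contq: "continuous_on ({0..T} \<times> sphere 0 1) (\<lambda>(t, x). q t x)"
    proof -
      have *: "continuous_on ({0..T} \<times> sphere 0 1) (\<lambda>z. U (fst z) *v snd z)"
      proof -
        have "continuous_on ({0..T} \<times> sphere (0::real^'n) 1) (\<lambda>z. U (fst z))"
          by (rule continuous_on_compose2[OF contU continuous_on_fst[OF continuous_on_id]]) auto
        then show ?thesis
          by (intro bounded_bilinear.continuous_on[OF bounded_bilinear_matrix_vector_mult] continuous_intros)
      qed
      show ?thesis unfolding q_def e_def case_prod_beta
        by (intro continuous_intros *)
    qed
    \<comment> \<open>Times paired with unit directions in which the perturbed form is nonpositive;
      compactness provides a pair with the latest time.\<close>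
    define S where "S = {z \<in> {0..T} \<times> sphere 0 1. q (fst z) (snd z) \<le> 0}"
    have "compact S"
    proof -
      have "S = ({0..T} \<times> sphere 0 1) \<inter> (\<lambda>(t, x). q t x) -` {..0}"
        by (auto simp: S_def)
      moreover have "closed (({0..T} \<times> sphere 0 1) \<inter> (\<lambda>(t, x). q t x) -` {..0})"
        by (intro continuous_closed_preimage contq closed_Times) auto
      moreover have "compact ({0..T} \<times> sphere (0::real^'n) 1)"
        by (intro compact_Times) auto
      ultimately show ?thesis
        by (metis Int_lower1 bounded_subset compact_eq_bounded_closed)
    qed
    moreover have "(t, x) \<in> S"
      using that neg by (auto simp: S_def q_def e_def)
    ultimately obtain z where z: "z \<in> S" "\<And>y. y \<in> S \<Longrightarrow> fst y \<le> fst z"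
      using continuous_attains_sup[of S fst] continuous_on_fst[OF continuous_on_id, of S] by blast
    obtain s y where sy: "z = (s, y)" by (cases z)
    have s: "s \<in> {0..T}" and y: "norm y = 1" and qy: "q s y \<le> 0"
      using z(1) by (auto simp: S_def sy)
    have after: "q r w > 0" if "r \<in> {s<..T}" "norm w = 1" for r w
    proof (rule ccontr)
      assume "\<not> q r w > 0"
      then have "(r, w) \<in> S" using that s by (simp add: S_def)
      then show False using z(2)[of "(r, w)"] that(1) by (simp add: sy)
    qed
    have "s \<noteq> T"
      using qy psd_mat_nonneg[OF UT, of y] e[of s] by (auto simp: q_def)
    then have "s < T" using s by auto
    have qder: "((\<lambda>r. q r w) has_real_derivative (w \<bullet> (U' s *v w) - k * e s)) (at s within {0..T})" for w
    proof -
      have bl: "bounded_linear (\<lambda>A::real^'n^'n. w \<bullet> (A *v w))"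
        by (rule bounded_linear_compose[OF bounded_linear_inner_right
            bounded_bilinear.bounded_linear_left[OF bounded_bilinear_matrix_vector_mult]])
      have "((\<lambda>r. w \<bullet> (U r *v w)) has_real_derivative (w \<bullet> (U' s *v w))) (at s within {0..T})"
        using bounded_linear.has_vector_derivative[OF bl der[OF s]]
        by (simp add: has_real_derivative_iff_has_vector_derivative)
      then show ?thesis unfolding q_def e_def
        by (auto intro!: derivative_eq_intros)
    qed
    have qs: "q s w \<ge> 0" if "norm w = 1" for w
    proof (rule ccontr)
      assume "\<not> ?thesis"
      then have "q s w < 0" by simp
      have "continuous (at s within {0..T}) (\<lambda>r. q r w)"
        using qder[of w] DERIV_continuous by blast
      then have "((\<lambda>r. q r w) \<longlongrightarrow> q s w) (at s within {0..T})" by (simp add: continuous_within)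
      then have "((\<lambda>r. q r w) \<longlongrightarrow> q s w) (at s within {s..T})"
        by (rule tendsto_within_subset) (use s in auto)
      then have "((\<lambda>r. q r w) \<longlongrightarrow> q s w) (at_right s)"
        using at_within_Icc_at_right[OF \<open>s < T\<close>] by simp
      then have "\<forall>\<^sub>F r in at_right s. q r w < 0" using \<open>q s w < 0\<close> order_tendstoD(2) by blast
      moreover have "\<forall>\<^sub>F r in at_right s. r \<in> {s<..<T}"
        using \<open>s < T\<close> eventually_at_right_real by blast
      ultimately have "\<forall>\<^sub>F r in at_right s. False"
        by eventually_elim (use after[OF _ that] in fastforce)
      then show False by simp
    qed
    have qall: "0 \<le> w \<bullet> (U s *v w) + e s * (norm w)\<^sup>2" for w
    proof (cases "w = 0")
      case False
      then have "0 \<le> q s (w /\<^sub>R norm w)" by (intro qs) auto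
      then have "0 \<le> (w \<bullet> (U s *v w)) / (norm w)\<^sup>2 + e s"
        by (simp add: q_def matrix_vector_mult_scaleR power2_eq_square divide_simps)
      then show ?thesis using False by (simp add: field_simps)
    qed simp
    have Vmul: "(U s + e s *\<^sub>R mat 1) *v w = U s *v w + e s *\<^sub>R w" for w
      by (simp add: matrix_vector_mult_add_rdistrib scaleR_matrix_vector_assoc[symmetric])
    have "psd_mat (U s + e s *\<^sub>R mat 1)"
      unfolding psd_mat_def
    proof
      show "symmetric_mat (U s + e s *\<^sub>R mat 1)"
        by (rule symmetric_matI) (simp add: Vmul inner_add_left inner_add_right symmetric_mat_inner[OF sym[OF s]])
      show "\<forall>x. 0 \<le> x \<bullet> ((U s + e s *\<^sub>R mat 1) *v x)"
        using qall by (simp add: Vmul inner_add_right dot_square_norm)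
    qed
    moreover have "y \<bullet> ((U s + e s *\<^sub>R mat 1) *v y) = 0"
      using qs[OF y] qy y by (simp add: Vmul inner_add_right dot_square_norm q_def)
    \<comment> \<open>A zero of a semidefinite form lies in its kernel, so \<open>y\<close> is an
      eigenvector of \<open>U s\<close> with eigenvalue \<open>- e s\<close>.\<close>
    ultimately have "(norm ((U s + e s *\<^sub>R mat 1) *v y))\<^sup>2 = 0"
      using psd_mat_Cauchy_Schwarz[of "U s + e s *\<^sub>R mat 1" "(U s + e s *\<^sub>R mat 1) *v y" y]
      by (simp add: dot_square_norm)
    then have Uy: "U s *v y = - (e s *\<^sub>R y)" by (simp add: Vmul add_eq_0_iff2)
    obtain a b c where abc: "norm a \<le> M" "norm b \<le> M" "norm c \<le> M"
      "y \<bullet> (U' s *v y) \<le> - (2 * ((U s *v y) \<bullet> a) + b \<bullet> (U s *v b) + c \<bullet> (U s *v c))"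
      using ineq[OF s, of y] y by auto
    have sq: "- (b \<bullet> (U s *v b)) \<le> e s * M\<^sup>2" if "norm b \<le> M" for b
    proof -
      have "e s * (norm b)\<^sup>2 \<le> e s * M\<^sup>2" using e[of s] that by (intro mult_left_mono power_mono) auto
      then show ?thesis using qall[of b] by simp
    qed
    have "\<bar>y \<bullet> a\<bar> \<le> M"
      using Cauchy_Schwarz_ineq2[of y a] y abc(1) by simp
    then have "e s * (y \<bullet> a) \<le> e s * M" using e[of s] by (intro mult_left_mono) auto
    moreover have "y \<bullet> (U' s *v y) \<le> 2 * (e s * (y \<bullet> a)) - b \<bullet> (U s *v b) - c \<bullet> (U s *v c)"
      using abc(4) by (simp add: Uy)
    moreover have "k * e s = 2 * (e s * M) + 2 * (e s * M\<^sup>2) + e s"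
      by (simp add: k_def algebra_simps)
    ultimately have "y \<bullet> (U' s *v y) - k * e s < 0"
      using sq[OF abc(2)] sq[OF abc(3)] e[of s] by linarith
    \<comment> \<open>The form along \<open>y\<close> would drop below its nonpositive value right
      after \<open>s\<close>, although \<open>s\<close> is the last bad time.\<close>
    from has_real_derivative_neg_dec_right[OF qder this] obtain h0 where h0: "h0 > 0"
      "\<And>h. h > 0 \<Longrightarrow> s + h \<in> {0..T} \<Longrightarrow> h < h0 \<Longrightarrow> q (s + h) y < q s y"
      by blast
    define h where "h = min (h0 / 2) (T - s)"
    have h: "h > 0" "h < h0" "s + h \<in> {s<..T}" "s + h \<in> {0..T}"
      using h0(1) \<open>s < T\<close> s by (auto simp: h_def min_def)
    have "q (s + h) y < q s y" by (rule h0(2)) (fact h)+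
    moreover have "q (s + h) y > 0" by (rule after) (fact h y)+
    ultimately show False using qy by simp
  qed
  show ?thesis unfolding psd_mat_def
  proof (intro conjI allI sym t)
    fix x :: "real^'n"
    have unit: "0 \<le> x \<bullet> (U t *v x)" if "norm x = 1" for x
    proof (rule field_le_epsilon)
      fix \<epsilon> :: real assume "\<epsilon> > 0"
      then show "0 \<le> x \<bullet> (U t *v x) + \<epsilon>"
        \<comment> \<open>Dividing by the exponential makes the perturbation at the fixed time
          \<open>t\<close> exactly \<open>\<epsilon>\<close>.\<close>
        using main[of "\<epsilon> / exp (k * (T - t))" t x] t that by simp
    qed
    show "0 \<le> x \<bullet> (U t *v x)"
    proof (cases "x = 0")
      case False
      then have "0 \<le> (x /\<^sub>R norm x) \<bullet> (U t *v (x /\<^sub>R norm x))" by (intro unit) auto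
      then show ?thesis using False by (simp add: matrix_vector_mult_scaleR zero_le_mult_iff)
    qed simp
  qed
qed

text \<open>
  The Hamiltonian whose minimum over the control \<open>v\<close> is the Riccati map: it is affine in the pair of
  matrices, which is what makes the comparison arguments work.
\<close>

definition ham ::
    "('n::finite, 'm::finite) lq_data \<Rightarrow> real^'n^'n \<Rightarrow> real^'n^'n \<Rightarrow> real^'n \<Rightarrow> real^'m \<Rightarrow> real" where
  "ham d P Pib x v = 2 * ((Pib *v x) \<bullet> (hatA d *v x + cB d *v v))
     + (hatC d *v x + cD d *v v) \<bullet> (P *v (hatC d *v x + cD d *v v))
     + (hatG d *v x) \<bullet> (Pib *v (hatG d *v x))
     + x \<bullet> (hatQ d *v x) + 2 * ((cS d *v x) \<bullet> v) + v \<bullet> (cR d *v v)"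

lemma ham_diff:
  "ham d P Pib x v - ham d P' Pib' x v = 2 * (((Pib - Pib') *v x) \<bullet> (hatA d *v x + cB d *v v))
     + (hatC d *v x + cD d *v v) \<bullet> ((P - P') *v (hatC d *v x + cD d *v v))
     + (hatG d *v x) \<bullet> ((Pib - Pib') *v (hatG d *v x))"
  by (simp add: ham_def matrix_vector_mult_diff_rdistrib inner_diff_left inner_diff_right algebra_simps)

text \<open>With both matrices zero only the running cost is left. Its weight \<open>1 - k\<close>
  is the gain that compensates the time derivative of the scaling factor in the lower half of the
  sandwich.\<close>

lemma ham_scale:
  "ham d (k *\<^sub>R P) (k *\<^sub>R Pib) x v = k * ham d P Pib x v + (1 - k) * ham d 0 0 x v"
  by (simp add: ham_def scaleR_matrix_vector_assoc[symmetric] algebra_simps)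

lemma mapR_Theta_bar:
  assumes "pd_mat (mapR d P)"
  shows "mapR d P *v (Theta_bar d P Pib *v x) = - (mapS_hat d P Pib *v x)"
  using matrix_mult_inv[OF pd_mat_invertible[OF assms]]
  by (simp add: Theta_bar_def matrix_vector_mul_assoc[symmetric] matrix_vector_mult_minus matrix_vector_mult_minus_right)

lemma mapR_theta:
  assumes "pd_mat (mapR d P)"
  shows "mapR d P *v theta d p P
    = - (transpose (cB d) *v p + transpose (cD d) *v (P *v csigma d) + cr d)"
  using matrix_mult_inv[OF pd_mat_invertible[OF assms]]
  by (simp add: theta_def matrix_vector_mult_minus_right del: transpose_matrix_vector)

lemma pd_mapR:
  assumes "pd_mat (cR d)" "psd_mat P"
  shows "pd_mat (mapR d P)"
  using assms symmetric_mapR[of d P] psd_mat_nonneg[of P]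
  by (auto simp: pd_mat_def mapR_inner add_pos_nonneg)

lemma mapS_hat_inner:
  assumes "symmetric_mat P" "symmetric_mat Pib"
  shows "v \<bullet> (mapS_hat d P Pib *v x) = (cB d *v v) \<bullet> (Pib *v x) + (cD d *v v) \<bullet> (P *v (hatC d *v x)) + v \<bullet> (cS d *v x)"
  by (simp add: mapS_hat_def matrix_vector_mult_add_rdistrib inner_add_right inner_transpose_mult
      matrix_vector_mul_assoc[symmetric] del: transpose_matrix_vector)

text \<open>Completion of the square in the control: the minimiser is the feedback
  \<open>Theta_bar\<close>, the minimum is the form of \<open>Psi2\<close>, and the curvature is
  \<open>mapR\<close>.\<close>

lemma ham_square:
  assumes sym: "symmetric_mat P" "symmetric_mat Pib" and R: "pd_mat (mapR d P)"
  shows "ham d P Pib x v = x \<bullet> (Psi2 d P Pib *v x)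
    + (v - Theta_bar d P Pib *v x) \<bullet> (mapR d P *v (v - Theta_bar d P Pib *v x))"
proof -
  define w where "w = Theta_bar d P Pib *v x"
  define k where "k = mapS_hat d P Pib *v x"
  have Rw: "mapR d P *v w = - k" using mapR_Theta_bar[OF R] by (simp add: w_def k_def)
  have wRv: "w \<bullet> (mapR d P *v v) = - (v \<bullet> k)"
    using symmetric_mat_inner[OF pd_mat_symmetric[OF R]] Rw by (metis inner_commute inner_minus_right)
  have sq: "(v - w) \<bullet> (mapR d P *v (v - w)) = v \<bullet> (mapR d P *v v) + 2 * (v \<bullet> k) - k \<bullet> w"
    by (simp add: matrix_vector_mult_diff_distrib inner_diff_left inner_diff_right inner_add_right Rw wRv inner_commute[of k])
  have w: "w = - (matrix_inv (mapR d P) *v k)"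
    by (simp add: w_def k_def Theta_bar_def matrix_vector_mul_assoc matrix_vector_mult_minus)
  have sPib: "x \<bullet> (Pib *v y) = (Pib *v x) \<bullet> y" "y \<bullet> (Pib *v x) = (Pib *v x) \<bullet> y" for y
    using symmetric_mat_inner[OF sym(2)] by (simp_all add: inner_commute)
  have "x \<bullet> (Psi2 d P Pib *v x) = x \<bullet> (Pib *v (hatA d *v x)) + (hatA d *v x) \<bullet> (Pib *v x)
      + (hatC d *v x) \<bullet> (P *v (hatC d *v x)) + (hatG d *v x) \<bullet> (Pib *v (hatG d *v x)) + x \<bullet> (hatQ d *v x) + k \<bullet> w"
    by (simp add: Psi2_def mapQ_hat_def matrix_vector_mult_add_rdistrib matrix_vector_mult_diff_rdistrib
        inner_add_right inner_diff_right inner_transpose_mult matrix_vector_mul_assoc[symmetric] w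
        k_def del: transpose_matrix_vector)
  then have psi: "x \<bullet> (Psi2 d P Pib *v x) = 2 * ((Pib *v x) \<bullet> (hatA d *v x))
      + (hatC d *v x) \<bullet> (P *v (hatC d *v x)) + (hatG d *v x) \<bullet> (Pib *v (hatG d *v x)) + x \<bullet> (hatQ d *v x) + k \<bullet> w"
    by (simp add: sPib)
  have "v \<bullet> k = (cB d *v v) \<bullet> (Pib *v x) + (cD d *v v) \<bullet> (P *v (hatC d *v x)) + v \<bullet> (cS d *v x)"
    unfolding k_def by (rule mapS_hat_inner[OF sym])
  moreover have "(hatC d *v x) \<bullet> (P *v (cD d *v v)) = (cD d *v v) \<bullet> (P *v (hatC d *v x))"
    using symmetric_mat_inner[OF sym(1)] by (metis inner_commute)
  moreover have "(cS d *v x) \<bullet> v = v \<bullet> (cS d *v x)" by (rule inner_commute)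
  ultimately show ?thesis
    unfolding w_def[symmetric] sq psi ham_def unfolding mapR_inner
    by (simp add: inner_add_left inner_add_right matrix_vector_right_distrib sPib)
qed

section \<open>Riccati equations\<close>

text \<open>The summand of \<open>mapR\<close> that contains \<open>P\<close> is semidefinite, so
  the coercivity constant of \<open>cR d\<close> serves for all \<open>P\<close> at once. Gains are
  estimated by multiplying with \<open>mapR\<close>, and no inverse matrix is ever bounded.\<close>

lemma Theta_bar_norm_bound:
  fixes d :: "('n::finite, 'm::finite) lq_data"
  assumes r: "r > 0" "\<And>v. r * (norm v)\<^sup>2 \<le> v \<bullet> (cR d *v v)"
    and R: "pd_mat (cR d)" and P: "psd_mat P"
  shows "r * norm (w :: real^'m) \<le> norm (mapR d P *v w)"
proof (cases "w = 0")
  case False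
  have "r * (norm w)\<^sup>2 \<le> w \<bullet> (mapR d P *v w)"
    using r(2)[of w] psd_mat_nonneg[OF P, of "cD d *v w"] by (simp add: mapR_inner)
  also have "\<dots> \<le> norm w * norm (mapR d P *v w)" by (rule norm_cauchy_schwarz)
  finally have "norm w * (r * norm w) \<le> norm w * norm (mapR d P *v w)"
    by (simp add: power2_eq_square mult_ac)
  then show ?thesis using False by simp
qed simp

lemma mapS_hat_mult:
  "mapS_hat d P Pib *v x = transpose (cB d) *v (Pib *v x) + transpose (cD d) *v (P *v (hatC d *v x)) + cS d *v x"
  by (simp add: mapS_hat_def matrix_vector_mult_add_rdistrib matrix_vector_mul_assoc[symmetric] del: transpose_matrix_vector)

lemma mapR_mult:
  "mapR d P *v v = cR d *v v + transpose (cD d) *v (P *v (cD d *v v))"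
  by (simp add: mapR_def matrix_vector_mult_add_rdistrib matrix_vector_mul_assoc[symmetric] del: transpose_matrix_vector)

text \<open>Each gain solves a linear equation with its own \<open>mapR\<close>. Subtracting them
  after moving the change of \<open>mapR\<close> to the right-hand side leaves an expression linear
  in the matrix differences, as in a resolvent identity.\<close>

lemma mapR_Theta_bar_diff:
  fixes d :: "('n::finite, 'm::finite) lq_data"
  assumes R: "pd_mat (cR d)" and P: "psd_mat P" and P': "psd_mat P'"
  shows "mapR d P *v ((Theta_bar d P Pib - Theta_bar d P' Pib') *v x)
    = transpose (cB d) *v ((Pib' - Pib) *v x)
      + transpose (cD d) *v ((P' - P) *v (hatC d *v x + cD d *v (Theta_bar d P' Pib' *v x)))"
proof -
  have "mapR d P *v ((Theta_bar d P Pib - Theta_bar d P' Pib') *v x)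
     = mapR d P *v (Theta_bar d P Pib *v x) - mapR d P *v (Theta_bar d P' Pib' *v x)"
    by (simp add: algebra_simps)
  also have "mapR d P *v (Theta_bar d P' Pib' *v x) = mapR d P' *v (Theta_bar d P' Pib' *v x)
     - transpose (cD d) *v ((P' - P) *v (cD d *v (Theta_bar d P' Pib' *v x)))"
    by (simp add: mapR_mult algebra_simps del: transpose_matrix_vector)
  finally show ?thesis
    by (simp add: mapR_Theta_bar[OF pd_mapR[OF R P]] mapR_Theta_bar[OF pd_mapR[OF R P']] mapS_hat_mult
        algebra_simps del: transpose_matrix_vector)
qed

lemma mapR_theta_diff:
  fixes d :: "('n::finite, 'm::finite) lq_data"
  assumes R: "pd_mat (cR d)" and P: "psd_mat P" and P': "psd_mat P'"
  shows "mapR d P *v (theta d p P - theta d p' P')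
    = transpose (cB d) *v (p' - p)
      + transpose (cD d) *v ((P' - P) *v (csigma d + cD d *v theta d p' P'))"
proof -
  have "mapR d P *v (theta d p P - theta d p' P') = mapR d P *v theta d p P - mapR d P *v theta d p' P'"
    by (simp add: algebra_simps)
  also have "mapR d P *v theta d p' P' = mapR d P' *v theta d p' P'
     - transpose (cD d) *v ((P' - P) *v (cD d *v theta d p' P'))"
    by (simp add: mapR_mult algebra_simps del: transpose_matrix_vector)
  finally show ?thesis
    by (simp add: mapR_theta[OF pd_mapR[OF R P]] mapR_theta[OF pd_mapR[OF R P']]
        algebra_simps del: transpose_matrix_vector)
qed

text \<open>The square completion at the zero matrices: minimising the running cost over the control
  gives the Schur complement.\<close>

lemma ham_zero_ge:
  fixes d :: "('n::finite, 'm::finite) lq_data"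
  assumes "pd_mat (cR d)"
  shows "x \<bullet> ((hatQ d - transpose (cS d) ** matrix_inv (cR d) ** cS d) *v x) \<le> ham d 0 0 x v"
proof -
  have 0: "symmetric_mat (0::real^'n^'n)" by (simp add: symmetric_mat_def transpose_def vec_eq_iff)
  have R: "mapR d 0 = cR d" by (simp add: mapR_def)
  have "Psi2 d 0 0 = hatQ d - transpose (cS d) ** matrix_inv (cR d) ** cS d"
    by (simp add: Psi2_def mapQ_hat_def mapS_hat_def R)
  then show ?thesis
    using ham_square[OF 0 0, of d x v] assms psd_mat_nonneg[OF pd_mat_imp_psd[OF assms]] by (simp add: R)
qed

lemma ham_Theta_bar:
  assumes "pd_mat (cR d)" "psd_mat P" "symmetric_mat Pib"
  shows "ham d P Pib x (Theta_bar d P Pib *v x) = x \<bullet> (Psi2 d P Pib *v x)"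
  using ham_square[OF psd_mat_symmetric[OF assms(2)] assms(3) pd_mapR[OF assms(1,2)]] by simp

lemma ham_ge_Psi2:
  assumes "pd_mat (cR d)" "psd_mat P" "symmetric_mat Pib"
  shows "x \<bullet> (Psi2 d P Pib *v x) \<le> ham d P Pib x v"
  using ham_square[OF psd_mat_symmetric[OF assms(2)] assms(3) pd_mapR[OF assms(1,2)]]
    psd_mat_nonneg[OF pd_mat_imp_psd[OF pd_mapR[OF assms(1,2)]]] by simp

text \<open>
  The hypothesis \<open>coupling\<close> covers both Riccati equations: in the first alternative the two matrices
  coincide and the equation is closed, in the second the bounds for the other matrix are known already.
\<close>

lemma riccati_sandwich:
  fixes d :: "('n::finite, 'm::finite) lq_data" and PT PibT :: "real \<Rightarrow> real^'n^'n" and c T :: real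
  defines "\<kappa> \<equiv> \<lambda>t. 1 - exp (- c * (T - t))"
  assumes R: "pd_mat (cR d)" and P: "psd_mat P" and Pib: "psd_mat Pib" and alg: "Psi2 d P Pib = 0"
    and psd: "\<And>t. t \<in> {0..T} \<Longrightarrow> psd_mat (PT t)" "\<And>t. t \<in> {0..T} \<Longrightarrow> psd_mat (PibT t)"
    and contP: "continuous_on {0..T} PT"
    and der: "\<And>t. t \<in> {0..T} \<Longrightarrow> (PibT has_vector_derivative - Psi2 d (PT t) (PibT t)) (at t within {0..T})"
    and final: "PibT T = 0"
    and c: "c > 0" "\<And>x v. c * (x \<bullet> (Pib *v x)) \<le> ham d 0 0 x v"
    and coupling: "(P = Pib \<and> PT = PibT) \<or>
      (\<forall>t\<in>{0..T}. psd_mat (PT t - \<kappa> t *\<^sub>R P) \<and> psd_mat (P - PT t))"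
  shows "\<forall>t\<in>{0..T}. psd_mat (PibT t - \<kappa> t *\<^sub>R Pib) \<and> psd_mat (Pib - PibT t)"
proof -
  have contPib: "continuous_on {0..T} PibT"
    using der by (meson continuous_on_eq_continuous_within has_vector_derivative_continuous)
  obtain r where r: "r > 0" "\<And>v. r * (norm v)\<^sup>2 \<le> v \<bullet> (cR d *v v)"
    using pd_mat_coercive[OF R] by metis
  \<comment> \<open>\<open>lyapunov_comparison\<close> needs one bound for the closed-loop
    coefficients over the whole interval. It may depend on \<open>T\<close>, since it does not enter
    the conclusion.\<close>
  obtain M where M: "M \<ge> 0" "\<And>t x. t \<in> {0..T} \<Longrightarrow>
      norm (hatA d *v x + cB d *v (Theta_bar d (PT t) (PibT t) *v x)) \<le> M * norm x
      \<and> norm (hatC d *v x + cD d *v (Theta_bar d (PT t) (PibT t) *v x)) \<le> M * norm x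
      \<and> norm (hatG d *v x) \<le> M * norm x
      \<and> norm (hatA d *v x + cB d *v (Theta_bar d P Pib *v x)) \<le> M * norm x
      \<and> norm (hatC d *v x + cD d *v (Theta_bar d P Pib *v x)) \<le> M * norm x"
  proof -
    obtain kk where kk: "kk > 0" "\<And>(A::real^'n^'n) x. norm (A *v x) \<le> norm A * norm x * kk"
      using bounded_bilinear.pos_bounded[OF bounded_bilinear_matrix_vector_mult] by metis
    obtain p1 where p1: "\<And>t. t \<in> {0..T} \<Longrightarrow> norm (PT t) \<le> p1" "p1 > 0"
      using compact_imp_bounded[OF compact_continuous_image[OF contP compact_Icc]]
      unfolding bounded_pos by (metis imageI)
    obtain p2 where p2: "\<And>t. t \<in> {0..T} \<Longrightarrow> norm (PibT t) \<le> p2" "p2 > 0"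
      using compact_imp_bounded[OF compact_continuous_image[OF contPib compact_Icc]]
      unfolding bounded_pos by (metis imageI)
    obtain a where a: "a > 0" "\<And>x. norm (hatA d *v x) \<le> a * norm x" using matrix_bound[of "hatA d"] by blast
    obtain b where b: "b > 0" "\<And>x. norm (cB d *v x) \<le> b * norm x" using matrix_bound[of "cB d"] by blast
    obtain b' where b': "b' > 0" "\<And>x. norm (transpose (cB d) *v x) \<le> b' * norm x" using matrix_bound[of "transpose (cB d)"] by blast
    obtain e where e: "e > 0" "\<And>x. norm (cD d *v x) \<le> e * norm x" using matrix_bound[of "cD d"] by blast
    obtain e' where e': "e' > 0" "\<And>x. norm (transpose (cD d) *v x) \<le> e' * norm x" using matrix_bound[of "transpose (cD d)"] by blast
    obtain cc where cc: "cc > 0" "\<And>x. norm (hatC d *v x) \<le> cc * norm x" using matrix_bound[of "hatC d"] by blast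
    obtain s where s: "s > 0" "\<And>x. norm (cS d *v x) \<le> s * norm x" using matrix_bound[of "cS d"] by blast
    obtain g where g: "g > 0" "\<And>x. norm (hatG d *v x) \<le> g * norm x" using matrix_bound[of "hatG d"] by blast
    obtain h where h: "h > 0" "\<And>x. norm (Theta_bar d P Pib *v x) \<le> h * norm x" using matrix_bound[of "Theta_bar d P Pib"] by blast
    \<comment> \<open>A bound for the gain along the trajectory: norms of the terms of
      \<open>mapS_hat\<close>, divided by the coercivity constant of \<open>cR d\<close>.\<close>
    define n where "n = (b' * p2 * kk + e' * p1 * kk * cc + s) / r"
    have n: "n \<ge> 0" using b' p2 kk e' p1 cc s r by (simp add: n_def)
    have th: "norm (Theta_bar d (PT t) (PibT t) *v x) \<le> n * norm x" if t: "t \<in> {0..T}" for t x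
    proof -
      have "r * norm (Theta_bar d (PT t) (PibT t) *v x) \<le> norm (mapS_hat d (PT t) (PibT t) *v x)"
        using Theta_bar_norm_bound[OF r R psd(1)[OF t]] mapR_Theta_bar[OF pd_mapR[OF R psd(1)[OF t]]]
        by (metis norm_minus_cancel)
      also have "\<dots> \<le> norm (transpose (cB d) *v (PibT t *v x))
          + norm (transpose (cD d) *v (PT t *v (hatC d *v x))) + norm (cS d *v x)"
        unfolding mapS_hat_mult by (meson norm_triangle_le norm_triangle_ineq add_mono order_refl)
      also have "norm (transpose (cB d) *v (PibT t *v x)) \<le> b' * (p2 * norm x * kk)"
        by (rule order_trans[OF b'(2)], intro mult_left_mono order_trans[OF kk(2)] mult_right_mono p2(1) t)
           (use b' kk in auto)
      also have "norm (transpose (cD d) *v (PT t *v (hatC d *v x))) \<le> e' * (p1 * (cc * norm x) * kk)"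
        by (rule order_trans[OF e'(2)], intro mult_left_mono order_trans[OF kk(2)] mult_right_mono mult_mono p1(1) t cc(2))
           (use e' kk p1 in auto)
      also have "norm (cS d *v x) \<le> s * norm x" by (rule s)
      finally have "r * norm (Theta_bar d (PT t) (PibT t) *v x)
          \<le> b' * (p2 * norm x * kk) + e' * (p1 * (cc * norm x) * kk) + s * norm x" by simp
      then show ?thesis using r(1) by (simp add: n_def field_simps)
    qed
    have sum: "norm (A *v x + B *v y) \<le> M * norm x" if "\<And>x. norm (A *v x) \<le> i * norm x" "\<And>x. norm (B *v x) \<le> j * norm x"
      "norm y \<le> l * norm x" "i + j * l \<le> M" "j \<ge> 0" for A :: "real^'n^'n" and B :: "real^'m^'n" and x y i j l M
    proof -
      have "norm (A *v x + B *v y) \<le> i * norm x + j * norm y"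
        using that(1)[of x] that(2)[of y] norm_triangle_ineq[of "A *v x" "B *v y"] by linarith
      also have "\<dots> \<le> i * norm x + j * (l * norm x)" using that(3,5) by (simp add: mult_left_mono)
      also have "\<dots> \<le> M * norm x" using that(4) mult_right_mono[OF that(4) norm_ge_zero[of x]] by (simp add: algebra_simps)
      finally show ?thesis .
    qed
    define M where "M = a + cc + g + (b + e) * (n + h)"
    have pos: "b * n \<ge> 0" "b * h \<ge> 0" "e * n \<ge> 0" "e * h \<ge> 0" using b e n h by auto
    show ?thesis
    proof (rule that[of M])
      show "M \<ge> 0" using a cc g pos by (simp add: M_def algebra_simps)
      fix t x assume t: "t \<in> {0..T}"
      have "norm (hatG d *v x) \<le> M * norm x"
        by (rule order_trans[OF g(2)], rule mult_right_mono) (use a cc g pos in \<open>simp_all add: M_def algebra_simps\<close>)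
      then show "norm (hatA d *v x + cB d *v (Theta_bar d (PT t) (PibT t) *v x)) \<le> M * norm x
        \<and> norm (hatC d *v x + cD d *v (Theta_bar d (PT t) (PibT t) *v x)) \<le> M * norm x
        \<and> norm (hatG d *v x) \<le> M * norm x
        \<and> norm (hatA d *v x + cB d *v (Theta_bar d P Pib *v x)) \<le> M * norm x
        \<and> norm (hatC d *v x + cD d *v (Theta_bar d P Pib *v x)) \<le> M * norm x"
        using sum[OF a(2) b(2) th[OF t, of x], of M] sum[OF cc(2) e(2) th[OF t, of x], of M]
          sum[OF a(2) b(2) h(2)[of x], of M] sum[OF cc(2) e(2) h(2)[of x], of M] a b cc e g pos
        by (simp add: M_def algebra_simps)
    qed
  qed
  have sPib: "symmetric_mat Pib" and sP: "symmetric_mat P" using P Pib by auto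
  have symdiff: "symmetric_mat (A - k *\<^sub>R B)" if "symmetric_mat A" "symmetric_mat B" for A B :: "real^'n^'n" and k
    by (rule symmetric_matI) (simp add: matrix_vector_mult_diff_rdistrib inner_diff_left inner_diff_right
        symmetric_mat_inner[OF that(1)] symmetric_mat_inner[OF that(2)] scaleR_matrix_vector_assoc[symmetric])
  have lower: "psd_mat (PibT t - \<kappa> t *\<^sub>R Pib)" if t: "t \<in> {0..T}" for t
  proof (rule lyapunov_comparison[OF _ _ _ M(1) _ t])
    fix t assume t: "t \<in> {0..T}"
    show "((\<lambda>t. PibT t - \<kappa> t *\<^sub>R Pib) has_vector_derivative
        - Psi2 d (PT t) (PibT t) - (- c * exp (- c * (T - t))) *\<^sub>R Pib) (at t within {0..T})"
      unfolding \<kappa>_def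
      by (rule has_vector_derivative_diff[OF der[OF t]])
         (auto intro!: derivative_eq_intros simp: has_vector_derivative_def algebra_simps)
    show "symmetric_mat (PibT t - \<kappa> t *\<^sub>R Pib)"
      by (intro symdiff psd_mat_symmetric psd(2) t Pib)
  next
    show "psd_mat (PibT T - \<kappa> T *\<^sub>R Pib)"
      by (simp add: final \<kappa>_def psd_mat_def symmetric_mat_def transpose_def vec_eq_iff)
  next
    fix t and x :: "real^'n" assume t: "t \<in> {0..T}"
    \<comment> \<open>The optimal control of the finite-horizon pair: there its Hamiltonian equals
      \<open>Psi2\<close>, while for the scaled algebraic pair a lower bound for an arbitrary
      control is enough.\<close>
    define v where "v = Theta_bar d (PT t) (PibT t) *v x"
    define e where "e = exp (- c * (T - t))"
    define U where "U = PibT t - \<kappa> t *\<^sub>R Pib"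
    define a where "a = hatA d *v x + cB d *v v"
    define b where "b = hatC d *v x + cD d *v v"
    define h where "h = hatG d *v x"
    have \<kappa>: "\<kappa> t \<ge> 0" "\<kappa> t = 1 - e" using t c(1) by (auto simp: \<kappa>_def e_def)
    have "x \<bullet> (Psi2 d (PT t) (PibT t) *v x) = ham d (PT t) (PibT t) x v"
      unfolding v_def using ham_Theta_bar[OF R psd(1)[OF t] psd_mat_symmetric[OF psd(2)[OF t]]] by simp
    moreover have "ham d (PT t) (PibT t) x v - ham d (\<kappa> t *\<^sub>R P) (\<kappa> t *\<^sub>R Pib) x v
        = 2 * ((U *v x) \<bullet> a) + b \<bullet> ((PT t - \<kappa> t *\<^sub>R P) *v b) + h \<bullet> (U *v h)"
      by (simp add: ham_diff U_def a_def b_def h_def)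
    \<comment> \<open>The derivative of \<open>\<kappa>\<close> is \<open>- c * e\<close>; the
      running cost of weight \<open>1 - \<kappa> t = e\<close> supplies exactly the amount
      \<open>e * c\<close> times the form of \<open>Pib\<close>.\<close>
    moreover have "ham d (\<kappa> t *\<^sub>R P) (\<kappa> t *\<^sub>R Pib) x v \<ge> e * (c * (x \<bullet> (Pib *v x)))"
    proof -
      have "0 \<le> ham d P Pib x v" using ham_ge_Psi2[OF R P sPib, of x v] by (simp add: alg)
      then have "0 \<le> \<kappa> t * ham d P Pib x v" using \<kappa>(1) by simp
      moreover have "e * (c * (x \<bullet> (Pib *v x))) \<le> e * ham d 0 0 x v"
        using c(2) by (intro mult_left_mono) (auto simp: e_def)
      ultimately show ?thesis unfolding ham_scale by (simp add: \<kappa>(2))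
    qed
    ultimately have key: "x \<bullet> ((- Psi2 d (PT t) (PibT t) - (- c * e) *\<^sub>R Pib) *v x)
        \<le> - (2 * ((U *v x) \<bullet> a) + b \<bullet> ((PT t - \<kappa> t *\<^sub>R P) *v b) + h \<bullet> (U *v h))"
      by (simp add: matrix_vector_mult_diff_rdistrib matrix_vector_mult_add_rdistrib matrix_vector_mult_minus
          inner_diff_right inner_add_right scaleR_matrix_vector_assoc[symmetric] mult_ac)
    have bounds: "norm a \<le> M * norm x" "norm b \<le> M * norm x" "norm h \<le> M * norm x"
      using M(2)[OF t, of x] by (auto simp: a_def b_def h_def v_def)
    show "\<exists>a b c'. norm a \<le> M * norm x \<and> norm b \<le> M * norm x \<and> norm c' \<le> M * norm x \<and>
       x \<bullet> ((- Psi2 d (PT t) (PibT t) - (- c * exp (- c * (T - t))) *\<^sub>R Pib) *v x)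
       \<le> - (2 * (((PibT t - \<kappa> t *\<^sub>R Pib) *v x) \<bullet> a) + b \<bullet> ((PibT t - \<kappa> t *\<^sub>R Pib) *v b)
           + c' \<bullet> ((PibT t - \<kappa> t *\<^sub>R Pib) *v c'))"
      using coupling
    proof
      assume "P = Pib \<and> PT = PibT"
      then show ?thesis using key bounds by (intro exI[of _ a] exI[of _ b] exI[of _ h]) (simp add: U_def e_def)
    next
      assume "\<forall>t\<in>{0..T}. psd_mat (PT t - \<kappa> t *\<^sub>R P) \<and> psd_mat (P - PT t)"
      then have "0 \<le> b \<bullet> ((PT t - \<kappa> t *\<^sub>R P) *v b)" using t psd_mat_nonneg by blast
      \<comment> \<open>The term in \<open>b\<close> involves the other matrix and is already
        nonnegative, so \<open>0\<close> may stand in its place.\<close>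
      then show ?thesis using key bounds M(1) by (intro exI[of _ a] exI[of _ 0] exI[of _ h]) (simp add: U_def e_def)
    qed
  qed
  have upper: "psd_mat (Pib - PibT t)" if t: "t \<in> {0..T}" for t
  proof (rule lyapunov_comparison[OF _ _ _ M(1) _ t])
    fix t assume t: "t \<in> {0..T}"
    show "((\<lambda>t. Pib - PibT t) has_vector_derivative (0 - - Psi2 d (PT t) (PibT t))) (at t within {0..T})"
      by (rule has_vector_derivative_diff[OF has_vector_derivative_const der[OF t]])
    show "symmetric_mat (Pib - PibT t)"
      using symdiff[of Pib "PibT t" 1] psd(2)[OF t] Pib by auto
  next
    show "psd_mat (Pib - PibT T)" by (simp add: final Pib)
  next
    fix t and x :: "real^'n" assume t: "t \<in> {0..T}"
    \<comment> \<open>The roles are exchanged: the control is optimal for the algebraic pair, whose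
      Hamiltonian is then 0, and the finite-horizon pair only needs the minimum property.\<close>
    define v where "v = Theta_bar d P Pib *v x"
    define U where "U = Pib - PibT t"
    define a where "a = hatA d *v x + cB d *v v"
    define b where "b = hatC d *v x + cD d *v v"
    define h where "h = hatG d *v x"
    have "x \<bullet> (Psi2 d (PT t) (PibT t) *v x) \<le> ham d (PT t) (PibT t) x v"
      by (rule ham_ge_Psi2[OF R psd(1)[OF t] psd_mat_symmetric[OF psd(2)[OF t]]])
    moreover have "ham d P Pib x v - ham d (PT t) (PibT t) x v
        = 2 * ((U *v x) \<bullet> a) + b \<bullet> ((P - PT t) *v b) + h \<bullet> (U *v h)"
      by (simp add: ham_diff U_def a_def b_def h_def)
    moreover have "ham d P Pib x v = 0"
      unfolding v_def using ham_Theta_bar[OF R P sPib] by (simp add: alg)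
    ultimately have key: "x \<bullet> ((0 - - Psi2 d (PT t) (PibT t)) *v x)
        \<le> - (2 * ((U *v x) \<bullet> a) + b \<bullet> ((P - PT t) *v b) + h \<bullet> (U *v h))"
      by simp
    have bounds: "norm a \<le> M * norm x" "norm b \<le> M * norm x" "norm h \<le> M * norm x"
      using M(2)[OF t, of x] by (auto simp: a_def b_def h_def v_def)
    show "\<exists>a b c'. norm a \<le> M * norm x \<and> norm b \<le> M * norm x \<and> norm c' \<le> M * norm x \<and>
       x \<bullet> ((0 - - Psi2 d (PT t) (PibT t)) *v x)
       \<le> - (2 * (((Pib - PibT t) *v x) \<bullet> a) + b \<bullet> ((Pib - PibT t) *v b)
           + c' \<bullet> ((Pib - PibT t) *v c'))"
      using coupling
    proof
      assume "P = Pib \<and> PT = PibT"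
      then show ?thesis using key bounds by (intro exI[of _ a] exI[of _ b] exI[of _ h]) (simp add: U_def)
    next
      assume "\<forall>t\<in>{0..T}. psd_mat (PT t - \<kappa> t *\<^sub>R P) \<and> psd_mat (P - PT t)"
      then have "0 \<le> b \<bullet> ((P - PT t) *v b)" using t psd_mat_nonneg by blast
      then show ?thesis using key bounds M(1) by (intro exI[of _ a] exI[of _ 0] exI[of _ h]) (simp add: U_def)
    qed
  qed
  show ?thesis using lower upper by blast
qed

text \<open>Energies are known only through an integrated balance, so \<open>v\<close> has an
  integrand \<open>g\<close> instead of a pointwise derivative. At the first time where
  \<open>v\<close> reaches \<open>w\<close>, continuity extends the strict inequality for
  \<open>w'\<close> to a short interval before it; integrating there contradicts
  \<open>v < w\<close> at its left end.\<close>

lemma scalar_comparison: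
  fixes v w g w' \<phi> \<psi> :: "real \<Rightarrow> real"
  assumes int: "\<And>t. t \<in> {0..T} \<Longrightarrow> (g has_integral (v t - v 0)) {0..t}"
    and der: "\<And>t. t \<in> {0..T} \<Longrightarrow> (w has_real_derivative w' t) (at t within {0..T})"
    and cont: "continuous_on {0..T} w'" "continuous_on {0..T} \<phi>" "continuous_on {0..T} \<psi>"
    and le: "\<And>t. t \<in> {0<..T} \<Longrightarrow> g t \<le> \<phi> t * v t + \<psi> t"
    and strict: "\<And>t. t \<in> {0..T} \<Longrightarrow> \<phi> t * w t + \<psi> t < w' t"
    and init: "v 0 < w 0" and t: "t \<in> {0..T}"
  shows "v t < w t"
proof (rule ccontr)
  assume neg: "\<not> v t < w t"
  have T: "0 \<le> T" using t by auto
  have gint: "g integrable_on {0..T}" using int[of T] T by auto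
  have "continuous_on {0..T} (\<lambda>s. v 0 + integral {0..s} g)"
    by (intro continuous_intros indefinite_integral_continuous_1 gint)
  then have contv: "continuous_on {0..T} v"
    by (rule continuous_on_eq) (simp add: integral_unique[OF int])
  have contw: "continuous_on {0..T} w"
    using der DERIV_continuous continuous_on_eq_continuous_within by blast
  define S where "S = {s \<in> {0..T}. w s \<le> v s}"
  have "S = {0..T} \<inter> (\<lambda>s. v s - w s) -` {0..}" by (auto simp: S_def)
  moreover have "closed ({0..T} \<inter> (\<lambda>s. v s - w s) -` {0..})"
    by (intro continuous_closed_preimage continuous_intros contv contw)
  ultimately have "closed S" by simp
  moreover have "bounded S" by (rule bounded_subset[of "{0..T}"]) (auto simp: S_def)
  ultimately have "compact S" by (simp add: compact_eq_bounded_closed)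
  moreover have "t \<in> S" using t neg by (auto simp: S_def)
  ultimately obtain s where s: "s \<in> S" "\<And>r. r \<in> S \<Longrightarrow> s \<le> r"
    using compact_attains_inf[of S] by blast
  have sT: "s \<in> {0..T}" and ws: "w s \<le> v s" using s(1) by (auto simp: S_def)
  have before: "v r < w r" if "0 \<le> r" "r < s" for r
  proof (rule ccontr)
    assume "\<not> v r < w r"
    then have "r \<in> S" using that sT by (auto simp: S_def)
    then show False using s(2) that by fastforce
  qed
  have "s > 0" using init ws sT by (cases "s = 0") auto
  \<comment> \<open>The slack of the strict inequality, evaluated along \<open>v\<close> instead of
    \<open>w\<close>; the two agree at the contact time.\<close>
  define h where "h r = w' r - (\<phi> r * v r + \<psi> r)" for r
  have conth: "continuous_on {0..T} h" unfolding h_def by (intro continuous_intros cont contv)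
  have lim: "(f \<longlongrightarrow> f s) (at_left s)" if "continuous_on {0..T} f" for f :: "real \<Rightarrow> real"
  proof -
    have "continuous_on {0..s} f" using continuous_on_subset[OF that] sT by auto
    then have "(f \<longlongrightarrow> f s) (at s within {0..s})" using sT by (auto simp: continuous_on_def)
    then show ?thesis using at_within_Icc_at_left[OF \<open>s > 0\<close>] by simp
  qed
  have "v s \<le> w s"
  proof (rule tendsto_le[OF _ lim[OF contw] lim[OF contv]])
    have "\<forall>\<^sub>F r in at_left s. r \<in> {0<..<s}" by (rule eventually_at_left_real) fact
    then show "\<forall>\<^sub>F r in at_left s. v r \<le> w r"
      by eventually_elim (use before in \<open>force intro: less_imp_le\<close>)
  qed simp
  then have "v s = w s" using ws by simp
  then have "h s > 0" using strict[OF sT] by (simp add: h_def)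
  then have "\<forall>\<^sub>F r in at_left s. h r > 0" using order_tendstoD(1)[OF lim[OF conth]] by blast
  then obtain b where b: "b < s" "\<And>r. b < r \<Longrightarrow> r < s \<Longrightarrow> h r > 0"
    unfolding eventually_at_left_field by blast
  \<comment> \<open>Strictly positive, because the differential inequality is not assumed at time 0,
    and close enough to \<open>s\<close> for \<open>h\<close> to stay positive.\<close>
  define r where "r = max (s / 2) ((b + s) / 2)"
  have r: "0 < r" "b < r" "r < s" using \<open>s > 0\<close> b by (auto simp: r_def max_def)
  have rs: "h q \<ge> 0" if "q \<in> {r..s}" for q
    using b(2)[of q] that r \<open>h s > 0\<close> by (cases "q = s") auto
  have "(g has_integral (v s - v r)) {r..s}"
  proof -
    have "integral {0..r} g + integral {r..s} g = integral {0..s} g"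
      by (rule Henstock_Kurzweil_Integration.integral_combine) (use r gint sT in \<open>auto intro: integrable_on_subinterval\<close>)
    moreover have "integral {0..r} g = v r - v 0" "integral {0..s} g = v s - v 0"
      using int[of r] int[of s] r sT by (auto simp: integral_unique)
    ultimately have "integral {r..s} g = v s - v r" by linarith
    moreover have "g integrable_on {r..s}" using gint by (rule integrable_on_subinterval) (use r sT in auto)
    ultimately show ?thesis using has_integral_integral by metis
  qed
  moreover have "(w' has_integral (w s - w r)) {r..s}"
  proof (rule fundamental_theorem_of_calculus)
    show "r \<le> s" using r by simp
    fix q assume "q \<in> {r..s}"
    then have "(w has_real_derivative w' q) (at q within {r..s})"
      using r sT by (intro DERIV_subset[OF der]) auto
    then show "(w has_vector_derivative w' q) (at q within {r..s})"
      by (simp add: has_real_derivative_iff_has_vector_derivative)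
  qed
  ultimately have "v s - v r \<le> w s - w r"
  proof (rule has_integral_le)
    fix q assume q: "q \<in> {r..s}"
    then have "g q \<le> \<phi> q * v q + \<psi> q" using r sT by (intro le) auto
    then show "g q \<le> w' q" using rs[OF q] by (simp add: h_def)
  qed
  then show False using before[of r] r \<open>v s = w s\<close> by simp
qed

text \<open>With the barred coefficients removed and both matrices equal, the second Riccati map
  becomes the first. Every result about \<open>Psi2\<close> and \<open>Theta_bar\<close> therefore
  also covers \<open>Psi1\<close> and \<open>Theta\<close>.\<close>

definition strip_bars :: "('n::finite, 'm::finite) lq_data \<Rightarrow> ('n, 'm) lq_data" where
  "strip_bars d = d\<lparr>cAb := 0, cCb := 0, cGb := 0, cQb := 0\<rparr>"

lemma strip_bars:
  "Psi1 d P = Psi2 (strip_bars d) P P" "Theta d P = Theta_bar (strip_bars d) P P"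
  "hatA (strip_bars d) = cA d" "hatC (strip_bars d) = cC d" "hatG (strip_bars d) = cG d"
  "hatQ (strip_bars d) = cQ d" "cB (strip_bars d) = cB d" "cD (strip_bars d) = cD d"
  "cR (strip_bars d) = cR d" "cS (strip_bars d) = cS d"
  by (simp_all add: strip_bars_def Psi1_def Psi2_def Theta_def Theta_bar_def mapR_def mapS_def mapS_hat_def
      mapQ_def mapQ_hat_def hatA_def hatC_def hatG_def hatQ_def)

section \<open>Dependence of the feedback gains on the Riccati data\<close>

lemma norm_matrix_sum:
  assumes "\<And>x. norm (A *v x) \<le> a * norm x" "norm y \<le> b" "0 \<le> a"
  shows "norm (A *v y) \<le> a * b"
  using assms(1)[of y] mult_left_mono[OF assms(2,3)] by linarith

text \<open>The constant involves only the reference pair \<open>P\<close>, \<open>Pib\<close>: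
  \<open>mapR d P'\<close> is inverted through its uniform lower bound, and the remaining factor is
  the reference closed-loop matrix \<open>L\<close>. Hence it does not depend on the
  horizon.\<close>

lemma Theta_bar_estimate:
  fixes d :: "('n::finite, 'm::finite) lq_data"
  assumes R: "pd_mat (cR d)" and P: "psd_mat P"
  shows "\<exists>K>0. \<forall>P' Pib' e. psd_mat P' \<longrightarrow> 0 \<le> e \<longrightarrow> (\<forall>x. norm ((P - P') *v x) \<le> e * norm x)
    \<longrightarrow> (\<forall>x. norm ((Pib - Pib') *v x) \<le> e * norm x)
    \<longrightarrow> (\<forall>x. norm ((Theta_bar d P' Pib' - Theta_bar d P Pib) *v x) \<le> K * e * norm x)"
proof -
  obtain r where r: "r > 0" "\<And>v. r * (norm v)\<^sup>2 \<le> v \<bullet> (cR d *v v)"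
    using pd_mat_coercive[OF R] by metis
  obtain b' where b': "b' > 0" "\<And>x. norm (transpose (cB d) *v x) \<le> b' * norm x"
    using matrix_bound[of "transpose (cB d)"] by blast
  obtain e' where e': "e' > 0" "\<And>x. norm (transpose (cD d) *v x) \<le> e' * norm x"
    using matrix_bound[of "transpose (cD d)"] by blast
  define L where "L = hatC d + cD d ** Theta_bar d P Pib"
  obtain l where l: "l > 0" "\<And>x. norm (L *v x) \<le> l * norm x" using matrix_bound[of L] by blast
  show ?thesis
  proof (intro exI[of _ "(b' + e' * l) / r"] conjI allI impI)
    show "0 < (b' + e' * l) / r" using b' e' l r by (simp add: add_pos_pos)
    fix P' Pib' :: "real^'n^'n" and e :: real and x :: "real^'n"
    assume P': "psd_mat P'" and e: "0 \<le> e" and dP: "\<forall>x. norm ((P - P') *v x) \<le> e * norm x"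
      and dPib: "\<forall>x. norm ((Pib - Pib') *v x) \<le> e * norm x"
    let ?w = "(Theta_bar d P' Pib' - Theta_bar d P Pib) *v x"
    have "r * norm ?w \<le> norm (mapR d P' *v ?w)" by (rule Theta_bar_norm_bound[OF r R P'])
    also have "\<dots> = norm (transpose (cB d) *v ((Pib - Pib') *v x) + transpose (cD d) *v ((P - P') *v (L *v x)))"
      by (simp add: mapR_Theta_bar_diff[OF R P' P] L_def matrix_vector_mult_add_rdistrib
          matrix_vector_mul_assoc[symmetric] del: transpose_matrix_vector)
    also have "\<dots> \<le> b' * (e * norm x) + e' * (e * (l * norm x))"
      by (intro norm_triangle_le add_mono norm_matrix_sum[OF b'(2)] norm_matrix_sum[OF e'(2)]
            norm_matrix_sum[OF dP[rule_format]] dPib[rule_format] l(2)) (use b' e' e in auto)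
    finally show "norm ?w \<le> (b' + e' * l) / r * e * norm x"
      using r(1) by (simp add: field_simps)
  qed
qed

lemma theta_estimate:
  fixes d :: "('n::finite, 'm::finite) lq_data"
  assumes R: "pd_mat (cR d)" and P: "psd_mat P"
  shows "\<exists>K>0. \<forall>P' p' e. psd_mat P' \<longrightarrow> 0 \<le> e \<longrightarrow> (\<forall>x. norm ((P - P') *v x) \<le> e * norm x)
    \<longrightarrow> norm (p' - p) \<le> e \<longrightarrow> norm (theta d p' P' - theta d p P) \<le> K * e"
proof -
  obtain r where r: "r > 0" "\<And>v. r * (norm v)\<^sup>2 \<le> v \<bullet> (cR d *v v)"
    using pd_mat_coercive[OF R] by metis
  obtain b' where b': "b' > 0" "\<And>x. norm (transpose (cB d) *v x) \<le> b' * norm x"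
    using matrix_bound[of "transpose (cB d)"] by blast
  obtain e' where e': "e' > 0" "\<And>x. norm (transpose (cD d) *v x) \<le> e' * norm x"
    using matrix_bound[of "transpose (cD d)"] by blast
  define w where "w = csigma d + cD d *v theta d p P"
  define l where "l = norm w"
  show ?thesis
  proof (intro exI[of _ "(b' + e' * l) / r"] conjI allI impI)
    show "0 < (b' + e' * l) / r" using b' e' r by (simp add: l_def add_pos_nonneg)
    fix P' :: "real^'n^'n" and p' e
    assume P': "psd_mat P'" and e: "0 \<le> e" and dP: "\<forall>x. norm ((P - P') *v x) \<le> e * norm x"
      and dp: "norm (p' - p) \<le> e"
    let ?w = "theta d p' P' - theta d p P"
    have "r * norm ?w \<le> norm (mapR d P' *v ?w)" by (rule Theta_bar_norm_bound[OF r R P'])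
    also have "\<dots> = norm (transpose (cB d) *v (p - p')
        + transpose (cD d) *v ((P - P') *v w))"
      by (simp add: mapR_theta_diff[OF R P' P] w_def del: transpose_matrix_vector)
    also have "\<dots> \<le> b' * e + e' * (e * l)"
      by (intro norm_triangle_le add_mono norm_matrix_sum[OF b'(2)] norm_matrix_sum[OF e'(2)]
            norm_matrix_sum[OF dP[rule_format]]) (use b' e' e dp in \<open>auto simp: norm_minus_commute l_def\<close>)
    finally show "norm ?w \<le> (b' + e' * l) / r * e" using r(1) by (simp add: field_simps)
  qed
qed

lemma continuous_on_matrixI:
  fixes f :: "'a::topological_space \<Rightarrow> real^'n^'m"
  assumes "\<And>x. continuous_on S (\<lambda>t. f t *v x)"
  shows "continuous_on S f"
proof -
  have "f t $ i $ j = (f t *v axis j 1) $ i" for t i j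
    by (simp add: matrix_vector_mult_basis column_def)
  then have "f = (\<lambda>t. \<chi> i j. (f t *v axis j 1) $ i)" by (simp add: fun_eq_iff vec_eq_iff)
  moreover have "continuous_on S (\<lambda>t. \<chi> i j. (f t *v axis j 1) $ i)"
    by (intro continuous_on_vec_lambda continuous_on_component assms)
  ultimately show ?thesis by metis
qed

text \<open>The difference identity for the gains bounds the increment by a quantity that tends to
  0, which replaces continuity of matrix inversion.\<close>

lemma continuous_on_Theta_bar:
  fixes d :: "('n::finite, 'm::finite) lq_data" and P Pib :: "real \<Rightarrow> real^'n^'n"
  assumes R: "pd_mat (cR d)" and P: "\<And>t. t \<in> S \<Longrightarrow> psd_mat (P t)"
    and cont: "continuous_on S P" "continuous_on S Pib"
  shows "continuous_on S (\<lambda>t. Theta_bar d (P t) (Pib t))"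
proof (rule continuous_on_matrixI)
  fix x
  obtain r where r: "r > 0" "\<And>v. r * (norm v)\<^sup>2 \<le> v \<bullet> (cR d *v v)"
    using pd_mat_coercive[OF R] by metis
  show "continuous_on S (\<lambda>t. Theta_bar d (P t) (Pib t) *v x)"
    unfolding continuous_on_def
  proof
    fix s assume s: "s \<in> S"
    let ?f = "\<lambda>t. transpose (cB d) *v ((Pib s - Pib t) *v x)
      + transpose (cD d) *v ((P s - P t) *v (hatC d *v x + cD d *v (Theta_bar d (P s) (Pib s) *v x)))"
    have lim: "(P \<longlongrightarrow> P s) (at s within S)" "(Pib \<longlongrightarrow> Pib s) (at s within S)"
      using cont s by (auto simp: continuous_on_def)
    have "((\<lambda>t. norm (?f t) / r) \<longlongrightarrow> norm (transpose (cB d) *v ((Pib s - Pib s) *v x)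
      + transpose (cD d) *v ((P s - P s) *v (hatC d *v x + cD d *v (Theta_bar d (P s) (Pib s) *v x)))) / r) (at s within S)"
      by (intro tendsto_intros bounded_bilinear.tendsto[OF bounded_bilinear_matrix_vector_mult] lim)
         (use r in auto)
    then have lim0: "((\<lambda>t. norm (?f t) / r) \<longlongrightarrow> 0) (at s within S)" by (simp del: transpose_matrix_vector)
    have "\<forall>\<^sub>F t in at s within S. norm (Theta_bar d (P t) (Pib t) *v x - Theta_bar d (P s) (Pib s) *v x) \<le> norm (?f t) / r"
      unfolding eventually_at_topological
    proof (intro exI[of _ UNIV] conjI ballI impI)
      fix t assume t: "t \<in> S"
      have "r * norm ((Theta_bar d (P t) (Pib t) - Theta_bar d (P s) (Pib s)) *v x) \<le> norm (?f t)"
        using Theta_bar_norm_bound[OF r R P[OF t], of "(Theta_bar d (P t) (Pib t) - Theta_bar d (P s) (Pib s)) *v x"]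
        unfolding mapR_Theta_bar_diff[OF R P[OF t] P[OF s]] .
      then show "norm (Theta_bar d (P t) (Pib t) *v x - Theta_bar d (P s) (Pib s) *v x) \<le> norm (?f t) / r"
        using r by (simp add: field_simps matrix_vector_mult_diff_rdistrib)
    qed auto
    then show "((\<lambda>t. Theta_bar d (P t) (Pib t) *v x) \<longlongrightarrow> Theta_bar d (P s) (Pib s) *v x) (at s within S)"
      by (rule Lim_null[THEN iffD2, OF Lim_null_comparison[OF _ lim0]])
  qed
qed

lemma continuous_on_theta:
  fixes d :: "('n::finite, 'm::finite) lq_data" and P :: "real \<Rightarrow> real^'n^'n" and p :: "real \<Rightarrow> real^'n"
  assumes R: "pd_mat (cR d)" and P: "\<And>t. t \<in> S \<Longrightarrow> psd_mat (P t)"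
    and cont: "continuous_on S P" "continuous_on S p"
  shows "continuous_on S (\<lambda>t. theta d (p t) (P t))"
  unfolding continuous_on_def
proof
  fix s assume s: "s \<in> S"
  obtain r where r: "r > 0" "\<And>v. r * (norm v)\<^sup>2 \<le> v \<bullet> (cR d *v v)"
    using pd_mat_coercive[OF R] by metis
  let ?f = "\<lambda>t. transpose (cB d) *v (p s - p t)
      + transpose (cD d) *v ((P s - P t) *v (csigma d + cD d *v theta d (p s) (P s)))"
  have lim: "(P \<longlongrightarrow> P s) (at s within S)" "(p \<longlongrightarrow> p s) (at s within S)"
    using cont s by (auto simp: continuous_on_def)
  have "((\<lambda>t. norm (?f t) / r) \<longlongrightarrow> norm (transpose (cB d) *v (p s - p s)
      + transpose (cD d) *v ((P s - P s) *v (csigma d + cD d *v theta d (p s) (P s)))) / r) (at s within S)"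
    by (intro tendsto_intros bounded_bilinear.tendsto[OF bounded_bilinear_matrix_vector_mult] lim)
       (use r in auto)
  then have lim0: "((\<lambda>t. norm (?f t) / r) \<longlongrightarrow> 0) (at s within S)" by (simp del: transpose_matrix_vector)
  have "\<forall>\<^sub>F t in at s within S. norm (theta d (p t) (P t) - theta d (p s) (P s)) \<le> norm (?f t) / r"
    unfolding eventually_at_topological
  proof (intro exI[of _ UNIV] conjI ballI impI)
    fix t assume t: "t \<in> S"
    have "r * norm (theta d (p t) (P t) - theta d (p s) (P s)) \<le> norm (?f t)"
      using Theta_bar_norm_bound[OF r R P[OF t], of "theta d (p t) (P t) - theta d (p s) (P s)"]
      unfolding mapR_theta_diff[OF R P[OF t] P[OF s]] .
    then show "norm (theta d (p t) (P t) - theta d (p s) (P s)) \<le> norm (?f t) / r"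
      using r by (simp add: field_simps)
  qed auto
  then show "((\<lambda>t. theta d (p t) (P t)) \<longlongrightarrow> theta d (p s) (P s)) (at s within S)"
    by (rule Lim_null[THEN iffD2, OF Lim_null_comparison[OF _ lim0]])
qed

text \<open>At the optimal feedback the Hamiltonian of an algebraic solution vanishes, so its
  dynamic part equals minus the running cost, and that is coercive by the Schur complement
  condition.\<close>

lemma closed_loop_lyapunov:
  fixes d :: "('n::finite, 'm::finite) lq_data"
  assumes R: "pd_mat (cR d)" and P: "psd_mat P" and Pib: "psd_mat Pib" and alg: "Psi2 d P Pib = 0"
    and Q: "pd_mat (hatQ d - transpose (cS d) ** matrix_inv (cR d) ** cS d)"
  shows "\<exists>\<epsilon>>0. \<forall>x. 2 * ((Pib *v x) \<bullet> (hatA d *v x + cB d *v (Theta_bar d P Pib *v x)))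
     + (hatC d *v x + cD d *v (Theta_bar d P Pib *v x)) \<bullet> (P *v (hatC d *v x + cD d *v (Theta_bar d P Pib *v x)))
     + (hatG d *v x) \<bullet> (Pib *v (hatG d *v x)) \<le> - \<epsilon> * (norm x)\<^sup>2"
proof -
  obtain \<epsilon> where \<epsilon>: "\<epsilon> > 0" "\<And>x. \<epsilon> * (norm x)\<^sup>2
      \<le> x \<bullet> ((hatQ d - transpose (cS d) ** matrix_inv (cR d) ** cS d) *v x)"
    using pd_mat_coercive[OF Q] by metis
  show ?thesis
  proof (intro exI[of _ \<epsilon>] conjI allI \<epsilon>)
    fix x
    have "ham d P Pib x (Theta_bar d P Pib *v x) = 0"
      using ham_Theta_bar[OF R P psd_mat_symmetric[OF Pib]] by (simp add: alg)
    moreover have "\<epsilon> * (norm x)\<^sup>2 \<le> ham d 0 0 x (Theta_bar d P Pib *v x)"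
      using \<epsilon>(2) ham_zero_ge[OF R] order_trans by blast
    ultimately show "2 * ((Pib *v x) \<bullet> (hatA d *v x + cB d *v (Theta_bar d P Pib *v x)))
     + (hatC d *v x + cD d *v (Theta_bar d P Pib *v x)) \<bullet> (P *v (hatC d *v x + cD d *v (Theta_bar d P Pib *v x)))
     + (hatG d *v x) \<bullet> (Pib *v (hatG d *v x)) \<le> - \<epsilon> * (norm x)\<^sup>2"
      by (simp add: ham_def)
  qed
qed

text \<open>Only the first term is a dynamics for \<open>p' - p\<close>, namely the transposed
  closed-loop drift tested against \<open>z\<close>; each other term contains a difference of
  matrices or of gains and acts as a forcing.\<close>

lemma Psi3_diff:
  fixes d :: "('n::finite, 'm::finite) lq_data"
  defines "\<Delta> \<equiv> \<lambda>P Pib P' Pib'. Theta_bar d P' Pib' - Theta_bar d P Pib"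
  shows "z \<bullet> (Psi3 d P' Pib' p' - Psi3 d P Pib p) = (hatA d *v z + cB d *v (Theta_bar d P Pib *v z)) \<bullet> (p' - p)
     + (cB d *v (\<Delta> P Pib P' Pib' *v z)) \<bullet> p' + (cD d *v (\<Delta> P Pib P' Pib' *v z)) \<bullet> (P' *v csigma d)
     + (hatC d *v z + cD d *v (Theta_bar d P Pib *v z)) \<bullet> ((P' - P) *v csigma d)
     + (\<Delta> P Pib P' Pib' *v z) \<bullet> cr d
     + z \<bullet> ((Pib' - Pib) *v cb d) + (hatG d *v z) \<bullet> ((Pib' - Pib) *v cgamma d)"
  unfolding Psi3_def \<Delta>_def
  by (simp add: inner_transpose_mult inner_diff_right inner_add_right inner_diff_left inner_add_left
      matrix_vector_mult_add_rdistrib matrix_vector_mult_diff_rdistrib matrix_vector_mult_diff_distrib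
      matrix_vector_mul_assoc[symmetric]
      del: transpose_matrix_vector)

text \<open>Coercivity of the minimised running cost divided by a norm bound of \<open>Pib\<close>.
  The resulting \<open>c\<close> is the exponential rate at which finite-horizon Riccati solutions
  approach the algebraic ones.\<close>

lemma ham_floor:
  fixes d :: "('n::finite, 'm::finite) lq_data"
  assumes R: "pd_mat (cR d)" and Pib: "psd_mat Pib"
    and Q: "pd_mat (hatQ d - transpose (cS d) ** matrix_inv (cR d) ** cS d)"
  shows "\<exists>c>0. \<forall>x v. c * (x \<bullet> (Pib *v x)) \<le> ham d 0 0 x v"
proof -
  obtain \<epsilon> where \<epsilon>: "\<epsilon> > 0" "\<And>x. \<epsilon> * (norm x)\<^sup>2
      \<le> x \<bullet> ((hatQ d - transpose (cS d) ** matrix_inv (cR d) ** cS d) *v x)"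
    using pd_mat_coercive[OF Q] by metis
  obtain k where k: "k > 0" "\<And>x. norm (Pib *v x) \<le> k * norm x"
    using matrix_bound[of Pib] by blast
  show ?thesis
  proof (intro exI[of _ "\<epsilon> / k"] conjI allI)
    show "\<epsilon> / k > 0" using \<epsilon> k by simp
    fix x v
    have "x \<bullet> (Pib *v x) \<le> norm x * norm (Pib *v x)" by (rule norm_cauchy_schwarz)
    also have "\<dots> \<le> norm x * (k * norm x)" by (intro mult_left_mono k) auto
    finally have "\<epsilon> * (x \<bullet> (Pib *v x)) \<le> \<epsilon> * (k * (norm x)\<^sup>2)"
      using \<epsilon>(1) by (intro mult_left_mono) (auto simp: power2_eq_square mult_ac)
    then have "\<epsilon> / k * (x \<bullet> (Pib *v x)) \<le> \<epsilon> * (norm x)\<^sup>2"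
      using k(1) by (simp add: field_simps)
    also have "\<dots> \<le> ham d 0 0 x v" using order_trans[OF \<epsilon>(2) ham_zero_ge[OF R]] .
    finally show "\<epsilon> / k * (x \<bullet> (Pib *v x)) \<le> ham d 0 0 x v" .
  qed
qed

lemma sandwich_norm_bound:
  assumes "psd_mat (P' - \<kappa> *\<^sub>R P)" "psd_mat (P - P')" "\<kappa> \<le> 1"
    and k: "\<And>x. norm (P *v x) \<le> k * norm x"
  shows "norm ((P - P') *v x) \<le> (1 - \<kappa>) * k * norm x"
proof (rule psd_mat_norm_bound[OF assms(2)])
  fix x
  have "0 \<le> x \<bullet> ((P' - \<kappa> *\<^sub>R P) *v x)" by (rule psd_mat_nonneg[OF assms(1)])
  then have "x \<bullet> ((P - P') *v x) \<le> (1 - \<kappa>) * (x \<bullet> (P *v x))"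
    by (simp add: matrix_vector_mult_diff_rdistrib inner_diff_right scaleR_matrix_vector_assoc[symmetric] algebra_simps)
  also have "x \<bullet> (P *v x) \<le> k * (norm x)\<^sup>2"
    using norm_cauchy_schwarz[of x "P *v x"] mult_left_mono[OF k[of x] norm_ge_zero[of x]]
    by (simp add: power2_eq_square mult_ac)
  finally show "x \<bullet> ((P - P') *v x) \<le> (1 - \<kappa>) * k * (norm x)\<^sup>2"
    using assms(3) by (simp add: mult_left_mono mult.assoc)
qed

section \<open>Exponential convergence of the finite-horizon Riccati solutions\<close>

lemma continuous_on_has_vector_derivative:
  "(\<And>t. t \<in> S \<Longrightarrow> (f has_vector_derivative f' t) (at t within S)) \<Longrightarrow> continuous_on S f"
  by (meson continuous_on_eq_continuous_within has_vector_derivative_continuous)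

text \<open>A Gronwall estimate in which both the multiplicative and the additive perturbation die
  out; it is used in reversed time for the linear term \<open>p\<close>.\<close>

lemma decaying_forcing:
  fixes a c K v0 :: real
  assumes pos: "a > 0" "c > 0" "K > 0" "v0 \<ge> 0"
  shows "\<exists>k>0. \<exists>l>0. \<forall>T v g. (\<forall>t\<in>{0..T}. (g has_integral (v t - v 0)) {0..t}) \<longrightarrow>
     (\<forall>t\<in>{0<..T}. g t \<le> (- a + K * exp (- c * t)) * v t + K * exp (- c * t)) \<longrightarrow> v 0 \<le> v0 \<longrightarrow>
     (\<forall>t\<in>{0..T}. v t \<le> k * exp (- l * t))"
proof -
  \<comment> \<open>The exponential cancels the smallest value of the correction factor in
    \<open>w\<close>, so \<open>w 0 = v0 + 1 + 2 * K / a\<close>. The 1 gives a strict start, and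
    \<open>2 * K / a\<close> lets half of the dissipation absorb the additive forcing.\<close>
  define k where "k = (v0 + 1 + 2 * K / a) * exp (K / c)"
  \<comment> \<open>\<open>l \<le> c\<close> keeps \<open>w\<close> above the forcing for all times;
    \<open>l \<le> a / 2\<close> leaves half of the dissipation free.\<close>
  define l where "l = min c (a / 2)"
  have k: "k > 0" using pos by (simp add: k_def add_nonneg_pos)
  have l: "l > 0" "l \<le> c" "l \<le> a / 2" using pos by (auto simp: l_def)
  define e where "e t = exp (- c * t)" for t
  \<comment> \<open>The middle factor has logarithmic derivative \<open>K * e t\<close> and so takes
    over the multiplicative perturbation.\<close>
  define w where "w t = k * exp (- (K / c) * e t) * exp (- l * t)" for t
  show ?thesis
  proof (rule exI[of _ k], intro exI[of _ l] conjI allI impI ballI k l)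
    fix T t v g
    assume int: "\<forall>t\<in>{0..T}. (g has_integral (v t - v 0)) {0..t}"
      and le: "\<forall>t\<in>{0<..T}. g t \<le> (- a + K * exp (- c * t)) * v t + K * exp (- c * t)"
      and v0: "v 0 \<le> v0" and t: "t \<in> {0..T}"
    have "v t < w t"
    proof (rule scalar_comparison[where \<phi> = "\<lambda>t. - a + K * e t" and \<psi> = "\<lambda>t. K * e t"
          and g = g and w' = "\<lambda>t. (K * e t - l) * w t", OF _ _ _ _ _ _ _ _ t])
      show "(w has_real_derivative (K * e t - l) * w t) (at t within {0..T})" for t
        unfolding w_def e_def
        by (rule derivative_eq_intros refl | simp)+ (use pos in \<open>simp add: field_simps\<close>)
      show "continuous_on {0..T} (\<lambda>t. (K * e t - l) * w t)"
        "continuous_on {0..T} (\<lambda>t. - a + K * e t)" "continuous_on {0..T} (\<lambda>t. K * e t)"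
        unfolding w_def e_def by (intro continuous_intros)+
      show "v 0 < w 0"
      proof -
        have "w 0 = v0 + 1 + 2 * K / a" by (simp add: w_def e_def k_def mult.assoc flip: exp_add)
        moreover have "2 * K / a > 0" using pos by simp
        ultimately show ?thesis using v0 by linarith
      qed
      fix t assume t: "t \<in> {0..T}"
      have "K * e t < (a - l) * w t"
      proof -
        have "e t \<le> 1" "e t > 0" using t pos by (auto simp: e_def)
        have "K * e t < (a / 2) * ((v0 + 1 + 2 * K / a) * e t)"
          using pos \<open>e t > 0\<close> by (simp add: field_simps add_pos_nonneg)
        also have "\<dots> \<le> (a - l) * w t"
        proof (intro mult_mono)
          have "e t \<le> exp (- l * t)" using l t by (auto simp: e_def intro!: mult_right_mono)
          have "(v0 + 1 + 2 * K / a) * e t \<le> (v0 + 1 + 2 * K / a) * exp (- l * t)"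
            using \<open>e t \<le> exp (- l * t)\<close> pos by (intro mult_left_mono) auto
          also have "\<dots> = k * exp (- (K / c)) * exp (- l * t)"
            by (simp add: k_def mult.assoc flip: exp_add)
          also have "\<dots> \<le> w t"
            unfolding w_def using \<open>e t \<le> 1\<close> pos k
            by (intro mult_right_mono mult_left_mono) (auto simp: field_simps)
          finally show "(v0 + 1 + 2 * K / a) * e t \<le> w t" .
        qed (use l pos \<open>e t > 0\<close> in auto)
        finally show ?thesis .
      qed
      then show "(- a + K * e t) * w t + K * e t < (K * e t - l) * w t" by (simp add: algebra_simps)
    qed (use int le in \<open>auto simp: e_def\<close>)
    also have "w t \<le> k * 1 * exp (- l * t)"
      unfolding w_def using k pos by (intro mult_right_mono mult_left_mono) (auto simp: e_def)
    finally show "v t \<le> k * exp (- l * t)" by simp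
  qed
qed

context
  fixes d :: "('n::finite, 'm::finite) lq_data" and P Pib :: "real^'n^'n" and p :: "real^'n"
  assumes R: "pd_mat (cR d)"
    and Q: "pd_mat (cQ d - transpose (cS d) ** matrix_inv (cR d) ** cS d)"
    and Qhat: "pd_mat (cQ d + cQb d - transpose (cS d) ** matrix_inv (cR d) ** cS d)"
    and alg: "algebraic_riccati_system d P Pib p"
begin

lemma riccati_matrix_turnpike:
  "\<exists>K>0. \<exists>c>0. \<forall>T PT PibT pT. riccati_system d T PT PibT pT \<longrightarrow> (\<forall>t\<in>{0..T}. \<forall>x.
     norm ((P - PT t) *v x) \<le> K * exp (- c * (T - t)) * norm x
     \<and> norm ((Pib - PibT t) *v x) \<le> K * exp (- c * (T - t)) * norm x)"
proof -
  let ?s = "strip_bars d"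
  have P: "psd_mat P" "Psi2 ?s P P = 0" and Pib: "psd_mat Pib" "Psi2 d P Pib = 0"
    using alg by (auto simp: algebraic_riccati_system_def strip_bars(1)[symmetric])
  obtain c1 where c1: "c1 > 0" "\<And>x v. c1 * (x \<bullet> (P *v x)) \<le> ham ?s 0 0 x v"
    using ham_floor[of ?s P] R P(1) Q by (auto simp: strip_bars)
  obtain c2 where c2: "c2 > 0" "\<And>x v. c2 * (x \<bullet> (Pib *v x)) \<le> ham d 0 0 x v"
    using ham_floor[of d Pib] R Pib(1) Qhat by (auto simp: hatQ_def)
  define c where "c = min c1 c2"
  have c: "c > 0" using c1 c2 by (simp add: c_def)
  have f1: "c * (x \<bullet> (P *v x)) \<le> ham ?s 0 0 x v" for x v
    using c1(2)[of x v] mult_right_mono[OF min.cobounded1[of c1 c2] psd_mat_nonneg[OF P(1), of x]]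
    by (simp add: c_def)
  have f2: "c * (x \<bullet> (Pib *v x)) \<le> ham d 0 0 x v" for x v
    using c2(2)[of x v] mult_right_mono[OF min.cobounded2[of c1 c2] psd_mat_nonneg[OF Pib(1), of x]]
    by (simp add: c_def)
  obtain k1 where k1: "k1 > 0" "\<And>x. norm (P *v x) \<le> k1 * norm x" using matrix_bound[of P] by blast
  obtain k2 where k2: "k2 > 0" "\<And>x. norm (Pib *v x) \<le> k2 * norm x" using matrix_bound[of Pib] by blast
  show ?thesis
  proof (rule exI[of _ "k1 + k2"], intro exI[of _ c] conjI allI impI ballI)
    show "k1 + k2 > 0" "c > 0" using k1 k2 c by auto
    fix T PT PibT pT t and x :: "real^'n"
    assume ric: "riccati_system d T PT PibT pT" and t: "t \<in> {0..T}"
    have psd: "\<And>t. t \<in> {0..T} \<Longrightarrow> psd_mat (PT t)" "\<And>t. t \<in> {0..T} \<Longrightarrow> psd_mat (PibT t)"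
      and der: "\<And>t. t \<in> {0..T} \<Longrightarrow> (PT has_vector_derivative - Psi2 ?s (PT t) (PT t)) (at t within {0..T})"
        "\<And>t. t \<in> {0..T} \<Longrightarrow> (PibT has_vector_derivative - Psi2 d (PT t) (PibT t)) (at t within {0..T})"
      and fin: "PT T = 0" "PibT T = 0"
      using ric by (auto simp: riccati_system_def strip_bars(1)[symmetric])
    have contP: "continuous_on {0..T} PT" using der(1) by (rule continuous_on_has_vector_derivative)
    \<comment> \<open>For the stripped data both matrices coincide, which is the first alternative
      of \<open>coupling\<close>; the result then feeds the second alternative for
      \<open>Pib\<close>.\<close>
    have 1: "\<forall>t\<in>{0..T}. psd_mat (PT t - (1 - exp (- c * (T - t))) *\<^sub>R P) \<and> psd_mat (P - PT t)"
      by (rule riccati_sandwich[OF _ P(1) P(1) P(2) psd(1) psd(1) contP der(1) fin(1) c f1])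
         (use R in \<open>auto simp: strip_bars\<close>)
    have 2: "\<forall>t\<in>{0..T}. psd_mat (PibT t - (1 - exp (- c * (T - t))) *\<^sub>R Pib) \<and> psd_mat (Pib - PibT t)"
      by (rule riccati_sandwich[OF R P(1) Pib(1) Pib(2) psd contP der(2) fin(2) c f2]) (use 1 in auto)
    have "norm ((P - PT t) *v x) \<le> exp (- c * (T - t)) * k1 * norm x"
      using sandwich_norm_bound[OF 1[rule_format, OF t, THEN conjunct1] 1[rule_format, OF t, THEN conjunct2] _ k1(2)] by simp
    also have "\<dots> \<le> (k1 + k2) * exp (- c * (T - t)) * norm x"
      using k2 by (simp add: algebra_simps)
    finally show "norm ((P - PT t) *v x) \<le> (k1 + k2) * exp (- c * (T - t)) * norm x" .
    have "norm ((Pib - PibT t) *v x) \<le> exp (- c * (T - t)) * k2 * norm x"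
      using sandwich_norm_bound[OF 2[rule_format, OF t, THEN conjunct1] 2[rule_format, OF t, THEN conjunct2] _ k2(2)] by simp
    also have "\<dots> \<le> (k1 + k2) * exp (- c * (T - t)) * norm x"
      using k1 by (simp add: algebra_simps)
    finally show "norm ((Pib - PibT t) *v x) \<le> (k1 + k2) * exp (- c * (T - t)) * norm x" .
  qed
qed

text \<open>In \<open>Psi3_diff\<close> every term except the closed-loop drift is bounded by a
  multiple of \<open>e\<close> and is at most affine in \<open>p' - p\<close>. The bound
  \<open>e \<le> 1\<close> keeps \<open>P'\<close> itself within a fixed distance of
  \<open>P\<close>.\<close>

lemma riccati_vector_forcing:
  "\<exists>K>0. \<forall>P' Pib' p' e z. psd_mat P' \<longrightarrow> 0 \<le> e \<longrightarrow> e \<le> 1 \<longrightarrow> (\<forall>x. norm ((P - P') *v x) \<le> L * e * norm x)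
    \<longrightarrow> (\<forall>x. norm ((Pib - Pib') *v x) \<le> L * e * norm x) \<longrightarrow>
    z \<bullet> Psi3 d P' Pib' p' \<le> (hatA d *v z + cB d *v (Theta_bar d P Pib *v z)) \<bullet> (p' - p)
      + K * e * norm z * (1 + norm (p' - p))" if L: "L > 0"
proof -
  have P: "psd_mat P" and Psi3: "Psi3 d P Pib p = 0" using alg by (auto simp: algebraic_riccati_system_def)
  obtain K0 where K0: "K0 > 0" "\<And>P' Pib' e x. psd_mat P' \<Longrightarrow> 0 \<le> e \<Longrightarrow> (\<forall>x. norm ((P - P') *v x) \<le> e * norm x)
    \<Longrightarrow> (\<forall>x. norm ((Pib - Pib') *v x) \<le> e * norm x)
    \<Longrightarrow> norm ((Theta_bar d P' Pib' - Theta_bar d P Pib) *v x) \<le> K0 * e * norm x"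
    using Theta_bar_estimate[OF R P, of Pib] by metis
  obtain b where b: "b > 0" "\<And>x. norm (cB d *v x) \<le> b * norm x" using matrix_bound[of "cB d"] by blast
  obtain e' where e': "e' > 0" "\<And>x. norm (cD d *v x) \<le> e' * norm x" using matrix_bound[of "cD d"] by blast
  obtain k where k: "k > 0" "\<And>x. norm (P *v x) \<le> k * norm x" using matrix_bound[of P] by blast
  define H where "H = hatC d + cD d ** Theta_bar d P Pib"
  obtain h where h: "h > 0" "\<And>x. norm (H *v x) \<le> h * norm x" using matrix_bound[of H] by blast
  obtain g where g: "g > 0" "\<And>x. norm (hatG d *v x) \<le> g * norm x" using matrix_bound[of "hatG d"] by blast
  define K1 where "K1 = K0 * L"
  have K1: "K1 > 0" using K0 L by (simp add: K1_def)
  define K where "K = b * K1 * (1 + norm p) + e' * K1 * ((k + L) * norm (csigma d)) + h * (L * norm (csigma d))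
     + K1 * norm (cr d) + L * norm (cb d) + g * (L * norm (cgamma d))"
  have K: "K > 0" unfolding K_def using b e' K1 k h g L by (simp add: add_pos_nonneg)
  show ?thesis
  proof (intro exI[of _ K] conjI allI impI K)
    fix P' Pib' :: "real^'n^'n" and p' z :: "real^'n" and e :: real
    assume P': "psd_mat P'" and e: "0 \<le> e" "e \<le> 1" and dP: "\<forall>x. norm ((P - P') *v x) \<le> L * e * norm x"
      and dPib: "\<forall>x. norm ((Pib - Pib') *v x) \<le> L * e * norm x"
    let ?\<Delta> = "(Theta_bar d P' Pib' - Theta_bar d P Pib) *v z"
    let ?z = "norm z" and ?y = "norm (p' - p)"
    have \<Delta>: "norm ?\<Delta> \<le> K1 * e * ?z"
      using K0(2)[OF P', of "L * e" Pib' z] dP dPib e L by (simp add: K1_def mult_ac)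
    have P's: "norm (P' *v s) \<le> (k + L) * norm s" for s
    proof -
      have "norm (P' *v s) = norm (P *v s - (P - P') *v s)" by (simp add: matrix_vector_mult_diff_rdistrib)
      also have "\<dots> \<le> k * norm s + L * e * norm s"
        by (rule norm_triangle_le_diff) (intro add_mono k dP[rule_format])
      also have "\<dots> \<le> k * norm s + L * 1 * norm s"
        using L e by (intro add_mono mult_right_mono mult_left_mono) auto
      finally show ?thesis by (simp add: algebra_simps)
    qed
    have dP': "norm ((P' - P) *v s) \<le> L * e * norm s" "norm ((Pib' - Pib) *v s) \<le> L * e * norm s" for s
      using dP[rule_format, of s] dPib[rule_format, of s]
      by (simp_all add: matrix_vector_mult_diff_rdistrib norm_minus_commute)
    have inn: "x \<bullet> y \<le> a * c" if "norm x \<le> a" "norm y \<le> c" for x y :: "'z::real_inner" and a c :: real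
      using norm_cauchy_schwarz[of x y] mult_mono[OF that] norm_ge_zero[of x] norm_ge_zero[of y] that by linarith
    have p': "norm p' \<le> (1 + norm p) * (1 + ?y)"
    proof -
      have "norm p' \<le> norm p + ?y" using norm_triangle_sub[of p' p] by simp
      moreover have "0 \<le> norm p * ?y" by simp
      moreover have "(1 + norm p) * (1 + ?y) = 1 + norm p + ?y + norm p * ?y" by (simp add: algebra_simps)
      ultimately show ?thesis by linarith
    qed
    have y1: "a \<le> a * (1 + ?y)" if "0 \<le> a" for a :: real using that by (simp add: algebra_simps)
    have t1: "(cB d *v ?\<Delta>) \<bullet> p' \<le> (b * (K1 * e * ?z)) * ((1 + norm p) * (1 + ?y))"
      by (intro inn p' norm_matrix_sum[OF b(2)] \<Delta>) (use b in auto)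
    have t2: "(cD d *v ?\<Delta>) \<bullet> (P' *v csigma d) \<le> (e' * (K1 * e * ?z)) * ((k + L) * norm (csigma d))"
      by (intro inn P's norm_matrix_sum[OF e'(2)] \<Delta>) (use e' in auto)
    have t3: "(hatC d *v z + cD d *v (Theta_bar d P Pib *v z)) \<bullet> ((P' - P) *v csigma d)
        \<le> (h * ?z) * (L * e * norm (csigma d))"
      using inn[OF h(2)[of z] dP'(1)[of "csigma d"]]
      by (simp add: H_def matrix_vector_mult_add_rdistrib matrix_vector_mul_assoc)
    have t4: "?\<Delta> \<bullet> cr d \<le> (K1 * e * ?z) * norm (cr d)" by (intro inn \<Delta>) auto
    have t5: "z \<bullet> ((Pib' - Pib) *v cb d) \<le> ?z * (L * e * norm (cb d))" by (intro inn dP') auto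
    have t6: "(hatG d *v z) \<bullet> ((Pib' - Pib) *v cgamma d) \<le> (g * ?z) * (L * e * norm (cgamma d))" by (intro inn dP' g)
    have "z \<bullet> Psi3 d P' Pib' p' - (hatA d *v z + cB d *v (Theta_bar d P Pib *v z)) \<bullet> (p' - p)
       \<le> (b * (K1 * e * ?z)) * ((1 + norm p) * (1 + ?y)) + ((e' * (K1 * e * ?z)) * ((k + L) * norm (csigma d))
         + (h * ?z) * (L * e * norm (csigma d)) + (K1 * e * ?z) * norm (cr d) + ?z * (L * e * norm (cb d))
         + (g * ?z) * (L * e * norm (cgamma d)))"
      using Psi3_diff[of z d P' Pib' p' P Pib p] Psi3 t1 t2 t3 t4 t5 t6 by simp
    also have "\<dots> \<le> (b * (K1 * e * ?z)) * ((1 + norm p) * (1 + ?y)) + ((e' * (K1 * e * ?z)) * ((k + L) * norm (csigma d))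
         + (h * ?z) * (L * e * norm (csigma d)) + (K1 * e * ?z) * norm (cr d) + ?z * (L * e * norm (cb d))
         + (g * ?z) * (L * e * norm (cgamma d))) * (1 + ?y)"
      by (intro add_left_mono y1) (use b e e' K1 k h g L in simp)
    also have "\<dots> = K * e * ?z * (1 + ?y)" by (simp add: K_def algebra_simps)
    finally show "z \<bullet> Psi3 d P' Pib' p' \<le> (hatA d *v z + cB d *v (Theta_bar d P Pib *v z)) \<bullet> (p' - p)
      + K * e * norm z * (1 + norm (p' - p))" by simp
  qed
qed


text \<open>The equation for \<open>p\<close> contains the transposed closed-loop drift, so the
  suitable Lyapunov function is the form of the inverse of \<open>Pib\<close>: with
  \<open>y = Pib *v z\<close> it equals the form of \<open>Pib\<close> at \<open>z\<close>, and the
  untransposed drift acts on \<open>z\<close>. Time is reversed because the data are given at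
  \<open>T\<close>.\<close>

lemma riccati_vector_turnpike:
  "\<exists>K>0. \<exists>c>0. \<forall>T PT PibT pT. riccati_system d T PT PibT pT \<longrightarrow>
     (\<forall>t\<in>{0..T}. norm (pT t - p) \<le> K * exp (- c * (T - t)))"
proof -
  have P: "psd_mat P" and Pib: "pd_mat Pib" "Psi2 d P Pib = 0"
    using alg by (auto simp: algebraic_riccati_system_def)
  obtain L c where L: "L > 0" "c > 0" and mat: "\<And>T PT PibT pT t x. riccati_system d T PT PibT pT \<Longrightarrow> t \<in> {0..T} \<Longrightarrow>
     norm ((P - PT t) *v x) \<le> L * exp (- c * (T - t)) * norm x
     \<and> norm ((Pib - PibT t) *v x) \<le> L * exp (- c * (T - t)) * norm x"
    using riccati_matrix_turnpike by metis
  obtain K where K: "K > 0" and force: "\<And>P' Pib' p' e z. psd_mat P' \<Longrightarrow> 0 \<le> e \<Longrightarrow> e \<le> 1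
     \<Longrightarrow> (\<forall>x. norm ((P - P') *v x) \<le> L * e * norm x) \<Longrightarrow> (\<forall>x. norm ((Pib - Pib') *v x) \<le> L * e * norm x)
    \<Longrightarrow> z \<bullet> Psi3 d P' Pib' p' \<le> (hatA d *v z + cB d *v (Theta_bar d P Pib *v z)) \<bullet> (p' - p)
      + K * e * norm z * (1 + norm (p' - p))"
    using riccati_vector_forcing[OF L(1)] by metis
  obtain \<epsilon> where \<epsilon>: "\<epsilon> > 0" and lyap: "\<And>x. 2 * ((Pib *v x) \<bullet> (hatA d *v x + cB d *v (Theta_bar d P Pib *v x)))
     + (hatC d *v x + cD d *v (Theta_bar d P Pib *v x)) \<bullet> (P *v (hatC d *v x + cD d *v (Theta_bar d P Pib *v x)))
     + (hatG d *v x) \<bullet> (Pib *v (hatG d *v x)) \<le> - \<epsilon> * (norm x)\<^sup>2"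
    using closed_loop_lyapunov[OF R P pd_mat_imp_psd[OF Pib(1)] Pib(2)] Qhat by (auto simp: hatQ_def)
  \<comment> \<open>A deterministic equation needs only the drift part; the two quadratic terms
    being dropped are nonnegative.\<close>
  have lyap': "2 * ((Pib *v x) \<bullet> (hatA d *v x + cB d *v (Theta_bar d P Pib *v x))) \<le> - \<epsilon> * (norm x)\<^sup>2" for x
    using lyap[of x] psd_mat_nonneg[OF P] psd_mat_nonneg[OF pd_mat_imp_psd[OF Pib(1)]] by (smt (verit))
  obtain c0 where c0: "c0 > 0" "\<And>x. c0 * (norm x)\<^sup>2 \<le> x \<bullet> (Pib *v x)" using pd_mat_coercive[OF Pib(1)] by metis
  obtain k2 where k2: "k2 > 0" "\<And>x. norm (Pib *v x) \<le> k2 * norm x" using matrix_bound[of Pib] by blast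
  define N where "N = matrix_inv Pib"
  have PibN: "Pib *v (N *v x) = x" for x
    unfolding N_def by (rule matrix_mult_inv[OF pd_mat_invertible[OF Pib(1)]])
  \<comment> \<open>Collects the forcing: \<open>K\<close> comes from the additive part, and
    division by \<open>c0\<close> converts the square of the norm of \<open>z\<close> into the
    Lyapunov function.\<close>
  define K2 where "K2 = K + (K + 2 * K * k2) / c0"
  have K2: "K2 > 0" using K k2 c0 by (simp add: K2_def add_pos_pos)
  \<comment> \<open>The final value \<open>pT T = 0\<close> makes the deviation at \<open>T\<close>
    equal to \<open>- p\<close>, so the reversed problem starts from this horizon-independent
    number.\<close>
  have v0: "0 \<le> p \<bullet> (N *v p)"
    using psd_mat_nonneg[OF pd_mat_imp_psd[OF Pib(1)], of "N *v p"] by (simp add: PibN inner_commute)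
  obtain k l where k: "k > 0" and l: "l > 0" and decay: "\<And>T v g t. (\<forall>t\<in>{0..T}. (g has_integral (v t - v 0)) {0..t}) \<Longrightarrow>
     (\<forall>t\<in>{0<..T}. g t \<le> (- (\<epsilon> / k2) + K2 * exp (- c * t)) * v t + K2 * exp (- c * t)) \<Longrightarrow> v 0 \<le> p \<bullet> (N *v p) \<Longrightarrow>
     t\<in>{0..T} \<Longrightarrow> v t \<le> k * exp (- l * t)"
    using decaying_forcing[of "\<epsilon> / k2" c K2 "p \<bullet> (N *v p)"] \<epsilon> k2 L K2 v0 by (metis divide_pos_pos)
  show ?thesis
  \<comment> \<open>The Lyapunov function controls the square of the deviation, hence the square
    root and the halved rate.\<close>
  proof (rule exI[of _ "sqrt (k2\<^sup>2 / c0 * k)"], intro exI[of _ "l / 2"] conjI allI impI ballI)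
    show "0 < sqrt (k2\<^sup>2 / c0 * k)" "0 < l / 2" using k2 c0 k l by auto
    fix T PT PibT pT t
    assume ric: "riccati_system d T PT PibT pT" and t: "t \<in> {0..T}"
    define y where "y s = pT s - p" for s
    define z where "z s = N *v y s" for s
    define v where "v s = y s \<bullet> z s" for s
    define \<psi> where "\<psi> s = Psi3 d (PT s) (PibT s) (pT s)" for s
    have Pz: "Pib *v z s = y s" for s by (simp add: z_def PibN)
    have v_eq: "v s = z s \<bullet> (Pib *v z s)" for s by (simp add: v_def Pz inner_commute)
    have derv: "(v has_real_derivative - (2 * (z s \<bullet> \<psi> s))) (at s within {0..T})" if s: "s \<in> {0..T}" for s
    proof -
      have "(pT has_vector_derivative - \<psi> s) (at s within {0..T})"
        using ric s by (auto simp: riccati_system_def \<psi>_def)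
      then have dy: "(y has_vector_derivative - \<psi> s) (at s within {0..T})"
        unfolding y_def using has_vector_derivative_diff[OF _ has_vector_derivative_const, of pT "- \<psi> s" _ p] by simp
      have dz: "(z has_vector_derivative N *v (- \<psi> s)) (at s within {0..T})"
        unfolding z_def by (rule bounded_linear.has_vector_derivative[OF matrix_vector_mul_bounded_linear dy])
      have "y s \<bullet> (N *v (- \<psi> s)) = z s \<bullet> (- \<psi> s)"
        using symmetric_mat_inner[OF pd_mat_symmetric[OF Pib(1)], of "z s" "N *v (- \<psi> s)"] by (simp add: Pz PibN)
      then have "y s \<bullet> (N *v (- \<psi> s)) + (- \<psi> s) \<bullet> z s = - (2 * (z s \<bullet> \<psi> s))"
        by (simp add: inner_commute)
      then show ?thesis
        using bounded_bilinear.has_vector_derivative[OF bounded_bilinear_inner dy dz]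
        by (simp add: has_real_derivative_iff_has_vector_derivative v_def[abs_def])
    qed
    define g where "g s = 2 * (z (T - s) \<bullet> \<psi> (T - s))" for s
    have "v (T - (T - t)) \<le> k * exp (- l * (T - t))"
    proof (rule decay[where v = "\<lambda>s. v (T - s)" and g = g])
      show "T - t \<in> {0..T}" using t by auto
      have "pT T = 0" using ric by (simp add: riccati_system_def)
      then show "v (T - 0) \<le> p \<bullet> (N *v p)"
        by (simp add: v_def z_def y_def matrix_vector_mult_minus_right)
      show "\<forall>t\<in>{0..T}. (g has_integral v (T - t) - v (T - 0)) {0..t}"
      proof
        fix t assume t: "t \<in> {0..T}"
        show "(g has_integral v (T - t) - v (T - 0)) {0..t}"
        proof (rule fundamental_theorem_of_calculus)
          show "0 \<le> t" using t by simp
          fix s assume s: "s \<in> {0..t}"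
          have "(v has_real_derivative - (2 * (z (T - s) \<bullet> \<psi> (T - s)))) (at (T - s) within (\<lambda>s. T - s) ` {0..t})"
            by (rule DERIV_subset[OF derv]) (use s t in auto)
          moreover have "((\<lambda>s. T - s) has_real_derivative - 1) (at s within {0..t})"
            by (auto intro!: derivative_eq_intros)
          ultimately have "(v \<circ> (\<lambda>s. T - s) has_real_derivative - (2 * (z (T - s) \<bullet> \<psi> (T - s))) * - 1) (at s within {0..t})"
            by (rule DERIV_image_chain)
          then show "((\<lambda>s. v (T - s)) has_vector_derivative g s) (at s within {0..t})"
            by (simp add: g_def o_def has_real_derivative_iff_has_vector_derivative)
        qed
      qed
      show "\<forall>t\<in>{0<..T}. g t \<le> (- (\<epsilon> / k2) + K2 * exp (- c * t)) * v (T - t) + K2 * exp (- c * t)"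
      proof
        fix t assume t: "t \<in> {0<..T}"
        define s where "s = T - t"
        have s: "s \<in> {0..T}" and Ts: "T - s = t" using t by (auto simp: s_def)
        define e where "e = exp (- c * t)"
        have e: "0 < e" "e \<le> 1" using L t by (auto simp: e_def)
        let ?n = "norm (z s)"
        have "psd_mat (PT s)" using ric s by (auto simp: riccati_system_def)
        then have "z s \<bullet> \<psi> s \<le> (hatA d *v z s + cB d *v (Theta_bar d P Pib *v z s)) \<bullet> y s + K * e * ?n * (1 + norm (y s))"
          unfolding \<psi>_def y_def by (rule force) (use e mat[OF ric s] in \<open>auto simp: Ts e_def\<close>)
        then have "g t \<le> 2 * ((Pib *v z s) \<bullet> (hatA d *v z s + cB d *v (Theta_bar d P Pib *v z s))) + 2 * (K * e * ?n * (1 + norm (y s)))"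
          by (simp add: g_def s_def[symmetric] Pz inner_commute)
        also have "\<dots> \<le> - \<epsilon> * ?n\<^sup>2 + (K + K * ?n\<^sup>2 + 2 * K * k2 * ?n\<^sup>2) * e"
        proof -
          have "norm (y s) \<le> k2 * ?n" using k2(2)[of "z s"] by (simp add: Pz)
          then have "K * e * ?n * (1 + norm (y s)) \<le> K * e * ?n * (1 + k2 * ?n)"
            using K e by (intro mult_left_mono) auto
          moreover have "2 * ?n \<le> 1 + ?n\<^sup>2" using sum_squares_bound[of 1 ?n] by simp
          then have "K * e * (2 * ?n) \<le> K * e * (1 + ?n\<^sup>2)" using K e by (intro mult_left_mono) auto
          ultimately show ?thesis using lyap'[of "z s"] by (simp add: algebra_simps power2_eq_square)
        qed
        also have "\<dots> \<le> - (\<epsilon> / k2) * v s + (K2 + K2 * v s) * e"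
        proof -
          have "v s \<le> k2 * ?n\<^sup>2"
            using norm_cauchy_schwarz[of "z s" "Pib *v z s"] mult_left_mono[OF k2(2)[of "z s"], of ?n]
            by (simp add: v_eq power2_eq_square mult_ac)
          then have 1: "\<epsilon> / k2 * v s \<le> \<epsilon> * ?n\<^sup>2" using \<epsilon> k2 by (simp add: field_simps)
          have c: "?n\<^sup>2 \<le> v s / c0" using c0(2)[of "z s"] c0(1) by (simp add: v_eq field_simps)
          have "v s \<ge> 0" by (simp add: v_eq psd_mat_nonneg[OF pd_mat_imp_psd[OF Pib(1)]])
          have "(K + 2 * K * k2) * ?n\<^sup>2 \<le> (K + 2 * K * k2) * (v s / c0)"
            using c K k2 by (intro mult_left_mono) auto
          also have "\<dots> \<le> K2 * v s" using \<open>v s \<ge> 0\<close> K by (simp add: K2_def algebra_simps add_divide_distrib)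
          finally have "(K + 2 * K * k2) * ?n\<^sup>2 \<le> K2 * v s" .
          moreover have "K \<le> K2" using K k2 c0 by (simp add: K2_def)
          ultimately have 2: "K + K * ?n\<^sup>2 + 2 * K * k2 * ?n\<^sup>2 \<le> K2 + K2 * v s"
            by (simp add: distrib_right)
          have "(K + K * ?n\<^sup>2 + 2 * K * k2 * ?n\<^sup>2) * e \<le> (K2 + K2 * v s) * e"
            by (rule mult_right_mono[OF 2]) (use e in simp)
          with 1 show ?thesis by linarith
        qed
        finally show "g t \<le> (- (\<epsilon> / k2) + K2 * exp (- c * t)) * v (T - t) + K2 * exp (- c * t)"
          by (simp add: s_def e_def algebra_simps)
      qed
    qed
    then have vle: "v t \<le> k * exp (- l * (T - t))" by simp
    have "c0 * (norm (y t))\<^sup>2 \<le> c0 * (k2 * norm (z t))\<^sup>2"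
      using k2(2)[of "z t"] c0 by (intro mult_left_mono power_mono) (auto simp: Pz)
    also have "\<dots> = k2\<^sup>2 * (c0 * (norm (z t))\<^sup>2)" by (simp add: power_mult_distrib)
    also have "\<dots> \<le> k2\<^sup>2 * (k * exp (- l * (T - t)))"
      using c0(2)[of "z t"] vle by (intro mult_left_mono) (auto simp: v_eq)
    finally have "(norm (y t))\<^sup>2 \<le> k2\<^sup>2 / c0 * k * exp (- l * (T - t))"
      using c0(1) by (simp add: field_simps)
    then have "norm (y t) \<le> sqrt (k2\<^sup>2 / c0 * k * exp (- l * (T - t)))" using real_le_rsqrt by blast
    also have "\<dots> = sqrt (k2\<^sup>2 / c0 * k) * sqrt (exp (- l * (T - t)))" by (rule real_sqrt_mult)
    also have "sqrt (exp (- l * (T - t))) = exp (- (l / 2) * (T - t))"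
      by (rule real_sqrt_unique) (auto simp: power2_eq_square simp flip: exp_add)
    finally show "norm (pT t - p) \<le> sqrt (k2\<^sup>2 / c0 * k) * exp (- (l / 2) * (T - t))" by (simp add: y_def)
  qed
qed

lemma riccati_turnpike:
  "\<exists>K>0. \<exists>c>0. \<forall>T PT PibT pT. riccati_system d T PT PibT pT \<longrightarrow> (\<forall>t\<in>{0..T}.
     (\<forall>x. norm ((Theta d (PT t) - Theta d P) *v x) \<le> K * exp (- c * (T - t)) * norm x)
     \<and> (\<forall>x. norm ((Theta_bar d (PT t) (PibT t) - Theta_bar d P Pib) *v x) \<le> K * exp (- c * (T - t)) * norm x)
     \<and> norm (theta d (pT t) (PT t) - theta d p P) \<le> K * exp (- c * (T - t)))"
proof -
  have P: "psd_mat P" using alg by (auto simp: algebraic_riccati_system_def)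
  obtain L c where L: "L > 0" "c > 0" and mat: "\<And>T PT PibT pT t x. riccati_system d T PT PibT pT \<Longrightarrow> t \<in> {0..T} \<Longrightarrow>
     norm ((P - PT t) *v x) \<le> L * exp (- c * (T - t)) * norm x
     \<and> norm ((Pib - PibT t) *v x) \<le> L * exp (- c * (T - t)) * norm x"
    using riccati_matrix_turnpike by metis
  obtain L' c' where L': "L' > 0" "c' > 0" and vec: "\<And>T PT PibT pT t. riccati_system d T PT PibT pT \<Longrightarrow> t \<in> {0..T} \<Longrightarrow>
     norm (pT t - p) \<le> L' * exp (- c' * (T - t))"
    using riccati_vector_turnpike by metis
  \<comment> \<open>The estimate for \<open>Theta\<close> is the one for \<open>Theta_bar\<close>
    with stripped data and both reference matrices equal to \<open>P\<close>.\<close>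
  obtain K1 where K1: "K1 > 0" "\<And>P' Pib' e x. psd_mat P' \<Longrightarrow> 0 \<le> e \<Longrightarrow> (\<forall>x. norm ((P - P') *v x) \<le> e * norm x)
    \<Longrightarrow> (\<forall>x. norm ((P - Pib') *v x) \<le> e * norm x)
    \<Longrightarrow> norm ((Theta_bar (strip_bars d) P' Pib' - Theta_bar (strip_bars d) P P) *v x) \<le> K1 * e * norm x"
    using Theta_bar_estimate[of "strip_bars d" P P] R P by (auto simp: strip_bars(9))
  obtain K2 where K2: "K2 > 0" "\<And>P' Pib' e x. psd_mat P' \<Longrightarrow> 0 \<le> e \<Longrightarrow> (\<forall>x. norm ((P - P') *v x) \<le> e * norm x)
    \<Longrightarrow> (\<forall>x. norm ((Pib - Pib') *v x) \<le> e * norm x)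
    \<Longrightarrow> norm ((Theta_bar d P' Pib' - Theta_bar d P Pib) *v x) \<le> K2 * e * norm x"
    using Theta_bar_estimate[OF R P, of Pib] by metis
  obtain K3 where K3: "K3 > 0" "\<And>P' p' e. psd_mat P' \<Longrightarrow> 0 \<le> e \<Longrightarrow> (\<forall>x. norm ((P - P') *v x) \<le> e * norm x)
    \<Longrightarrow> norm (p' - p) \<le> e \<Longrightarrow> norm (theta d p' P' - theta d p P) \<le> K3 * e"
    using theta_estimate[OF R P, of p] by metis
  define K where "K = (K1 + K2 + K3) * (L + L')"
  have pos: "K > 0" "min c c' > 0" using K1 K2 K3 L L' by (auto simp: K_def)
  have main: "(\<forall>x. norm ((Theta d (PT t) - Theta d P) *v x) \<le> K * exp (- min c c' * (T - t)) * norm x)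
     \<and> (\<forall>x. norm ((Theta_bar d (PT t) (PibT t) - Theta_bar d P Pib) *v x) \<le> K * exp (- min c c' * (T - t)) * norm x)
     \<and> norm (theta d (pT t) (PT t) - theta d p P) \<le> K * exp (- min c c' * (T - t))"
    if ric: "riccati_system d T PT PibT pT" and t: "t \<in> {0..T}" for T PT PibT pT t
  proof -
    define E where "E = exp (- min c c' * (T - t))"
    define e where "e = (L + L') * E"
    have E: "exp (- c * (T - t)) \<le> E" "exp (- c' * (T - t)) \<le> E" "E > 0"
      using t by (auto simp: E_def intro!: mult_right_mono)
    have "L * exp (- c * (T - t)) \<le> e" "L' * exp (- c' * (T - t)) \<le> e"
      unfolding e_def using E L L' by (auto intro!: mult_mono)
    then have e: "norm ((P - PT t) *v x) \<le> e * norm x" "norm ((Pib - PibT t) *v x) \<le> e * norm x"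
      "norm (pT t - p) \<le> e" for x
      using mat[OF ric t, of x] vec[OF ric t] by (meson mult_right_mono norm_ge_zero order_trans)+
    have e0: "0 \<le> e" using L L' E by (simp add: e_def)
    have K: "k * e \<le> K * E" if "k \<in> {K1, K2, K3}" for k
      using that K1 K2 K3 L L' E by (auto simp: K_def e_def mult.assoc intro!: mult_right_mono)
    have psd: "psd_mat (PT t)" using ric t by (auto simp: riccati_system_def)
    have "norm ((Theta d (PT t) - Theta d P) *v x) \<le> K * E * norm x" for x
    proof -
      have "norm ((Theta d (PT t) - Theta d P) *v x) \<le> K1 * e * norm x"
        unfolding strip_bars(2) by (rule K1(2)[OF psd e0]) (use e in auto)
      also have "\<dots> \<le> K * E * norm x" by (rule mult_right_mono[OF K]) auto
      finally show ?thesis .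
    qed
    moreover have "norm ((Theta_bar d (PT t) (PibT t) - Theta_bar d P Pib) *v x) \<le> K * E * norm x" for x
    proof -
      have "norm ((Theta_bar d (PT t) (PibT t) - Theta_bar d P Pib) *v x) \<le> K2 * e * norm x"
        by (rule K2(2)[OF psd e0]) (use e in auto)
      also have "\<dots> \<le> K * E * norm x" by (rule mult_right_mono[OF K]) auto
      finally show ?thesis .
    qed
    moreover have "norm (theta d (pT t) (PT t) - theta d p P) \<le> K * E"
    proof -
      have "norm (theta d (pT t) (PT t) - theta d p P) \<le> K3 * e"
        by (rule K3(2)[OF psd e0]) (use e in auto)
      also have "\<dots> \<le> K * E" by (rule K) auto
      finally show ?thesis .
    qed
    ultimately show ?thesis by (simp add: E_def)
  qed
  show ?thesis
    by (rule exI[of _ K], rule conjI[OF pos(1)], rule exI[of _ "min c c'"], rule conjI[OF pos(2)],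
        intro allI impI ballI, rule main)
qed

end

section \<open>Mean square calculus\<close>

definition sqint :: "'a measure \<Rightarrow> ('a \<Rightarrow> 'b::euclidean_space) \<Rightarrow> bool" where
  "sqint M f \<longleftrightarrow> f \<in> borel_measurable M \<and> integrable M (\<lambda>x. (norm (f x))\<^sup>2)"

lemma sqint_measurable [dest]: "sqint M f \<Longrightarrow> f \<in> borel_measurable M"
  and sqint_integrable_sq: "sqint M f \<Longrightarrow> integrable M (\<lambda>x. (norm (f x))\<^sup>2)"
  by (auto simp: sqint_def)

lemma sqint_bound:
  assumes "f \<in> borel_measurable M" "integrable M g" "AE x in M. (norm (f x))\<^sup>2 \<le> g x"
  shows "sqint M f"
  unfolding sqint_def
  by (intro conjI assms(1) Bochner_Integration.integrable_bound[OF assms(2)])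
     (use assms in \<open>auto elim!: eventually_mono\<close>)

lemma norm_add_sq_le: "(norm (x + y))\<^sup>2 \<le> 2 * (norm x)\<^sup>2 + 2 * (norm (y::'a::real_inner))\<^sup>2"
proof -
  have "0 \<le> (norm (x - y))\<^sup>2" by simp
  then show ?thesis by (simp add: power2_norm_eq_inner inner_add_left inner_add_right inner_diff_left inner_diff_right inner_commute)
qed

lemma sqint_add: "sqint M f \<Longrightarrow> sqint M g \<Longrightarrow> sqint M (\<lambda>x. f x + g x)"
  by (rule sqint_bound[where g = "\<lambda>x. 2 * (norm (f x))\<^sup>2 + 2 * (norm (g x))\<^sup>2", OF borel_measurable_add[OF sqint_measurable sqint_measurable]])
     (simp_all add: sqint_integrable_sq norm_add_sq_le)

lemma sqint_bounded_linear:
  assumes "bounded_linear h" "sqint M f"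
  shows "sqint M (\<lambda>x. h (f x))"
proof -
  obtain k where k: "\<And>x. norm (h x) \<le> norm x * k" using bounded_linear.bounded[OF assms(1)] by blast
  have "h \<in> borel_measurable borel"
    using linear_continuous_on[OF assms(1)] by (rule borel_measurable_continuous_onI)
  then have "(\<lambda>x. h (f x)) \<in> borel_measurable M" using assms(2) by (auto intro: measurable_compose)
  then show ?thesis
  proof (rule sqint_bound[where g = "\<lambda>x. (norm (f x))\<^sup>2 * k\<^sup>2"])
    show "integrable M (\<lambda>x. (norm (f x))\<^sup>2 * k\<^sup>2)" using sqint_integrable_sq[OF assms(2)] by simp
    have "(norm (h x))\<^sup>2 \<le> (norm x)\<^sup>2 * k\<^sup>2" for x
      using power_mono[OF k norm_ge_zero, of x 2] by (simp add: power_mult_distrib)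
    then show "AE x in M. (norm (h (f x)))\<^sup>2 \<le> (norm (f x))\<^sup>2 * k\<^sup>2" by simp
  qed
qed

lemma sqint_uminus: "sqint M f \<Longrightarrow> sqint M (\<lambda>x. - f x)"
  by (rule sqint_bounded_linear[OF bounded_linear_minus[OF bounded_linear_ident]])

lemma sqint_diff: "sqint M f \<Longrightarrow> sqint M g \<Longrightarrow> sqint M (\<lambda>x. f x - g x)"
  using sqint_add[OF _ sqint_uminus] by fastforce

lemma sqint_mult_mat: "sqint M f \<Longrightarrow> sqint M (\<lambda>x. A *v f x)" for A :: "real^'a^'b"
  by (rule sqint_bounded_linear[OF matrix_vector_mul_bounded_linear])

lemma sqint_zero [simp]: "sqint M (\<lambda>x. 0)"
  by (simp add: sqint_def)

lemma (in finite_measure) sqint_const [simp]: "sqint M (\<lambda>x. c)"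
  by (simp add: sqint_def)

lemma sqint_bounded_mult:
  fixes c :: "'a \<Rightarrow> real"
  assumes "sqint M f" "c \<in> borel_measurable M" "AE x in M. \<bar>c x\<bar> \<le> C"
  shows "sqint M (\<lambda>x. c x *\<^sub>R f x)"
proof (rule sqint_bound[where g = "\<lambda>x. C\<^sup>2 * (norm (f x))\<^sup>2"])
  show "(\<lambda>x. c x *\<^sub>R f x) \<in> borel_measurable M" using assms by auto
  show "integrable M (\<lambda>x. C\<^sup>2 * (norm (f x))\<^sup>2)" using sqint_integrable_sq[OF assms(1)] by simp
  show "AE x in M. (norm (c x *\<^sub>R f x))\<^sup>2 \<le> C\<^sup>2 * (norm (f x))\<^sup>2"
    using assms(3)
  proof eventually_elim
    case (elim x)
    then have "\<bar>c x\<bar>\<^sup>2 \<le> C\<^sup>2" by (intro power_mono) auto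
    then show ?case by (simp add: power_mult_distrib mult_right_mono)
  qed
qed

lemma sqint_mult_bounded:
  fixes c :: "'a \<Rightarrow> real"
  assumes "sqint M c" "f \<in> borel_measurable M" "AE x in M. norm (f x) \<le> C"
  shows "sqint M (\<lambda>x. c x *\<^sub>R f x)"
proof (rule sqint_bound[where g = "\<lambda>x. C\<^sup>2 * (norm (c x))\<^sup>2"])
  show "(\<lambda>x. c x *\<^sub>R f x) \<in> borel_measurable M" using assms by auto
  show "integrable M (\<lambda>x. C\<^sup>2 * (norm (c x))\<^sup>2)" using sqint_integrable_sq[OF assms(1)] by simp
  show "AE x in M. (norm (c x *\<^sub>R f x))\<^sup>2 \<le> C\<^sup>2 * (norm (c x))\<^sup>2"
    using assms(3)
  proof eventually_elim
    case (elim x)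
    then have "(norm (f x))\<^sup>2 \<le> C\<^sup>2" by (intro power_mono) auto
    then show ?case by (simp add: power_mult_distrib mult_left_mono mult.commute[of "C\<^sup>2"])
  qed
qed

lemma sqint_cong_AE:
  assumes "sqint M f" "g \<in> borel_measurable M" "AE x in M. f x = g x"
  shows "sqint M g"
  by (rule sqint_bound[OF assms(2) sqint_integrable_sq[OF assms(1)]]) (use assms(3) in \<open>auto elim!: eventually_mono\<close>)

lemma inner_le_sq: "\<bar>x \<bullet> y\<bar> \<le> (norm x)\<^sup>2 + (norm (y::'a::real_inner))\<^sup>2"
proof -
  have "\<bar>x \<bullet> y\<bar> \<le> norm x * norm y" by (rule Cauchy_Schwarz_ineq2)
  also have "\<dots> \<le> (norm x)\<^sup>2 + (norm y)\<^sup>2"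
    using sum_squares_bound[of "norm x" "norm y"] mult_nonneg_nonneg[OF norm_ge_zero[of x] norm_ge_zero[of y]]
    by linarith
  finally show ?thesis .
qed

lemma sqint_inner [intro]:
  assumes "sqint M f" "sqint M g"
  shows "integrable M (\<lambda>x. f x \<bullet> g x)"
proof (rule Bochner_Integration.integrable_bound)
  show "integrable M (\<lambda>x. (norm (f x))\<^sup>2 + (norm (g x))\<^sup>2)"
    using assms by (simp add: sqint_integrable_sq)
  show "(\<lambda>x. f x \<bullet> g x) \<in> borel_measurable M" using assms by (intro borel_measurable_inner sqint_measurable)
qed (simp add: inner_le_sq)

lemma (in finite_measure) sqint_integrable:
  assumes "sqint M f"
  shows "integrable M f"
proof (rule Bochner_Integration.integrable_bound)
  show "integrable M (\<lambda>x. 1 + (norm (f x))\<^sup>2)"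
    using assms by (simp add: sqint_integrable_sq)
  show "f \<in> borel_measurable M" using assms by auto
  have "r \<le> 1 + r\<^sup>2" for r :: real
    using sum_squares_bound[of r 1] zero_le_power2[of r] unfolding power_one by linarith
  then show "AE x in M. norm (f x) \<le> norm (1 + (norm (f x))\<^sup>2)" by simp
qed

lemma sqint_Cauchy_Schwarz:
  assumes f: "sqint M f" and g: "sqint M g"
  shows "(\<integral>x. f x \<bullet> g x \<partial>M)\<^sup>2 \<le> (\<integral>x. (norm (f x))\<^sup>2 \<partial>M) * (\<integral>x. (norm (g x))\<^sup>2 \<partial>M)"
proof (rule nonneg_form_discriminant)
  fix r s :: real
  have "0 \<le> (\<integral>x. (norm (r *\<^sub>R f x + s *\<^sub>R g x))\<^sup>2 \<partial>M)" by simp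
  also have "\<dots> = (\<integral>x. r * r * (norm (f x))\<^sup>2 + 2 * r * s * (f x \<bullet> g x) + s * s * (norm (g x))\<^sup>2 \<partial>M)"
    by (intro Bochner_Integration.integral_cong refl)
       (simp add: power2_norm_eq_inner inner_add_left inner_add_right inner_commute algebra_simps)
  also have "\<dots> = r * r * (\<integral>x. (norm (f x))\<^sup>2 \<partial>M) + 2 * r * s * (\<integral>x. f x \<bullet> g x \<partial>M) + s * s * (\<integral>x. (norm (g x))\<^sup>2 \<partial>M)"
    using f g by (simp add: sqint_integrable_sq sqint_inner)
  finally show "0 \<le> r * r * (\<integral>x. (norm (f x))\<^sup>2 \<partial>M) + 2 * r * s * (\<integral>x. f x \<bullet> g x \<partial>M) + s * s * (\<integral>x. (norm (g x))\<^sup>2 \<partial>M)" .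
qed

lemma sqint_abs_inner_le:
  assumes f: "sqint M f" and g: "sqint M g"
  shows "\<bar>\<integral>x. f x \<bullet> g x \<partial>M\<bar> \<le> sqrt (\<integral>x. (norm (f x))\<^sup>2 \<partial>M) * sqrt (\<integral>x. (norm (g x))\<^sup>2 \<partial>M)"
  using real_sqrt_le_mono[OF sqint_Cauchy_Schwarz[OF assms]] by (simp add: real_sqrt_mult)

text \<open>Square integrability is part of the definition: the Bochner integral of a non-integrable
  function is 0, which would otherwise count as convergence.\<close>

definition L2_lim :: "'a measure \<Rightarrow> (nat \<Rightarrow> 'a \<Rightarrow> 'b::euclidean_space) \<Rightarrow> ('a \<Rightarrow> 'b) \<Rightarrow> bool" where
  "L2_lim M F f \<longleftrightarrow> (\<forall>j. sqint M (F j)) \<and> sqint M f \<and> (\<lambda>j. \<integral>x. (norm (F j x - f x))\<^sup>2 \<partial>M) \<longlonglongrightarrow> 0"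

lemma L2_limD: "L2_lim M F f \<Longrightarrow> sqint M (F j)" "L2_lim M F f \<Longrightarrow> sqint M f"
  by (auto simp: L2_lim_def)

lemma L2_lim_bound:
  assumes "\<And>j. sqint M (F j)" "sqint M f" "\<And>j. (\<integral>x. (norm (F j x - f x))\<^sup>2 \<partial>M) \<le> k * a j" "a \<longlonglongrightarrow> 0"
  shows "L2_lim M F f"
  unfolding L2_lim_def
proof (intro conjI allI assms)
  show "(\<lambda>j. \<integral>x. (norm (F j x - f x))\<^sup>2 \<partial>M) \<longlonglongrightarrow> 0"
  proof (rule tendsto_sandwich[OF _ _ tendsto_const])
    show "(\<lambda>j. k * a j) \<longlonglongrightarrow> 0" using tendsto_mult_right_zero[OF assms(4)] by simp
  qed (use assms(3) in auto)
qed

lemma L2_lim_const: "sqint M f \<Longrightarrow> L2_lim M (\<lambda>_. f) f"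
  by (simp add: L2_lim_def)

lemma L2_lim_inner:
  assumes F: "L2_lim M F f" and G: "L2_lim M G g"
  shows "(\<lambda>j. \<integral>x. F j x \<bullet> G j x \<partial>M) \<longlonglongrightarrow> (\<integral>x. f x \<bullet> g x \<partial>M)"
proof -
  note s = L2_limD[OF F] L2_limD[OF G]
  define a where "a j = sqrt (\<integral>x. (norm (F j x - f x))\<^sup>2 \<partial>M)" for j
  define b where "b j = sqrt (\<integral>x. (norm (G j x - g x))\<^sup>2 \<partial>M)" for j
  define A where "A = sqrt (\<integral>x. (norm (f x))\<^sup>2 \<partial>M)"
  define B where "B = sqrt (\<integral>x. (norm (g x))\<^sup>2 \<partial>M)"
  have lim: "a \<longlonglongrightarrow> 0" "b \<longlonglongrightarrow> 0"
    using tendsto_real_sqrt[of "\<lambda>j. \<integral>x. (norm (F j x - f x))\<^sup>2 \<partial>M" 0 sequentially]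
      tendsto_real_sqrt[of "\<lambda>j. \<integral>x. (norm (G j x - g x))\<^sup>2 \<partial>M" 0 sequentially] F G
    by (simp_all add: a_def[abs_def] b_def[abs_def] L2_lim_def)
  have le: "norm ((\<integral>x. F j x \<bullet> G j x \<partial>M) - (\<integral>x. f x \<bullet> g x \<partial>M)) \<le> a j * b j + a j * B + A * b j" for j
  proof -
    have d: "sqint M (\<lambda>x. F j x - f x)" "sqint M (\<lambda>x. G j x - g x)"
      by (intro sqint_diff s)+
    have "(\<integral>x. F j x \<bullet> G j x \<partial>M) - (\<integral>x. f x \<bullet> g x \<partial>M) = (\<integral>x. F j x \<bullet> G j x - f x \<bullet> g x \<partial>M)"
      by (rule Bochner_Integration.integral_diff[symmetric]) (intro sqint_inner s)+
    also have "\<dots> = (\<integral>x. (F j x - f x) \<bullet> (G j x - g x) + (F j x - f x) \<bullet> g x + f x \<bullet> (G j x - g x) \<partial>M)"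
      by (simp add: inner_diff_left inner_diff_right)
    also have "\<dots> = (\<integral>x. (F j x - f x) \<bullet> (G j x - g x) \<partial>M) + (\<integral>x. (F j x - f x) \<bullet> g x \<partial>M)
       + (\<integral>x. f x \<bullet> (G j x - g x) \<partial>M)"
      by (simp add: sqint_inner s d)
    finally show ?thesis
      using sqint_abs_inner_le[OF d] sqint_abs_inner_le[OF d(1) s(4)] sqint_abs_inner_le[OF s(2) d(2)]
      unfolding a_def b_def A_def B_def real_norm_def by linarith
  qed
  have lim0: "(\<lambda>j. a j * b j + a j * B + A * b j) \<longlonglongrightarrow> 0"
    using tendsto_add[OF tendsto_add[OF tendsto_mult[OF lim] tendsto_mult[OF lim(1) tendsto_const[of B]]]
        tendsto_mult[OF tendsto_const[of A] lim(2)]] by simp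
  have "(\<lambda>j. (\<integral>x. F j x \<bullet> G j x \<partial>M) - (\<integral>x. f x \<bullet> g x \<partial>M)) \<longlonglongrightarrow> 0"
    by (rule Lim_null_comparison[OF _ lim0]) (rule always_eventually, rule allI, rule le)
  then show ?thesis by (rule LIM_zero_cancel)
qed

lemma L2_lim_inner_const:
  assumes "sqint M \<zeta>" "L2_lim M G g"
  shows "(\<lambda>j. \<integral>x. \<zeta> x \<bullet> G j x \<partial>M) \<longlonglongrightarrow> (\<integral>x. \<zeta> x \<bullet> g x \<partial>M)"
  by (rule L2_lim_inner[OF L2_lim_const[OF assms(1)] assms(2)])

lemma integral_norm_add_sq_le:
  assumes "sqint M f" "sqint M g"
  shows "(\<integral>x. (norm (f x + g x))\<^sup>2 \<partial>M) \<le> 2 * (\<integral>x. (norm (f x))\<^sup>2 \<partial>M) + 2 * (\<integral>x. (norm (g x))\<^sup>2 \<partial>M)"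
proof -
  have "(\<integral>x. (norm (f x + g x))\<^sup>2 \<partial>M) \<le> (\<integral>x. 2 * (norm (f x))\<^sup>2 + 2 * (norm (g x))\<^sup>2 \<partial>M)"
    using assms by (intro integral_mono) (auto simp: sqint_integrable_sq sqint_add norm_add_sq_le)
  also have "\<dots> = 2 * (\<integral>x. (norm (f x))\<^sup>2 \<partial>M) + 2 * (\<integral>x. (norm (g x))\<^sup>2 \<partial>M)"
    using assms by (simp add: sqint_integrable_sq)
  finally show ?thesis .
qed

lemma L2_lim_add:
  assumes F: "L2_lim M F f" and G: "L2_lim M G g"
  shows "L2_lim M (\<lambda>j x. F j x + G j x) (\<lambda>x. f x + g x)"
proof (rule L2_lim_bound[where k = 1])
  note s = L2_limD[OF F] L2_limD[OF G]
  show "sqint M (\<lambda>x. F j x + G j x)" "sqint M (\<lambda>x. f x + g x)" for j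
    by (intro sqint_add s)+
  show "(\<integral>x. (norm ((F j x + G j x) - (f x + g x)))\<^sup>2 \<partial>M)
    \<le> 1 * (2 * (\<integral>x. (norm (F j x - f x))\<^sup>2 \<partial>M) + 2 * (\<integral>x. (norm (G j x - g x))\<^sup>2 \<partial>M))" for j
    using integral_norm_add_sq_le[OF sqint_diff[OF s(1,2)] sqint_diff[OF s(3,4)], of j j] by (simp add: algebra_simps)
  show "(\<lambda>j. 2 * (\<integral>x. (norm (F j x - f x))\<^sup>2 \<partial>M) + 2 * (\<integral>x. (norm (G j x - g x))\<^sup>2 \<partial>M)) \<longlonglongrightarrow> 0"
    by (intro tendsto_add_zero tendsto_mult_right_zero) (use F G in \<open>simp_all add: L2_lim_def\<close>)
qed

lemma L2_lim_bounded_linear: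
  assumes h: "bounded_linear h" and F: "L2_lim M F f"
  shows "L2_lim M (\<lambda>j x. h (F j x)) (\<lambda>x. h (f x))"
proof -
  interpret bounded_linear h by fact
  obtain k where k: "\<And>x. norm (h x) \<le> norm x * k" using bounded by blast
  note s = L2_limD[OF F]
  show ?thesis
  proof (rule L2_lim_bound[where k = "k\<^sup>2"])
    show "sqint M (\<lambda>x. h (F j x))" "sqint M (\<lambda>x. h (f x))" for j
      by (intro sqint_bounded_linear[OF h] s)+
    show "(\<integral>x. (norm (h (F j x) - h (f x)))\<^sup>2 \<partial>M) \<le> k\<^sup>2 * (\<integral>x. (norm (F j x - f x))\<^sup>2 \<partial>M)" for j
    proof -
      have d: "sqint M (\<lambda>x. F j x - f x)" by (intro sqint_diff s)
      have "(norm (h (F j x) - h (f x)))\<^sup>2 \<le> k\<^sup>2 * (norm (F j x - f x))\<^sup>2" for x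
        using power_mono[OF k norm_ge_zero, of "F j x - f x" 2] by (simp add: diff power_mult_distrib mult.commute)
      then have "(\<integral>x. (norm (h (F j x) - h (f x)))\<^sup>2 \<partial>M) \<le> (\<integral>x. k\<^sup>2 * (norm (F j x - f x))\<^sup>2 \<partial>M)"
        using sqint_integrable_sq[OF sqint_bounded_linear[OF h d]] sqint_integrable_sq[OF d]
        by (intro integral_mono) (auto simp: diff)
      then show ?thesis by simp
    qed
    show "(\<lambda>j. \<integral>x. (norm (F j x - f x))\<^sup>2 \<partial>M) \<longlonglongrightarrow> 0" using F by (simp add: L2_lim_def)
  qed
qed

lemma L2_lim_shift:
  assumes F: "L2_lim M F f" and G: "\<And>j. sqint M (G j)" and lim: "(\<lambda>j. \<integral>x. (norm (G j x - F j x))\<^sup>2 \<partial>M) \<longlonglongrightarrow> 0"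
  shows "L2_lim M G f"
proof (rule L2_lim_bound[where k = 2])
  note s = L2_limD[OF F]
  show "sqint M (G j)" "sqint M f" for j by (rule G, rule s)
  show "(\<integral>x. (norm (G j x - f x))\<^sup>2 \<partial>M) \<le> 2 * ((\<integral>x. (norm (G j x - F j x))\<^sup>2 \<partial>M) + (\<integral>x. (norm (F j x - f x))\<^sup>2 \<partial>M))" for j
    using integral_norm_add_sq_le[OF sqint_diff[OF G s(1)] sqint_diff[OF s(1,2)], of j j j] by simp
  show "(\<lambda>j. (\<integral>x. (norm (G j x - F j x))\<^sup>2 \<partial>M) + (\<integral>x. (norm (F j x - f x))\<^sup>2 \<partial>M)) \<longlonglongrightarrow> 0"
    by (intro tendsto_add_zero lim) (use F in \<open>simp add: L2_lim_def\<close>)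
qed

lemma L2_lim_diff_zero:
  assumes F: "L2_lim M F f" and G: "L2_lim M G f"
  shows "(\<lambda>j. \<integral>x. (norm (G j x - F j x))\<^sup>2 \<partial>M) \<longlonglongrightarrow> 0"
  using L2_lim_add[OF G L2_lim_bounded_linear[OF bounded_linear_minus[OF bounded_linear_ident] F]]
  by (simp add: L2_lim_def)

text \<open>Passage from extended to real integrals: some error is already finite, so the limit is
  square integrable, and from then on both kinds of integral agree.\<close>

lemma L2_lim_of_nn_integral:
  assumes J: "J \<in> borel_measurable M" and S: "\<And>j. sqint M (S j)"
    and lim: "(\<lambda>j. \<integral>\<^sup>+x. ennreal ((norm (J x - S j x))\<^sup>2) \<partial>M) \<longlonglongrightarrow> 0"
  shows "L2_lim M S J"
proof -
  have meas: "(\<lambda>x. J x - S j x) \<in> borel_measurable M" for j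
    by (rule borel_measurable_diff[OF J sqint_measurable[OF S]])
  have "\<forall>\<^sub>F j in sequentially. (\<integral>\<^sup>+x. ennreal ((norm (J x - S j x))\<^sup>2) \<partial>M) < 1"
    using order_tendstoD(2)[OF lim] by simp
  then obtain j where "(\<integral>\<^sup>+x. ennreal ((norm (J x - S j x))\<^sup>2) \<partial>M) < 1"
    using eventually_sequentially by auto
  then have "(\<integral>\<^sup>+x. ennreal (norm ((norm (J x - S j x))\<^sup>2)) \<partial>M) < \<infinity>"
    using order_less_trans[OF _ ennreal_one_less_top] by simp
  then have "sqint M (\<lambda>x. J x - S j x)"
    unfolding sqint_def using meas[of j] by (auto intro!: integrableI_bounded)
  from sqint_add[OF this S[of j]] have sJ: "sqint M J" by simp
  have "(\<integral>\<^sup>+x. ennreal ((norm (J x - S j x))\<^sup>2) \<partial>M) = ennreal (\<integral>x. (norm (S j x - J x))\<^sup>2 \<partial>M)" for j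
    using sqint_integrable_sq[OF sqint_diff[OF S[of j] sJ]]
    by (subst nn_integral_eq_integral[symmetric]) (auto simp: norm_minus_commute)
  then have "(\<lambda>j. ennreal (\<integral>x. (norm (S j x - J x))\<^sup>2 \<partial>M)) \<longlonglongrightarrow> ennreal 0" using lim by simp
  then have "(\<lambda>j. \<integral>x. (norm (S j x - J x))\<^sup>2 \<partial>M) \<longlonglongrightarrow> 0"
    by (subst (asm) tendsto_ennreal_iff) auto
  then show ?thesis using S sJ by (simp add: L2_lim_def)
qed

section \<open>The filtrations\<close>

lemma sets_sigma_subset_measure:
  assumes "A \<subseteq> Pow S" "space N = S" "A \<subseteq> sets N"
  shows "sets (sigma S A) \<subseteq> sets N"
  using assms sets.sigma_sets_subset[of A N] by (simp add: sets_measure_of)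

lemma measurable_mono_sets:
  "f \<in> measurable N L \<Longrightarrow> sets N \<subseteq> sets N' \<Longrightarrow> space N = space N' \<Longrightarrow> f \<in> measurable N' L"
  by (auto simp: measurable_def)

context prob_space
begin

lemma finite_subalgebra: "subalgebra M F \<Longrightarrow> finite_measure_subalgebra M F"
  by (intro finite_measure_subalgebra.intro finite_measure_subalgebra_axioms.intro finite_measure_axioms)

lemma indep_var_of_algebras:
  assumes ind: "indep_set A B" and A: "sigma_algebra (space M) A" and B: "sigma_algebra (space M) B"
    and X: "\<And>S. S \<in> sets borel \<Longrightarrow> X -` S \<inter> space M \<in> A" and Y: "\<And>S. S \<in> sets borel \<Longrightarrow> Y -` S \<inter> space M \<in> B"
  shows "indep_var borel (X :: 'a \<Rightarrow> real) borel (Y :: 'a \<Rightarrow> real)"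
proof -
  have ev: "A \<subseteq> events" "B \<subseteq> events" using ind by (auto simp: indep_sets2_eq)
  have "sigma_sets (space M) {X -` S \<inter> space M | S. S \<in> sets borel} \<subseteq> A"
    by (rule sigma_algebra.sigma_sets_subset[OF A]) (use X in auto)
  moreover have "sigma_sets (space M) {Y -` S \<inter> space M | S. S \<in> sets borel} \<subseteq> B"
    by (rule sigma_algebra.sigma_sets_subset[OF B]) (use Y in auto)
  moreover have "random_variable borel X" "random_variable borel Y"
    using X Y ev by (auto intro!: measurableI)
  ultimately show ?thesis
    using ind unfolding indep_var_eq indep_sets2_eq by (meson order_trans subsetD)
qed

lemma path_algebra_gen_subset:
  "(\<Union>s\<in>I. {V s -` B \<inter> space M | B. B \<in> sets borel}) \<subseteq> Pow (space M)"
  by auto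

lemma space_path_algebra [simp]: "space (path_algebra V I) = space M"
  by (simp add: path_algebra_def space_measure_of_conv)

lemma measurable_path_algebra: "s \<in> I \<Longrightarrow> V s \<in> borel_measurable (path_algebra V I)"
  unfolding path_algebra_def
  by (intro measurableI) (auto simp: space_measure_of_conv sets_measure_of[OF path_algebra_gen_subset])

lemma sets_path_algebra_subset:
  assumes "space N = space M" "\<And>s. s \<in> I \<Longrightarrow> V s \<in> borel_measurable N"
  shows "sets (path_algebra V I) \<subseteq> sets N"
  unfolding path_algebra_def
  by (rule sets_sigma_subset_measure[OF path_algebra_gen_subset assms(1)])
     (use assms in \<open>auto simp: measurable_sets simp flip: assms(1)\<close>)

lemma path_algebra_mono: "I \<subseteq> J \<Longrightarrow> sets (path_algebra V I) \<subseteq> sets (path_algebra V J)"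
  by (rule sets_path_algebra_subset) (auto intro: measurable_path_algebra)

end

context brownian_basis
begin

lemma measurable_W: "0 \<le> t \<Longrightarrow> W t \<in> borel_measurable M"
  and measurable_W0: "0 \<le> t \<Longrightarrow> W0 t \<in> borel_measurable M"
  using brownian_W brownian_W0 by (auto simp: standard_brownian_motion_def)

lemma path_W_events: "sets (path_algebra W {0..}) \<subseteq> events"
  and path_W0_events: "sets (path_algebra W0 {0..}) \<subseteq> events"
  by (rule sets_path_algebra_subset; simp add: measurable_W measurable_W0)+

lemma F0_events: "sets F0 \<subseteq> events" and space_F0: "space F0 = space M"
  using subalg_F0 by (auto simp: subalgebra_def)

lemma path_W0_Icc: "sets (path_algebra W0 {0..t}) \<subseteq> sets (path_algebra W0 {0..})"
  and path_W_Icc: "sets (path_algebra W {0..t}) \<subseteq> sets (path_algebra W {0..})"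
  by (auto intro!: path_algebra_mono)

lemma null_subset: "N \<in> null_sets M \<Longrightarrow> A \<in> events \<Longrightarrow> A \<inter> N \<in> null_sets M"
  by (auto simp: null_set_Int1 null_set_Int2)

lemma null_sets_events: "null_sets M \<subseteq> events"
  by auto

text \<open>The basis only states independence of \<open>F0\<close> from the joint noise and of the
  two noises from each other; an event of the form \<open>B \<inter> C\<close> belongs to the joint
  path algebra, which links the two statements.\<close>

lemma triple_indep:
  assumes A: "A \<in> sets F0" and B: "B \<in> sets (path_algebra W {0..})" and C: "C \<in> sets (path_algebra W0 {0..})"
  shows "prob (A \<inter> B \<inter> C) = prob A * prob B * prob C"
proof -
  let ?P = "path_algebra (\<lambda>s w. (W s w, W0 s w)) {0..}"
  have pair: "(\<lambda>w. (W s w, W0 s w)) \<in> borel_measurable ?P" if "s \<in> {0..}" for s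
    using measurable_path_algebra[of s "{0..}" "\<lambda>s w. (W s w, W0 s w)"] that by simp
  have "W s \<in> borel_measurable ?P" "W0 s \<in> borel_measurable ?P" if "s \<in> {0..}" for s
    using measurable_compose[OF pair[OF that] borel_measurable_continuous_onI[OF continuous_on_fst[OF continuous_on_id]]]
      measurable_compose[OF pair[OF that] borel_measurable_continuous_onI[OF continuous_on_snd[OF continuous_on_id]]] by simp_all
  then have "sets (path_algebra W {0..}) \<subseteq> sets ?P" "sets (path_algebra W0 {0..}) \<subseteq> sets ?P"
    by (intro sets_path_algebra_subset; simp)+
  then have "B \<inter> C \<in> sets ?P" using B C by auto
  then have "prob (A \<inter> (B \<inter> C)) = prob A * prob (B \<inter> C)"
    using indep_F0 A by (auto simp: indep_sets2_eq)
  moreover have "prob (B \<inter> C) = prob B * prob C"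
    using indep_W_W0 B C by (auto simp: indep_sets2_eq)
  ultimately show ?thesis by (simp add: Int_assoc)
qed

text \<open>All of \<open>W\<close> and the common noise up to time \<open>s\<close>: the largest information under which \<open>W0\<close> still has independent increments after \<open>s\<close>.\<close>

definition enlarged :: "real \<Rightarrow> 'w measure" where
  "enlarged s = sigma (space M) (sets F0 \<union> sets (path_algebra W {0..}) \<union> sets (path_algebra W0 {0..s}) \<union> null_sets M)"

lemma enlarged_gen: "sets F0 \<union> sets (path_algebra W {0..}) \<union> sets (path_algebra W0 {0..s}) \<union> null_sets M \<subseteq> events"
  using F0_events path_W_events order_trans[OF path_W0_Icc path_W0_events] null_sets_events by simp

lemma events_Pow: "X \<subseteq> events \<Longrightarrow> X \<subseteq> Pow (space M)"
  using sets.space_closed by blast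

lemma space_enlarged [simp]: "space (enlarged s) = space M"
  and space_flt0 [simp]: "space (flt0 s) = space M"
  and space_raw_flt [simp]: "space (raw_flt s) = space M"
  and space_flt [simp]: "space (flt s) = space M"
  by (simp_all add: enlarged_def flt0_def raw_flt_def flt_def space_measure_of_conv)

lemma flt0_gen: "sets (path_algebra W0 {0..t}) \<union> null_sets M \<subseteq> events"
  using order_trans[OF path_W0_Icc path_W0_events] null_sets_events by simp

lemma sets_enlarged: "sets (enlarged s) = sigma_sets (space M)
    (sets F0 \<union> sets (path_algebra W {0..}) \<union> sets (path_algebra W0 {0..s}) \<union> null_sets M)"
  unfolding enlarged_def by (rule sets_measure_of[OF events_Pow[OF enlarged_gen]])

lemma sets_flt0: "sets (flt0 t) = sigma_sets (space M) (sets (path_algebra W0 {0..t}) \<union> null_sets M)"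
  unfolding flt0_def by (rule sets_measure_of[OF events_Pow[OF flt0_gen]])

lemma subalg_enlarged: "subalgebra M (enlarged s)" and subalg_flt0: "subalgebra M (flt0 s)"
  using sets.sigma_sets_subset[OF enlarged_gen] sets.sigma_sets_subset[OF flt0_gen]
  by (auto simp: subalgebra_def sets_enlarged sets_flt0)

lemma raw_flt_gen: "sets F0 \<union> sets (path_algebra W {0..t}) \<union> sets (path_algebra W0 {0..t}) \<union> null_sets M \<subseteq> events"
  using F0_events order_trans[OF path_W_Icc path_W_events] order_trans[OF path_W0_Icc path_W0_events] null_sets_events by simp

lemma sets_raw_flt: "sets (raw_flt t) = sigma_sets (space M)
    (sets F0 \<union> sets (path_algebra W {0..t}) \<union> sets (path_algebra W0 {0..t}) \<union> null_sets M)"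
  unfolding raw_flt_def by (rule sets_measure_of[OF events_Pow[OF raw_flt_gen]])

lemma subalg_raw_flt: "subalgebra M (raw_flt t)"
  using sets.sigma_sets_subset[OF raw_flt_gen] by (auto simp: subalgebra_def sets_raw_flt)

lemma raw_flt_mono: "s \<le> t \<Longrightarrow> sets (raw_flt s) \<subseteq> sets (raw_flt t)"
  unfolding sets_raw_flt
  using path_algebra_mono[of "{0..s}" "{0..t}" W] path_algebra_mono[of "{0..s}" "{0..t}" W0]
  by (intro sigma_sets_mono') auto

lemma flt0_mono: "s \<le> t \<Longrightarrow> sets (flt0 s) \<subseteq> sets (flt0 t)"
  unfolding sets_flt0 using path_algebra_mono[of "{0..s}" "{0..t}" W0] by (intro sigma_sets_mono') auto

lemma flt0_raw_flt: "sets (flt0 t) \<subseteq> sets (raw_flt t)"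
  unfolding sets_flt0 sets_raw_flt by (intro sigma_sets_mono') auto

lemma raw_flt_enlarged: "sets (raw_flt t) \<subseteq> sets (enlarged t)"
  unfolding sets_enlarged sets_raw_flt using path_W_Icc by (intro sigma_sets_mono') auto

text \<open>The intersection is already a sigma-algebra, so the \<open>sigma\<close> in the
  definition adds no sets.\<close>

lemma sets_flt: "sets (flt t) = (\<Inter>s\<in>{t<..}. sets (raw_flt s))"
proof -
  let ?I = "\<Inter>s\<in>{t<..}. sets (raw_flt s)"
  have into: "X \<subseteq> space M" if "X \<in> ?I" for X
    using that sets.sets_into_space[of X "raw_flt (t + 1)"] by auto
  have "sigma_algebra (space M) ?I"
    unfolding sigma_algebra_iff2
  proof (intro conjI ballI allI impI)
    show "?I \<subseteq> Pow (space M)" using into by blast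
    show "{} \<in> ?I" by simp
    show "space M - X \<in> ?I" if X: "X \<in> ?I" for X
    proof
      fix s assume "s \<in> {t<..}"
      then have "X \<in> sets (raw_flt s)" using X by blast
      then show "space M - X \<in> sets (raw_flt s)" using sets.compl_sets[of X "raw_flt s"] by simp
    qed
    show "(\<Union>i. A i) \<in> ?I" if "range A \<subseteq> ?I" for A :: "nat \<Rightarrow> 'w set"
      using that by (intro INT_I sets.countable_UN) auto
  qed
  moreover have "?I \<subseteq> Pow (space M)"
    using sets.sets_into_space[of _ "raw_flt (t + 1)"] by force
  ultimately show ?thesis unfolding flt_def by (simp add: sets_measure_of sigma_algebra.sigma_sets_eq)
qed

lemma flt_raw_flt: "s < t \<Longrightarrow> sets (flt s) \<subseteq> sets (raw_flt t)"
  by (auto simp: sets_flt)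

lemma raw_flt_flt: "s \<le> t \<Longrightarrow> sets (raw_flt s) \<subseteq> sets (flt t)"
  unfolding sets_flt by (intro INT_greatest raw_flt_mono) auto

lemma flt_mono: "s \<le> t \<Longrightarrow> sets (flt s) \<subseteq> sets (flt t)"
  unfolding sets_flt by auto

lemma subalg_flt: "subalgebra M (flt t)"
  using flt_raw_flt[of t "t + 1"] subalg_raw_flt[of "t + 1"] by (auto simp: subalgebra_def)

text \<open>\<open>F0\<close> and \<open>W\<close> together are what the common noise does not
  reveal. Independence is checked on intersections of events, which are stable under intersection;
  null sets are adjoined by hand because they are independent of everything.\<close>

lemma hidden_indep_flt0:
  "indep_set (sigma_sets (space M) {A \<inter> B | A B. A \<in> sets F0 \<and> B \<in> sets (path_algebra W {0..})}) (sets (flt0 t))"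
  unfolding sets_flt0
proof (rule indep_set_sigma_sets)
  show "Int_stable {A \<inter> B | A B. A \<in> sets F0 \<and> B \<in> sets (path_algebra W {0..})}"
  proof (rule Int_stableI)
    fix X Y assume "X \<in> {A \<inter> B | A B. A \<in> sets F0 \<and> B \<in> sets (path_algebra W {0..})}"
      "Y \<in> {A \<inter> B | A B. A \<in> sets F0 \<and> B \<in> sets (path_algebra W {0..})}"
    then obtain A B A' B' where "X = A \<inter> B" "Y = A' \<inter> B'" "A \<in> sets F0" "A' \<in> sets F0"
      "B \<in> sets (path_algebra W {0..})" "B' \<in> sets (path_algebra W {0..})" by blast
    then show "X \<inter> Y \<in> {A \<inter> B | A B. A \<in> sets F0 \<and> B \<in> sets (path_algebra W {0..})}"
      by (intro CollectI exI[of _ "A \<inter> A'"] exI[of _ "B \<inter> B'"]) auto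
  qed
  show "Int_stable (sets (path_algebra W0 {0..t}) \<union> null_sets M)"
  proof (rule Int_stableI)
    fix X Y assume XY: "X \<in> sets (path_algebra W0 {0..t}) \<union> null_sets M" "Y \<in> sets (path_algebra W0 {0..t}) \<union> null_sets M"
    then have ev: "X \<in> events" "Y \<in> events" using flt0_gen by blast+
    show "X \<inter> Y \<in> sets (path_algebra W0 {0..t}) \<union> null_sets M"
    proof (cases "X \<in> null_sets M \<or> Y \<in> null_sets M")
      case True
      then show ?thesis using null_subset[of X Y] null_subset[of Y X] ev by (auto simp: Int_commute)
    next
      case False
      then show ?thesis using XY by auto
    qed
  qed
  show "indep_set {A \<inter> B | A B. A \<in> sets F0 \<and> B \<in> sets (path_algebra W {0..})} (sets (path_algebra W0 {0..t}) \<union> null_sets M)"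
    unfolding indep_sets2_eq
  proof (intro conjI ballI)
    show ev: "{A \<inter> B | A B. A \<in> sets F0 \<and> B \<in> sets (path_algebra W {0..})} \<subseteq> events"
      using F0_events path_W_events by auto
    show "sets (path_algebra W0 {0..t}) \<union> null_sets M \<subseteq> events" by (rule flt0_gen)
    fix X C assume X: "X \<in> {A \<inter> B | A B. A \<in> sets F0 \<and> B \<in> sets (path_algebra W {0..})}"
      and C: "C \<in> sets (path_algebra W0 {0..t}) \<union> null_sets M"
    then obtain A B where AB: "X = A \<inter> B" "A \<in> sets F0" "B \<in> sets (path_algebra W {0..})" by blast
    have "prob (A \<inter> B \<inter> space M) = prob A * prob B * prob (space M)"
      using triple_indep[OF AB(2,3), of "space M"] sets.top[of "path_algebra W0 {0..}"] by simp
    moreover have "A \<inter> B \<inter> space M = A \<inter> B" using X ev AB(1) sets.sets_into_space by blast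
    ultimately have pX: "prob X = prob A * prob B" by (simp add: AB(1) prob_space)
    show "prob (X \<inter> C) = prob X * prob C"
    proof (cases "C \<in> null_sets M")
      case True
      then show ?thesis using null_subset[OF True subsetD[OF ev X]] by (simp add: measure_eq_0_null_sets)
    next
      case False
      then show ?thesis using triple_indep[OF AB(2,3), of C] C path_W0_Icc pX AB(1) by auto
    qed
  qed
qed

text \<open>An intersection-stable generator of triple intersections, which makes induction over
  disjoint unions available.\<close>

lemma sets_enlarged_eq:
  "sets (enlarged s) = sigma_sets (space M)
    {A \<inter> B \<inter> C | A B C. A \<in> sets F0 \<and> B \<in> sets (path_algebra W {0..}) \<and> C \<in> sets (flt0 s)}" (is "_ = sigma_sets _ ?P")
proof
  have sub: "sets F0 \<subseteq> sets (enlarged s)" "sets (path_algebra W {0..}) \<subseteq> sets (enlarged s)"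
    by (auto simp: sets_enlarged)
  have "sets (flt0 s) \<subseteq> sets (enlarged s)"
    unfolding sets_flt0 sets_enlarged by (intro sigma_sets_mono') auto
  then have "A \<inter> B \<inter> C \<in> sets (enlarged s)"
    if "A \<in> sets F0" "B \<in> sets (path_algebra W {0..})" "C \<in> sets (flt0 s)" for A B C
    using sub that by (intro sets.Int) blast+
  then have "?P \<subseteq> sets (enlarged s)" by blast
  then show "sigma_sets (space M) ?P \<subseteq> sets (enlarged s)"
    using sets.sigma_sets_subset[of ?P "enlarged s"] by simp
  have top: "space M \<in> sets F0" "space M \<in> sets (path_algebra W {0..})" "space M \<in> sets (flt0 s)"
    using sets.top[of F0] sets.top[of "path_algebra W {0..}"] sets.top[of "flt0 s"] by (simp_all add: space_F0)
  have P: "A \<inter> B \<inter> C \<in> ?P" if "A \<in> sets F0" "B \<in> sets (path_algebra W {0..})" "C \<in> sets (flt0 s)" for A B C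
    using that by blast
  have ev: "A \<subseteq> space M" if "A \<in> events" for A using that by (rule sets.sets_into_space)
  have 1: "sets F0 \<subseteq> ?P"
  proof
    fix A assume A: "A \<in> sets F0"
    then have "A \<inter> space M \<inter> space M = A" using ev F0_events by blast
    then show "A \<in> ?P" using P[OF A top(2,3)] by simp
  qed
  have 2: "sets (path_algebra W {0..}) \<subseteq> ?P"
  proof
    fix A assume A: "A \<in> sets (path_algebra W {0..})"
    then have "space M \<inter> A \<inter> space M = A" using ev path_W_events by blast
    then show "A \<in> ?P" using P[OF top(1) A top(3)] by simp
  qed
  have 3: "sets (flt0 s) \<subseteq> ?P"
  proof
    fix A assume A: "A \<in> sets (flt0 s)"
    then have "space M \<inter> space M \<inter> A = A" using ev subalg_flt0[of s] by (auto simp: subalgebra_def)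
    then show "A \<in> ?P" using P[OF top(1,2) A] by simp
  qed
  have "sets (path_algebra W0 {0..s}) \<union> null_sets M \<subseteq> sets (flt0 s)" by (auto simp: sets_flt0)
  then have 4: "sets (path_algebra W0 {0..s}) \<union> null_sets M \<subseteq> ?P" using 3 by (rule order_trans)
  have "sets F0 \<union> sets (path_algebra W {0..}) \<union> sets (path_algebra W0 {0..s}) \<union> null_sets M \<subseteq> ?P"
    using 1 2 4 by (simp only: Un_subset_iff)
  then show "sets (enlarged s) \<subseteq> sigma_sets (space M) ?P"
    unfolding sets_enlarged by (rule sigma_sets_mono')
qed

lemma flt0_enlarged: "sets (flt0 s) \<subseteq> sets (enlarged s)"
  using flt0_raw_flt raw_flt_enlarged by blast

end

section \<open>Conditioning on the common noise and increments after a given time\<close>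

context brownian_basis
begin

lemma hidden_factor:
  assumes f: "integrable M f" "f \<in> borel_measurable (flt0 t)"
    and A: "A \<in> sets F0" and B: "B \<in> sets (path_algebra W {0..})" and C: "C \<in> sets (flt0 t)"
  shows "(\<integral>w\<in>A \<inter> B \<inter> C. f w \<partial>M) = prob (A \<inter> B) * (\<integral>w\<in>C. f w \<partial>M)"
proof -
  let ?S = "sigma_sets (space M) {A \<inter> B | A B. A \<in> sets F0 \<and> B \<in> sets (path_algebra W {0..})}"
  have ev: "A \<in> events" "B \<in> events" "C \<in> events"
    using A B C F0_events path_W_events subalg_flt0[of t] by (auto simp: subalgebra_def)
  have ABin: "A \<inter> B \<in> ?S" using A B by blast
  have P: "{A \<inter> B | A B. A \<in> sets F0 \<and> B \<in> sets (path_algebra W {0..})} \<subseteq> Pow (space M)"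
    using F0_events sets.sets_into_space by blast
  have S: "sigma_algebra (space M) ?S" by (rule sigma_algebra_sigma_sets[OF P])
  have Cf: "(\<lambda>w. indicator C w * f w) \<in> borel_measurable (flt0 t)"
    using C f(2) by (intro borel_measurable_times borel_measurable_indicator)
  have "indep_var borel (indicator (A \<inter> B) :: 'w \<Rightarrow> real) borel (\<lambda>w. indicator C w * f w)"
  proof (rule indep_var_of_algebras[OF hidden_indep_flt0 S])
    show "sigma_algebra (space M) (sets (flt0 t))" using sets.sigma_algebra_axioms[of "flt0 t"] by simp
    fix X :: "real set" assume "X \<in> sets borel"
    then show "(\<lambda>w. indicator C w * f w) -` X \<inter> space M \<in> sets (flt0 t)"
      using measurable_sets[OF Cf] by simp
    have "(indicator (A \<inter> B) :: 'w \<Rightarrow> real) \<in> borel_measurable (sigma (space M) ?S)"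
      using ABin sigma_algebra.sets_measure_of_eq[OF S] by (intro borel_measurable_indicator) simp
    from measurable_sets[OF this \<open>X \<in> sets borel\<close>]
    show "(indicator (A \<inter> B) :: 'w \<Rightarrow> real) -` X \<inter> space M \<in> ?S"
      using sigma_algebra.sets_measure_of_eq[OF S] by (simp add: space_measure_of_conv)
  qed
  moreover have "integrable M (\<lambda>w. indicator C w * f w)"
    using integrable_mult_indicator[OF ev(3) f(1)] by simp
  ultimately have "(\<integral>w. indicator (A \<inter> B) w * (indicator C w * f w) \<partial>M)
      = (\<integral>w. indicator (A \<inter> B) w \<partial>M) * (\<integral>w. indicator C w * f w \<partial>M)"
    using ev by (intro indep_var_lebesgue_integral) (auto intro!: integrable_real_indicator simp: emeasure_eq_measure)
  then show ?thesis
    unfolding set_lebesgue_integral_def using ev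
    by (simp add: indicator_inter_arith[of "A \<inter> B" C] mult.assoc)
qed

text \<open>Hidden information, independent of the common noise, does not improve predictions of the
  common noise (immersion of filtrations). On triple intersections the hidden event factors out of
  both integrals, and a Dynkin induction does the rest.\<close>

lemma cond_exp_enlarged:
  assumes f: "integrable M f" "f \<in> borel_measurable (flt0 t)" and st: "s \<le> t"
  shows "AE w in M. real_cond_exp M (enlarged s) f w = real_cond_exp M (flt0 s) f w"
proof -
  interpret E: finite_measure_subalgebra M "enlarged s" by (rule finite_subalgebra[OF subalg_enlarged])
  interpret F: finite_measure_subalgebra M "flt0 s" by (rule finite_subalgebra[OF subalg_flt0])
  let ?g = "real_cond_exp M (flt0 s) f"
  have g: "integrable M ?g" using F.real_cond_exp_int(1)[OF f(1)] .
  have gt: "?g \<in> borel_measurable (flt0 t)"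
    by (rule measurable_mono_sets[OF borel_measurable_cond_exp flt0_mono[OF st]]) simp
  let ?P = "{A \<inter> B \<inter> C | A B C. A \<in> sets F0 \<and> B \<in> sets (path_algebra W {0..}) \<and> C \<in> sets (flt0 s)}"
  have stable: "Int_stable ?P"
  proof (rule Int_stableI)
    fix X Y assume "X \<in> ?P" "Y \<in> ?P"
    then obtain A B C A' B' C' where "X = A \<inter> B \<inter> C" "Y = A' \<inter> B' \<inter> C'" "A \<in> sets F0" "A' \<in> sets F0"
      "B \<in> sets (path_algebra W {0..})" "B' \<in> sets (path_algebra W {0..})" "C \<in> sets (flt0 s)" "C' \<in> sets (flt0 s)"
      by blast
    then show "X \<inter> Y \<in> ?P"
      by (intro CollectI exI[of _ "A \<inter> A'"] exI[of _ "B \<inter> B'"] exI[of _ "C \<inter> C'"]) auto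
  qed
  have PPow: "?P \<subseteq> Pow (space M)" using F0_events sets.sets_into_space by blast
  have sub: "sigma_sets (space M) ?P \<subseteq> events"
    using subalg_enlarged[of s] by (simp add: subalgebra_def sets_enlarged_eq)
  have eq: "(\<integral>w\<in>X. f w \<partial>M) = (\<integral>w\<in>X. ?g w \<partial>M)" if X: "X \<in> sigma_sets (space M) ?P" for X
    using stable PPow X
  proof (induction rule: sigma_sets_induct_disjoint)
    case (basic X)
    then obtain A B C where ABC: "X = A \<inter> B \<inter> C" "A \<in> sets F0" "B \<in> sets (path_algebra W {0..})" "C \<in> sets (flt0 s)"
      by blast
    have Ct: "C \<in> sets (flt0 t)" using ABC(4) flt0_mono[OF st] by blast
    show ?case
      unfolding ABC(1) hidden_factor[OF f ABC(2,3) Ct] hidden_factor[OF g gt ABC(2,3) Ct]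
      by (simp add: F.real_cond_exp_intA[OF f(1) ABC(4)])
  next
    case empty
    show ?case by (simp add: set_lebesgue_integral_def)
  next
    case (compl X)
    have X: "X \<in> events" using compl(1) sub by blast
    have split: "(\<integral>w\<in>space M - X. h w \<partial>M) = (\<integral>w. h w \<partial>M) - (\<integral>w\<in>X. h w \<partial>M)"
      if h: "integrable M h" for h :: "'w \<Rightarrow> real"
    proof -
      have "(\<integral>w\<in>space M - X. h w \<partial>M) = (\<integral>w. h w - indicator X w * h w \<partial>M)"
        unfolding set_lebesgue_integral_def
        by (intro Bochner_Integration.integral_cong refl) (auto simp: indicator_def)
      then show ?thesis
        using integrable_mult_indicator[OF X h] h by (simp add: set_lebesgue_integral_def)
    qed
    show ?case using compl F.real_cond_exp_int(2)[OF f(1)] by (simp add: split f(1) g)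
  next
    case (union A)
    have A: "A i \<in> events" for i using union(2) sub by blast
    have int: "set_integrable M (\<Union>i. A i) h" if h: "integrable M h" for h :: "'w \<Rightarrow> real"
      unfolding set_integrable_def by (rule integrable_mult_indicator[OF _ h]) (use A in auto)
    have disj: "A i \<inter> A j = {}" if "i \<noteq> j" for i j using union(1) that by (simp add: disjoint_family_on_def)
    have "(\<integral>w\<in>(\<Union>i. A i). h w \<partial>M) = (\<Sum>i. \<integral>w\<in>A i. h w \<partial>M)" if h: "integrable M h" for h :: "'w \<Rightarrow> real"
      by (rule lebesgue_integral_countable_add[OF A disj int[OF h]])
    then show ?case using union(3) f(1) g by simp
  qed
  show ?thesis
  proof (rule E.real_cond_exp_charact[OF _ f(1) g])
    show "?g \<in> borel_measurable (enlarged s)"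
      by (rule measurable_mono_sets[OF borel_measurable_cond_exp flt0_enlarged]) simp
  qed (use eq in \<open>simp add: sets_enlarged_eq\<close>)
qed

lemma increment_flt0: "0 \<le> s \<Longrightarrow> s \<le> b \<Longrightarrow> (\<lambda>w. W0 b w - W0 s w) \<in> borel_measurable (flt0 b)"
  by (intro borel_measurable_diff measurable_mono_sets[OF measurable_path_algebra[of _ "{0..b}"]])
     (auto simp: sets_flt0)

lemma W0_L2:
  assumes "0 \<le> s" "s \<le> b"
  shows "sqint M (\<lambda>w. W0 b w - W0 s w)" "(\<integral>w. W0 b w - W0 s w \<partial>M) = 0"
    "(\<integral>w. (W0 b w - W0 s w)\<^sup>2 \<partial>M) = b - s"
proof -
  have "sqint M (\<lambda>w. W0 b w - W0 s w) \<and> (\<integral>w. W0 b w - W0 s w \<partial>M) = 0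
    \<and> (\<integral>w. (W0 b w - W0 s w)\<^sup>2 \<partial>M) = b - s"
  proof (cases "s = b")
    case False
    then have sb: "s < b" using assms by simp
    have D: "distributed M lborel (\<lambda>w. W0 b w - W0 s w) (normal_density 0 (sqrt (b - s)))"
      using brownian_W0 assms sb by (auto simp: standard_brownian_motion_def)
    have e: "expectation (\<lambda>w. W0 b w - W0 s w) = 0"
      by (rule normal_distributed_expectation[OF _ D]) (use sb in simp)
    have "variance (\<lambda>w. W0 b w - W0 s w) = (sqrt (b - s))\<^sup>2"
      by (rule normal_distributed_variance[OF _ D]) (use sb in simp)
    then have v: "(\<integral>w. (W0 b w - W0 s w)\<^sup>2 \<partial>M) = b - s" using sb by (simp add: e)
    \<comment> \<open>A non-integrable function would have Bochner integral 0, but this integral is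
      \<open>b - s > 0\<close>.\<close>
    then have "integrable M (\<lambda>w. (W0 b w - W0 s w)\<^sup>2)"
      using sb not_integrable_integral_eq by fastforce
    then show ?thesis using e v assms sb
      by (auto simp: sqint_def intro!: borel_measurable_diff measurable_W0)
  qed simp
  then show "sqint M (\<lambda>w. W0 b w - W0 s w)" "(\<integral>w. W0 b w - W0 s w \<partial>M) = 0"
    "(\<integral>w. (W0 b w - W0 s w)\<^sup>2 \<partial>M) = b - s" by auto
qed

text \<open>The basis gives independence of the raw path up to \<open>s\<close>; it is first
  extended over the null sets contained in \<open>flt0 s\<close>.\<close>

lemma increment_cond_exp:
  fixes h :: "real \<Rightarrow> real"
  assumes s: "0 \<le> s" "s < b" and h: "h \<in> borel_measurable borel" "integrable M (\<lambda>w. h (W0 b w - W0 s w))"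
  shows "AE w in M. real_cond_exp M (flt0 s) (\<lambda>w. h (W0 b w - W0 s w)) w = (\<integral>w. h (W0 b w - W0 s w) \<partial>M)"
proof -
  interpret F: finite_measure_subalgebra M "flt0 s" by (rule finite_subalgebra[OF subalg_flt0])
  let ?\<Delta> = "\<lambda>w. W0 b w - W0 s w"
  let ?V = "vimage_algebra (space M) ?\<Delta> borel"
  have ind: "indep_set (sets (path_algebra W0 {0..s})) (sets ?V)"
    using brownian_W0 s by (auto simp: standard_brownian_motion_def)
  have V: "sigma_sets (space M) (sets ?V) = sets ?V"
    using sets.sigma_sets_eq[of ?V] by simp
  have "indep_set (sigma_sets (space M) (sets (path_algebra W0 {0..s}) \<union> null_sets M)) (sigma_sets (space M) (sets ?V))"
  proof (rule indep_set_sigma_sets)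
    show "Int_stable (sets ?V)" by (rule Int_stableI) auto
    show "Int_stable (sets (path_algebra W0 {0..s}) \<union> null_sets M)"
    proof (rule Int_stableI)
      fix X Y assume XY: "X \<in> sets (path_algebra W0 {0..s}) \<union> null_sets M" "Y \<in> sets (path_algebra W0 {0..s}) \<union> null_sets M"
      then have ev: "X \<in> events" "Y \<in> events" using flt0_gen by blast+
      show "X \<inter> Y \<in> sets (path_algebra W0 {0..s}) \<union> null_sets M"
      proof (cases "X \<in> null_sets M \<or> Y \<in> null_sets M")
        case True
        then show ?thesis using null_subset[of X Y] null_subset[of Y X] ev by (auto simp: Int_commute)
      next
        case False
        then show ?thesis using XY by auto
      qed
    qed
    show "indep_set (sets (path_algebra W0 {0..s}) \<union> null_sets M) (sets ?V)"
      unfolding indep_sets2_eq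
    proof (intro conjI ballI)
      show "sets (path_algebra W0 {0..s}) \<union> null_sets M \<subseteq> events" by (rule flt0_gen)
      show Vev: "sets ?V \<subseteq> events" using ind by (simp add: indep_sets2_eq)
      fix C D assume C: "C \<in> sets (path_algebra W0 {0..s}) \<union> null_sets M" and D: "D \<in> sets ?V"
      show "prob (C \<inter> D) = prob C * prob D"
      proof (cases "C \<in> null_sets M")
        case True
        then show ?thesis using null_subset[OF True subsetD[OF Vev D]]
          by (simp add: measure_eq_0_null_sets Int_commute)
      next
        case False
        then show ?thesis using C D ind by (auto simp: indep_sets2_eq)
      qed
    qed
  qed
  then have ind': "indep_set (sets (flt0 s)) (sets ?V)" by (simp add: sets_flt0 V)
  show ?thesis
  proof (rule F.real_cond_exp_charact)
    fix C assume C: "C \<in> sets (flt0 s)"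
    then have Cev: "C \<in> events" using subalg_flt0[of s] by (auto simp: subalgebra_def)
    have "indep_var borel (indicator C :: 'w \<Rightarrow> real) borel (\<lambda>w. h (?\<Delta> w))"
    proof (rule indep_var_of_algebras[OF ind'])
      show "sigma_algebra (space M) (sets (flt0 s))" using sets.sigma_algebra_axioms[of "flt0 s"] by simp
      show "sigma_algebra (space M) (sets ?V)" using sets.sigma_algebra_axioms[of ?V] by simp
      fix X :: "real set" assume X: "X \<in> sets borel"
      show "(indicator C :: 'w \<Rightarrow> real) -` X \<inter> space M \<in> sets (flt0 s)"
        using measurable_sets[OF borel_measurable_indicator[OF C] X] by simp
      have "?\<Delta> \<in> measurable ?V borel" by (rule measurable_vimage_algebra1) auto
      then have "(\<lambda>w. h (?\<Delta> w)) \<in> borel_measurable ?V" using h(1) by (rule measurable_compose)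
      from measurable_sets[OF this X] show "(\<lambda>w. h (?\<Delta> w)) -` X \<inter> space M \<in> sets ?V" by simp
    qed
    then have "(\<integral>w. indicator C w * h (?\<Delta> w) \<partial>M) = (\<integral>w. indicator C w \<partial>M) * (\<integral>w. h (?\<Delta> w) \<partial>M)"
      using Cev h by (intro indep_var_lebesgue_integral) (auto intro!: integrable_real_indicator simp: emeasure_eq_measure)
    then show "(\<integral>w\<in>C. h (?\<Delta> w) \<partial>M) = (\<integral>w\<in>C. (\<integral>w. h (?\<Delta> w) \<partial>M) \<partial>M)"
      by (simp add: set_lebesgue_integral_def)
  qed (use h in auto)
qed

text \<open>Conditioning on \<open>enlarged s\<close> reduces to conditioning on
  \<open>flt0 s\<close>, where the increment has a constant conditional expectation. The other
  factor may thus involve \<open>F0\<close> and the whole path of \<open>W\<close>.\<close>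

lemma increment_factor:
  fixes h :: "real \<Rightarrow> real"
  assumes s: "0 \<le> s" "s < b" and h: "h \<in> borel_measurable borel" "integrable M (\<lambda>w. h (W0 b w - W0 s w))"
    and \<zeta>: "\<zeta> \<in> borel_measurable (enlarged s)" "integrable M (\<lambda>w. \<zeta> w * h (W0 b w - W0 s w))"
  shows "(\<integral>w. \<zeta> w * h (W0 b w - W0 s w) \<partial>M) = (\<integral>w. \<zeta> w \<partial>M) * (\<integral>w. h (W0 b w - W0 s w) \<partial>M)"
proof -
  interpret E: finite_measure_subalgebra M "enlarged s" by (rule finite_subalgebra[OF subalg_enlarged])
  let ?f = "\<lambda>w. h (W0 b w - W0 s w)"
  have fb: "?f \<in> borel_measurable (flt0 b)"
    using increment_flt0[of s b] s h(1) by (auto intro: measurable_compose)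
  have "AE w in M. real_cond_exp M (enlarged s) ?f w = (\<integral>w. ?f w \<partial>M)"
    using cond_exp_enlarged[OF h(2) fb, of s] increment_cond_exp[OF s h] s by auto
  then have "(\<integral>w. \<zeta> w * real_cond_exp M (enlarged s) ?f w \<partial>M) = (\<integral>w. \<zeta> w * (\<integral>w. ?f w \<partial>M) \<partial>M)"
    using measurable_from_subalg[OF subalg_enlarged \<zeta>(1)] by (intro integral_cong_AE) auto
  moreover have "(\<integral>w. \<zeta> w * real_cond_exp M (enlarged s) ?f w \<partial>M) = (\<integral>w. \<zeta> w * ?f w \<partial>M)"
    by (rule E.real_cond_exp_intg(2)[OF \<zeta>(2,1)]) (use h in auto)
  ultimately show ?thesis by simp
qed

text \<open>The filtration \<open>flt\<close> looks into the immediate future, so integrands are only measurable at every later time.\<close>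

definition future_germ :: "real \<Rightarrow> ('w \<Rightarrow> 'b::euclidean_space) \<Rightarrow> bool" where
  "future_germ a f \<longleftrightarrow> (\<forall>s>a. f \<in> borel_measurable (enlarged s))"

text \<open>Left end points strictly inside the interval that tend to \<open>a\<close>; the summand
  2 in the denominator keeps even the one with index 0 below \<open>b\<close>. A future germ at
  \<open>a\<close> is measurable with respect to the enlargement at each of them.\<close>

lemma W0_L2_lim:
  assumes "0 \<le> a" "a < b"
  defines "s \<equiv> \<lambda>n. a + (b - a) / (real n + 2)"
  shows "L2_lim M (\<lambda>n w. W0 b w - W0 (s n) w) (\<lambda>w. W0 b w - W0 a w)" "a < s n" "s n < b" "s \<longlonglongrightarrow> a"
proof -
  have s: "a < s n" "s n < b" for n
  proof -
    have "(b - a) / (real n + 2) < (b - a) / 1" by (rule divide_strict_left_mono) (use assms in auto)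
    then show "a < s n" "s n < b" using assms by (auto simp: s_def)
  qed
  have lim0: "(\<lambda>n. (b - a) / (real n + 2)) \<longlonglongrightarrow> 0"
    by real_asymp
  then show "s \<longlonglongrightarrow> a" unfolding s_def using tendsto_add[OF tendsto_const[of a] lim0] by simp
  show "a < s n" "s n < b" by (rule s)+
  show "L2_lim M (\<lambda>n w. W0 b w - W0 (s n) w) (\<lambda>w. W0 b w - W0 a w)"
  proof (rule L2_lim_bound[where k = 1, OF _ _ _ lim0])
    show "sqint M (\<lambda>w. W0 b w - W0 (s j) w)" "sqint M (\<lambda>w. W0 b w - W0 a w)" for j
      using s[of j] assms by (auto intro!: W0_L2)
    fix j
    have "(\<integral>w. (norm ((W0 b w - W0 (s j) w) - (W0 b w - W0 a w)))\<^sup>2 \<partial>M) = (\<integral>w. (W0 (s j) w - W0 a w)\<^sup>2 \<partial>M)"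
      by (intro Bochner_Integration.integral_cong refl) (simp add: power2_commute)
    also have "\<dots> = s j - a" using W0_L2(3)[of a "s j"] s[of j] assms by simp
    finally show "(\<integral>w. (norm ((W0 b w - W0 (s j) w) - (W0 b w - W0 a w)))\<^sup>2 \<partial>M) \<le> 1 * ((b - a) / (real j + 2))"
      by (simp add: s_def)
  qed
qed

text \<open>The factorisation holds for increments that start at \<open>s n > a\<close>; mean square
  convergence of these increments carries it to \<open>a\<close>.\<close>

lemma increment_mean:
  assumes \<zeta>: "sqint M \<zeta>" "future_germ a \<zeta>" and ab: "0 \<le> a" "a \<le> b"
  shows "(\<integral>w. \<zeta> w * (W0 b w - W0 a w) \<partial>M) = 0"
proof (cases "a = b")
  case False
  then have ab': "a < b" using ab by simp
  note lim = W0_L2_lim[OF ab(1) ab']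
  define s where "s n = a + (b - a) / (real n + 2)" for n
  have s: "a < s n" "s n < b" for n using lim(2,3) by (auto simp: s_def)
  have L: "L2_lim M (\<lambda>n w. W0 b w - W0 (s n) w) (\<lambda>w. W0 b w - W0 a w)"
    using lim(1) by (simp add: s_def)
  have 0: "(\<integral>w. \<zeta> w * (W0 b w - W0 (s n) w) \<partial>M) = 0" for n
    using increment_factor[of "s n" b "\<lambda>x. x" \<zeta>] s[of n] ab \<zeta> sqint_integrable[OF W0_L2(1), of "s n" b]
      sqint_inner[OF \<zeta>(1) W0_L2(1), of "s n" b] W0_L2(2)[of "s n" b]
    by (auto simp: future_germ_def)
  have "(\<lambda>n. \<integral>w. \<zeta> w * (W0 b w - W0 (s n) w) \<partial>M) \<longlonglongrightarrow> (\<integral>w. \<zeta> w * (W0 b w - W0 a w) \<partial>M)"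
    using L2_lim_inner_const[OF \<zeta>(1) L] by simp
  then show ?thesis unfolding 0 by (simp add: LIMSEQ_const_iff)
qed simp

text \<open>The same approximation from the right. Boundedness of \<open>\<zeta>\<close> makes its
  product with the increments converge in mean square, so the square passes to the limit as an inner
  product of two convergent sequences.\<close>

lemma increment_square:
  fixes \<zeta> :: "'w \<Rightarrow> real"
  assumes \<zeta>: "future_germ a \<zeta>" "AE w in M. \<bar>\<zeta> w\<bar> \<le> c" and ab: "0 \<le> a" "a \<le> b"
  shows "(\<integral>w. \<zeta> w * (W0 b w - W0 a w)\<^sup>2 \<partial>M) = (b - a) * (\<integral>w. \<zeta> w \<partial>M)"
proof (cases "a = b")
  case False
  then have ab': "a < b" using ab by simp
  note lim = W0_L2_lim[OF ab(1) ab']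
  define s where "s n = a + (b - a) / (real n + 2)" for n
  have s: "a < s n" "s n < b" for n using lim(2,3) by (auto simp: s_def)
  have sa: "s \<longlonglongrightarrow> a" using lim(4) by (simp add: s_def[abs_def])
  have L: "L2_lim M (\<lambda>n w. W0 b w - W0 (s n) w) (\<lambda>w. W0 b w - W0 a w)"
    using lim(1) by (simp add: s_def)
  have \<zeta>m: "\<zeta> \<in> borel_measurable M"
    using \<zeta>(1) measurable_from_subalg[OF subalg_enlarged] by (meson future_germ_def gt_ex)
  have L': "L2_lim M (\<lambda>n w. \<zeta> w * (W0 b w - W0 (s n) w)) (\<lambda>w. \<zeta> w * (W0 b w - W0 a w))"
  proof (rule L2_lim_bound[where k = "c\<^sup>2"])
    show sq: "sqint M (\<lambda>w. \<zeta> w * (W0 b w - W0 (s j) w))" "sqint M (\<lambda>w. \<zeta> w * (W0 b w - W0 a w))" for j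
      using sqint_bounded_mult[OF L2_limD(1)[OF L] \<zeta>m \<zeta>(2)] sqint_bounded_mult[OF L2_limD(2)[OF L] \<zeta>m \<zeta>(2)] by simp_all
    show "(\<lambda>n. \<integral>w. (norm ((W0 b w - W0 (s n) w) - (W0 b w - W0 a w)))\<^sup>2 \<partial>M) \<longlonglongrightarrow> 0"
      using L by (simp add: L2_lim_def)
    fix j
    have "(\<integral>w. (norm (\<zeta> w * (W0 b w - W0 (s j) w) - \<zeta> w * (W0 b w - W0 a w)))\<^sup>2 \<partial>M)
       \<le> (\<integral>w. c\<^sup>2 * (norm ((W0 b w - W0 (s j) w) - (W0 b w - W0 a w)))\<^sup>2 \<partial>M)"
    proof (rule integral_mono_AE)
      show "integrable M (\<lambda>w. (norm (\<zeta> w * (W0 b w - W0 (s j) w) - \<zeta> w * (W0 b w - W0 a w)))\<^sup>2)"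
        by (rule sqint_integrable_sq[OF sqint_diff[OF sq]])
      show "integrable M (\<lambda>w. c\<^sup>2 * (norm ((W0 b w - W0 (s j) w) - (W0 b w - W0 a w)))\<^sup>2)"
        by (intro integrable_mult_right sqint_integrable_sq sqint_diff L2_limD[OF L])
      show "AE w in M. (norm (\<zeta> w * (W0 b w - W0 (s j) w) - \<zeta> w * (W0 b w - W0 a w)))\<^sup>2
        \<le> c\<^sup>2 * (norm ((W0 b w - W0 (s j) w) - (W0 b w - W0 a w)))\<^sup>2"
        using \<zeta>(2)
      proof eventually_elim
        case (elim w)
        then have "\<bar>\<zeta> w\<bar>\<^sup>2 \<le> c\<^sup>2" by (intro power_mono) auto
        then have "(\<zeta> w)\<^sup>2 * (W0 a w - W0 (s j) w)\<^sup>2 \<le> c\<^sup>2 * (W0 a w - W0 (s j) w)\<^sup>2"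
          by (intro mult_right_mono) auto
        then show ?case by (simp add: power_mult_distrib flip: right_diff_distrib)
      qed
    qed
    then show "(\<integral>w. (norm (\<zeta> w * (W0 b w - W0 (s j) w) - \<zeta> w * (W0 b w - W0 a w)))\<^sup>2 \<partial>M)
      \<le> c\<^sup>2 * (\<integral>w. (norm ((W0 b w - W0 (s j) w) - (W0 b w - W0 a w)))\<^sup>2 \<partial>M)" by simp
  qed
  have 0: "(\<integral>w. \<zeta> w * (W0 b w - W0 (s n) w)\<^sup>2 \<partial>M) = (b - s n) * (\<integral>w. \<zeta> w \<partial>M)" for n
  proof -
    have "(\<integral>w. \<zeta> w * (W0 b w - W0 (s n) w)\<^sup>2 \<partial>M) = (\<integral>w. \<zeta> w \<partial>M) * (\<integral>w. (W0 b w - W0 (s n) w)\<^sup>2 \<partial>M)"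
    proof (rule increment_factor[where h = "\<lambda>x. x\<^sup>2"])
      show "0 \<le> s n" "s n < b" using s[of n] ab by auto
      show "\<zeta> \<in> borel_measurable (enlarged (s n))" using \<zeta>(1) s by (simp add: future_germ_def)
      show "integrable M (\<lambda>w. (W0 b w - W0 (s n) w)\<^sup>2)"
        using sqint_integrable_sq[OF L2_limD(1)[OF L], of n] by simp
      show "integrable M (\<lambda>w. \<zeta> w * (W0 b w - W0 (s n) w)\<^sup>2)"
        using sqint_inner[OF L2_limD(1)[OF L'] L2_limD(1)[OF L], of n n] by (simp add: power2_eq_square mult.assoc)
    qed simp
    then show ?thesis using W0_L2(3)[of "s n" b] s[of n] ab by simp
  qed
  have "(\<lambda>n. \<integral>w. \<zeta> w * (W0 b w - W0 (s n) w)\<^sup>2 \<partial>M) \<longlonglongrightarrow> (\<integral>w. \<zeta> w * (W0 b w - W0 a w)\<^sup>2 \<partial>M)"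
    using L2_lim_inner[OF L' L] by (simp add: power2_eq_square mult.assoc)
  moreover have "(\<lambda>n. (b - s n) * (\<integral>w. \<zeta> w \<partial>M)) \<longlonglongrightarrow> (b - a) * (\<integral>w. \<zeta> w \<partial>M)"
    by (intro tendsto_intros sa)
  ultimately show ?thesis unfolding 0 by (rule LIMSEQ_unique)
qed simp

end

section \<open>Time integrals and conditional means\<close>

text \<open>A finite measure carried by the interval, so that product measures and Fubini apply
  without indicator functions.\<close>

definition time_measure :: "real \<Rightarrow> real measure" where
  "time_measure t = restrict_space lborel {0..t}"

lemma sets_time_measure [measurable_cong]: "sets (time_measure t) = sets (restrict_space borel {0..t})"
  unfolding time_measure_def by (simp add: sets_restrict_space)

lemma space_time_measure [simp]: "space (time_measure t) = {0..t}"
  by (simp add: time_measure_def space_restrict_space)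

lemma finite_time_measure [simp]: "finite_measure (time_measure t)"
  unfolding time_measure_def by (rule finite_measureI) (simp add: emeasure_restrict_space space_restrict_space emeasure_lborel_Icc_eq)

lemma integral_time_measure:
  fixes f :: "real \<Rightarrow> 'b::euclidean_space"
  shows "(\<integral>s. f s \<partial>time_measure t) = (LBINT s:{0..t}. f s)"
    "integrable (time_measure t) f \<longleftrightarrow> set_integrable lborel {0..t} f"
  by (simp_all add: time_measure_def integral_restrict_space integrable_restrict_space
      set_lebesgue_integral_def set_integrable_def)

lemma borel_measurable_time: "f \<in> borel_measurable borel \<Longrightarrow> f \<in> borel_measurable (time_measure t)"
  unfolding time_measure_def by (intro measurable_restrict_space1) simp

lemma integral_time_measure_indicator:
  assumes "A \<in> sets borel"
  shows "(\<integral>s. (indicator A s :: real) \<partial>time_measure t) = measure lborel (A \<inter> {0..t})"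
proof -
  have "(\<integral>s. (indicator A s :: real) \<partial>time_measure t) = (\<integral>s. (indicator (A \<inter> {0..t}) s :: real) \<partial>lborel)"
    unfolding integral_time_measure(1) set_lebesgue_integral_def
    by (intro Bochner_Integration.integral_cong refl) (auto simp: indicator_def)
  then show ?thesis by simp
qed

lemma nn_integral_time_measure:
  assumes "f \<in> borel_measurable (time_measure t)"
  shows "(\<integral>\<^sup>+s. f s \<partial>time_measure t) = (\<integral>\<^sup>+s\<in>{0..t}. f s \<partial>lborel)"
  unfolding time_measure_def by (rule nn_integral_restrict_space) simp

lemma AE_time_measure: "(AE s in time_measure t. P s) \<longleftrightarrow> (AE s in lborel. s \<in> {0..t} \<longrightarrow> P s)"
  unfolding time_measure_def by (rule AE_restrict_space_iff) simp

text \<open>Time 0 is exceptional because adaptedness without looking ahead comes from left limits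
  of paths; one instant is negligible in all time integrals.\<close>

lemma AE_time_measure_pos: "(\<And>s. 0 < s \<Longrightarrow> s \<le> t \<Longrightarrow> P s) \<Longrightarrow> AE s in time_measure t. P s"
  unfolding AE_time_measure using AE_lborel_singleton[of 0] by (auto elim!: eventually_mono)

context prob_space
begin

abbreviation path_measure :: "real \<Rightarrow> (real \<times> 'a) measure" where
  "path_measure t \<equiv> time_measure t \<Otimes>\<^sub>M M"

lemma pair_time: "pair_sigma_finite (time_measure t) M"
  by (intro pair_sigma_finite.intro finite_measure.axioms(1) finite_time_measure finite_measure_axioms)

lemma finite_path_measure: "finite_measure (path_measure t)"
  by (intro finite_measure_pair_measure finite_time_measure finite_measure_axioms)

lemma path_integral:
  fixes f :: "real \<times> 'a \<Rightarrow> real"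
  assumes "integrable (path_measure t) f"
  shows "(\<integral>z. f z \<partial>path_measure t) = (\<integral>s. (\<integral>w. f (s, w) \<partial>M) \<partial>time_measure t)"
    "integrable (time_measure t) (\<lambda>s. \<integral>w. f (s, w) \<partial>M)"
    "AE s in time_measure t. integrable M (\<lambda>w. f (s, w))"
proof -
  interpret pair_sigma_finite "time_measure t" M by (rule pair_time)
  show "(\<integral>z. f z \<partial>path_measure t) = (\<integral>s. (\<integral>w. f (s, w) \<partial>M) \<partial>time_measure t)"
    "integrable (time_measure t) (\<lambda>s. \<integral>w. f (s, w) \<partial>M)"
    "AE s in time_measure t. integrable M (\<lambda>w. f (s, w))"
    using integral_fst'[OF assms] integrable_fst'[OF assms] AE_integrable_fst'[OF assms] by simp_all
qed

lemma sqint_path_const: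
  assumes "sqint M \<zeta>"
  shows "sqint (path_measure t) (\<lambda>(s, w). \<zeta> w)"
  unfolding sqint_def
proof
  interpret pair_sigma_finite "time_measure t" M by (rule pair_time)
  interpret finite_measure "time_measure t" by simp
  have [measurable]: "\<zeta> \<in> borel_measurable M" using assms by auto
  show m: "(\<lambda>(s, w). \<zeta> w) \<in> borel_measurable (path_measure t)" by measurable
  have [measurable]: "(\<lambda>z. (norm (case z of (s, w) \<Rightarrow> \<zeta> w))\<^sup>2) \<in> borel_measurable (path_measure t)"
    using m by measurable
  show "integrable (path_measure t) (\<lambda>z. (norm (case z of (s, w) \<Rightarrow> \<zeta> w))\<^sup>2)"
    by (rule Fubini_integrable) (use assms in \<open>simp_all add: sqint_integrable_sq\<close>)
qed

lemma sqint_section: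
  assumes "sqint (path_measure t) H"
  shows "AE s in time_measure t. sqint M (\<lambda>w. H (s, w))"
proof -
  have "AE s in time_measure t. integrable M (\<lambda>w. (norm (H (s, w)))\<^sup>2)"
    by (rule path_integral(3)[OF sqint_integrable_sq[OF assms]])
  then show ?thesis
  proof (rule AE_mp, intro AE_I2 impI)
    fix s assume "s \<in> space (time_measure t)" "integrable M (\<lambda>w. (norm (H (s, w)))\<^sup>2)"
    then show "sqint M (\<lambda>w. H (s, w))"
      using measurable_compose[OF measurable_Pair1' sqint_measurable[OF assms], of s] by (auto simp: sqint_def)
  qed
qed

lemma path_inner:
  assumes "sqint (path_measure t) H" "sqint (path_measure t) H'"
  shows "(\<integral>z. H z \<bullet> H' z \<partial>path_measure t) = (\<integral>s. (\<integral>w. H (s, w) \<bullet> H' (s, w) \<partial>M) \<partial>time_measure t)"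
    "integrable (time_measure t) (\<lambda>s. \<integral>w. H (s, w) \<bullet> H' (s, w) \<partial>M)"
  by (rule path_integral[OF sqint_inner[OF assms]])+

lemma sqint_path_restrict:
  assumes H: "sqint (path_measure t) H" and st: "s \<le> t"
  shows "sqint (path_measure s) H"
    "(\<integral>z. (norm (H z))\<^sup>2 \<partial>path_measure s) \<le> (\<integral>z. (norm (H z))\<^sup>2 \<partial>path_measure t)"
proof -
  have sub: "{0..s} \<subseteq> {0..t}" using st by auto
  have "(\<lambda>x. x) \<in> measurable (time_measure s) (time_measure t)"
    unfolding time_measure_def by (rule measurable_restrict_space3) (use sub in auto)
  then have id: "(\<lambda>z. z) \<in> measurable (path_measure s) (path_measure t)"
    using measurable_Pair[OF measurable_compose[OF measurable_fst] measurable_snd, of "\<lambda>x. x" "time_measure s" "time_measure t" M] by simp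
  have m: "H \<in> borel_measurable (path_measure s)"
    using measurable_compose[OF id sqint_measurable[OF H]] by simp
  have le: "(\<integral>\<^sup>+z. ennreal ((norm (H z))\<^sup>2) \<partial>path_measure s) \<le> (\<integral>\<^sup>+z. ennreal ((norm (H z))\<^sup>2) \<partial>path_measure t)"
  proof -
    have mt: "(\<lambda>z. ennreal ((norm (H z))\<^sup>2)) \<in> borel_measurable (path_measure t)" using sqint_measurable[OF H] by measurable
    have ms: "(\<lambda>z. ennreal ((norm (H z))\<^sup>2)) \<in> borel_measurable (path_measure s)" using m by measurable
    let ?f = "\<lambda>s. \<integral>\<^sup>+w. ennreal ((norm (H (s, w)))\<^sup>2) \<partial>M"
    have fm: "?f \<in> borel_measurable (time_measure t)" by (rule borel_measurable_nn_integral_fst[OF mt])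
    have fs: "?f \<in> borel_measurable (time_measure s)" by (rule borel_measurable_nn_integral_fst[OF ms])
    have "(\<integral>\<^sup>+s\<in>{0..s}. ?f s \<partial>lborel) \<le> (\<integral>\<^sup>+s\<in>{0..t}. ?f s \<partial>lborel)"
      using sub by (intro nn_integral_mono mult_left_mono) (auto simp: indicator_def)
    then show ?thesis
      unfolding nn_integral_fst[OF ms, symmetric] nn_integral_fst[OF mt, symmetric]
        nn_integral_time_measure[OF fs] nn_integral_time_measure[OF fm] .
  qed
  have fin: "(\<integral>\<^sup>+z. ennreal ((norm (H z))\<^sup>2) \<partial>path_measure t) = ennreal (\<integral>z. (norm (H z))\<^sup>2 \<partial>path_measure t)"
    by (rule nn_integral_eq_integral[OF sqint_integrable_sq[OF H]]) simp
  then have fin': "(\<integral>\<^sup>+z. ennreal (norm ((norm (H z))\<^sup>2)) \<partial>path_measure s) < \<infinity>"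
    using le_less_trans[OF le[unfolded fin] ennreal_less_top] by simp
  show *: "sqint (path_measure s) H"
    unfolding sqint_def using m fin' by (auto intro!: integrableI_bounded)
  have "ennreal (\<integral>z. (norm (H z))\<^sup>2 \<partial>path_measure s) \<le> ennreal (\<integral>z. (norm (H z))\<^sup>2 \<partial>path_measure t)"
    using le fin nn_integral_eq_integral[OF sqint_integrable_sq[OF *]] by simp
  then show "(\<integral>z. (norm (H z))\<^sup>2 \<partial>path_measure s) \<le> (\<integral>z. (norm (H z))\<^sup>2 \<partial>path_measure t)"
    by (subst (asm) ennreal_le_iff) auto
qed

end

section \<open>Vector-valued conditional expectation as an orthogonal projection\<close>

definition vec_cond_exp :: "'a measure \<Rightarrow> 'a measure \<Rightarrow> ('a \<Rightarrow> real^'n) \<Rightarrow> 'a \<Rightarrow> real^'n" where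
  "vec_cond_exp M F f w = (\<chi> i. real_cond_exp M F (\<lambda>w'. f w' $ i) w)"

lemma sqint_component: "sqint M f \<Longrightarrow> sqint M (\<lambda>x. f x $ i)" for f :: "'a \<Rightarrow> real^'n"
  by (rule sqint_bounded_linear[OF bounded_linear_vec_nth])

lemma borel_measurable_vecI: "(\<And>i. (\<lambda>x. f x $ i) \<in> borel_measurable M) \<Longrightarrow> f \<in> borel_measurable M"
  for f :: "'a \<Rightarrow> real^'n"
  unfolding borel_measurable_euclidean_space[of f] by (auto simp: Basis_vec_def inner_axis)

context finite_measure_subalgebra
begin

lemma measurable_vec_cond_exp: "vec_cond_exp M F f \<in> borel_measurable F"
  by (rule borel_measurable_vecI) (simp add: vec_cond_exp_def)

lemma sqint_vec_cond_exp:
  fixes f :: "'a \<Rightarrow> real^'n"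
  assumes "sqint M f"
  shows "sqint M (vec_cond_exp M F f)"
proof (rule sqint_bound)
  show "vec_cond_exp M F f \<in> borel_measurable M"
    by (rule borel_measurable_vecI) (simp add: vec_cond_exp_def)
  have "integrable M (\<lambda>w. (real_cond_exp M F (\<lambda>w'. f w' $ i) w)\<^sup>2)" for i
  proof (rule integrable_convex_cond_exp[where I = UNIV and q = power2])
    show "integrable M (\<lambda>x. f x $ i)" using sqint_integrable[OF sqint_component[OF assms]] .
    show "integrable M (\<lambda>x. (f x $ i)\<^sup>2)" using sqint_integrable_sq[OF sqint_component[OF assms, of i]] by simp
    show "convex_on (UNIV::real set) power2" by (rule convex_power2)
  qed auto
  then show "integrable M (\<lambda>w. \<Sum>i\<in>UNIV. (real_cond_exp M F (\<lambda>w'. f w' $ i) w)\<^sup>2)" by auto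
  show "AE w in M. (norm (vec_cond_exp M F f w))\<^sup>2 \<le> (\<Sum>i\<in>UNIV. (real_cond_exp M F (\<lambda>w'. f w' $ i) w)\<^sup>2)"
    by (simp add: norm_vec_def L2_set_def vec_cond_exp_def sum_nonneg)
qed

lemma vec_cond_exp_inner:
  fixes f :: "'a \<Rightarrow> real^'n" and \<zeta> :: "'a \<Rightarrow> real^'n"
  assumes f: "sqint M f" and \<zeta>: "sqint M \<zeta>" "\<zeta> \<in> borel_measurable F"
  shows "(\<integral>w. \<zeta> w \<bullet> vec_cond_exp M F f w \<partial>M) = (\<integral>w. \<zeta> w \<bullet> f w \<partial>M)"
proof -
  have int: "integrable M (\<lambda>w. \<zeta> w $ i * g w $ i)" if "sqint M g" for g :: "'a \<Rightarrow> real^'n" and i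
    using sqint_inner[OF sqint_component[OF \<zeta>(1), of i] sqint_component[OF that, of i]] by simp
  have "(\<integral>w. \<zeta> w $ i * vec_cond_exp M F f w $ i \<partial>M) = (\<integral>w. \<zeta> w $ i * f w $ i \<partial>M)" for i
    unfolding vec_cond_exp_def vec_lambda_beta
  proof (rule real_cond_exp_intg(2)[OF int[OF f]])
    show "(\<lambda>w. \<zeta> w $ i) \<in> borel_measurable F"
      using measurable_compose[OF \<zeta>(2) borel_measurable_continuous_onI[OF linear_continuous_on[OF bounded_linear_vec_nth]]] .
    show "(\<lambda>w. f w $ i) \<in> borel_measurable M" using sqint_component[OF f] by auto
  qed
  then show ?thesis
    unfolding inner_vec_def inner_real_def
    by (subst (1 2) Bochner_Integration.integral_sum) (use int[OF f] int[OF sqint_vec_cond_exp[OF f]] in auto)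
qed

text \<open>The difference of the two candidates is itself an admissible test function, so its mean
  square is zero.\<close>

lemma vec_cond_exp_charact:
  fixes f :: "'a \<Rightarrow> real^'n" and g :: "'a \<Rightarrow> real^'n"
  assumes f: "sqint M f" and g: "sqint M g" "g \<in> borel_measurable F"
    and eq: "\<And>\<zeta>. sqint M \<zeta> \<Longrightarrow> \<zeta> \<in> borel_measurable F \<Longrightarrow> (\<integral>w. \<zeta> w \<bullet> g w \<partial>M) = (\<integral>w. \<zeta> w \<bullet> f w \<partial>M)"
  shows "AE w in M. vec_cond_exp M F f w = g w"
proof -
  define h where "h w = vec_cond_exp M F f w - g w" for w
  have h: "sqint M h" "h \<in> borel_measurable F"
    unfolding h_def using sqint_vec_cond_exp[OF f] measurable_vec_cond_exp[of f] g by (auto intro: sqint_diff)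
  have "(\<integral>w. (norm (h w))\<^sup>2 \<partial>M) = (\<integral>w. h w \<bullet> vec_cond_exp M F f w - h w \<bullet> g w \<partial>M)"
    by (simp add: power2_norm_eq_inner h_def inner_diff_right)
  also have "\<dots> = (\<integral>w. h w \<bullet> vec_cond_exp M F f w \<partial>M) - (\<integral>w. h w \<bullet> g w \<partial>M)"
    by (intro Bochner_Integration.integral_diff sqint_inner h sqint_vec_cond_exp f g)
  also have "\<dots> = 0" using vec_cond_exp_inner[OF f h] eq[OF h] by simp
  finally have "AE w in M. (norm (h w))\<^sup>2 = 0"
    using integral_nonneg_eq_0_iff_AE[OF sqint_integrable_sq[OF h(1)]] by simp
  then show ?thesis by (auto simp: h_def)
qed

lemma vec_cond_exp_contraction:
  fixes f :: "'a \<Rightarrow> real^'n"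
  assumes f: "sqint M f"
  shows "(\<integral>w. (norm (vec_cond_exp M F f w))\<^sup>2 \<partial>M) \<le> (\<integral>w. (norm (f w))\<^sup>2 \<partial>M)"
proof -
  let ?g = "vec_cond_exp M F f"
  note g = sqint_vec_cond_exp[OF f]
  define a where "a = (\<integral>w. (norm (?g w))\<^sup>2 \<partial>M)"
  define b where "b = (\<integral>w. (norm (f w))\<^sup>2 \<partial>M)"
  have "a = (\<integral>w. ?g w \<bullet> f w \<partial>M)"
    unfolding a_def power2_norm_eq_inner by (rule vec_cond_exp_inner[OF f g measurable_vec_cond_exp])
  then have "a\<^sup>2 \<le> a * b" using sqint_Cauchy_Schwarz[OF g f] by (simp add: a_def b_def)
  moreover have "a \<ge> 0" "b \<ge> 0" by (simp_all add: a_def b_def)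
  ultimately have "a \<le> b" by (cases "a = 0") (auto simp: power2_eq_square)
  then show ?thesis by (simp add: a_def b_def)
qed

lemma vec_cond_exp_add:
  fixes f :: "'a \<Rightarrow> real^'n" and g :: "'a \<Rightarrow> real^'n"
  assumes f: "sqint M f" and g: "sqint M g"
  shows "AE w in M. vec_cond_exp M F (\<lambda>w. f w + g w) w = vec_cond_exp M F f w + vec_cond_exp M F g w"
proof (rule vec_cond_exp_charact[OF sqint_add[OF f g] sqint_add[OF sqint_vec_cond_exp[OF f] sqint_vec_cond_exp[OF g]]])
  show "(\<lambda>w. vec_cond_exp M F f w + vec_cond_exp M F g w) \<in> borel_measurable F"
    by (intro borel_measurable_add measurable_vec_cond_exp)
  fix \<zeta> :: "'a \<Rightarrow> real^'n" assume \<zeta>: "sqint M \<zeta>" "\<zeta> \<in> borel_measurable F"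
  show "(\<integral>w. \<zeta> w \<bullet> (vec_cond_exp M F f w + vec_cond_exp M F g w) \<partial>M) = (\<integral>w. \<zeta> w \<bullet> (f w + g w) \<partial>M)"
    by (simp add: inner_add_right sqint_inner[OF \<zeta>(1)] f g sqint_vec_cond_exp vec_cond_exp_inner[OF _ \<zeta>])
qed

lemma vec_cond_exp_cong:
  fixes f :: "'a \<Rightarrow> real^'n" and g :: "'a \<Rightarrow> real^'n"
  assumes "AE w in M. f w = g w" "f \<in> borel_measurable M" "g \<in> borel_measurable M"
  shows "AE w in M. vec_cond_exp M F f w = vec_cond_exp M F g w"
proof -
  have vm: "(\<lambda>w. h w $ i) \<in> borel_measurable M" if "h \<in> borel_measurable M" for h :: "'a \<Rightarrow> real^'n" and i
    using measurable_compose[OF that borel_measurable_continuous_onI[OF linear_continuous_on[OF bounded_linear_vec_nth]]] .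
  have "AE w in M. real_cond_exp M F (\<lambda>w'. f w' $ i) w = real_cond_exp M F (\<lambda>w'. g w' $ i) w" for i
    by (rule real_cond_exp_cong) (use assms vm in auto)
  then have "AE w in M. \<forall>i\<in>UNIV. real_cond_exp M F (\<lambda>w'. f w' $ i) w = real_cond_exp M F (\<lambda>w'. g w' $ i) w"
    by (intro AE_finite_allI) auto
  then show ?thesis by eventually_elim (simp add: vec_cond_exp_def)
qed

lemma vec_cond_exp_scale:
  fixes f :: "'a \<Rightarrow> real^'n"
  assumes c: "c \<in> borel_measurable F" and f: "f \<in> borel_measurable M" "sqint M (\<lambda>w. c w *\<^sub>R f w)"
  shows "AE w in M. vec_cond_exp M F (\<lambda>w. c w *\<^sub>R f w) w = c w *\<^sub>R vec_cond_exp M F f w"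
proof -
  have "AE w in M. real_cond_exp M F (\<lambda>w'. c w' * f w' $ i) w = c w * real_cond_exp M F (\<lambda>w'. f w' $ i) w" for i
  proof (rule real_cond_exp_mult[OF c])
    show "(\<lambda>w. f w $ i) \<in> borel_measurable M"
      using measurable_compose[OF f(1) borel_measurable_continuous_onI[OF linear_continuous_on[OF bounded_linear_vec_nth]]] .
    show "integrable M (\<lambda>w. c w * f w $ i)" using sqint_integrable[OF sqint_component[OF f(2), of i]] by simp
  qed
  then have "AE w in M. \<forall>i\<in>UNIV. real_cond_exp M F (\<lambda>w'. c w' * f w' $ i) w = c w * real_cond_exp M F (\<lambda>w'. f w' $ i) w"
    by (intro AE_finite_allI) auto
  then show ?thesis by eventually_elim (simp add: vec_cond_exp_def vec_eq_iff)
qed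

text \<open>Needed so that projected coefficients are again admissible in step integrals; the
  dimension enters by estimating the norm through the components.\<close>

lemma vec_cond_exp_bounded:
  fixes f :: "'a \<Rightarrow> real^'n"
  assumes f: "f \<in> borel_measurable M" "AE w in M. norm (f w) \<le> c"
  shows "AE w in M. norm (vec_cond_exp M F f w) \<le> real CARD('n) * c"
proof -
  have fi: "integrable M f" by (rule integrable_const_bound[OF f(2,1)])
  have "AE w in M. \<bar>real_cond_exp M F (\<lambda>w'. f w' $ i) w\<bar> \<le> c" for i
  proof -
    have i: "integrable M (\<lambda>w. f w $ i)" using integrable_bounded_linear[OF bounded_linear_vec_nth fi] .
    have b: "AE w in M. \<bar>f w $ i\<bar> \<le> c"
      using f(2) by eventually_elim (rule order_trans[OF component_le_norm_cart])
    have "AE w in M. real_cond_exp M F (\<lambda>w'. f w' $ i) w \<le> c"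
      by (rule real_cond_exp_le_c[OF i]) (use b in eventually_elim, simp)
    moreover have "AE w in M. real_cond_exp M F (\<lambda>w'. f w' $ i) w \<ge> - c"
      by (rule real_cond_exp_ge_c[OF i]) (use b in eventually_elim, simp)
    ultimately show ?thesis by eventually_elim simp
  qed
  then have "AE w in M. \<forall>i\<in>UNIV. \<bar>real_cond_exp M F (\<lambda>w'. f w' $ i) w\<bar> \<le> c"
    by (intro AE_finite_allI) auto
  then show ?thesis
  proof eventually_elim
    case (elim w)
    have "norm (vec_cond_exp M F f w) \<le> (\<Sum>i\<in>UNIV. \<bar>vec_cond_exp M F f w $ i\<bar>)" by (rule norm_le_l1_cart)
    also have "\<dots> \<le> (\<Sum>i\<in>(UNIV::'n set). c)" using elim by (intro sum_mono) (simp add: vec_cond_exp_def)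
    finally show ?case by simp
  qed
qed

end

section \<open>Stochastic integrals in mean square\<close>

text \<open>An inductive form of step integrals: the intervals may overlap and come in any order, so
  sums and linear images stay in the class without refining partitions. Coefficients are bounded
  almost everywhere only, as conditional expectations are. The driving noise is a parameter, to
  serve both \<open>W\<close> and \<open>W0\<close>.\<close>

inductive simple_integral ::
    "'w measure \<Rightarrow> (real \<Rightarrow> 'w measure) \<Rightarrow> (real \<Rightarrow> 'w \<Rightarrow> real) \<Rightarrow> (real \<Rightarrow> 'w \<Rightarrow> 'b::euclidean_space)
      \<Rightarrow> (real \<Rightarrow> 'w \<Rightarrow> 'b) \<Rightarrow> bool" for M F V where
  zero: "simple_integral M F V (\<lambda>s w. 0) (\<lambda>t w. 0)"
| step: "simple_integral M F V H S \<Longrightarrow> 0 \<le> a \<Longrightarrow> a \<le> b \<Longrightarrow> \<eta> \<in> borel_measurable (F a) \<Longrightarrow>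
    AE w in M. norm (\<eta> w) \<le> c \<Longrightarrow>
    simple_integral M F V (\<lambda>s w. indicator {a<..b} s *\<^sub>R \<eta> w + H s w)
      (\<lambda>t w. (V (min b t) w - V (min a t) w) *\<^sub>R \<eta> w + S t w)"

lemma simple_integral_add:
  assumes "simple_integral M F V H S" "simple_integral M F V H' S'"
  shows "simple_integral M F V (\<lambda>s w. H s w + H' s w) (\<lambda>t w. S t w + S' t w)"
  using assms(1)
proof induction
  case zero
  then show ?case using assms(2) by simp
next
  case (step H S a b \<eta> c)
  then show ?case using simple_integral.step[OF step.IH step(2-5)] by (simp add: add.assoc)
qed

lemma simple_integral_bounded_linear:
  assumes "simple_integral M F V H S" "bounded_linear h"
  shows "simple_integral M F V (\<lambda>s w. h (H s w)) (\<lambda>t w. h (S t w))"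
  using assms(1)
proof induction
  interpret bounded_linear h by fact
  case zero
  show ?case using simple_integral.zero by (simp add: zero)
next
  interpret bounded_linear h by fact
  case (step H S a b \<eta> c)
  obtain k where k: "\<And>x. norm (h x) \<le> norm x * k" "k > 0" using pos_bounded by blast
  have m: "(\<lambda>w. h (\<eta> w)) \<in> borel_measurable (F a)"
    by (rule measurable_compose[OF step(4) borel_measurable_continuous_onI[OF linear_continuous_on[OF assms(2)]]])
  have "AE w in M. norm (h (\<eta> w)) \<le> c * k"
    using step(5)
  proof eventually_elim
    case (elim w)
    show ?case by (rule order_trans[OF k(1) mult_right_mono[OF elim]]) (use k(2) in simp)
  qed
  then show ?case using simple_integral.step[OF step.IH step(2,3) m] by (simp add: add scaleR)
qed

section \<open>Isometry and martingale property of step integrals against W0\<close>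

context brownian_basis
begin

lemma future_germ_of_measurable:
  assumes "f \<in> borel_measurable N" "space N = space M" "\<And>s. a < s \<Longrightarrow> sets N \<subseteq> sets (enlarged s)"
  shows "future_germ a f"
  unfolding future_germ_def
proof (intro allI impI)
  fix s assume "a < s"
  then show "f \<in> borel_measurable (enlarged s)"
    by (intro measurable_mono_sets[OF assms(1)] assms(3)) (simp_all add: assms(2))
qed

lemma future_germI: "f \<in> borel_measurable (flt a) \<Longrightarrow> future_germ a f"
  by (rule future_germ_of_measurable[of f "flt a"], assumption, simp)
     (rule order_trans[OF flt_raw_flt raw_flt_enlarged])

lemma future_germ_mono: "future_germ a f \<Longrightarrow> a \<le> b \<Longrightarrow> future_germ b f"
  by (auto simp: future_germ_def)

lemma future_germ_measurable: "future_germ a f \<Longrightarrow> f \<in> borel_measurable M"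
  using measurable_from_subalg[OF subalg_enlarged] by (meson future_germ_def gt_ex)

lemma path_W0_enlarged: "s \<le> c \<Longrightarrow> sets (path_algebra W0 {0..s}) \<subseteq> sets (enlarged c)"
  unfolding sets_enlarged using path_algebra_mono[of "{0..s}" "{0..c}" W0]
  by (auto intro: sigma_sets.Basic)

lemma future_germ_W0: "0 \<le> s \<Longrightarrow> s \<le> c \<Longrightarrow> future_germ c (W0 s)"
  by (rule future_germ_of_measurable[OF measurable_path_algebra[of s "{0..s}" W0]])
     (use path_W0_enlarged in auto)

lemma indicator_abs_le_1: "\<bar>indicator A x\<bar> \<le> (1::real)"
  by (simp add: indicator_def)

lemma future_germ_diff: "future_germ a f \<Longrightarrow> future_germ a g \<Longrightarrow> future_germ a (\<lambda>w. f w - g w)"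
  and future_germ_inner: "future_germ a f \<Longrightarrow> future_germ a g \<Longrightarrow> future_germ a (\<lambda>w. f w \<bullet> g w)"
  and future_germ_mult: "future_germ a k \<Longrightarrow> future_germ a l \<Longrightarrow> future_germ a (\<lambda>w. k w * l w :: real)"
  unfolding future_germ_def by (auto intro: borel_measurable_diff borel_measurable_inner borel_measurable_times)

lemma AE_abs_inner_le:
  fixes \<eta> \<eta>' :: "'w \<Rightarrow> 'b::euclidean_space"
  assumes "AE w in M. norm (\<eta> w) \<le> c" "AE w in M. norm (\<eta>' w) \<le> c'"
  shows "AE w in M. \<bar>\<eta> w \<bullet> \<eta>' w\<bar> \<le> c * c'"
  using assms
proof eventually_elim
  case (elim w)
  have "\<bar>\<eta> w \<bullet> \<eta>' w\<bar> \<le> norm (\<eta> w) * norm (\<eta>' w)" by (rule Cauchy_Schwarz_ineq2)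
  also have "\<dots> \<le> c * c'"
    by (rule mult_mono) (use elim norm_ge_zero[of "\<eta> w"] in \<open>auto intro: order_trans[OF norm_ge_zero]\<close>)
  finally show ?case .
qed

text \<open>Only the overlap of the two intervals contributes. The weight is known when the later
  interval starts, so every product of non-overlapping increments has mean zero.\<close>

lemma increment_pair_aux:
  fixes \<zeta> :: "'w \<Rightarrow> real"
  assumes ac: "0 \<le> a" "a \<le> c" and ab: "a \<le> b" and cd: "c \<le> d"
    and \<zeta>: "future_germ c \<zeta>" "AE w in M. \<bar>\<zeta> w\<bar> \<le> k"
  shows "(\<integral>w. \<zeta> w * (W0 b w - W0 a w) * (W0 d w - W0 c w) \<partial>M) = max 0 (min b d - c) * (\<integral>w. \<zeta> w \<partial>M)"
proof -
  have \<zeta>m: "\<zeta> \<in> borel_measurable M" using future_germ_measurable[OF \<zeta>(1)] .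
  have sq: "sqint M (\<lambda>w. \<zeta> w * (W0 y w - W0 x w))" if "0 \<le> x" "x \<le> y" for x y
    using sqint_bounded_mult[OF W0_L2(1)[OF that] \<zeta>m \<zeta>(2)] by simp
  have fg: "future_germ e (\<lambda>w. \<zeta> w * (W0 y w - W0 x w))" if "c \<le> e" "0 \<le> x" "x \<le> e" "0 \<le> y" "y \<le> e" for x y e
    using future_germ_mult[OF future_germ_mono[OF \<zeta>(1) that(1)] future_germ_diff[OF future_germ_W0 future_germ_W0], of y x] that by simp
  have mean: "(\<integral>w. \<zeta> w * (W0 y w - W0 x w) * (W0 q w - W0 p w) \<partial>M) = 0"
    if "0 \<le> x" "x \<le> y" "y \<le> p" "c \<le> p" "p \<le> q" for x y p q
    by (rule increment_mean[OF sq fg]) (use that in auto)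
  have int: "integrable M (\<lambda>w. \<zeta> w * (W0 y w - W0 x w) * (W0 q w - W0 p w))"
    if "0 \<le> x" "x \<le> y" "0 \<le> p" "p \<le> q" for x y p q
    using sqint_inner[OF sq[of x y] W0_L2(1)[of p q]] that by simp
  show ?thesis
  proof (cases "b \<le> c")
    case True
    then show ?thesis using mean[of a b c d] ac ab cd by simp
  next
    case False
    then have cb: "c \<le> b" by simp
    define m where "m = min b d"
    have m: "c \<le> m" "m \<le> b" "m \<le> d" using cb cd by (auto simp: m_def)
    have sqr: "(\<integral>w. \<zeta> w * (W0 m w - W0 c w) * (W0 m w - W0 c w) \<partial>M) = (m - c) * (\<integral>w. \<zeta> w \<partial>M)"
      using increment_square[OF \<zeta>, of m] m ac by (simp add: power2_eq_square mult.assoc)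
    have z: "(\<integral>w. \<zeta> w * (W0 b w - W0 m w) * (W0 m w - W0 c w) \<partial>M) = 0"
      using mean[of c m m b] m ac by (simp add: mult_ac)
    have zz: "(\<integral>w. \<zeta> w * (W0 b w - W0 c w) * (W0 d w - W0 m w) \<partial>M) = 0"
    proof (cases "b \<le> d")
      case True
      then have "m = b" by (simp add: m_def)
      then show ?thesis using mean[of c b b d] m ac by simp
    next
      case False
      then have "m = d" by (simp add: m_def)
      then show ?thesis by simp
    qed
    \<comment> \<open>In the first three products either one increment starts after the other has
      ended or a factor is zero; the last is the square over the overlap from \<open>c\<close> to
      \<open>m\<close>.\<close>
    have "(\<integral>w. \<zeta> w * (W0 b w - W0 a w) * (W0 d w - W0 c w) \<partial>M)
      = (\<integral>w. \<zeta> w * (W0 c w - W0 a w) * (W0 d w - W0 c w) + (\<zeta> w * (W0 b w - W0 c w) * (W0 d w - W0 m w)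
        + (\<zeta> w * (W0 b w - W0 m w) * (W0 m w - W0 c w) + \<zeta> w * (W0 m w - W0 c w) * (W0 m w - W0 c w))) \<partial>M)"
      by (intro Bochner_Integration.integral_cong refl) (simp add: algebra_simps)
    also have "\<dots> = 0 + (0 + (0 + (m - c) * (\<integral>w. \<zeta> w \<partial>M)))"
      using int[of a c c d] int[of c b m d] int[of m b c m] int[of c m c m] mean[of a c c d] z zz sqr m ac ab cd cb
      by simp
    finally show ?thesis using m by (simp add: m_def[symmetric])
  qed
qed

lemma increment_pair:
  fixes \<eta> \<eta>' :: "'w \<Rightarrow> 'b::euclidean_space"
  assumes ab: "0 \<le> a" "a \<le> b" and cd: "0 \<le> c" "c \<le> d"
    and \<eta>: "\<eta> \<in> borel_measurable (flt a)" "AE w in M. norm (\<eta> w) \<le> k"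
    and \<eta>': "\<eta>' \<in> borel_measurable (flt c)" "AE w in M. norm (\<eta>' w) \<le> k'"
  shows "(\<integral>w. ((W0 b w - W0 a w) *\<^sub>R \<eta> w) \<bullet> ((W0 d w - W0 c w) *\<^sub>R \<eta>' w) \<partial>M)
    = max 0 (min b d - max a c) * (\<integral>w. \<eta> w \<bullet> \<eta>' w \<partial>M)"
proof -
  have fg: "future_germ (max a c) (\<lambda>w. \<eta> w \<bullet> \<eta>' w)"
    by (intro future_germ_inner future_germ_mono[OF future_germI[OF \<eta>(1)]] future_germ_mono[OF future_germI[OF \<eta>'(1)]]) auto
  note bd = AE_abs_inner_le[OF \<eta>(2) \<eta>'(2)]
  show ?thesis
  proof (cases "a \<le> c")
    case True
    then show ?thesis
      using increment_pair_aux[OF ab(1) True ab(2) cd(2) _ bd] fg by (simp add: mult_ac max_absorb2)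
  next
    case False
    then show ?thesis
      using increment_pair_aux[OF cd(1) _ cd(2) ab(2) _ bd] fg by (simp add: mult_ac max_absorb1 min.commute)
  qed
qed

lemma simple_step_sqint:
  fixes \<eta> :: "'w \<Rightarrow> 'b::euclidean_space"
  assumes "0 \<le> a" "a \<le> b" "\<eta> \<in> borel_measurable (flt a)" "AE w in M. norm (\<eta> w) \<le> c" "0 \<le> t"
  shows "sqint M (\<lambda>w. (W0 (min b t) w - W0 (min a t) w) *\<^sub>R \<eta> w)"
    "sqint (path_measure t) (\<lambda>(s, w). indicator {a<..b} s *\<^sub>R \<eta> w)"
proof -
  have \<eta>: "\<eta> \<in> borel_measurable M" using measurable_from_subalg[OF subalg_flt assms(3)] .
  show "sqint M (\<lambda>w. (W0 (min b t) w - W0 (min a t) w) *\<^sub>R \<eta> w)"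
    by (rule sqint_mult_bounded[OF W0_L2(1) \<eta> assms(4)]) (use assms in auto)
  have "sqint M (\<lambda>w. 1 *\<^sub>R \<eta> w)"
    by (rule sqint_mult_bounded[OF sqint_const \<eta> assms(4)])
  then have "sqint (path_measure t) (\<lambda>(s, w). \<eta> w)" using sqint_path_const by simp
  moreover have "(\<lambda>z. indicator {a<..b} (fst z) :: real) \<in> borel_measurable (path_measure t)"
    by (rule measurable_compose[OF measurable_fst borel_measurable_time]) simp
  ultimately show "sqint (path_measure t) (\<lambda>(s, w). indicator {a<..b} s *\<^sub>R \<eta> w)"
    using sqint_bounded_mult[of "path_measure t" "\<lambda>(s, w). \<eta> w" "\<lambda>z. indicator {a<..b} (fst z)" 1,
        OF _ _ AE_I2[OF indicator_abs_le_1]]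
    by (simp add: case_prod_unfold)
qed

lemma simple_integral_sqint:
  assumes "simple_integral M flt W0 H S" "0 \<le> t"
  shows "sqint M (S t)" "sqint (path_measure t) (\<lambda>(s, w). H s w)"
  using assms
proof induction
  case (step H S a b \<eta> c)
  { case 1 then show ?case using sqint_add[OF simple_step_sqint(1)[OF step(2-5)] step.IH(1)] by simp }
  { case 2 then show ?case using sqint_add[OF simple_step_sqint(2)[OF step(2-5)] step.IH(2)] by (simp add: case_prod_unfold) }
qed (simp_all add: case_prod_unfold)

text \<open>Cutting at \<open>t\<close> commutes with intersecting intervals, so both sides equal
  the length of the truncated overlap times the mean inner product of the coefficients.\<close>

lemma simple_step_isometry:
  fixes \<eta> \<eta>' :: "'w \<Rightarrow> 'b::euclidean_space"
  assumes 1: "0 \<le> a" "a \<le> b" "\<eta> \<in> borel_measurable (flt a)" "AE w in M. norm (\<eta> w) \<le> k"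
    and 2: "0 \<le> c" "c \<le> d" "\<eta>' \<in> borel_measurable (flt c)" "AE w in M. norm (\<eta>' w) \<le> k'" and t: "0 \<le> t"
  shows "(\<integral>w. ((W0 (min b t) w - W0 (min a t) w) *\<^sub>R \<eta> w) \<bullet> ((W0 (min d t) w - W0 (min c t) w) *\<^sub>R \<eta>' w) \<partial>M)
    = (\<integral>z. (case z of (s, w) \<Rightarrow> indicator {a<..b} s *\<^sub>R \<eta> w) \<bullet> (case z of (s, w) \<Rightarrow> indicator {c<..d} s *\<^sub>R \<eta>' w) \<partial>path_measure t)"
proof -
  let ?e = "\<integral>w. \<eta> w \<bullet> \<eta>' w \<partial>M"
  have "(\<integral>z. (case z of (s, w) \<Rightarrow> indicator {a<..b} s *\<^sub>R \<eta> w) \<bullet> (case z of (s, w) \<Rightarrow> indicator {c<..d} s *\<^sub>R \<eta>' w) \<partial>path_measure t)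
     = (\<integral>s. (\<integral>w. (indicator {a<..b} s *\<^sub>R \<eta> w) \<bullet> (indicator {c<..d} s *\<^sub>R \<eta>' w) \<partial>M) \<partial>time_measure t)"
    unfolding path_inner(1)[OF simple_step_sqint(2)[OF 1 t] simple_step_sqint(2)[OF 2 t]] by (simp only: prod.case)
  also have "\<dots> = (\<integral>s. indicator ({a<..b} \<inter> {c<..d}) s * ?e \<partial>time_measure t)"
    by (intro Bochner_Integration.integral_cong refl) (auto simp: indicator_def)
  also have "\<dots> = measure lborel ({a<..b} \<inter> {c<..d} \<inter> {0..t}) * ?e"
    unfolding Bochner_Integration.integral_mult_left_zero
    by (subst integral_time_measure_indicator) auto
  also have "{a<..b} \<inter> {c<..d} \<inter> {0..t} = {max a c<..min (min b d) t}" using 1 by auto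
  also have "measure lborel {max a c<..min (min b d) t} = max 0 (min (min b d) t - max a c)"
    by (cases "max a c \<le> min (min b d) t") (auto simp: max_def)
  finally have rhs: "(\<integral>z. (case z of (s, w) \<Rightarrow> indicator {a<..b} s *\<^sub>R \<eta> w) \<bullet> (case z of (s, w) \<Rightarrow> indicator {c<..d} s *\<^sub>R \<eta>' w) \<partial>path_measure t)
     = max 0 (min (min b d) t - max a c) * ?e" .
  show ?thesis
  proof (cases "t \<le> a \<or> t \<le> c")
    case True
    then have "min b t = min a t \<or> min d t = min c t" using 1 2 by auto
    then have "(\<integral>w. ((W0 (min b t) w - W0 (min a t) w) *\<^sub>R \<eta> w) \<bullet> ((W0 (min d t) w - W0 (min c t) w) *\<^sub>R \<eta>' w) \<partial>M) = 0"
      by auto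
    moreover have "max 0 (min (min b d) t - max a c) = 0" using True by auto
    ultimately show ?thesis unfolding rhs by simp
  next
    case False
    then have m: "min a t = a" "min c t = c" by auto
    have "min (min b t) (min d t) = min (min b d) t" by auto
    then show ?thesis
      unfolding rhs m using increment_pair[OF 1(1) _ 2(1) _ 1(3,4) 2(3,4), of "min b t" "min d t"] False 1 2 by simp
  qed
qed

lemma simple_isometry:
  assumes S: "simple_integral M flt W0 H S" and S': "simple_integral M flt W0 H' S'" and t: "0 \<le> t"
  shows "(\<integral>w. S t w \<bullet> S' t w \<partial>M) = (\<integral>z. (case z of (s, w) \<Rightarrow> H s w) \<bullet> (case z of (s, w) \<Rightarrow> H' s w) \<partial>path_measure t)"
  using S
proof induction
  case (step H S a b \<eta> c)
  note 1 = step(2-5)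
  note s1 = simple_step_sqint[OF 1 t]
  have aux: "(\<integral>w. ((W0 (min b t) w - W0 (min a t) w) *\<^sub>R \<eta> w) \<bullet> S' t w \<partial>M)
    = (\<integral>z. (case z of (s, w) \<Rightarrow> indicator {a<..b} s *\<^sub>R \<eta> w) \<bullet> (case z of (s, w) \<Rightarrow> H' s w) \<partial>path_measure t)"
    using S'
  proof induction
    case (step H S a' b' \<eta>' c')
    note s2 = simple_step_sqint[OF step(2-5) t] and s3 = simple_integral_sqint[OF step(1) t]
    show ?case
      using simple_step_isometry[OF 1 step(2-5) t] step.IH sqint_inner[OF s1(1) s2(1)] sqint_inner[OF s1(1) s3(1)]
        sqint_inner[OF s1(2) s2(2)] sqint_inner[OF s1(2) s3(2)]
      by (simp add: inner_add_right case_prod_unfold del: inner_scaleR_left inner_scaleR_right)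
  qed simp
  note s2 = simple_integral_sqint[OF step(1) t] and s3 = simple_integral_sqint[OF S' t]
  show ?case
    using aux step.IH sqint_inner[OF s1(1) s3(1)] sqint_inner[OF s2(1) s3(1)]
      sqint_inner[OF s1(2) s3(2)] sqint_inner[OF s2(2) s3(2)]
    by (simp add: inner_add_left case_prod_unfold del: inner_scaleR_left inner_scaleR_right)
qed simp

text \<open>What a step adds after \<open>s\<close> is an increment that starts at
  \<open>max s (min a t)\<close>; if \<open>a \<le> t\<close>, both \<open>\<zeta>\<close> and the
  coefficient are known there up to the immediate future.\<close>

lemma simple_martingale:
  assumes S: "simple_integral M flt W0 H S" and \<zeta>: "sqint M \<zeta>" "future_germ s \<zeta>" and st: "0 \<le> s" "s \<le> t"
  shows "(\<integral>w. \<zeta> w \<bullet> S t w \<partial>M) = (\<integral>w. \<zeta> w \<bullet> S s w \<partial>M)"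
  using S
proof induction
  case (step H S a b \<eta> c)
  note 1 = step(2-5)
  have t: "0 \<le> t" using st by simp
  have \<eta>: "\<eta> \<in> borel_measurable M" using measurable_from_subalg[OF subalg_flt 1(3)] .
  note s1 = simple_step_sqint(1)[OF 1 t] and s2 = simple_step_sqint(1)[OF 1 st(1)]
    and s3 = simple_integral_sqint(1)[OF step(1) t] and s4 = simple_integral_sqint(1)[OF step(1) st(1)]
  \<comment> \<open>The cut-off end points of the part of the step that lies between
    \<open>s\<close> and \<open>t\<close>; it degenerates to a point when the step is over before
    \<open>s\<close> or starts after \<open>t\<close>.\<close>
  define b' where "b' = max s (min b t)"
  define a' where "a' = max s (min a t)"
  have ab': "0 \<le> a'" "a' \<le> b'" using 1 st by (auto simp: a'_def b'_def max_def min_def)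
  have cut: "W0 (min x t) w - W0 (min x s) w = W0 (max s (min x t)) w - W0 s w" for x w
    using st by (auto simp: max_def min_def)
  have "(\<integral>w. \<zeta> w \<bullet> ((W0 b' w - W0 a' w) *\<^sub>R \<eta> w) \<partial>M) = 0"
  proof (cases "a \<le> t")
    case True
    have "sqint M (\<lambda>w. \<zeta> w \<bullet> \<eta> w)"
    proof (rule sqint_bound)
      show "(\<lambda>w. \<zeta> w \<bullet> \<eta> w) \<in> borel_measurable M" using \<zeta>(1) \<eta> by (intro borel_measurable_inner) auto
      show "integrable M (\<lambda>w. c\<^sup>2 * (norm (\<zeta> w))\<^sup>2)" using sqint_integrable_sq[OF \<zeta>(1)] by simp
      show "AE w in M. (norm (\<zeta> w \<bullet> \<eta> w))\<^sup>2 \<le> c\<^sup>2 * (norm (\<zeta> w))\<^sup>2"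
        using 1(4)
      proof eventually_elim
        case (elim w)
        have "\<bar>\<zeta> w \<bullet> \<eta> w\<bar> \<le> norm (\<zeta> w) * c"
          by (rule order_trans[OF Cauchy_Schwarz_ineq2 mult_left_mono[OF elim norm_ge_zero]])
        from power_mono[OF this abs_ge_zero, of 2] show ?case by (simp add: power_mult_distrib mult.commute)
      qed
    qed
    moreover have "future_germ a' (\<lambda>w. \<zeta> w \<bullet> \<eta> w)"
      by (intro future_germ_inner future_germ_mono[OF \<zeta>(2)] future_germ_mono[OF future_germI[OF 1(3)]])
         (use True in \<open>auto simp: a'_def\<close>)
    ultimately show ?thesis using increment_mean[of "\<lambda>w. \<zeta> w \<bullet> \<eta> w" a' b'] ab' by (simp add: mult.commute)
  next
    case False
    then have "a' = b'" using 1 by (auto simp: a'_def b'_def)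
    then show ?thesis by simp
  qed
  moreover have "(W0 b' w - W0 a' w) *\<^sub>R \<eta> w = (W0 (min b t) w - W0 (min a t) w) *\<^sub>R \<eta> w - (W0 (min b s) w - W0 (min a s) w) *\<^sub>R \<eta> w" for w
    using cut[of b w] cut[of a w] unfolding a'_def b'_def by (simp flip: scaleR_diff_left)
  ultimately have "(\<integral>w. \<zeta> w \<bullet> ((W0 (min b t) w - W0 (min a t) w) *\<^sub>R \<eta> w) \<partial>M)
     = (\<integral>w. \<zeta> w \<bullet> ((W0 (min b s) w - W0 (min a s) w) *\<^sub>R \<eta> w) \<partial>M)"
    using sqint_inner[OF \<zeta>(1) s1] sqint_inner[OF \<zeta>(1) s2]
    by (simp add: inner_diff_right del: inner_scaleR_left inner_scaleR_right)
  then show ?case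
    using step.IH sqint_inner[OF \<zeta>(1) s1] sqint_inner[OF \<zeta>(1) s2] sqint_inner[OF \<zeta>(1) s3] sqint_inner[OF \<zeta>(1) s4]
    by (simp add: inner_add_right del: inner_scaleR_left inner_scaleR_right)
qed simp

end

section \<open>Exchange of the two noises, cross terms, and projection onto the common noise\<close>

context brownian_basis
begin

text \<open>The basis is symmetric in the two noises, so everything about integrals against
  \<open>W0\<close> transfers to \<open>W\<close>. The enlargement of the swapped basis contains the
  entire path of \<open>W0\<close>.\<close>

lemma swapped: "brownian_basis M W0 W F0"
proof -
  let ?P = "path_algebra (\<lambda>s w. (W s w, W0 s w)) {0..}"
  have "(\<lambda>w. (W0 s w, W s w)) \<in> borel_measurable ?P" if "s \<in> {0..}" for s
  proof -
    have pair: "(\<lambda>w. (W s w, W0 s w)) \<in> borel_measurable ?P"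
      using measurable_path_algebra[of s "{0..}" "\<lambda>s w. (W s w, W0 s w)"] that by simp
    have "continuous_on UNIV (\<lambda>z::real \<times> real. (snd z, fst z))" by (intro continuous_intros)
    from measurable_compose[OF pair borel_measurable_continuous_onI[OF this]] show ?thesis by simp
  qed
  then have "sets (path_algebra (\<lambda>s w. (W0 s w, W s w)) {0..}) \<subseteq> sets ?P"
    by (intro sets_path_algebra_subset) auto
  then have "indep_set (sets F0) (sets (path_algebra (\<lambda>s w. (W0 s w, W s w)) {0..}))"
    using indep_F0 unfolding indep_sets2_eq by blast
  moreover have "indep_set (sets (path_algebra W0 {0..})) (sets (path_algebra W {0..}))"
    using indep_W_W0 unfolding indep_sets2_eq by (metis Int_commute mult.commute)
  ultimately show ?thesis
    by (intro brownian_basis.intro brownian_basis_axioms.intro prob_space_axioms)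
       (use complete subalg_F0 atomless_F0 brownian_W brownian_W0 in auto)
qed

lemma flt_swapped: "brownian_basis.flt M W0 W F0 = flt"
proof -
  have "brownian_basis.raw_flt M W0 W F0 t = raw_flt t" for t
    unfolding brownian_basis.raw_flt_def[OF swapped] raw_flt_def
    by (rule arg_cong2[where f = sigma]) auto
  then show ?thesis
    by (intro ext) (simp add: brownian_basis.flt_def[OF swapped] flt_def)
qed

lemmas simple_integral_sqint_W = brownian_basis.simple_integral_sqint[OF swapped, unfolded flt_swapped]
lemmas simple_step_sqint_W = brownian_basis.simple_step_sqint[OF swapped, unfolded flt_swapped]
lemmas simple_isometry_W = brownian_basis.simple_isometry[OF swapped, unfolded flt_swapped]
lemmas simple_martingale_W = brownian_basis.simple_martingale[OF swapped, unfolded flt_swapped]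

definition future_germ_W :: "real \<Rightarrow> ('w \<Rightarrow> 'b::euclidean_space) \<Rightarrow> bool" where
  "future_germ_W a f \<longleftrightarrow> brownian_basis.future_germ M W0 W F0 a f"

lemma future_germ_WI: "f \<in> borel_measurable (flt a) \<Longrightarrow> future_germ_W a f"
  unfolding future_germ_W_def
  using brownian_basis.future_germI[OF swapped, of f a] by (simp add: flt_swapped)

lemma path_W0_enlarged_W: "sets (path_algebra W0 {0..}) \<subseteq> sets (brownian_basis.enlarged M W0 W F0 a)"
  unfolding brownian_basis.sets_enlarged[OF swapped] by auto

lemma future_germ_W_W0: "0 \<le> s \<Longrightarrow> future_germ_W a (W0 s)"
  unfolding future_germ_W_def
  by (rule brownian_basis.future_germ_of_measurable[OF swapped measurable_path_algebra[of s "{0..}" W0]])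
     (use path_W0_enlarged_W in auto)

lemma future_germ_W': "0 \<le> s \<Longrightarrow> future_germ a (W s)"
  by (rule future_germ_of_measurable[OF measurable_path_algebra[of s "{0..}" W]])
     (auto simp: sets_enlarged)

text \<open>No relation between \<open>a\<close> and \<open>t\<close> is required: relative to
  \<open>W\<close>, even the future of the common noise counts as known. This is why integrals
  against \<open>W\<close> disappear under conditioning on the common noise.\<close>

lemma future_germ_W_flt0: "f \<in> borel_measurable (flt0 t) \<Longrightarrow> future_germ_W a f"
  unfolding future_germ_W_def
proof (rule brownian_basis.future_germ_of_measurable[OF swapped, of f "flt0 t"])
  fix s
  have "sets (path_algebra W0 {0..t}) \<union> null_sets M \<subseteq> sets (brownian_basis.enlarged M W0 W F0 s)"
    using path_W0_enlarged_W path_W0_Icc by (auto simp: brownian_basis.sets_enlarged[OF swapped])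
  then show "sets (flt0 t) \<subseteq> sets (brownian_basis.enlarged M W0 W F0 s)"
    unfolding sets_flt0
    using sets.sigma_sets_subset[of _ "brownian_basis.enlarged M W0 W F0 s"]
      brownian_basis.space_enlarged[OF swapped, of s] by simp
qed simp_all

lemma simple_integral_start:
  "simple_integral M F V H S \<Longrightarrow> S 0 w = 0"
  by (induction rule: simple_integral.induct) (simp_all add: min_absorb2)

text \<open>The increment that starts later is integrated first. Seen from its noise the whole path
  of the other one is known, and both coefficients are known at its start, so its mean is
  zero.\<close>

lemma cross_step:
  fixes \<eta> \<eta>' :: "'w \<Rightarrow> 'b::euclidean_space"
  assumes 1: "0 \<le> a" "a \<le> b" "\<eta> \<in> borel_measurable (flt a)" "AE w in M. norm (\<eta> w) \<le> k"
    and 2: "0 \<le> c" "c \<le> d" "\<eta>' \<in> borel_measurable (flt c)" "AE w in M. norm (\<eta>' w) \<le> k'"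
  shows "(\<integral>w. ((W b w - W a w) *\<^sub>R \<eta> w) \<bullet> ((W0 d w - W0 c w) *\<^sub>R \<eta>' w) \<partial>M) = 0"
proof -
  have m: "\<eta> \<in> borel_measurable M" "\<eta>' \<in> borel_measurable M"
    using measurable_from_subalg[OF subalg_flt] 1(3) 2(3) by blast+
  note bd = AE_abs_inner_le[OF 1(4) 2(4)]
  have mi: "(\<lambda>w. \<eta> w \<bullet> \<eta>' w) \<in> borel_measurable M" by (intro borel_measurable_inner m)
  show ?thesis
  proof (cases "c \<le> a")
    case True
    let ?\<zeta> = "\<lambda>w. (\<eta> w \<bullet> \<eta>' w) * (W0 d w - W0 c w)"
    have "\<eta>' \<in> borel_measurable (flt a)"
      by (rule measurable_mono_sets[OF 2(3) flt_mono[OF True]]) simp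
    then have "future_germ_W a ?\<zeta>"
      using future_germ_WI[OF 1(3)] future_germ_WI[of \<eta>' a] future_germ_W_W0[of d a] future_germ_W_W0[of c a] 2
      unfolding future_germ_W_def
      by (intro brownian_basis.future_germ_mult[OF swapped] brownian_basis.future_germ_inner[OF swapped]
          brownian_basis.future_germ_diff[OF swapped]) auto
    moreover have "sqint M ?\<zeta>"
      using sqint_bounded_mult[OF W0_L2(1)[OF 2(1,2)] mi bd] by simp
    ultimately have "(\<integral>w. ?\<zeta> w * (W b w - W a w) \<partial>M) = 0"
      unfolding future_germ_W_def by (intro brownian_basis.increment_mean[OF swapped] 1)
    then show ?thesis by (simp add: mult_ac)
  next
    case False
    let ?\<zeta> = "\<lambda>w. (\<eta> w \<bullet> \<eta>' w) * (W b w - W a w)"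
    have "\<eta> \<in> borel_measurable (flt c)"
      by (rule measurable_mono_sets[OF 1(3) flt_mono]) (use False in auto)
    then have "future_germ c ?\<zeta>"
      using future_germI[OF 2(3)] future_germI[of \<eta> c] future_germ_W'[of b c] future_germ_W'[of a c] 1
      by (intro future_germ_mult future_germ_inner future_germ_diff) auto
    moreover have "sqint M ?\<zeta>"
      using sqint_bounded_mult[OF brownian_basis.W0_L2(1)[OF swapped 1(1,2)] mi bd] by simp
    ultimately have "(\<integral>w. ?\<zeta> w * (W0 d w - W0 c w) \<partial>M) = 0"
      by (intro increment_mean 2)
    then show ?thesis by (simp add: mult_ac)
  qed
qed

lemma cross_step_min:
  fixes \<eta> \<eta>' :: "'w \<Rightarrow> 'b::euclidean_space"
  assumes 1: "0 \<le> a" "a \<le> b" "\<eta> \<in> borel_measurable (flt a)" "AE w in M. norm (\<eta> w) \<le> k"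
    and 2: "0 \<le> c" "c \<le> d" "\<eta>' \<in> borel_measurable (flt c)" "AE w in M. norm (\<eta>' w) \<le> k'" and t: "0 \<le> t"
  shows "(\<integral>w. ((W (min b t) w - W (min a t) w) *\<^sub>R \<eta> w) \<bullet> ((W0 (min d t) w - W0 (min c t) w) *\<^sub>R \<eta>' w) \<partial>M) = 0"
proof (cases "t \<le> a \<or> t \<le> c")
  case True
  then have "min b t = min a t \<or> min d t = min c t" using 1 2 by auto
  then show ?thesis by auto
next
  case False
  then have m: "min a t = a" "min c t = c" by auto
  show ?thesis unfolding m using cross_step[OF 1(1) _ 1(3,4) 2(1) _ 2(3,4), of "min b t" "min d t"] False 1 2 by simp
qed

lemma simple_cross:
  assumes S: "simple_integral M flt W H S" and S': "simple_integral M flt W0 H' S'" and t: "0 \<le> t"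
  shows "(\<integral>w. S t w \<bullet> S' t w \<partial>M) = 0"
  using S
proof induction
  case (step H S a b \<eta> c)
  note 1 = step(2-5)
  note s1 = simple_step_sqint_W(1)[OF 1 t]
  have aux: "(\<integral>w. ((W (min b t) w - W (min a t) w) *\<^sub>R \<eta> w) \<bullet> S' t w \<partial>M) = 0"
    using S'
  proof induction
    case (step H S a' b' \<eta>' c')
    note s2 = simple_step_sqint(1)[OF step(2-5) t] and s3 = simple_integral_sqint(1)[OF step(1) t]
    show ?case
      using cross_step_min[OF 1 step(2-5) t] step.IH sqint_inner[OF s1 s2] sqint_inner[OF s1 s3]
      by (simp add: inner_add_right del: inner_scaleR_left inner_scaleR_right)
  qed simp
  note s2 = simple_integral_sqint_W(1)[OF step(1) t] and s3 = simple_integral_sqint(1)[OF S' t]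
  show ?case
    using aux step.IH sqint_inner[OF s1 s3] sqint_inner[OF s2 s3]
    by (simp add: inner_add_left del: inner_scaleR_left inner_scaleR_right)
qed simp

text \<open>Completeness makes every subset of a null set measurable, and \<open>raw_flt\<close>
  contains all null sets, so changes on a null set are harmless.\<close>

lemma AE_equal_measurable_raw_flt:
  fixes f g :: "'w \<Rightarrow> 'b::topological_space"
  assumes g: "g \<in> borel_measurable (raw_flt s)" and eq: "AE w in M. f w = g w"
  shows "f \<in> borel_measurable (raw_flt s)"
proof (rule measurableI)
  fix B :: "'b set" assume B: "B \<in> sets borel"
  obtain N where N: "N \<in> null_sets M" "{w \<in> space M. f w \<noteq> g w} \<subseteq> N"
    using eq by (auto simp: eventually_ae_filter)
  have null: "null_sets M \<subseteq> sets (raw_flt s)" by (auto simp: sets_raw_flt)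
  have "f -` B \<inter> space M \<inter> N \<in> null_sets M"
    using complete_measure.complete[OF complete, of "f -` B \<inter> space M \<inter> N" N] N(1)
    by (intro null_sets_subset[OF N(1)]) auto
  then have "(g -` B \<inter> space (raw_flt s) - N) \<union> (f -` B \<inter> space M \<inter> N) \<in> sets (raw_flt s)"
    using measurable_sets[OF g B] null N(1) by blast
  moreover have "(g -` B \<inter> space (raw_flt s) - N) \<union> (f -` B \<inter> space M \<inter> N) = f -` B \<inter> space (raw_flt s)"
    using N(2) by auto
  ultimately show "f -` B \<inter> space (raw_flt s) \<in> sets (raw_flt s)" by simp
qed simp

text \<open>The dual of \<open>cond_exp_enlarged\<close>: common noise after \<open>s\<close> tells
  nothing new about a variable known at \<open>s\<close>. The conditional expectation is moved onto
  the test function, where that lemma applies.\<close>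

lemma vec_cond_exp_later:
  fixes \<eta> :: "'w \<Rightarrow> real^'n"
  assumes \<eta>: "sqint M \<eta>" "\<eta> \<in> borel_measurable (enlarged s)" and st: "s \<le> t"
  shows "AE w in M. vec_cond_exp M (flt0 t) \<eta> w = vec_cond_exp M (flt0 s) \<eta> w"
proof -
  interpret S: finite_measure_subalgebra M "flt0 s" by (rule finite_subalgebra[OF subalg_flt0])
  interpret T: finite_measure_subalgebra M "flt0 t" by (rule finite_subalgebra[OF subalg_flt0])
  interpret E: finite_measure_subalgebra M "enlarged s" by (rule finite_subalgebra[OF subalg_enlarged])
  show ?thesis
  proof (rule T.vec_cond_exp_charact[OF \<eta>(1) S.sqint_vec_cond_exp[OF \<eta>(1)]])
    show "vec_cond_exp M (flt0 s) \<eta> \<in> borel_measurable (flt0 t)"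
      by (rule measurable_mono_sets[OF S.measurable_vec_cond_exp flt0_mono[OF st]]) simp
    fix \<zeta> :: "'w \<Rightarrow> real^'n" assume \<zeta>: "sqint M \<zeta>" "\<zeta> \<in> borel_measurable (flt0 t)"
    have "AE w in M. \<forall>i\<in>UNIV. real_cond_exp M (enlarged s) (\<lambda>w. \<zeta> w $ i) w = real_cond_exp M (flt0 s) (\<lambda>w. \<zeta> w $ i) w"
    proof (intro AE_finite_allI)
      fix i
      have "(\<lambda>w. \<zeta> w $ i) \<in> borel_measurable (flt0 t)"
        by (rule measurable_compose[OF \<zeta>(2) borel_measurable_continuous_onI[OF linear_continuous_on[OF bounded_linear_vec_nth]]])
      then show "AE w in M. real_cond_exp M (enlarged s) (\<lambda>w. \<zeta> w $ i) w = real_cond_exp M (flt0 s) (\<lambda>w. \<zeta> w $ i) w"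
        by (rule cond_exp_enlarged[OF sqint_integrable[OF sqint_component[OF \<zeta>(1)]] _ st])
    qed simp
    then have same: "AE w in M. vec_cond_exp M (enlarged s) \<zeta> w = vec_cond_exp M (flt0 s) \<zeta> w"
      by eventually_elim (simp add: vec_cond_exp_def)
    have "(\<integral>w. \<zeta> w \<bullet> \<eta> w \<partial>M) = (\<integral>w. \<eta> w \<bullet> vec_cond_exp M (enlarged s) \<zeta> w \<partial>M)"
      using E.vec_cond_exp_inner[OF \<zeta>(1) \<eta>] by (simp add: inner_commute)
    also have "\<dots> = (\<integral>w. \<eta> w \<bullet> vec_cond_exp M (flt0 s) \<zeta> w \<partial>M)"
    proof (rule integral_cong_AE)
      show "(\<lambda>w. \<eta> w \<bullet> vec_cond_exp M (enlarged s) \<zeta> w) \<in> borel_measurable M"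
        "(\<lambda>w. \<eta> w \<bullet> vec_cond_exp M (flt0 s) \<zeta> w) \<in> borel_measurable M"
        by (intro borel_measurable_inner sqint_measurable \<eta> \<zeta> E.sqint_vec_cond_exp S.sqint_vec_cond_exp)+
      show "AE w in M. \<eta> w \<bullet> vec_cond_exp M (enlarged s) \<zeta> w = \<eta> w \<bullet> vec_cond_exp M (flt0 s) \<zeta> w"
        using same by eventually_elim simp
    qed
    also have "\<dots> = (\<integral>w. vec_cond_exp M (flt0 s) \<zeta> w \<bullet> vec_cond_exp M (flt0 s) \<eta> w \<partial>M)"
      using S.vec_cond_exp_inner[OF \<eta>(1) S.sqint_vec_cond_exp[OF \<zeta>(1)] S.measurable_vec_cond_exp]
      by (simp add: inner_commute)
    also have "\<dots> = (\<integral>w. \<zeta> w \<bullet> vec_cond_exp M (flt0 s) \<eta> w \<partial>M)"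
      using S.vec_cond_exp_inner[OF \<zeta>(1) S.sqint_vec_cond_exp[OF \<eta>(1)] S.measurable_vec_cond_exp]
      by (simp add: inner_commute)
    finally show "(\<integral>w. \<zeta> w \<bullet> vec_cond_exp M (flt0 s) \<eta> w \<partial>M) = (\<integral>w. \<zeta> w \<bullet> \<eta> w \<partial>M)" by simp
  qed
qed

text \<open>It has to be checked at every \<open>s > a\<close>. For \<open>s \<le> t\<close> the
  projection agrees almost everywhere with the one onto \<open>flt0 s\<close>; for later
  \<open>s\<close> it is measurable through \<open>flt0 t\<close>.\<close>

lemma vec_cond_exp_measurable_flt:
  fixes \<eta> :: "'w \<Rightarrow> real^'n"
  assumes \<eta>: "sqint M \<eta>" "\<eta> \<in> borel_measurable (flt a)"
  shows "vec_cond_exp M (flt0 t) \<eta> \<in> borel_measurable (flt a)"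
proof -
  interpret T: finite_measure_subalgebra M "flt0 t" by (rule finite_subalgebra[OF subalg_flt0])
  have raw: "vec_cond_exp M (flt0 t) \<eta> \<in> borel_measurable (raw_flt s)" if s: "a < s" for s
  proof (cases "s \<le> t")
    case True
    interpret S: finite_measure_subalgebra M "flt0 s" by (rule finite_subalgebra[OF subalg_flt0])
    have "\<eta> \<in> borel_measurable (enlarged s)"
      by (rule measurable_mono_sets[OF \<eta>(2) order_trans[OF flt_raw_flt[OF s] raw_flt_enlarged]]) simp
    from vec_cond_exp_later[OF \<eta>(1) this True] show ?thesis
      by (rule AE_equal_measurable_raw_flt[rotated])
         (rule measurable_mono_sets[OF S.measurable_vec_cond_exp flt0_raw_flt], simp)
  next
    case False
    then show ?thesis
      by (intro measurable_mono_sets[OF T.measurable_vec_cond_exp order_trans[OF flt0_raw_flt raw_flt_mono]]) auto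
  qed
  show ?thesis
  proof (rule measurableI)
    fix B :: "(real^'n) set" assume "B \<in> sets borel"
    then show "vec_cond_exp M (flt0 t) \<eta> -` B \<inter> space (flt a) \<in> sets (flt a)"
      unfolding sets_flt using measurable_sets[OF raw] by auto
  qed simp
qed

text \<open>Projecting a step integral amounts to projecting its coefficients, since increments of
  \<open>W0\<close> up to \<open>t\<close> are known to \<open>flt0 t\<close>. Steps that start at
  or after \<open>t\<close> contribute nothing and are dropped.\<close>

lemma simple_projection:
  fixes H S :: "real \<Rightarrow> 'w \<Rightarrow> real^'n"
  assumes "simple_integral M flt W0 H S" "0 \<le> t"
  shows "\<exists>H' S'. simple_integral M flt W0 H' S'
    \<and> (\<forall>s\<in>{0<..t}. AE w in M. H' s w = vec_cond_exp M (flt0 s) (H s) w)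
    \<and> (AE w in M. S' t w = vec_cond_exp M (flt0 t) (S t) w)"
  using assms
proof induction
  case zero
  have "AE w in M. vec_cond_exp M (flt0 s) (\<lambda>w. 0 :: real^'n) w = 0" for s
    by (rule finite_measure_subalgebra.vec_cond_exp_charact[OF finite_subalgebra[OF subalg_flt0]]) auto
  then have "AE w in M. 0 = vec_cond_exp M (flt0 s) (\<lambda>w. 0 :: real^'n) w" for s
    by (rule AE_mp) (auto intro!: AE_I2)
  then show ?case using simple_integral.zero[of M flt W0] by blast
next
  case (step H S a b \<eta> c)
  note 1 = step(2-5)
  obtain H' S' where IH: "simple_integral M flt W0 H' S'"
    "\<And>s. s \<in> {0<..t} \<Longrightarrow> AE w in M. H' s w = vec_cond_exp M (flt0 s) (H s) w"
    "AE w in M. S' t w = vec_cond_exp M (flt0 t) (S t) w"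
    using step.IH[OF step.prems] by blast
  show ?case
  proof (cases "a < t")
    case False
    then have "min b t = min a t" using 1 by auto
    moreover have "indicator {a<..b} s = (0::real)" if "s \<in> {0<..t}" for s using that False by (simp add: indicator_def)
    ultimately show ?thesis using IH by (intro exI[of _ H'] exI[of _ S']) simp
  next
    case True
    interpret T: finite_measure_subalgebra M "flt0 t" by (rule finite_subalgebra[OF subalg_flt0])
    have \<eta>m: "\<eta> \<in> borel_measurable M" using measurable_from_subalg[OF subalg_flt 1(3)] .
    have \<eta>s: "sqint M \<eta>" using sqint_mult_bounded[OF sqint_const[of "1::real"] \<eta>m 1(4)] by simp
    \<comment> \<open>One projection at the terminal time serves all \<open>s\<close> inside the
      step, because \<open>\<eta>\<close> is known by then and later common noise does not change
      its projection.\<close>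
    define \<eta>' where "\<eta>' = vec_cond_exp M (flt0 t) \<eta>"
    have \<eta>': "\<eta>' \<in> borel_measurable (flt a)"
      unfolding \<eta>'_def by (rule vec_cond_exp_measurable_flt[OF \<eta>s 1(3)])
    have bd: "AE w in M. norm (\<eta>' w) \<le> real CARD('n) * c"
      unfolding \<eta>'_def by (rule T.vec_cond_exp_bounded[OF \<eta>m 1(4)])
    show ?thesis
    proof (intro exI conjI ballI)
      show "simple_integral M flt W0 (\<lambda>s w. indicator {a<..b} s *\<^sub>R \<eta>' w + H' s w)
        (\<lambda>t w. (W0 (min b t) w - W0 (min a t) w) *\<^sub>R \<eta>' w + S' t w)"
        by (rule simple_integral.step[OF IH(1) 1(1,2) \<eta>' bd])
      let ?c = "\<lambda>w. W0 (min b t) w - W0 (min a t) w"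
      have cm: "?c \<in> borel_measurable (flt0 t)"
        by (rule measurable_mono_sets[OF increment_flt0[of "min a t" "min b t"] flt0_mono[of "min b t" t]])
           (use 1 step.prems in auto)
      note cs = simple_step_sqint(1)[OF 1 step.prems]
      note Ss = simple_integral_sqint(1)[OF step(1) step.prems]
      show "AE w in M. (W0 (min b t) w - W0 (min a t) w) *\<^sub>R \<eta>' w + S' t w
        = vec_cond_exp M (flt0 t) (\<lambda>w. (W0 (min b t) w - W0 (min a t) w) *\<^sub>R \<eta> w + S t w) w"
        using IH(3) T.vec_cond_exp_scale[OF cm \<eta>m cs] T.vec_cond_exp_add[OF cs Ss]
        by eventually_elim (simp add: \<eta>'_def)
      fix s assume s: "s \<in> {0<..t}"
      interpret S: finite_measure_subalgebra M "flt0 s" by (rule finite_subalgebra[OF subalg_flt0])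
      show "AE w in M. indicator {a<..b} s *\<^sub>R \<eta>' w + H' s w
        = vec_cond_exp M (flt0 s) (\<lambda>w. indicator {a<..b} s *\<^sub>R \<eta> w + H s w) w"
      proof (cases "s \<in> {a<..b}")
        case True
        have Hs: "sqint M (H s)"
          using step(1)
        proof induction
          case (step H S a b \<eta> c)
          have "\<eta> \<in> borel_measurable M" using measurable_from_subalg[OF subalg_flt step(4)] .
          then have "sqint M \<eta>" using sqint_mult_bounded[OF sqint_const[of "1::real"] _ step(5)] by simp
          then show ?case
            by (intro sqint_add step.IH sqint_bounded_linear[OF bounded_linear_scaleR_right])
        qed simp
        have "\<eta> \<in> borel_measurable (enlarged s)"
          by (rule measurable_mono_sets[OF 1(3) order_trans[OF flt_raw_flt raw_flt_enlarged]]) (use True in auto)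
        from vec_cond_exp_later[OF \<eta>s this, of t] have "AE w in M. \<eta>' w = vec_cond_exp M (flt0 s) \<eta> w"
          using s by (simp add: \<eta>'_def)
        then show ?thesis
          using IH(2)[OF s] S.vec_cond_exp_add[OF \<eta>s Hs] by eventually_elim (use True in simp)
      next
        case False
        then show ?thesis using IH(2)[OF s] by simp
      qed
    qed
  qed
qed

end

section \<open>Ito integrals as mean square limits\<close>

context brownian_basis
begin

text \<open>A relaxation of \<open>has_ito_integral\<close>: the integrand is only required to be
  jointly measurable and approximable. This makes the class closed under sums, linear maps and
  projection onto the common noise.\<close>

definition ito_int ::
    "(real \<Rightarrow> 'w \<Rightarrow> real) \<Rightarrow> (real \<Rightarrow> 'w \<Rightarrow> 'b::euclidean_space) \<Rightarrow> real \<Rightarrow> ('w \<Rightarrow> 'b) \<Rightarrow> bool" where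
  "ito_int V H t J \<longleftrightarrow> (\<exists>Hs Ss. (\<forall>j. simple_integral M flt V (Hs j) (Ss j))
     \<and> L2_lim (path_measure t) (\<lambda>j (s, w). Hs j s w) (\<lambda>(s, w). H s w) \<and> L2_lim M (\<lambda>j. Ss j t) J)"

lemma noise_sqint:
  assumes "V = W \<or> V = W0" "simple_integral M flt V H S" "0 \<le> t"
  shows "sqint M (S t)" "sqint (path_measure t) (\<lambda>(s, w). H s w)"
  using assms simple_integral_sqint simple_integral_sqint_W by blast+

lemma noise_isometry:
  assumes "V = W \<or> V = W0" "simple_integral M flt V H S" "simple_integral M flt V H' S'" "0 \<le> t"
  shows "(\<integral>w. S t w \<bullet> S' t w \<partial>M) = (\<integral>z. (case z of (s, w) \<Rightarrow> H s w) \<bullet> (case z of (s, w) \<Rightarrow> H' s w) \<partial>path_measure t)"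
  using assms(1)
proof
  assume "V = W" then show ?thesis using simple_isometry_W assms(2-4) by blast
next
  assume "V = W0" then show ?thesis using simple_isometry assms(2-4) by blast
qed

lemma noise_martingale:
  assumes "V = W \<or> V = W0" "simple_integral M flt V H S" "sqint M \<zeta>" "\<zeta> \<in> borel_measurable (flt s)" "0 \<le> s" "s \<le> t"
  shows "(\<integral>w. \<zeta> w \<bullet> S t w \<partial>M) = (\<integral>w. \<zeta> w \<bullet> S s w \<partial>M)"
  using assms(1)
proof
  assume "V = W"
  then show ?thesis
    using simple_martingale_W[OF _ assms(3) _ assms(5,6)] assms(2) future_germ_WI[OF assms(4)]
    unfolding future_germ_W_def by blast
next
  assume "V = W0"
  then show ?thesis using simple_martingale[OF _ assms(3) future_germI[OF assms(4)] assms(5,6)] assms(2) by blast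
qed

lemma ito_sqint:
  assumes "ito_int V H t J"
  shows "sqint M J" "sqint (path_measure t) (\<lambda>(s, w). H s w)"
  using assms L2_limD(2) unfolding ito_int_def by blast+

lemma ito_isometry:
  assumes V: "V = W \<or> V = W0" and J: "ito_int V H t J" and J': "ito_int V H' t J'" and t: "0 \<le> t"
  shows "(\<integral>w. J w \<bullet> J' w \<partial>M) = (\<integral>z. (case z of (s, w) \<Rightarrow> H s w) \<bullet> (case z of (s, w) \<Rightarrow> H' s w) \<partial>path_measure t)"
proof -
  obtain Hs Ss where 1: "\<And>j. simple_integral M flt V (Hs j) (Ss j)"
    "L2_lim (path_measure t) (\<lambda>j (s, w). Hs j s w) (\<lambda>(s, w). H s w)" "L2_lim M (\<lambda>j. Ss j t) J"
    using J by (auto simp: ito_int_def)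
  obtain Hs' Ss' where 2: "\<And>j. simple_integral M flt V (Hs' j) (Ss' j)"
    "L2_lim (path_measure t) (\<lambda>j (s, w). Hs' j s w) (\<lambda>(s, w). H' s w)" "L2_lim M (\<lambda>j. Ss' j t) J'"
    using J' by (auto simp: ito_int_def)
  show ?thesis
    using LIMSEQ_unique[OF L2_lim_inner[OF 1(3) 2(3), unfolded noise_isometry[OF V 1(1) 2(1) t]] L2_lim_inner[OF 1(2) 2(2)]] .
qed

lemma ito_cross:
  assumes J: "ito_int W H t J" and J': "ito_int W0 H' t J'" and t: "0 \<le> t"
  shows "(\<integral>w. J w \<bullet> J' w \<partial>M) = 0"
proof -
  obtain Hs Ss where 1: "\<And>j. simple_integral M flt W (Hs j) (Ss j)" "L2_lim M (\<lambda>j. Ss j t) J"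
    using J by (auto simp: ito_int_def)
  obtain Hs' Ss' where 2: "\<And>j. simple_integral M flt W0 (Hs' j) (Ss' j)" "L2_lim M (\<lambda>j. Ss' j t) J'"
    using J' by (auto simp: ito_int_def)
  show ?thesis
    using L2_lim_inner[OF 1(2) 2(2)] simple_cross[OF 1(1) 2(1) t] by (simp add: LIMSEQ_const_iff)
qed

text \<open>The integrals up to \<open>s\<close> and up to \<open>t\<close> come with unrelated
  approximating sequences; the isometry shows that the sequence for \<open>t\<close>, stopped at
  \<open>s\<close>, also converges to the integral up to \<open>s\<close>.\<close>

lemma ito_martingale:
  assumes V: "V = W \<or> V = W0" and J: "ito_int V H t J" and J': "ito_int V H s J'" and st: "0 \<le> s" "s \<le> t"
    and \<zeta>: "sqint M \<zeta>" "\<zeta> \<in> borel_measurable (flt s)"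
  shows "(\<integral>w. \<zeta> w \<bullet> J w \<partial>M) = (\<integral>w. \<zeta> w \<bullet> J' w \<partial>M)"
proof -
  obtain Hs Ss where 1: "\<And>j. simple_integral M flt V (Hs j) (Ss j)"
    "L2_lim (path_measure t) (\<lambda>j (s, w). Hs j s w) (\<lambda>(s, w). H s w)" "L2_lim M (\<lambda>j. Ss j t) J"
    using J by (auto simp: ito_int_def)
  obtain Hs' Ss' where 2: "\<And>j. simple_integral M flt V (Hs' j) (Ss' j)"
    "L2_lim (path_measure s) (\<lambda>j (s, w). Hs' j s w) (\<lambda>(s, w). H s w)" "L2_lim M (\<lambda>j. Ss' j s) J'"
    using J' by (auto simp: ito_int_def)
  note sq = noise_sqint[OF V 1(1) st(1)] noise_sqint[OF V 2(1) st(1)]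
  have restr: "L2_lim (path_measure s) (\<lambda>j (s, w). Hs j s w) (\<lambda>(s, w). H s w)"
  proof (rule L2_lim_bound[where k = 1 and a = "\<lambda>j. \<integral>z. (norm ((case z of (s, w) \<Rightarrow> Hs j s w) - (case z of (s, w) \<Rightarrow> H s w)))\<^sup>2 \<partial>path_measure t"])
    show "sqint (path_measure s) (\<lambda>(s, w). Hs j s w)" for j by (rule sq(2))
    show "sqint (path_measure s) (\<lambda>(s, w). H s w)" by (rule L2_limD(2)[OF 2(2)])
    show "(\<integral>z. (norm ((case z of (s, w) \<Rightarrow> Hs j s w) - (case z of (s, w) \<Rightarrow> H s w)))\<^sup>2 \<partial>path_measure s)
      \<le> 1 * (\<integral>z. (norm ((case z of (s, w) \<Rightarrow> Hs j s w) - (case z of (s, w) \<Rightarrow> H s w)))\<^sup>2 \<partial>path_measure t)" for j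
      using sqint_path_restrict(2)[OF sqint_diff[OF L2_limD(1)[OF 1(2), of j] L2_limD(2)[OF 1(2)]] st(2)] by simp
    show "(\<lambda>j. \<integral>z. (norm ((case z of (s, w) \<Rightarrow> Hs j s w) - (case z of (s, w) \<Rightarrow> H s w)))\<^sup>2 \<partial>path_measure t) \<longlonglongrightarrow> 0"
      using 1(2) unfolding L2_lim_def by blast
  qed
  \<comment> \<open>The difference of the two sequences is again a step integral, so its mean square
    at \<open>s\<close> is the distance of two approximations of the same integrand.\<close>
  have iso: "(\<integral>w. (norm (Ss j s w - Ss' j s w))\<^sup>2 \<partial>M)
     = (\<integral>z. (norm ((case z of (s, w) \<Rightarrow> Hs j s w) - (case z of (s, w) \<Rightarrow> Hs' j s w)))\<^sup>2 \<partial>path_measure s)" for j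
  proof -
    have "simple_integral M flt V (\<lambda>s w. Hs j s w + - Hs' j s w) (\<lambda>s w. Ss j s w + - Ss' j s w)"
      using simple_integral_add[OF 1(1) simple_integral_bounded_linear[OF 2(1) bounded_linear_minus[OF bounded_linear_ident]]] .
    from noise_isometry[OF V this this st(1)] show ?thesis by (simp add: power2_norm_eq_inner case_prod_unfold)
  qed
  have "L2_lim M (\<lambda>j. Ss j s) J'"
    using L2_lim_shift[OF 2(3) sq(1)] L2_lim_diff_zero[OF 2(2) restr] by (simp add: iso)
  from L2_lim_inner_const[OF \<zeta>(1) this]
  have "(\<lambda>j. \<integral>w. \<zeta> w \<bullet> Ss j t w \<partial>M) \<longlonglongrightarrow> (\<integral>w. \<zeta> w \<bullet> J' w \<partial>M)"
    by (simp add: noise_martingale[OF V 1(1) \<zeta> st])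
  then show ?thesis using LIMSEQ_unique L2_lim_inner_const[OF \<zeta>(1) 1(3)] by blast
qed

lemma ito_orthogonal_initial:
  assumes V: "V = W \<or> V = W0" and J: "ito_int V H t J" and t: "0 \<le> t"
    and \<zeta>: "sqint M \<zeta>" "\<zeta> \<in> borel_measurable (flt 0)"
  shows "(\<integral>w. \<zeta> w \<bullet> J w \<partial>M) = 0"
proof -
  obtain Hs Ss where 1: "\<And>j. simple_integral M flt V (Hs j) (Ss j)" "L2_lim M (\<lambda>j. Ss j t) J"
    using J by (auto simp: ito_int_def)
  have "(\<integral>w. \<zeta> w \<bullet> Ss j t w \<partial>M) = 0" for j
    using noise_martingale[OF V 1(1) \<zeta> order_refl t] simple_integral_start[OF 1(1)] by simp
  then show ?thesis using L2_lim_inner_const[OF \<zeta>(1) 1(2)] by (simp add: LIMSEQ_const_iff)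
qed

lemma ito_orthogonal_flt0:
  assumes J: "ito_int W H t J" and t: "0 \<le> t"
    and \<zeta>: "sqint M \<zeta>" "\<zeta> \<in> borel_measurable (flt0 t')"
  shows "(\<integral>w. \<zeta> w \<bullet> J w \<partial>M) = 0"
proof -
  obtain Hs Ss where 1: "\<And>j. simple_integral M flt W (Hs j) (Ss j)" "L2_lim M (\<lambda>j. Ss j t) J"
    using J by (auto simp: ito_int_def)
  have "(\<integral>w. \<zeta> w \<bullet> Ss j t w \<partial>M) = 0" for j
    using simple_martingale_W[OF 1(1) \<zeta>(1) future_germ_W_flt0[OF \<zeta>(2), of 0, unfolded future_germ_W_def] order_refl t]
      simple_integral_start[OF 1(1)] by simp
  then show ?thesis using L2_lim_inner_const[OF \<zeta>(1) 1(2)] by (simp add: LIMSEQ_const_iff)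
qed

lemma ito_add:
  assumes "ito_int V H t J" "ito_int V H' t J'"
  shows "ito_int V (\<lambda>s w. H s w + H' s w) t (\<lambda>w. J w + J' w)"
proof -
  obtain Hs Ss where 1: "\<And>j. simple_integral M flt V (Hs j) (Ss j)"
    "L2_lim (path_measure t) (\<lambda>j (s, w). Hs j s w) (\<lambda>(s, w). H s w)" "L2_lim M (\<lambda>j. Ss j t) J"
    using assms(1) by (auto simp: ito_int_def)
  obtain Hs' Ss' where 2: "\<And>j. simple_integral M flt V (Hs' j) (Ss' j)"
    "L2_lim (path_measure t) (\<lambda>j (s, w). Hs' j s w) (\<lambda>(s, w). H' s w)" "L2_lim M (\<lambda>j. Ss' j t) J'"
    using assms(2) by (auto simp: ito_int_def)
  show ?thesis
    unfolding ito_int_def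
  proof (rule exI[of _ "\<lambda>j s w. Hs j s w + Hs' j s w"], rule exI[of _ "\<lambda>j s w. Ss j s w + Ss' j s w"],
      intro conjI allI)
    show "simple_integral M flt V (\<lambda>s w. Hs j s w + Hs' j s w) (\<lambda>s w. Ss j s w + Ss' j s w)" for j
      by (rule simple_integral_add[OF 1(1) 2(1)])
    show "L2_lim (path_measure t) (\<lambda>j (s, w). Hs j s w + Hs' j s w) (\<lambda>(s, w). H s w + H' s w)"
      using L2_lim_add[OF 1(2) 2(2)] by (simp add: case_prod_unfold)
    show "L2_lim M (\<lambda>j w. Ss j t w + Ss' j t w) (\<lambda>w. J w + J' w)"
      by (rule L2_lim_add[OF 1(3) 2(3)])
  qed
qed

lemma ito_bounded_linear:
  assumes "ito_int V H t J" and h: "bounded_linear h"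
  shows "ito_int V (\<lambda>s w. h (H s w)) t (\<lambda>w. h (J w))"
proof -
  obtain Hs Ss where 1: "\<And>j. simple_integral M flt V (Hs j) (Ss j)"
    "L2_lim (path_measure t) (\<lambda>j (s, w). Hs j s w) (\<lambda>(s, w). H s w)" "L2_lim M (\<lambda>j. Ss j t) J"
    using assms(1) by (auto simp: ito_int_def)
  show ?thesis
    unfolding ito_int_def
  proof (rule exI[of _ "\<lambda>j s w. h (Hs j s w)"], rule exI[of _ "\<lambda>j s w. h (Ss j s w)"], intro conjI allI)
    show "simple_integral M flt V (\<lambda>s w. h (Hs j s w)) (\<lambda>s w. h (Ss j s w))" for j
      by (rule simple_integral_bounded_linear[OF 1(1) h])
    show "L2_lim (path_measure t) (\<lambda>j (s, w). h (Hs j s w)) (\<lambda>(s, w). h (H s w))"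
      using L2_lim_bounded_linear[OF h 1(2)] by (simp add: case_prod_unfold)
    show "L2_lim M (\<lambda>j w. h (Ss j t w)) (\<lambda>w. h (J w))"
      by (rule L2_lim_bounded_linear[OF h 1(3)])
  qed
qed

text \<open>Conditional expectation contracts mean squares, at the terminal time and at almost every
  intermediate time. The projected step integrals therefore converge whenever the original ones
  do.\<close>

lemma ito_projection:
  fixes H :: "real \<Rightarrow> 'w \<Rightarrow> real^'n"
  assumes J: "ito_int W0 H t J" and t: "0 \<le> t" and Hh: "sqint (path_measure t) (\<lambda>(s, w). Hh s w)"
    and proj: "\<And>s. 0 < s \<Longrightarrow> s \<le> t \<Longrightarrow> AE w in M. Hh s w = vec_cond_exp M (flt0 s) (H s) w"
  shows "ito_int W0 Hh t (vec_cond_exp M (flt0 t) J)"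
proof -
  interpret T: finite_measure_subalgebra M "flt0 t" by (rule finite_subalgebra[OF subalg_flt0])
  obtain Hs Ss where 1: "\<And>j. simple_integral M flt W0 (Hs j) (Ss j)"
    "L2_lim (path_measure t) (\<lambda>j (s, w). Hs j s w) (\<lambda>(s, w). H s w)" "L2_lim M (\<lambda>j. Ss j t) J"
    using J by (auto simp: ito_int_def)
  define Q where "Q j H' S' \<longleftrightarrow> simple_integral M flt W0 H' S'
    \<and> (\<forall>s\<in>{0<..t}. AE w in M. H' s w = vec_cond_exp M (flt0 s) (Hs j s) w)
    \<and> (AE w in M. S' t w = vec_cond_exp M (flt0 t) (Ss j t) w)" for j H' S'
  have "\<forall>j. \<exists>p. Q j (fst p) (snd p)"
  proof
    fix j
    obtain H' S' where "Q j H' S'" unfolding Q_def using simple_projection[OF 1(1)[of j] t] by blast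
    then show "\<exists>p. Q j (fst p) (snd p)" by (intro exI[of _ "(H', S')"]) simp
  qed
  then obtain p where p: "\<And>j. Q j (fst (p j)) (snd (p j))" using choice[of "\<lambda>j p. Q j (fst p) (snd p)"] by blast
  define H' where "H' j = fst (p j)" for j
  define S' where "S' j = snd (p j)" for j
  have 2: "\<And>j. simple_integral M flt W0 (H' j) (S' j)"
    "\<And>j s. s \<in> {0<..t} \<Longrightarrow> AE w in M. H' j s w = vec_cond_exp M (flt0 s) (Hs j s) w"
    "\<And>j. AE w in M. S' j t w = vec_cond_exp M (flt0 t) (Ss j t) w"
    using p by (simp_all add: Q_def H'_def S'_def)
  have vdiff: "AE w in M. vec_cond_exp M (flt0 s) f w - vec_cond_exp M (flt0 s) g w = vec_cond_exp M (flt0 s) (\<lambda>w. f w - g w) w"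
    if f: "sqint M f" and g: "sqint M g" for f g :: "'w \<Rightarrow> real^'n" and s
  proof -
    interpret S: finite_measure_subalgebra M "flt0 s" by (rule finite_subalgebra[OF subalg_flt0])
    show ?thesis using S.vec_cond_exp_add[OF sqint_diff[OF f g] g] by eventually_elim simp
  qed
  have contr: "(\<integral>w. (norm (f' w - g' w))\<^sup>2 \<partial>M) \<le> (\<integral>w. (norm (f w - g w))\<^sup>2 \<partial>M)"
    if f: "sqint M f" and g: "sqint M g" and f': "sqint M f'" "AE w in M. f' w = vec_cond_exp M (flt0 s) f w"
      and g': "sqint M g'" "AE w in M. g' w = vec_cond_exp M (flt0 s) g w" for f g f' g' :: "'w \<Rightarrow> real^'n" and s
  proof -
    interpret S: finite_measure_subalgebra M "flt0 s" by (rule finite_subalgebra[OF subalg_flt0])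
    note fg = sqint_diff[OF f g]
    have "(\<integral>w. (norm (f' w - g' w))\<^sup>2 \<partial>M) = (\<integral>w. (norm (vec_cond_exp M (flt0 s) (\<lambda>w. f w - g w) w))\<^sup>2 \<partial>M)"
    proof (rule integral_cong_AE)
      show "(\<lambda>w. (norm (f' w - g' w))\<^sup>2) \<in> borel_measurable M"
        using sqint_integrable_sq[OF sqint_diff[OF f'(1) g'(1)]] by auto
      show "(\<lambda>w. (norm (vec_cond_exp M (flt0 s) (\<lambda>w. f w - g w) w))\<^sup>2) \<in> borel_measurable M"
        using sqint_integrable_sq[OF S.sqint_vec_cond_exp[OF fg]] by auto
      show "AE w in M. (norm (f' w - g' w))\<^sup>2 = (norm (vec_cond_exp M (flt0 s) (\<lambda>w. f w - g w) w))\<^sup>2"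
        using f'(2) g'(2) vdiff[OF f g, of s] by eventually_elim simp
    qed
    then show ?thesis using S.vec_cond_exp_contraction[OF fg] by simp
  qed
  show ?thesis
    unfolding ito_int_def
  proof (rule exI[of _ H'], rule exI[of _ S'], intro conjI allI 2(1))
    note sq' = noise_sqint[OF disjI2[OF refl] 2(1) t]
    show "L2_lim M (\<lambda>j. S' j t) (vec_cond_exp M (flt0 t) J)"
    proof (rule L2_lim_bound[where k = 1 and a = "\<lambda>j. \<integral>w. (norm (Ss j t w - J w))\<^sup>2 \<partial>M"])
      show "(\<integral>w. (norm (S' j t w - vec_cond_exp M (flt0 t) J w))\<^sup>2 \<partial>M) \<le> 1 * (\<integral>w. (norm (Ss j t w - J w))\<^sup>2 \<partial>M)" for j
        using contr[OF L2_limD(1)[OF 1(3)] L2_limD(2)[OF 1(3)] sq'(1) 2(3) T.sqint_vec_cond_exp[OF L2_limD(2)[OF 1(3)]] AE_I2] by simp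
      show "(\<lambda>j. \<integral>w. (norm (Ss j t w - J w))\<^sup>2 \<partial>M) \<longlonglongrightarrow> 0" using 1(3) by (simp add: L2_lim_def)
    qed (rule sq'(1), rule T.sqint_vec_cond_exp[OF L2_limD(2)[OF 1(3)]])
    show "L2_lim (path_measure t) (\<lambda>j (s, w). H' j s w) (\<lambda>(s, w). Hh s w)"
    proof (rule L2_lim_bound[where k = 1 and a = "\<lambda>j. \<integral>z. (norm ((case z of (s, w) \<Rightarrow> Hs j s w) - (case z of (s, w) \<Rightarrow> H s w)))\<^sup>2 \<partial>path_measure t"])
      show "(\<lambda>j. \<integral>z. (norm ((case z of (s, w) \<Rightarrow> Hs j s w) - (case z of (s, w) \<Rightarrow> H s w)))\<^sup>2 \<partial>path_measure t) \<longlonglongrightarrow> 0"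
        using 1(2) unfolding L2_lim_def by blast
      show "sqint (path_measure t) (\<lambda>(s, w). H' j s w)" for j by (rule sq'(2))
      show "sqint (path_measure t) (\<lambda>(s, w). Hh s w)" by (rule Hh)
      fix j
      note d1 = sqint_integrable_sq[OF sqint_diff[OF sq'(2)[of j] Hh]]
      note d2 = sqint_integrable_sq[OF sqint_diff[OF L2_limD(1)[OF 1(2), of j] L2_limD(2)[OF 1(2)]]]
      have "(\<integral>s. (\<integral>w. (norm (H' j s w - Hh s w))\<^sup>2 \<partial>M) \<partial>time_measure t) \<le> (\<integral>s. (\<integral>w. (norm (Hs j s w - H s w))\<^sup>2 \<partial>M) \<partial>time_measure t)"
      proof (rule integral_mono_AE)
        show "integrable (time_measure t) (\<lambda>s. \<integral>w. (norm (H' j s w - Hh s w))\<^sup>2 \<partial>M)"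
          "integrable (time_measure t) (\<lambda>s. \<integral>w. (norm (Hs j s w - H s w))\<^sup>2 \<partial>M)"
          using path_integral(2)[OF d1] path_integral(2)[OF d2] by simp_all
        have "AE s in time_measure t. 0 < s \<and> s \<le> t" by (rule AE_time_measure_pos) simp
        then show "AE s in time_measure t. (\<integral>w. (norm (H' j s w - Hh s w))\<^sup>2 \<partial>M) \<le> (\<integral>w. (norm (Hs j s w - H s w))\<^sup>2 \<partial>M)"
          using sqint_section[OF sq'(2)[of j]] sqint_section[OF Hh] sqint_section[OF L2_limD(1)[OF 1(2), of j]] sqint_section[OF L2_limD(2)[OF 1(2)]]
        proof eventually_elim
          case (elim s)
          then have s: "sqint M (H' j s)" "sqint M (Hh s)" "sqint M (Hs j s)" "sqint M (H s)" by simp_all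
          have "s \<in> {0<..t}" using elim by simp
          then show ?case
            using contr[OF s(3,4,1) 2(2)[OF \<open>s \<in> {0<..t}\<close>] s(2) proj] by simp
        qed
      qed
      then show "(\<integral>z. (norm ((case z of (s, w) \<Rightarrow> H' j s w) - (case z of (s, w) \<Rightarrow> Hh s w)))\<^sup>2 \<partial>path_measure t)
        \<le> 1 * (\<integral>z. (norm ((case z of (s, w) \<Rightarrow> Hs j s w) - (case z of (s, w) \<Rightarrow> H s w)))\<^sup>2 \<partial>path_measure t)"
        using path_integral(1)[OF d1] path_integral(1)[OF d2] by simp
    qed
  qed
qed

lemma simple_integral_step_process:
  assumes "step_data k \<tau> \<eta>"
  shows "simple_integral M flt V (step_process k \<tau> \<eta>) (step_integral V k \<tau> \<eta>)"
  using assms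
proof (induction k)
  case 0
  then show ?case using simple_integral.zero by (simp add: step_process_def[abs_def] step_integral_def[abs_def])
next
  case (Suc k)
  then have k: "step_data k \<tau> \<eta>" by (auto simp: step_data_def)
  have nonneg: "0 \<le> \<tau> i" if "i \<le> k" for i
    using that
  proof (induction i)
    case 0
    then show ?case using Suc.prems by (simp add: step_data_def)
  next
    case (Suc i)
    then show ?case using k unfolding step_data_def by (meson Suc_leD Suc_le_lessD order_trans)
  qed
  have d: "\<tau> k \<le> \<tau> (Suc k)" "\<eta> k \<in> borel_measurable (flt (\<tau> k))" "bounded (\<eta> k ` space M)"
    using Suc.prems by (auto simp: step_data_def)
  obtain c where "\<And>w. w \<in> space M \<Longrightarrow> norm (\<eta> k w) \<le> c" using d(3) unfolding bounded_iff by auto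
  then have "AE w in M. norm (\<eta> k w) \<le> c" by (rule AE_I2)
  from simple_integral.step[OF Suc.IH[OF k] nonneg[OF order_refl] d(1,2) this]
  moreover have "step_process (Suc k) \<tau> \<eta> = (\<lambda>s w. indicator {\<tau> k<..\<tau> (Suc k)} s *\<^sub>R \<eta> k w + step_process k \<tau> \<eta> s w)"
    by (intro ext) (simp only: step_process_def sum.lessThan_Suc add.commute)
  moreover have "step_integral V (Suc k) \<tau> \<eta>
      = (\<lambda>t w. (V (min (\<tau> (Suc k)) t) w - V (min (\<tau> k) t) w) *\<^sub>R \<eta> k w + step_integral V k \<tau> \<eta> t w)"
    by (intro ext) (simp only: step_integral_def sum.lessThan_Suc add.commute)
  ultimately show ?case by simp
qed

lemma sq_integral_path:
  assumes "(\<lambda>(s, w). f s w) \<in> borel_measurable (path_measure t)"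
  shows "sq_integral {0..t} f = (\<integral>\<^sup>+z. ennreal ((norm (case z of (s, w) \<Rightarrow> f s w))\<^sup>2) \<partial>path_measure t)"
proof -
  interpret pair_sigma_finite "time_measure t" M by (rule pair_time)
  have m: "(\<lambda>z. ennreal ((norm (case z of (s, w) \<Rightarrow> f s w))\<^sup>2)) \<in> borel_measurable (path_measure t)"
    using assms by measurable
  have "sq_integral {0..t} f = (\<integral>\<^sup>+w. (\<integral>\<^sup>+s. ennreal ((norm (f s w))\<^sup>2) \<partial>time_measure t) \<partial>M)"
    unfolding sq_integral_def
  proof (rule nn_integral_cong)
    fix w assume "w \<in> space M"
    from measurable_Pair1[OF m this] have "(\<lambda>s. ennreal ((norm (f s w))\<^sup>2)) \<in> borel_measurable (time_measure t)" by simp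
    then show "(\<integral>\<^sup>+s\<in>{0..t}. ennreal ((norm (f s w))\<^sup>2) \<partial>lborel) = (\<integral>\<^sup>+s. ennreal ((norm (f s w))\<^sup>2) \<partial>time_measure t)"
      by (rule nn_integral_time_measure[symmetric])
  qed
  then show ?thesis using nn_integral_snd[OF m] by simp
qed

lemma progressive_path_measurable:
  assumes "progressive F I H" "t \<in> I" "subalgebra M (F t)"
  shows "(\<lambda>(s, w). H s w) \<in> borel_measurable (path_measure t)"
proof -
  have "(\<lambda>(s, w). H s w) \<in> borel_measurable (restrict_space borel {0..t} \<Otimes>\<^sub>M F t)"
    using assms(1,2) by (simp add: progressive_def)
  moreover have "(\<lambda>z. (fst z, snd z)) \<in> measurable (path_measure t) (restrict_space borel {0..t} \<Otimes>\<^sub>M F t)"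
  proof (rule measurable_Pair)
    show "fst \<in> measurable (path_measure t) (restrict_space borel {0..t})"
      using measurable_fst[of "time_measure t" M] measurable_cong_sets[OF refl sets_time_measure] by blast
    have "(\<lambda>w. w) \<in> measurable M (F t)"
      using assms(3) by (intro measurableI) (auto simp: subalgebra_def dest: sets.sets_into_space)
    then show "snd \<in> measurable (path_measure t) (F t)"
      using measurable_compose[OF measurable_snd[of "time_measure t" M]] by blast
  qed
  ultimately have "(\<lambda>z. case (fst z, snd z) of (s, w) \<Rightarrow> H s w) \<in> borel_measurable (path_measure t)"
    by (rule measurable_compose[rotated])
  then show ?thesis by simp
qed

lemma ito_of_has_ito_integral:
  assumes V: "V = W \<or> V = W0" and t: "0 \<le> t" and J: "has_ito_integral V H t J"
  shows "ito_int V H t J"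
proof -
  obtain k \<tau> \<eta> where step: "\<And>j. step_data (k j) (\<tau> j) (\<eta> j)"
    and lim1: "(\<lambda>j. sq_integral {0..t} (\<lambda>s w. H s w - step_process (k j) (\<tau> j) (\<eta> j) s w)) \<longlonglongrightarrow> 0"
    and lim2: "(\<lambda>j. \<integral>\<^sup>+w. ennreal ((norm (J w - step_integral V (k j) (\<tau> j) (\<eta> j) t w))\<^sup>2) \<partial>M) \<longlonglongrightarrow> 0"
    and H: "progressive flt {0..t} H" and Jm: "J \<in> borel_measurable M"
    using J by (auto simp: has_ito_integral_def)
  note simple = simple_integral_step_process[OF step, of V]
  note sq = noise_sqint[OF V simple t]
  have Hm: "(\<lambda>(s, w). H s w) \<in> borel_measurable (path_measure t)"
    by (rule progressive_path_measurable[OF H _ subalg_flt]) (use t in simp)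
  show ?thesis
    unfolding ito_int_def
  proof (rule exI[of _ "\<lambda>j. step_process (k j) (\<tau> j) (\<eta> j)"], rule exI[of _ "\<lambda>j. step_integral V (k j) (\<tau> j) (\<eta> j)"],
      intro conjI allI simple)
    show "L2_lim M (\<lambda>j. step_integral V (k j) (\<tau> j) (\<eta> j) t) J"
      by (rule L2_lim_of_nn_integral[OF Jm sq(1) lim2])
    have "sq_integral {0..t} (\<lambda>s w. H s w - step_process (k j) (\<tau> j) (\<eta> j) s w)
       = (\<integral>\<^sup>+z. ennreal ((norm ((case z of (s, w) \<Rightarrow> H s w) - (case z of (s, w) \<Rightarrow> step_process (k j) (\<tau> j) (\<eta> j) s w)))\<^sup>2) \<partial>path_measure t)" for j
      using sq_integral_path[of "\<lambda>s w. H s w - step_process (k j) (\<tau> j) (\<eta> j) s w" t]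
        borel_measurable_diff[OF Hm sqint_measurable[OF sq(2)[of j]]] by (simp add: case_prod_unfold)
    then show "L2_lim (path_measure t) (\<lambda>j (s, w). step_process (k j) (\<tau> j) (\<eta> j) s w) (\<lambda>(s, w). H s w)"
      using lim1 by (intro L2_lim_of_nn_integral[OF Hm sq(2)]) simp
  qed
qed

end

section \<open>The product rule in mean\<close>

lemma pair_time_time: "pair_sigma_finite (time_measure t) (time_measure t)"
  by (intro pair_sigma_finite.intro finite_measure.axioms(1) finite_time_measure)

text \<open>This replaces integration by parts.\<close>

lemma integral_square_split:
  fixes K :: "real \<times> real \<Rightarrow> real"
  assumes K: "integrable (time_measure t \<Otimes>\<^sub>M time_measure t) K"
  shows "(\<integral>s. (\<integral>r. K (r, s) \<partial>time_measure t) \<partial>time_measure t)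
    = (\<integral>s. (\<integral>r. indicator {..s} r * K (r, s) \<partial>time_measure t) \<partial>time_measure t)
      + (\<integral>r. (\<integral>s. indicator {..r} s * K (r, s) \<partial>time_measure t) \<partial>time_measure t)"
    "integrable (time_measure t) (\<lambda>s. \<integral>r. indicator {..s} r * K (r, s) \<partial>time_measure t)"
    "integrable (time_measure t) (\<lambda>r. \<integral>s. indicator {..r} s * K (r, s) \<partial>time_measure t)"
proof -
  interpret pair_sigma_finite "time_measure t" "time_measure t" by (rule pair_time_time)
  let ?A = "{z :: real \<times> real. fst z \<le> snd z}" and ?B = "{z :: real \<times> real. snd z \<le> fst z}"
  have b: "(\<lambda>x::real. x) \<in> borel_measurable (time_measure t)" by (rule borel_measurable_time) simp
  have [measurable]: "(\<lambda>z. fst z) \<in> borel_measurable (time_measure t \<Otimes>\<^sub>M time_measure t)"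
    "(\<lambda>z. snd z) \<in> borel_measurable (time_measure t \<Otimes>\<^sub>M time_measure t)"
    by (rule measurable_compose[OF measurable_fst b], rule measurable_compose[OF measurable_snd b])
  have "(\<lambda>z. if fst z \<le> snd z then 1 else 0 :: real) \<in> borel_measurable (time_measure t \<Otimes>\<^sub>M time_measure t)"
    "(\<lambda>z. if snd z \<le> fst z then 1 else 0 :: real) \<in> borel_measurable (time_measure t \<Otimes>\<^sub>M time_measure t)"
    by measurable
  moreover have "(indicator ?A :: real \<times> real \<Rightarrow> real) = (\<lambda>z. if fst z \<le> snd z then 1 else 0)"
    "(indicator ?B :: real \<times> real \<Rightarrow> real) = (\<lambda>z. if snd z \<le> fst z then 1 else 0)"
    by (auto simp: fun_eq_iff indicator_def)
  ultimately have A: "(indicator ?A :: real \<times> real \<Rightarrow> real) \<in> borel_measurable (time_measure t \<Otimes>\<^sub>M time_measure t)"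
    and B: "(indicator ?B :: real \<times> real \<Rightarrow> real) \<in> borel_measurable (time_measure t \<Otimes>\<^sub>M time_measure t)"
    by simp_all
  have KA: "integrable (time_measure t \<Otimes>\<^sub>M time_measure t) (\<lambda>z. indicator ?A z * K z)"
    and KB: "integrable (time_measure t \<Otimes>\<^sub>M time_measure t) (\<lambda>z. indicator ?B z * K z)"
    by (rule Bochner_Integration.integrable_bound[OF K], use A B K in \<open>auto simp: indicator_def\<close>)+
  have ia: "indicator ?A (r, s) = (indicator {..s} r :: real)" and ib: "indicator ?B (r, s) = (indicator {..r} s :: real)" for r s :: real
    by (simp_all add: indicator_def)
  have KA': "integrable (time_measure t \<Otimes>\<^sub>M time_measure t) (case_prod (\<lambda>r s. indicator {..s} r * K (r, s)))"
    using KA by (simp add: case_prod_unfold flip: ia)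
  have KB': "integrable (time_measure t \<Otimes>\<^sub>M time_measure t) (case_prod (\<lambda>r s. indicator {..r} s * K (r, s)))"
    using KB by (simp add: case_prod_unfold flip: ib)
  have K': "integrable (time_measure t \<Otimes>\<^sub>M time_measure t) (case_prod (\<lambda>r s. K (r, s)))" using K by (simp add: case_prod_unfold)
  show "integrable (time_measure t) (\<lambda>s. \<integral>r. indicator {..s} r * K (r, s) \<partial>time_measure t)"
    by (rule integrable_snd[OF KA'])
  show "integrable (time_measure t) (\<lambda>r. \<integral>s. indicator {..r} s * K (r, s) \<partial>time_measure t)"
    by (rule integrable_fst[OF KB'])
  have swap: "(\<integral>r. (\<integral>s. indicator {..r} s * K (r, s) \<partial>time_measure t) \<partial>time_measure t)
     = (\<integral>s. (\<integral>r. indicator {..r} s * K (r, s) \<partial>time_measure t) \<partial>time_measure t)"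
    using Fubini_integral[OF KB'] by simp
  have "(\<integral>s. (\<integral>r. K (r, s) \<partial>time_measure t) \<partial>time_measure t)
     = (\<integral>s. (\<integral>r. indicator {..s} r * K (r, s) \<partial>time_measure t) + (\<integral>r. indicator {..r} s * K (r, s) \<partial>time_measure t) \<partial>time_measure t)"
  proof (rule integral_cong_AE)
    show "(\<lambda>s. \<integral>r. K (r, s) \<partial>time_measure t) \<in> borel_measurable (time_measure t)"
      using integrable_snd[OF K'] by simp
    show "(\<lambda>s. (\<integral>r. indicator {..s} r * K (r, s) \<partial>time_measure t) + (\<integral>r. indicator {..r} s * K (r, s) \<partial>time_measure t)) \<in> borel_measurable (time_measure t)"
      using integrable_snd[OF KA'] integrable_snd[OF KB'] by simp
    show "AE s in time_measure t. (\<integral>r. K (r, s) \<partial>time_measure t)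
       = (\<integral>r. indicator {..s} r * K (r, s) \<partial>time_measure t) + (\<integral>r. indicator {..r} s * K (r, s) \<partial>time_measure t)"
      using AE_integrable_snd[OF K'] AE_integrable_snd[OF KA'] AE_integrable_snd[OF KB']
    proof eventually_elim
      case (elim s)
      have "(\<integral>r. K (r, s) \<partial>time_measure t) = (\<integral>r. indicator {..s} r * K (r, s) + indicator {..r} s * K (r, s) \<partial>time_measure t)"
      proof (rule integral_cong_AE)
        show "(\<lambda>r. K (r, s)) \<in> borel_measurable (time_measure t)" using elim(1) by simp
        show "(\<lambda>r. indicator {..s} r * K (r, s) + indicator {..r} s * K (r, s)) \<in> borel_measurable (time_measure t)"
          using elim(2,3) by simp
        \<comment> \<open>Both closed triangles contain the diagonal, which is a null set.\<close>
        have "AE r in time_measure t. r \<noteq> s"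
          unfolding AE_time_measure using AE_lborel_singleton[of s] by (auto elim!: eventually_mono)
        then show "AE r in time_measure t. K (r, s) = indicator {..s} r * K (r, s) + indicator {..r} s * K (r, s)"
          by eventually_elim (auto simp: indicator_def)
      qed
      then show ?case using elim by simp
    qed
  qed
  also have "\<dots> = (\<integral>s. (\<integral>r. indicator {..s} r * K (r, s) \<partial>time_measure t) \<partial>time_measure t)
      + (\<integral>s. (\<integral>r. indicator {..r} s * K (r, s) \<partial>time_measure t) \<partial>time_measure t)"
    by (rule Bochner_Integration.integral_add[OF integrable_snd[OF KA'] integrable_snd[OF KB']])
  finally show "(\<integral>s. (\<integral>r. K (r, s) \<partial>time_measure t) \<partial>time_measure t)
    = (\<integral>s. (\<integral>r. indicator {..s} r * K (r, s) \<partial>time_measure t) \<partial>time_measure t)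
      + (\<integral>r. (\<integral>s. indicator {..r} s * K (r, s) \<partial>time_measure t) \<partial>time_measure t)"
    by (simp add: swap)
qed

lemma integral_time_measure_restrict:
  fixes f :: "real \<Rightarrow> 'b::euclidean_space"
  assumes "s \<in> {0..t}"
  shows "(\<integral>r. f r \<partial>time_measure s) = (\<integral>r. indicator {..s} r *\<^sub>R f r \<partial>time_measure t)"
  unfolding integral_time_measure(1) set_lebesgue_integral_def
  by (intro Bochner_Integration.integral_cong refl) (use assms in \<open>auto simp: indicator_def\<close>)

context prob_space
begin

lemma sqint_time_integral:
  fixes \<beta> :: "real \<Rightarrow> 'a \<Rightarrow> 'b::euclidean_space"
  assumes \<beta>: "sqint (path_measure t) (\<lambda>(s, w). \<beta> s w)" and t: "0 \<le> t"
  shows "sqint M (\<lambda>w. \<integral>s. \<beta> s w \<partial>time_measure t)"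
    "AE w in M. sqint (time_measure t) (\<lambda>s. \<beta> s w)"
proof -
  interpret pair_sigma_finite "time_measure t" M by (rule pair_time)
  interpret ft: finite_measure "time_measure t" by simp
  have sq: "integrable (path_measure t) (case_prod (\<lambda>s w. (norm (\<beta> s w))\<^sup>2))"
    using sqint_integrable_sq[OF \<beta>] by (simp add: case_prod_unfold)
  have sec: "(\<lambda>s. \<beta> s w) \<in> borel_measurable (time_measure t)" if "w \<in> space M" for w
    using measurable_Pair1[OF sqint_measurable[OF \<beta>] that] by simp
  show *: "AE w in M. sqint (time_measure t) (\<lambda>s. \<beta> s w)"
    using AE_integrable_snd[OF sq] AE_space by eventually_elim (simp add: sqint_def sec)
  have swap: "(\<lambda>(w, s). \<beta> s w) \<in> borel_measurable (M \<Otimes>\<^sub>M time_measure t)"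
    using measurable_pair_swap[OF sqint_measurable[OF \<beta>]] by (simp add: case_prod_unfold)
  show "sqint M (\<lambda>w. \<integral>s. \<beta> s w \<partial>time_measure t)"
  proof (rule sqint_bound)
    show "(\<lambda>w. \<integral>s. \<beta> s w \<partial>time_measure t) \<in> borel_measurable M"
      by (rule M1.borel_measurable_lebesgue_integral[OF swap])
    show "integrable M (\<lambda>w. t * (\<integral>s. (norm (\<beta> s w))\<^sup>2 \<partial>time_measure t))"
      using integrable_snd[OF sq] by simp
    show "AE w in M. (norm (\<integral>s. \<beta> s w \<partial>time_measure t))\<^sup>2 \<le> t * (\<integral>s. (norm (\<beta> s w))\<^sup>2 \<partial>time_measure t)"
      using *
    proof eventually_elim
      case (elim w)
      let ?I = "\<integral>s. \<beta> s w \<partial>time_measure t"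
      have len: "measure (time_measure t) {0..t} = t"
        using t by (simp add: time_measure_def measure_restrict_space)
      \<comment> \<open>Cauchy-Schwarz against the constant function with value \<open>?I\<close>;
        one factor of its squared norm cancels at the end.\<close>
      have "(norm ?I)\<^sup>2 = (\<integral>s. ?I \<bullet> \<beta> s w \<partial>time_measure t)"
        using ft.sqint_integrable[OF elim] by (simp add: power2_norm_eq_inner)
      then have "((norm ?I)\<^sup>2)\<^sup>2 \<le> (\<integral>s. (norm ?I)\<^sup>2 \<partial>time_measure t) * (\<integral>s. (norm (\<beta> s w))\<^sup>2 \<partial>time_measure t)"
        using sqint_Cauchy_Schwarz[OF ft.sqint_const elim, of ?I] by simp
      then have "(norm ?I)\<^sup>2 * (norm ?I)\<^sup>2 \<le> (norm ?I)\<^sup>2 * (t * (\<integral>s. (norm (\<beta> s w))\<^sup>2 \<partial>time_measure t))"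
        by (simp add: len power2_eq_square mult_ac)
      moreover have "0 \<le> t * (\<integral>s. (norm (\<beta> s w))\<^sup>2 \<partial>time_measure t)" using t by simp
      ultimately show ?case
      proof (cases "?I = 0")
        case False
        then have "0 < (norm ?I)\<^sup>2" by simp
        with \<open>(norm ?I)\<^sup>2 * (norm ?I)\<^sup>2 \<le> (norm ?I)\<^sup>2 * (t * (\<integral>s. (norm (\<beta> s w))\<^sup>2 \<partial>time_measure t))\<close>
        show ?thesis by (rule mult_left_le_imp_le)
      qed simp
    qed
  qed
qed

lemma time_integral_inner:
  fixes \<beta> :: "real \<Rightarrow> 'a \<Rightarrow> 'b::euclidean_space"
  assumes \<zeta>: "sqint M \<zeta>" and \<beta>: "sqint (path_measure t) (\<lambda>(s, w). \<beta> s w)" and t: "0 \<le> t"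
  shows "(\<integral>w. \<zeta> w \<bullet> (\<integral>s. \<beta> s w \<partial>time_measure t) \<partial>M) = (\<integral>s. (\<integral>w. \<zeta> w \<bullet> \<beta> s w \<partial>M) \<partial>time_measure t)"
    "integrable (time_measure t) (\<lambda>s. \<integral>w. \<zeta> w \<bullet> \<beta> s w \<partial>M)"
proof -
  interpret pair_sigma_finite "time_measure t" M by (rule pair_time)
  interpret ft: finite_measure "time_measure t" by simp
  have int: "integrable (path_measure t) (case_prod (\<lambda>s w. \<zeta> w \<bullet> \<beta> s w))"
    using sqint_inner[OF sqint_path_const[OF \<zeta>] \<beta>] by (simp add: case_prod_unfold)
  show "integrable (time_measure t) (\<lambda>s. \<integral>w. \<zeta> w \<bullet> \<beta> s w \<partial>M)" by (rule integrable_fst[OF int])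
  have "(\<integral>w. \<zeta> w \<bullet> (\<integral>s. \<beta> s w \<partial>time_measure t) \<partial>M) = (\<integral>w. (\<integral>s. \<zeta> w \<bullet> \<beta> s w \<partial>time_measure t) \<partial>M)"
  proof (rule integral_cong_AE)
    show "(\<lambda>w. \<zeta> w \<bullet> (\<integral>s. \<beta> s w \<partial>time_measure t)) \<in> borel_measurable M"
      by (intro borel_measurable_inner sqint_measurable \<zeta> sqint_time_integral(1)[OF \<beta> t])
    show "(\<lambda>w. \<integral>s. \<zeta> w \<bullet> \<beta> s w \<partial>time_measure t) \<in> borel_measurable M" using integrable_snd[OF int] by simp
    show "AE w in M. \<zeta> w \<bullet> (\<integral>s. \<beta> s w \<partial>time_measure t) = (\<integral>s. \<zeta> w \<bullet> \<beta> s w \<partial>time_measure t)"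
      using sqint_time_integral(2)[OF \<beta> t] by eventually_elim (simp add: ft.sqint_integrable)
  qed
  also have "\<dots> = (\<integral>s. (\<integral>w. \<zeta> w \<bullet> \<beta> s w \<partial>M) \<partial>time_measure t)"
    using Fubini_integral[OF int] by simp
  finally show "(\<integral>w. \<zeta> w \<bullet> (\<integral>s. \<beta> s w \<partial>time_measure t) \<partial>M) = (\<integral>s. (\<integral>w. \<zeta> w \<bullet> \<beta> s w \<partial>M) \<partial>time_measure t)" .
qed

text \<open>The expectation of the product is the integral over the square of the correlation kernel
  \<open>K\<close>; on each of the two triangles the inner integral is one of the running
  integrals.\<close>

lemma time_integral_product:
  fixes \<beta> \<beta>' :: "real \<Rightarrow> 'a \<Rightarrow> 'b::euclidean_space"
  assumes \<beta>: "sqint (path_measure t) (\<lambda>(s, w). \<beta> s w)" and \<beta>': "sqint (path_measure t) (\<lambda>(s, w). \<beta>' s w)" and t: "0 \<le> t"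
  defines "I \<equiv> \<lambda>s w. \<integral>r. \<beta> r w \<partial>time_measure s" and "I' \<equiv> \<lambda>s w. \<integral>r. \<beta>' r w \<partial>time_measure s"
  shows "(\<integral>w. I t w \<bullet> I' t w \<partial>M) = (\<integral>s. (\<integral>w. I s w \<bullet> \<beta>' s w \<partial>M) \<partial>time_measure t)
     + (\<integral>s. (\<integral>w. \<beta> s w \<bullet> I' s w \<partial>M) \<partial>time_measure t)"
    "integrable (time_measure t) (\<lambda>s. \<integral>w. I s w \<bullet> \<beta>' s w \<partial>M)"
    "integrable (time_measure t) (\<lambda>s. \<integral>w. \<beta> s w \<bullet> I' s w \<partial>M)"
proof -
  interpret tt: pair_sigma_finite "time_measure t" "time_measure t" by (rule pair_time_time)
  interpret ft: finite_measure "time_measure t" by simp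
  define K where "K z = (\<integral>w. \<beta> (fst z) w \<bullet> \<beta>' (snd z) w \<partial>M)" for z
  define N where "N s = (\<integral>w. (norm (\<beta> s w))\<^sup>2 \<partial>M)" for s
  define N' where "N' s = (\<integral>w. (norm (\<beta>' s w))\<^sup>2 \<partial>M)" for s
  have N: "integrable (time_measure t) N" "integrable (time_measure t) N'"
    unfolding N_def N'_def using path_integral(2)[OF sqint_integrable_sq[OF \<beta>]] path_integral(2)[OF sqint_integrable_sq[OF \<beta>']] by simp_all
  have sec: "AE s in time_measure t. sqint M (\<beta> s)" "AE s in time_measure t. sqint M (\<beta>' s)"
    using sqint_section[OF \<beta>] sqint_section[OF \<beta>'] by simp_all
  have Km: "K \<in> borel_measurable (time_measure t \<Otimes>\<^sub>M time_measure t)"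
    unfolding K_def
  proof (rule borel_measurable_lebesgue_integral)
    let ?N = "(time_measure t \<Otimes>\<^sub>M time_measure t) \<Otimes>\<^sub>M M"
    have "(\<lambda>x. (fst (fst x), snd x)) \<in> measurable ?N (path_measure t)" "(\<lambda>x. (snd (fst x), snd x)) \<in> measurable ?N (path_measure t)"
      by measurable
    from measurable_compose[OF this(1) sqint_measurable[OF \<beta>]] measurable_compose[OF this(2) sqint_measurable[OF \<beta>']]
    show "(\<lambda>(z, w). \<beta> (fst z) w \<bullet> \<beta>' (snd z) w) \<in> borel_measurable ?N"
      unfolding case_prod_unfold by (intro borel_measurable_inner) (simp_all add: case_prod_unfold)
  qed
  \<comment> \<open>A sum rather than a product of norms: it is integrable over the square because
    each summand depends on one time only.\<close>
  have Kle: "\<bar>K (r, s)\<bar> \<le> N r + N' s" if "sqint M (\<beta> r)" "sqint M (\<beta>' s)" for r s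
  proof -
    have "\<bar>K (r, s)\<bar> \<le> (\<integral>w. \<bar>\<beta> r w \<bullet> \<beta>' s w\<bar> \<partial>M)" unfolding K_def by (simp add: integral_abs_bound)
    also have "\<dots> \<le> (\<integral>w. (norm (\<beta> r w))\<^sup>2 + (norm (\<beta>' s w))\<^sup>2 \<partial>M)"
      using that by (intro integral_mono) (auto simp: sqint_integrable_sq inner_le_sq sqint_inner)
    also have "\<dots> = N r + N' s" using that by (simp add: N_def N'_def sqint_integrable_sq)
    finally show ?thesis .
  qed
  have "integrable (time_measure t \<Otimes>\<^sub>M time_measure t) K"
  proof (rule tt.Fubini_integrable[OF Km])
    have Kin: "AE r in time_measure t. integrable (time_measure t) (\<lambda>s. K (r, s)) \<and>
      (\<integral>s. \<bar>K (r, s)\<bar> \<partial>time_measure t) \<le> measure (time_measure t) {0..t} * N r + (\<integral>s. N' s \<partial>time_measure t)"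
      using sec(1) AE_space
    proof eventually_elim
      case (elim r)
      have Kr: "(\<lambda>s. K (r, s)) \<in> borel_measurable (time_measure t)" using measurable_Pair2[OF Km elim(2)] .
      have le: "AE s in time_measure t. \<bar>K (r, s)\<bar> \<le> N r + N' s"
        using sec(2) by eventually_elim (rule Kle[OF elim(1)])
      have i: "integrable (time_measure t) (\<lambda>s. K (r, s))"
        by (rule Bochner_Integration.integrable_bound[where f = "\<lambda>s. N r + N' s"])
           (use N Kr le in \<open>auto elim!: eventually_mono\<close>)
      have "(\<integral>s. \<bar>K (r, s)\<bar> \<partial>time_measure t) \<le> (\<integral>s. N r + N' s \<partial>time_measure t)"
        by (rule integral_mono_AE) (use i N le in auto)
      then show ?case using i N by simp
    qed
    then show "AE r in time_measure t. integrable (time_measure t) (\<lambda>s. K (r, s))" by eventually_elim simp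
    show "integrable (time_measure t) (\<lambda>r. \<integral>s. norm (K (r, s)) \<partial>time_measure t)"
    proof (rule Bochner_Integration.integrable_bound)
      show "integrable (time_measure t) (\<lambda>r. measure (time_measure t) {0..t} * N r + (\<integral>s. N' s \<partial>time_measure t))"
        using N by simp
      have "(\<lambda>(r, s). norm (K (r, s))) \<in> borel_measurable (time_measure t \<Otimes>\<^sub>M time_measure t)"
        using Km by (simp add: case_prod_unfold)
      then show "(\<lambda>r. \<integral>s. norm (K (r, s)) \<partial>time_measure t) \<in> borel_measurable (time_measure t)"
        by (rule tt.M1.borel_measurable_lebesgue_integral)
      show "AE r in time_measure t. norm (\<integral>s. norm (K (r, s)) \<partial>time_measure t)
        \<le> norm (measure (time_measure t) {0..t} * N r + (\<integral>s. N' s \<partial>time_measure t))"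
        using Kin by eventually_elim (auto intro: order_trans[OF _ abs_ge_self])
    qed
  qed
  note split = integral_square_split[OF this]
  have \<beta>s: "sqint (path_measure s) (\<lambda>(s, w). \<beta> s w)" "sqint (path_measure s) (\<lambda>(s, w). \<beta>' s w)" if "s \<le> t" for s
    using sqint_path_restrict(1)[OF \<beta> that] sqint_path_restrict(1)[OF \<beta>' that] .
  have 1: "AE s in time_measure t. (\<integral>w. I s w \<bullet> \<beta>' s w \<partial>M) = (\<integral>r. indicator {..s} r * K (r, s) \<partial>time_measure t)"
    using sec(2) AE_space
  proof eventually_elim
    case (elim s)
    then have s: "0 \<le> s" "s \<le> t" by auto
    have "(\<integral>w. I s w \<bullet> \<beta>' s w \<partial>M) = (\<integral>r. K (r, s) \<partial>time_measure s)"
      using time_integral_inner(1)[OF elim(1) \<beta>s(1)[OF s(2)] s(1)] by (simp add: I_def K_def inner_commute)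
    also have "\<dots> = (\<integral>r. indicator {..s} r *\<^sub>R K (r, s) \<partial>time_measure t)"
      by (rule integral_time_measure_restrict) (use s in auto)
    finally show ?case by (simp only: real_scaleR_def)
  qed
  have 2: "AE s in time_measure t. (\<integral>w. \<beta> s w \<bullet> I' s w \<partial>M) = (\<integral>r. indicator {..s} r * K (s, r) \<partial>time_measure t)"
    using sec(1) AE_space
  proof eventually_elim
    case (elim s)
    then have s: "0 \<le> s" "s \<le> t" by auto
    have "(\<integral>w. \<beta> s w \<bullet> I' s w \<partial>M) = (\<integral>r. K (s, r) \<partial>time_measure s)"
      using time_integral_inner(1)[OF elim(1) \<beta>s(2)[OF s(2)] s(1)] by (simp add: I'_def K_def)
    also have "\<dots> = (\<integral>r. indicator {..s} r *\<^sub>R K (s, r) \<partial>time_measure t)"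
      by (rule integral_time_measure_restrict) (use s in auto)
    finally show ?case by (simp only: real_scaleR_def)
  qed
  have It: "sqint M (I t)" unfolding I_def by (rule sqint_time_integral(1)[OF \<beta> t])
  have "(\<integral>w. I t w \<bullet> I' t w \<partial>M) = (\<integral>s. (\<integral>w. I t w \<bullet> \<beta>' s w \<partial>M) \<partial>time_measure t)"
    unfolding I'_def by (rule time_integral_inner(1)[OF It \<beta>' t])
  also have "\<dots> = (\<integral>s. (\<integral>r. K (r, s) \<partial>time_measure t) \<partial>time_measure t)"
  proof (rule integral_cong_AE)
    show "(\<lambda>s. \<integral>w. I t w \<bullet> \<beta>' s w \<partial>M) \<in> borel_measurable (time_measure t)"
      using time_integral_inner(2)[OF It \<beta>' t] by simp
    have "(\<lambda>(s, r). K (r, s)) \<in> borel_measurable (time_measure t \<Otimes>\<^sub>M time_measure t)"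
      using measurable_pair_swap[OF Km] by (simp add: case_prod_unfold)
    then show "(\<lambda>s. \<integral>r. K (r, s) \<partial>time_measure t) \<in> borel_measurable (time_measure t)"
      by (rule tt.M1.borel_measurable_lebesgue_integral)
    show "AE s in time_measure t. (\<integral>w. I t w \<bullet> \<beta>' s w \<partial>M) = (\<integral>r. K (r, s) \<partial>time_measure t)"
      using sec(2)
    proof eventually_elim
      case (elim s)
      then show ?case using time_integral_inner(1)[OF elim \<beta> t] by (simp add: I_def K_def inner_commute)
    qed
  qed
  finally have e: "(\<integral>w. I t w \<bullet> I' t w \<partial>M) = (\<integral>s. (\<integral>r. K (r, s) \<partial>time_measure t) \<partial>time_measure t)" .
  \<comment> \<open>Joint measurability of the running integral is needed to integrate over time;
    its variable upper limit is encoded by an indicator on the fixed interval.\<close>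
  have joint: "(\<lambda>z. \<integral>r. \<gamma> r (snd z) \<partial>time_measure (fst z)) \<in> borel_measurable (path_measure t)"
    if "(\<lambda>(s, w). \<gamma> s w) \<in> borel_measurable (path_measure t)" for \<gamma> :: "real \<Rightarrow> 'a \<Rightarrow> 'b"
  proof -
    let ?N = "path_measure t \<Otimes>\<^sub>M time_measure t"
    have b: "(\<lambda>x::real. x) \<in> borel_measurable (time_measure t)" by (rule borel_measurable_time) simp
    have [measurable]: "(\<lambda>x. fst (fst x)) \<in> borel_measurable ?N" "(\<lambda>x. snd x) \<in> borel_measurable ?N"
      by (rule measurable_compose[OF measurable_compose[OF measurable_fst measurable_fst] b],
          rule measurable_compose[OF measurable_snd b])
    have "(\<lambda>x. if snd x \<le> fst (fst x) then 1 else 0 :: real) \<in> borel_measurable ?N" by measurable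
    moreover have "(\<lambda>x. indicator {..fst (fst x)} (snd x) :: real) = (\<lambda>x :: (real \<times> 'a) \<times> real. if snd x \<le> fst (fst x) then 1 else 0)"
      by (auto simp: fun_eq_iff indicator_def)
    ultimately have ind: "(\<lambda>x. indicator {..fst (fst x)} (snd x) :: real) \<in> borel_measurable ?N" by simp
    have "(\<lambda>x. (snd x, snd (fst x))) \<in> measurable ?N (path_measure t)" by measurable
    from measurable_compose[OF this that] have "(\<lambda>x. \<gamma> (snd x) (snd (fst x))) \<in> borel_measurable ?N" by simp
    with ind have "(\<lambda>x. indicator {..fst (fst x)} (snd x) *\<^sub>R \<gamma> (snd x) (snd (fst x))) \<in> borel_measurable ?N"
      by (rule borel_measurable_scaleR)
    then have "(\<lambda>(z, r). indicator {..fst z} r *\<^sub>R \<gamma> r (snd z)) \<in> borel_measurable ?N" by (simp add: case_prod_unfold)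
    then have "(\<lambda>z. \<integral>r. indicator {..fst z} r *\<^sub>R \<gamma> r (snd z) \<partial>time_measure t) \<in> borel_measurable (path_measure t)"
      by (rule tt.M1.borel_measurable_lebesgue_integral)
    moreover have "(\<integral>r. \<gamma> r (snd z) \<partial>time_measure (fst z)) = (\<integral>r. indicator {..fst z} r *\<^sub>R \<gamma> r (snd z) \<partial>time_measure t)"
      if "z \<in> space (path_measure t)" for z
      by (rule integral_time_measure_restrict) (use that in \<open>auto simp: space_pair_measure\<close>)
    ultimately show ?thesis by (subst measurable_cong)
  qed
  note jI = joint[OF sqint_measurable[OF \<beta>]] and jI' = joint[OF sqint_measurable[OF \<beta>']]
  have "(\<lambda>(s, w). I s w \<bullet> \<beta>' s w) \<in> borel_measurable (path_measure t)"
    using borel_measurable_inner[OF jI sqint_measurable[OF \<beta>']] by (simp add: I_def case_prod_unfold)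
  then have m1: "(\<lambda>s. \<integral>w. I s w \<bullet> \<beta>' s w \<partial>M) \<in> borel_measurable (time_measure t)"
    by (rule borel_measurable_lebesgue_integral)
  have "(\<lambda>(s, w). \<beta> s w \<bullet> I' s w) \<in> borel_measurable (path_measure t)"
    using borel_measurable_inner[OF sqint_measurable[OF \<beta>] jI'] by (simp add: I'_def case_prod_unfold)
  then have m2: "(\<lambda>s. \<integral>w. \<beta> s w \<bullet> I' s w \<partial>M) \<in> borel_measurable (time_measure t)"
    by (rule borel_measurable_lebesgue_integral)
  show "integrable (time_measure t) (\<lambda>s. \<integral>w. I s w \<bullet> \<beta>' s w \<partial>M)"
    using integrable_cong_AE[OF m1 _ 1] split(2) by auto
  show "integrable (time_measure t) (\<lambda>s. \<integral>w. \<beta> s w \<bullet> I' s w \<partial>M)"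
    using integrable_cong_AE[OF m2 _ 2] split(3) by auto
  show "(\<integral>w. I t w \<bullet> I' t w \<partial>M) = (\<integral>s. (\<integral>w. I s w \<bullet> \<beta>' s w \<partial>M) \<partial>time_measure t)
     + (\<integral>s. (\<integral>w. \<beta> s w \<bullet> I' s w \<partial>M) \<partial>time_measure t)"
    unfolding e split(1) using integral_cong_AE[OF m1 _ 1] integral_cong_AE[OF m2 _ 2] split(2,3) by auto
qed

end

section \<open>The product rule in expectation for mean square Ito processes\<close>

context brownian_basis
begin

text \<open>Exactly the data used by the product rule, with the representation required separately
  at each time. Adaptedness of the drift is what allows running stochastic integrals to be replaced
  by terminal ones.\<close>

definition l2_ito ::
    "real \<Rightarrow> ('w \<Rightarrow> 'b::euclidean_space) \<Rightarrow> (real \<Rightarrow> 'w \<Rightarrow> 'b) \<Rightarrow> (real \<Rightarrow> 'w \<Rightarrow> 'b) \<Rightarrow> (real \<Rightarrow> 'w \<Rightarrow> 'b)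
      \<Rightarrow> (real \<Rightarrow> 'w \<Rightarrow> 'b) \<Rightarrow> bool" where
  "l2_ito T x0 \<beta> \<alpha> \<alpha>0 X \<longleftrightarrow>
     sqint M x0 \<and> x0 \<in> borel_measurable (flt 0)
     \<and> sqint (path_measure T) (\<lambda>(s, w). \<beta> s w) \<and> sqint (path_measure T) (\<lambda>(s, w). X s w)
     \<and> (\<forall>s\<in>{0<..T}. \<beta> s \<in> borel_measurable (flt s))
     \<and> (\<forall>t\<in>{0..T}. sqint M (X t) \<and> (\<exists>J J0. ito_int W \<alpha> t J \<and> ito_int W0 \<alpha>0 t J0 \<and>
          (AE w in M. X t w = x0 w + (\<integral>s. \<beta> s w \<partial>time_measure t) + J w + J0 w)))"

text \<open>Since the test drift at time \<open>s\<close> is known then, the martingale property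
  replaces the integrals up to \<open>s\<close> inside \<open>X s\<close> by those up to the fixed
  time \<open>t\<close>, which can be taken out of the time integral.\<close>

lemma l2_ito_drift_inner:
  assumes X: "l2_ito T x0 \<beta> \<alpha> \<alpha>0 X" and t: "t \<in> {0..T}"
    and J: "ito_int W \<alpha> t J" and J0: "ito_int W0 \<alpha>0 t J0"
    and \<beta>': "sqint (path_measure t) (\<lambda>(s, w). \<beta>' s w)" "\<And>s. s \<in> {0<..T} \<Longrightarrow> \<beta>' s \<in> borel_measurable (flt s)"
  shows "(\<integral>s. (\<integral>w. X s w \<bullet> \<beta>' s w \<partial>M) \<partial>time_measure t)
    = (\<integral>s. (\<integral>w. x0 w \<bullet> \<beta>' s w \<partial>M) \<partial>time_measure t)
      + (\<integral>s. (\<integral>w. (\<integral>r. \<beta> r w \<partial>time_measure s) \<bullet> \<beta>' s w \<partial>M) \<partial>time_measure t)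
      + (\<integral>s. (\<integral>w. J w \<bullet> \<beta>' s w \<partial>M) \<partial>time_measure t) + (\<integral>s. (\<integral>w. J0 w \<bullet> \<beta>' s w \<partial>M) \<partial>time_measure t)"
    "integrable (time_measure t) (\<lambda>s. \<integral>w. X s w \<bullet> \<beta>' s w \<partial>M)"
proof -
  have t0: "0 \<le> t" "t \<le> T" using t by auto
  have x0: "sqint M x0" "x0 \<in> borel_measurable (flt 0)" and \<beta>T: "sqint (path_measure T) (\<lambda>(s, w). \<beta> s w)"
    and XT: "sqint (path_measure T) (\<lambda>(s, w). X s w)"
    using X by (auto simp: l2_ito_def)
  note \<beta> = sqint_path_restrict(1)[OF \<beta>T t0(2)] and Xt = sqint_path_restrict(1)[OF XT t0(2)]
  show "integrable (time_measure t) (\<lambda>s. \<integral>w. X s w \<bullet> \<beta>' s w \<partial>M)"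
    using path_inner(2)[OF Xt \<beta>'(1)] by simp
  note i1 = time_integral_inner(2)[OF x0(1) \<beta>'(1) t0(1)]
  note i2 = time_integral_product(2)[OF \<beta> \<beta>'(1) t0(1)]
  note i3 = time_integral_inner(2)[OF ito_sqint(1)[OF J] \<beta>'(1) t0(1)]
  note i4 = time_integral_inner(2)[OF ito_sqint(1)[OF J0] \<beta>'(1) t0(1)]
  have pos: "AE s in time_measure t. 0 < s \<and> s \<le> t" by (rule AE_time_measure_pos) simp
  have "(\<integral>s. (\<integral>w. X s w \<bullet> \<beta>' s w \<partial>M) \<partial>time_measure t)
    = (\<integral>s. (\<integral>w. x0 w \<bullet> \<beta>' s w \<partial>M) + (\<integral>w. (\<integral>r. \<beta> r w \<partial>time_measure s) \<bullet> \<beta>' s w \<partial>M)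
      + (\<integral>w. J w \<bullet> \<beta>' s w \<partial>M) + (\<integral>w. J0 w \<bullet> \<beta>' s w \<partial>M) \<partial>time_measure t)"
  proof (rule integral_cong_AE)
    show "(\<lambda>s. \<integral>w. X s w \<bullet> \<beta>' s w \<partial>M) \<in> borel_measurable (time_measure t)"
      using path_inner(2)[OF Xt \<beta>'(1)] by simp
    show "(\<lambda>s. (\<integral>w. x0 w \<bullet> \<beta>' s w \<partial>M) + (\<integral>w. (\<integral>r. \<beta> r w \<partial>time_measure s) \<bullet> \<beta>' s w \<partial>M)
      + (\<integral>w. J w \<bullet> \<beta>' s w \<partial>M) + (\<integral>w. J0 w \<bullet> \<beta>' s w \<partial>M)) \<in> borel_measurable (time_measure t)"
      by (intro borel_measurable_add borel_measurable_integrable i1 i2 i3 i4)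
    show "AE s in time_measure t. (\<integral>w. X s w \<bullet> \<beta>' s w \<partial>M) = (\<integral>w. x0 w \<bullet> \<beta>' s w \<partial>M)
      + (\<integral>w. (\<integral>r. \<beta> r w \<partial>time_measure s) \<bullet> \<beta>' s w \<partial>M)
      + (\<integral>w. J w \<bullet> \<beta>' s w \<partial>M) + (\<integral>w. J0 w \<bullet> \<beta>' s w \<partial>M)"
      using pos sqint_section[OF \<beta>'(1)]
    proof eventually_elim
      case (elim s)
      then have s: "0 \<le> s" "s \<le> t" "s \<in> {0<..T}" "s \<in> {0..T}" and b: "sqint M (\<beta>' s)" using t0 by auto
      obtain Js J0s where Js: "ito_int W \<alpha> s Js" "ito_int W0 \<alpha>0 s J0s"
        "AE w in M. X s w = x0 w + (\<integral>r. \<beta> r w \<partial>time_measure s) + Js w + J0s w" and Xs: "sqint M (X s)"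
        using X s(4) unfolding l2_ito_def by blast
      note Is = sqint_time_integral(1)[OF sqint_path_restrict(1)[OF \<beta> s(2)] s(1)]
      have "(\<integral>w. X s w \<bullet> \<beta>' s w \<partial>M)
        = (\<integral>w. x0 w \<bullet> \<beta>' s w + (\<integral>r. \<beta> r w \<partial>time_measure s) \<bullet> \<beta>' s w + Js w \<bullet> \<beta>' s w + J0s w \<bullet> \<beta>' s w \<partial>M)"
      proof (rule integral_cong_AE)
        show "(\<lambda>w. X s w \<bullet> \<beta>' s w) \<in> borel_measurable M" by (intro borel_measurable_inner sqint_measurable Xs b)
        show "(\<lambda>w. x0 w \<bullet> \<beta>' s w + (\<integral>r. \<beta> r w \<partial>time_measure s) \<bullet> \<beta>' s w + Js w \<bullet> \<beta>' s w + J0s w \<bullet> \<beta>' s w) \<in> borel_measurable M"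
          by (intro borel_measurable_add borel_measurable_inner sqint_measurable b x0(1) Is ito_sqint(1)[OF Js(1)] ito_sqint(1)[OF Js(2)])
        show "AE w in M. X s w \<bullet> \<beta>' s w = x0 w \<bullet> \<beta>' s w + (\<integral>r. \<beta> r w \<partial>time_measure s) \<bullet> \<beta>' s w + Js w \<bullet> \<beta>' s w + J0s w \<bullet> \<beta>' s w"
          using Js(3) by eventually_elim (simp add: inner_add_left)
      qed
      also have "\<dots> = (\<integral>w. x0 w \<bullet> \<beta>' s w \<partial>M) + (\<integral>w. (\<integral>r. \<beta> r w \<partial>time_measure s) \<bullet> \<beta>' s w \<partial>M)
          + (\<integral>w. Js w \<bullet> \<beta>' s w \<partial>M) + (\<integral>w. J0s w \<bullet> \<beta>' s w \<partial>M)"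
        by (simp add: sqint_inner[OF x0(1) b] sqint_inner[OF Is b] sqint_inner[OF ito_sqint(1)[OF Js(1)] b]
            sqint_inner[OF ito_sqint(1)[OF Js(2)] b])
      also have "(\<integral>w. Js w \<bullet> \<beta>' s w \<partial>M) = (\<integral>w. J w \<bullet> \<beta>' s w \<partial>M)"
        using ito_martingale[OF _ J Js(1) s(1,2) b \<beta>'(2)[OF s(3)]] by (simp add: inner_commute)
      also have "(\<integral>w. J0s w \<bullet> \<beta>' s w \<partial>M) = (\<integral>w. J0 w \<bullet> \<beta>' s w \<partial>M)"
        using ito_martingale[OF _ J0 Js(2) s(1,2) b \<beta>'(2)[OF s(3)]] by (simp add: inner_commute)
      finally show ?case .
    qed
  qed
  then show "(\<integral>s. (\<integral>w. X s w \<bullet> \<beta>' s w \<partial>M) \<partial>time_measure t)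
    = (\<integral>s. (\<integral>w. x0 w \<bullet> \<beta>' s w \<partial>M) \<partial>time_measure t)
      + (\<integral>s. (\<integral>w. (\<integral>r. \<beta> r w \<partial>time_measure s) \<bullet> \<beta>' s w \<partial>M) \<partial>time_measure t)
      + (\<integral>s. (\<integral>w. J w \<bullet> \<beta>' s w \<partial>M) \<partial>time_measure t) + (\<integral>s. (\<integral>w. J0 w \<bullet> \<beta>' s w \<partial>M) \<partial>time_measure t)"
    using i1 i2 i3 i4 by simp
qed

text \<open>Expand both states at \<open>t\<close> into initial value, drift integral and two
  stochastic integrals. Drift times drift is the triangle identity, the isometry gives the quadratic
  terms, and drift times stochastic integral is what \<open>l2_ito_drift_inner\<close> produces from
  the state terms of \<open>g\<close>.\<close>

theorem l2_ito_product:
  assumes X: "l2_ito T x0 \<beta> \<alpha> \<alpha>0 X" and X': "l2_ito T x0' \<beta>' \<alpha>' \<alpha>0' X'" and t: "t \<in> {0..T}"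
  defines "g \<equiv> \<lambda>s. (\<integral>w. X s w \<bullet> \<beta>' s w \<partial>M) + (\<integral>w. \<beta> s w \<bullet> X' s w \<partial>M)
     + (\<integral>w. \<alpha> s w \<bullet> \<alpha>' s w \<partial>M) + (\<integral>w. \<alpha>0 s w \<bullet> \<alpha>0' s w \<partial>M)"
  shows "(\<integral>w. X t w \<bullet> X' t w \<partial>M) = (\<integral>w. x0 w \<bullet> x0' w \<partial>M) + (\<integral>s. g s \<partial>time_measure t)"
    "integrable (time_measure t) g"
proof -
  have t0: "0 \<le> t" "t \<le> T" using t by auto
  have x: "sqint M x0" "x0 \<in> borel_measurable (flt 0)" "sqint M x0'" "x0' \<in> borel_measurable (flt 0)"
    and \<beta>T: "sqint (path_measure T) (\<lambda>(s, w). \<beta> s w)" "sqint (path_measure T) (\<lambda>(s, w). \<beta>' s w)"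
    and ad: "\<And>s. s \<in> {0<..T} \<Longrightarrow> \<beta> s \<in> borel_measurable (flt s)" "\<And>s. s \<in> {0<..T} \<Longrightarrow> \<beta>' s \<in> borel_measurable (flt s)"
    using X X' by (auto simp: l2_ito_def)
  note \<beta> = sqint_path_restrict(1)[OF \<beta>T(1) t0(2)] and \<beta>' = sqint_path_restrict(1)[OF \<beta>T(2) t0(2)]
  obtain J J0 where J: "ito_int W \<alpha> t J" "ito_int W0 \<alpha>0 t J0"
    "AE w in M. X t w = x0 w + (\<integral>s. \<beta> s w \<partial>time_measure t) + J w + J0 w" and Xt: "sqint M (X t)"
    using X t unfolding l2_ito_def by blast
  obtain J' J0' where J': "ito_int W \<alpha>' t J'" "ito_int W0 \<alpha>0' t J0'"
    "AE w in M. X' t w = x0' w + (\<integral>s. \<beta>' s w \<partial>time_measure t) + J' w + J0' w" and Xt': "sqint M (X' t)"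
    using X' t unfolding l2_ito_def by blast
  define I where "I w = (\<integral>s. \<beta> s w \<partial>time_measure t)" for w
  define I' where "I' w = (\<integral>s. \<beta>' s w \<partial>time_measure t)" for w
  have I: "sqint M I" "sqint M I'"
    unfolding I_def I'_def by (rule sqint_time_integral(1)[OF \<beta> t0(1)], rule sqint_time_integral(1)[OF \<beta>' t0(1)])
  note sJ = ito_sqint(1)[OF J(1)] ito_sqint(1)[OF J(2)] ito_sqint(1)[OF J'(1)] ito_sqint(1)[OF J'(2)]
  have nW: "W = W \<or> W = W0" and nW0: "W0 = W \<or> W0 = W0" by simp_all
  \<comment> \<open>Stochastic integrals are orthogonal to variables known at time 0 and to
    integrals against the other noise.\<close>
  have z: "(\<integral>w. x0 w \<bullet> J' w \<partial>M) = 0" "(\<integral>w. x0 w \<bullet> J0' w \<partial>M) = 0"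
    "(\<integral>w. J w \<bullet> x0' w \<partial>M) = 0" "(\<integral>w. J0 w \<bullet> x0' w \<partial>M) = 0"
    "(\<integral>w. J w \<bullet> J0' w \<partial>M) = 0" "(\<integral>w. J0 w \<bullet> J' w \<partial>M) = 0"
    using ito_orthogonal_initial[OF nW J'(1) t0(1) x(1,2)] ito_orthogonal_initial[OF nW0 J'(2) t0(1) x(1,2)]
      ito_orthogonal_initial[OF nW J(1) t0(1) x(3,4)] ito_orthogonal_initial[OF nW0 J(2) t0(1) x(3,4)]
      ito_cross[OF J(1) J'(2) t0(1)] ito_cross[OF J'(1) J(2) t0(1)]
    by (simp_all add: inner_commute)
  note ii = time_integral_inner(1)[OF x(1) \<beta>' t0(1), folded I'_def] time_integral_inner(1)[OF x(3) \<beta> t0(1), folded I_def]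
    time_integral_inner(1)[OF sJ(1) \<beta>' t0(1), folded I'_def] time_integral_inner(1)[OF sJ(2) \<beta>' t0(1), folded I'_def]
    time_integral_inner(1)[OF sJ(3) \<beta> t0(1), folded I_def] time_integral_inner(1)[OF sJ(4) \<beta> t0(1), folded I_def]
  note d1 = l2_ito_drift_inner[OF X t J(1,2) \<beta>' ad(2)]
  note d2 = l2_ito_drift_inner[OF X' t J'(1,2) \<beta> ad(1)]
  have d2': "integrable (time_measure t) (\<lambda>s. \<integral>w. \<beta> s w \<bullet> X' s w \<partial>M)" using d2(2) by (simp add: inner_commute)
  note a1 = path_inner[OF ito_sqint(2)[OF J(1)] ito_sqint(2)[OF J'(1)], simplified]
  note a2 = path_inner[OF ito_sqint(2)[OF J(2)] ito_sqint(2)[OF J'(2)], simplified]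
  show "integrable (time_measure t) g"
    unfolding g_def using d1(2) d2' a1(2) a2(2) by simp
  have g: "(\<integral>s. g s \<partial>time_measure t) = (\<integral>s. (\<integral>w. X s w \<bullet> \<beta>' s w \<partial>M) \<partial>time_measure t)
     + (\<integral>s. (\<integral>w. X' s w \<bullet> \<beta> s w \<partial>M) \<partial>time_measure t)
     + (\<integral>s. (\<integral>w. \<alpha> s w \<bullet> \<alpha>' s w \<partial>M) \<partial>time_measure t) + (\<integral>s. (\<integral>w. \<alpha>0 s w \<bullet> \<alpha>0' s w \<partial>M) \<partial>time_measure t)"
    unfolding g_def using d1(2) d2' a1(2) a2(2) by (simp add: inner_commute[of "\<beta> _ _"])
  have comm: "(\<integral>w. \<beta> s w \<bullet> f w \<partial>M) = (\<integral>w. f w \<bullet> \<beta> s w \<partial>M)" for s f by (simp add: inner_commute)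
  have "(\<integral>w. X t w \<bullet> X' t w \<partial>M) = (\<integral>w. (x0 w + I w + J w + J0 w) \<bullet> (x0' w + I' w + J' w + J0' w) \<partial>M)"
  proof (rule integral_cong_AE)
    show "(\<lambda>w. X t w \<bullet> X' t w) \<in> borel_measurable M" by (intro borel_measurable_inner sqint_measurable Xt Xt')
    show "(\<lambda>w. (x0 w + I w + J w + J0 w) \<bullet> (x0' w + I' w + J' w + J0' w)) \<in> borel_measurable M"
      by (intro borel_measurable_inner sqint_measurable sqint_add x I sJ)
    show "AE w in M. X t w \<bullet> X' t w = (x0 w + I w + J w + J0 w) \<bullet> (x0' w + I' w + J' w + J0' w)"
      using J(3) J'(3) by eventually_elim (simp add: I_def I'_def)
  qed
  also have "\<dots> = (\<integral>w. x0 w \<bullet> x0' w \<partial>M) + (\<integral>w. x0 w \<bullet> I' w \<partial>M) + (\<integral>w. x0 w \<bullet> J' w \<partial>M) + (\<integral>w. x0 w \<bullet> J0' w \<partial>M)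
     + ((\<integral>w. x0' w \<bullet> I w \<partial>M) + (\<integral>w. I w \<bullet> I' w \<partial>M) + (\<integral>w. J' w \<bullet> I w \<partial>M) + (\<integral>w. J0' w \<bullet> I w \<partial>M))
     + ((\<integral>w. J w \<bullet> x0' w \<partial>M) + (\<integral>w. J w \<bullet> I' w \<partial>M) + (\<integral>w. J w \<bullet> J' w \<partial>M) + (\<integral>w. J w \<bullet> J0' w \<partial>M))
     + ((\<integral>w. J0 w \<bullet> x0' w \<partial>M) + (\<integral>w. J0 w \<bullet> I' w \<partial>M) + (\<integral>w. J0 w \<bullet> J' w \<partial>M) + (\<integral>w. J0 w \<bullet> J0' w \<partial>M))"
    by (simp add: inner_add_left inner_add_right sqint_inner x I sJ inner_commute[of "I _" "x0' _"]
        inner_commute[of "I _" "J' _"] inner_commute[of "I _" "J0' _"])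
  also have "\<dots> = (\<integral>w. x0 w \<bullet> x0' w \<partial>M) + (\<integral>s. g s \<partial>time_measure t)"
    unfolding z ii time_integral_product(1)[OF \<beta> \<beta>' t0(1), folded I_def I'_def] g d1(1) d2(1)
      ito_isometry[OF nW J(1) J'(1) t0(1)] ito_isometry[OF nW0 J(2) J'(2) t0(1)] a1(1) a2(1)
    by (simp add: comm) (use d1(1) d2(1) in linarith)
  finally show "(\<integral>w. X t w \<bullet> X' t w \<partial>M) = (\<integral>w. x0 w \<bullet> x0' w \<partial>M) + (\<integral>s. g s \<partial>time_measure t)" .
qed

lemma time_integral_AE_add:
  assumes "sqint (path_measure t) (\<lambda>(s, w). \<beta> s w)" "sqint (path_measure t) (\<lambda>(s, w). \<beta>' s w)" "0 \<le> t"
  shows "AE w in M. (\<integral>s. \<beta> s w + \<beta>' s w \<partial>time_measure t) = (\<integral>s. \<beta> s w \<partial>time_measure t) + (\<integral>s. \<beta>' s w \<partial>time_measure t)"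
  using sqint_time_integral(2)[OF assms(1,3)] sqint_time_integral(2)[OF assms(2,3)]
  by eventually_elim (simp add: finite_measure.sqint_integrable[OF finite_time_measure])

lemma l2_ito_add:
  assumes X: "l2_ito T x0 \<beta> \<alpha> \<alpha>0 X" and X': "l2_ito T x0' \<beta>' \<alpha>' \<alpha>0' X'"
  shows "l2_ito T (\<lambda>w. x0 w + x0' w) (\<lambda>s w. \<beta> s w + \<beta>' s w) (\<lambda>s w. \<alpha> s w + \<alpha>' s w) (\<lambda>s w. \<alpha>0 s w + \<alpha>0' s w)
    (\<lambda>s w. X s w + X' s w)"
proof -
  have \<beta>T: "sqint (path_measure T) (\<lambda>(s, w). \<beta> s w)" "sqint (path_measure T) (\<lambda>(s, w). \<beta>' s w)"
    "sqint (path_measure T) (\<lambda>(s, w). X s w)" "sqint (path_measure T) (\<lambda>(s, w). X' s w)"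
    using X X' by (auto simp: l2_ito_def)
  show ?thesis
    unfolding l2_ito_def
  proof (intro conjI ballI)
    show "sqint M (\<lambda>w. x0 w + x0' w)" "(\<lambda>w. x0 w + x0' w) \<in> borel_measurable (flt 0)"
      using X X' by (auto simp: l2_ito_def intro: sqint_add)
    show "sqint (path_measure T) (\<lambda>(s, w). \<beta> s w + \<beta>' s w)" "sqint (path_measure T) (\<lambda>(s, w). X s w + X' s w)"
      using sqint_add[OF \<beta>T(1,2)] sqint_add[OF \<beta>T(3,4)] by (simp_all add: case_prod_unfold)
    show "(\<lambda>w. \<beta> s w + \<beta>' s w) \<in> borel_measurable (flt s)" if "s \<in> {0<..T}" for s
      by (intro borel_measurable_add) (use X X' that in \<open>auto simp: l2_ito_def\<close>)
    fix t assume t: "t \<in> {0..T}"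
    then have t0: "0 \<le> t" "t \<le> T" by auto
    obtain J J0 where J: "ito_int W \<alpha> t J" "ito_int W0 \<alpha>0 t J0"
      "AE w in M. X t w = x0 w + (\<integral>s. \<beta> s w \<partial>time_measure t) + J w + J0 w" and Xt: "sqint M (X t)"
      using X t unfolding l2_ito_def by blast
    obtain J' J0' where J': "ito_int W \<alpha>' t J'" "ito_int W0 \<alpha>0' t J0'"
      "AE w in M. X' t w = x0' w + (\<integral>s. \<beta>' s w \<partial>time_measure t) + J' w + J0' w" and Xt': "sqint M (X' t)"
      using X' t unfolding l2_ito_def by blast
    show "sqint M (\<lambda>w. X t w + X' t w)" by (rule sqint_add[OF Xt Xt'])
    have "AE w in M. X t w + X' t w = x0 w + x0' w + (\<integral>s. \<beta> s w + \<beta>' s w \<partial>time_measure t) + (J w + J' w) + (J0 w + J0' w)"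
      using J(3) J'(3) time_integral_AE_add[OF sqint_path_restrict(1)[OF \<beta>T(1) t0(2)] sqint_path_restrict(1)[OF \<beta>T(2) t0(2)] t0(1)]
      by eventually_elim simp
    then show "\<exists>Ja J0a. ito_int W (\<lambda>s w. \<alpha> s w + \<alpha>' s w) t Ja \<and> ito_int W0 (\<lambda>s w. \<alpha>0 s w + \<alpha>0' s w) t J0a \<and>
      (AE w in M. X t w + X' t w = x0 w + x0' w + (\<integral>s. \<beta> s w + \<beta>' s w \<partial>time_measure t) + Ja w + J0a w)"
      using ito_add[OF J(1) J'(1)] ito_add[OF J(2) J'(2)] by blast
  qed
qed

lemma l2_ito_bounded_linear:
  assumes X: "l2_ito T x0 \<beta> \<alpha> \<alpha>0 X" and h: "bounded_linear h"
  shows "l2_ito T (\<lambda>w. h (x0 w)) (\<lambda>s w. h (\<beta> s w)) (\<lambda>s w. h (\<alpha> s w)) (\<lambda>s w. h (\<alpha>0 s w)) (\<lambda>s w. h (X s w))"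
proof -
  interpret bounded_linear h by fact
  have \<beta>T: "sqint (path_measure T) (\<lambda>(s, w). \<beta> s w)" "sqint (path_measure T) (\<lambda>(s, w). X s w)"
    using X by (auto simp: l2_ito_def)
  have hm: "(\<lambda>w. h (f w)) \<in> borel_measurable N" if "f \<in> borel_measurable N" for f and N :: "'w measure"
    by (rule measurable_compose[OF that borel_measurable_continuous_onI[OF linear_continuous_on[OF h]]])
  show ?thesis
    unfolding l2_ito_def
  proof (intro conjI ballI)
    show "sqint M (\<lambda>w. h (x0 w))" "(\<lambda>w. h (x0 w)) \<in> borel_measurable (flt 0)"
      using X by (auto simp: l2_ito_def intro: sqint_bounded_linear[OF h] hm)
    show "sqint (path_measure T) (\<lambda>(s, w). h (\<beta> s w))" "sqint (path_measure T) (\<lambda>(s, w). h (X s w))"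
      using sqint_bounded_linear[OF h \<beta>T(1)] sqint_bounded_linear[OF h \<beta>T(2)] by (simp_all add: case_prod_unfold)
    show "(\<lambda>w. h (\<beta> s w)) \<in> borel_measurable (flt s)" if "s \<in> {0<..T}" for s
      using X that by (auto simp: l2_ito_def intro: hm)
    fix t assume t: "t \<in> {0..T}"
    then have t0: "0 \<le> t" "t \<le> T" by auto
    obtain J J0 where J: "ito_int W \<alpha> t J" "ito_int W0 \<alpha>0 t J0"
      "AE w in M. X t w = x0 w + (\<integral>s. \<beta> s w \<partial>time_measure t) + J w + J0 w" and Xt: "sqint M (X t)"
      using X t unfolding l2_ito_def by blast
    show "sqint M (\<lambda>w. h (X t w))" by (rule sqint_bounded_linear[OF h Xt])
    have "AE w in M. h (X t w) = h (x0 w) + (\<integral>s. h (\<beta> s w) \<partial>time_measure t) + h (J w) + h (J0 w)"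
      using J(3) sqint_time_integral(2)[OF sqint_path_restrict(1)[OF \<beta>T(1) t0(2)] t0(1)]
      by eventually_elim
         (simp add: add integral_bounded_linear[OF h finite_measure.sqint_integrable[OF finite_time_measure]])
    then show "\<exists>Ja J0a. ito_int W (\<lambda>s w. h (\<alpha> s w)) t Ja \<and> ito_int W0 (\<lambda>s w. h (\<alpha>0 s w)) t J0a \<and>
      (AE w in M. h (X t w) = h (x0 w) + (\<integral>s. h (\<beta> s w) \<partial>time_measure t) + Ja w + J0a w)"
      using ito_bounded_linear[OF J(1) h] ito_bounded_linear[OF J(2) h] by blast
  qed
qed

lemma l2_ito_diff:
  assumes X: "l2_ito T x0 \<beta> \<alpha> \<alpha>0 X" and X': "l2_ito T x0' \<beta>' \<alpha>' \<alpha>0' X'"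
  shows "l2_ito T (\<lambda>w. x0 w - x0' w) (\<lambda>s w. \<beta> s w - \<beta>' s w) (\<lambda>s w. \<alpha> s w - \<alpha>' s w) (\<lambda>s w. \<alpha>0 s w - \<alpha>0' s w)
    (\<lambda>s w. X s w - X' s w)"
  using l2_ito_add[OF X l2_ito_bounded_linear[OF X' bounded_linear_minus[OF bounded_linear_ident]]] by simp

end

section \<open>The closed-loop equation\<close>

lemma measurable_matrix_vector_mult:
  fixes A :: "'a \<Rightarrow> real^'n^'m"
  assumes "A \<in> borel_measurable N" "x \<in> borel_measurable N"
  shows "(\<lambda>z. A z *v x z) \<in> borel_measurable N"
  by (rule borel_measurable_continuous_Pair[OF assms])
     (intro bounded_bilinear.continuous_on[OF bounded_bilinear_matrix_vector_mult] continuous_intros)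

lemma measurable_const_matrix_mult:
  fixes A :: "real^'n^'m"
  shows "x \<in> borel_measurable N \<Longrightarrow> (\<lambda>z. A *v x z) \<in> borel_measurable N"
  by (rule measurable_matrix_vector_mult) simp_all

lemma continuous_time_measurable:
  "continuous_on {0..T} f \<Longrightarrow> f \<in> borel_measurable (time_measure T)"
  for f :: "real \<Rightarrow> 'b::topological_space"
  using borel_measurable_continuous_on_restrict[of "{0..T}" f] measurable_cong_sets[OF sets_time_measure refl] by blast

context brownian_basis
begin

lemma ito_zero: "ito_int V (\<lambda>s w. 0) t (\<lambda>w. 0)"
  unfolding ito_int_def
  by (rule exI[of _ "\<lambda>j s w. 0"], rule exI[of _ "\<lambda>j s w. 0"])
     (simp add: simple_integral.zero L2_lim_def case_prod_unfold)

lemma F0_raw_flt: "sets F0 \<subseteq> sets (raw_flt s)"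
  by (auto simp: sets_raw_flt)

lemma F0_flt: "sets F0 \<subseteq> sets (flt s)"
  using F0_raw_flt by (auto simp: sets_flt)

lemma L4_F0_sqint:
  fixes \<xi> :: "'w \<Rightarrow> real^'n"
  assumes "L4_F0 \<xi>"
  shows "\<xi> \<in> borel_measurable F0" "sqint M \<xi>"
proof -
  show m: "\<xi> \<in> borel_measurable F0" using assms by (simp add: L4_F0_def)
  have mM: "\<xi> \<in> borel_measurable M" by (rule measurable_from_subalg[OF subalg_F0 m])
  have "integrable M (\<lambda>w. norm (\<xi> w) ^ 4)"
    using assms mM by (intro integrableI_bounded) (auto simp: L4_F0_def)
  then have i: "integrable M (\<lambda>w. 1 + norm (\<xi> w) ^ 4)" by simp
  have "r\<^sup>2 \<le> 1 + r ^ 4" for r :: real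
  proof -
    have "2 * r\<^sup>2 * 1 \<le> (r\<^sup>2)\<^sup>2 + 1\<^sup>2" by (rule sum_squares_bound)
    moreover have "(r\<^sup>2)\<^sup>2 = r ^ 4" by simp
    ultimately have "2 * r\<^sup>2 \<le> r ^ 4 + 1" by simp
    then show ?thesis using zero_le_power2[of r] by linarith
  qed
  then show "sqint M \<xi>" by (intro sqint_bound[OF mM i]) simp
qed

text \<open>The initial state is hidden information, independent of the common noise, so
  conditioning on the latter yields the plain mean.\<close>

lemma vec_cond_exp_F0:
  fixes \<xi> :: "'w \<Rightarrow> real^'n"
  assumes \<xi>: "\<xi> \<in> borel_measurable F0" "sqint M \<xi>"
  shows "AE w in M. vec_cond_exp M (flt0 t) \<xi> w = (\<integral>w. \<xi> w \<partial>M)"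
proof (rule finite_measure_subalgebra.vec_cond_exp_charact[OF finite_subalgebra[OF subalg_flt0] \<xi>(2)])
  let ?m = "\<integral>w. \<xi> w \<partial>M"
  show "sqint M (\<lambda>w. ?m)" "(\<lambda>w. ?m) \<in> borel_measurable (flt0 t)" by simp_all
  fix \<zeta> :: "'w \<Rightarrow> real^'n" assume \<zeta>: "sqint M \<zeta>" "\<zeta> \<in> borel_measurable (flt0 t)"
  let ?S = "sigma_sets (space M) {A \<inter> B | A B. A \<in> sets F0 \<and> B \<in> sets (path_algebra W {0..})}"
  have P: "{A \<inter> B | A B. A \<in> sets F0 \<and> B \<in> sets (path_algebra W {0..})} \<subseteq> Pow (space M)"
    using F0_events sets.sets_into_space by blast
  have nth: "(\<lambda>w. f w $ i) \<in> borel_measurable N" if "f \<in> borel_measurable N" for f :: "'w \<Rightarrow> real^'n" and i and N :: "'w measure"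
    using measurable_compose[OF that borel_measurable_continuous_onI[OF linear_continuous_on[OF bounded_linear_vec_nth]]] .
  have prod: "(\<integral>w. \<xi> w $ i * \<zeta> w $ i \<partial>M) = (\<integral>w. \<xi> w $ i \<partial>M) * (\<integral>w. \<zeta> w $ i \<partial>M)" for i
  proof (rule indep_var_lebesgue_integral)
    show "indep_var borel (\<lambda>w. \<xi> w $ i) borel (\<lambda>w. \<zeta> w $ i)"
    proof (rule indep_var_of_algebras[OF hidden_indep_flt0 sigma_algebra_sigma_sets[OF P]])
      show "sigma_algebra (space M) (sets (flt0 t))" using sets.sigma_algebra_axioms[of "flt0 t"] by simp
      fix X :: "real set" assume X: "X \<in> sets borel"
      show "(\<lambda>w. \<zeta> w $ i) -` X \<inter> space M \<in> sets (flt0 t)" using measurable_sets[OF nth[OF \<zeta>(2)] X] by simp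
      have F: "(\<lambda>w. \<xi> w $ i) -` X \<inter> space M \<in> sets F0" using measurable_sets[OF nth[OF \<xi>(1)] X] by (simp add: space_F0)
      have "(\<lambda>w. \<xi> w $ i) -` X \<inter> space M = ((\<lambda>w. \<xi> w $ i) -` X \<inter> space M) \<inter> space M" by blast
      moreover have "space M \<in> sets (path_algebra W {0..})" using sets.top[of "path_algebra W {0..}"] by simp
      ultimately show "(\<lambda>w. \<xi> w $ i) -` X \<inter> space M \<in> ?S" using F by (intro sigma_sets.Basic) blast
    qed
    show "integrable M (\<lambda>w. \<xi> w $ i)" "integrable M (\<lambda>w. \<zeta> w $ i)"
      by (intro sqint_integrable sqint_component \<xi> \<zeta>)+
  qed
  have comp: "(\<integral>w. \<xi> w \<partial>M) $ i = (\<integral>w. \<xi> w $ i \<partial>M)" for i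
    using integral_bounded_linear[OF bounded_linear_vec_nth sqint_integrable[OF \<xi>(2)], of i] by simp
  have i1: "integrable M (\<lambda>w. \<zeta> w $ i * \<xi> w $ i)" and i2: "integrable M (\<lambda>w. \<zeta> w $ i * ?m $ i)" for i
    using sqint_inner[OF sqint_component[OF \<zeta>(1), of i] sqint_component[OF \<xi>(2), of i]]
      sqint_integrable[OF sqint_component[OF \<zeta>(1), of i]] by simp_all
  show "(\<integral>w. \<zeta> w \<bullet> ?m \<partial>M) = (\<integral>w. \<zeta> w \<bullet> \<xi> w \<partial>M)"
    unfolding inner_vec_def inner_real_def
    by (simp only: Bochner_Integration.integral_sum[OF i1] Bochner_Integration.integral_sum[OF i2])
       (intro sum.cong refl, simp add: comp prod mult.commute)
qed

end

text \<open>A closed-loop pair on \<open>I\<close> viewed on a finite horizon \<open>T\<close>, so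
  that the ergodic pair can be used on every interval. Continuity of \<open>\<Theta>b\<close> and
  \<open>\<theta>\<close> provides measurability and square integrability of
  \<open>mdrift\<close>.\<close>

locale mean_field_solution = brownian_basis M W W0 F0
  for M :: "'w measure" and W W0 F0 +
  fixes d :: "('n::finite, 'm::finite) lq_data" and I :: "real set" and T :: real and \<xi> :: "'w \<Rightarrow> real^'n"
    and \<Theta> \<Theta>b :: "real \<Rightarrow> real^'n^'m" and \<theta> :: "real \<Rightarrow> real^'m"
    and X Z :: "real \<Rightarrow> 'w \<Rightarrow> real^'n" and u :: "real \<Rightarrow> 'w \<Rightarrow> real^'m"
  assumes I: "{0..T} \<subseteq> I" and T: "0 \<le> T" and \<xi>: "L4_F0 \<xi>"
    and u: "progressive flt I u" "locally_sq_integrable I u"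
    and eq: "mf_state_equation d I \<xi> X Z u"
    and feedback: "\<And>t. t \<in> I \<Longrightarrow> AE w in M. u t w = \<Theta> t *v (X t w - Z t w) + \<Theta>b t *v Z t w + \<theta> t"
    and cont: "continuous_on {0..T} \<Theta>b" "continuous_on {0..T} \<theta>"
begin

lemma path: "progressive flt I X" "locally_sq_integrable I X" "AE w in M. continuous_on I (\<lambda>t. X t w)"
  "progressive flt0 I Z" "\<And>t. t \<in> I \<Longrightarrow> AE w in M. Z t w = vec_cond_exp M (flt0 t) (X t) w"
  using eq by (auto simp: mf_state_equation_def ito_process_def conditional_mean_def vec_cond_exp_def)

lemma in_I: "t \<in> {0..T} \<Longrightarrow> t \<in> I"
  using I by auto

lemma progressive_section:
  fixes H :: "real \<Rightarrow> 'w \<Rightarrow> 'b::euclidean_space"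
  assumes "progressive F I H" "t \<in> {0..T}"
  shows "H t \<in> borel_measurable (F t)"
proof -
  have "(\<lambda>(s, w). H s w) \<in> borel_measurable (restrict_space borel {0..t} \<Otimes>\<^sub>M F t)"
    using assms in_I by (auto simp: progressive_def)
  from measurable_compose[OF measurable_Pair1' this, of t] show ?thesis
    using assms(2) by (simp add: space_restrict_space)
qed

lemma sqint_path_of_locally:
  fixes H :: "real \<Rightarrow> 'w \<Rightarrow> 'b::euclidean_space"
  assumes "progressive flt I H" "locally_sq_integrable I H"
  shows "sqint (path_measure T) (\<lambda>(s, w). H s w)"
proof -
  have TI: "T \<in> I" using in_I T by simp
  have m: "(\<lambda>(s, w). H s w) \<in> borel_measurable (path_measure T)"
    by (rule progressive_path_measurable[OF assms(1) TI subalg_flt])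
  have "sq_integral {0..T} H < \<infinity>" using assms(2) TI by (simp add: locally_sq_integrable_def)
  then show ?thesis
    unfolding sqint_def using m by (auto intro!: integrableI_bounded simp: sq_integral_path[OF m])
qed

lemma X_flt: "t \<in> {0..T} \<Longrightarrow> X t \<in> borel_measurable (flt t)"
  and u_flt: "t \<in> {0..T} \<Longrightarrow> u t \<in> borel_measurable (flt t)"
  and Z_flt0: "t \<in> {0..T} \<Longrightarrow> Z t \<in> borel_measurable (flt0 t)"
  using progressive_section path(1,4) u(1) by blast+

lemma Z_raw_flt: "t \<in> {0..T} \<Longrightarrow> Z t \<in> borel_measurable (raw_flt t)"
  by (rule measurable_mono_sets[OF Z_flt0 flt0_raw_flt]) simp_all

lemma Z_flt: "t \<in> {0..T} \<Longrightarrow> Z t \<in> borel_measurable (flt t)"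
  by (rule measurable_mono_sets[OF Z_raw_flt raw_flt_flt]) simp_all

lemma XT: "sqint (path_measure T) (\<lambda>(s, w). X s w)"
  and uT: "sqint (path_measure T) (\<lambda>(s, w). u s w)"
  using sqint_path_of_locally path(1,2) u by blast+

lemma sqint_Z_section:
  assumes "sqint M (X t)" "t \<in> {0..T}"
  shows "sqint M (Z t)" "(\<integral>w. (norm (Z t w))\<^sup>2 \<partial>M) \<le> (\<integral>w. (norm (X t w))\<^sup>2 \<partial>M)"
proof -
  interpret F: finite_measure_subalgebra M "flt0 t" by (rule finite_subalgebra[OF subalg_flt0])
  have Zm: "Z t \<in> borel_measurable M" by (rule measurable_from_subalg[OF subalg_flt0 Z_flt0[OF assms(2)]])
  have AE: "AE w in M. vec_cond_exp M (flt0 t) (X t) w = Z t w"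
    using path(5)[OF in_I[OF assms(2)]] by eventually_elim simp
  show "sqint M (Z t)" by (rule sqint_cong_AE[OF F.sqint_vec_cond_exp[OF assms(1)] Zm AE])
  have "(\<integral>w. (norm (Z t w))\<^sup>2 \<partial>M) = (\<integral>w. (norm (vec_cond_exp M (flt0 t) (X t) w))\<^sup>2 \<partial>M)"
  proof (rule integral_cong_AE)
    show "(\<lambda>w. (norm (Z t w))\<^sup>2) \<in> borel_measurable M" using Zm by measurable
    show "(\<lambda>w. (norm (vec_cond_exp M (flt0 t) (X t) w))\<^sup>2) \<in> borel_measurable M"
      using sqint_integrable_sq[OF F.sqint_vec_cond_exp[OF assms(1)]] by auto
    show "AE w in M. (norm (Z t w))\<^sup>2 = (norm (vec_cond_exp M (flt0 t) (X t) w))\<^sup>2"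
      using AE by eventually_elim simp
  qed
  then show "(\<integral>w. (norm (Z t w))\<^sup>2 \<partial>M) \<le> (\<integral>w. (norm (X t w))\<^sup>2 \<partial>M)"
    using F.vec_cond_exp_contraction[OF assms(1)] by simp
qed

lemma Z_path_measurable: "(\<lambda>(s, w). Z s w) \<in> borel_measurable (path_measure T)"
  by (rule progressive_path_measurable[OF path(4) in_I subalg_flt0]) (use T in simp)

text \<open>Joint measurability comes from the chosen progressive version of the conditional mean;
  the size is controlled at almost every time by contraction against the state.\<close>

lemma ZT: "sqint (path_measure T) (\<lambda>(s, w). Z s w)"
  unfolding sqint_def
proof
  interpret pair_sigma_finite "time_measure T" M by (rule pair_time)
  show "(\<lambda>(s, w). Z s w) \<in> borel_measurable (path_measure T)" by (rule Z_path_measurable)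
  then have m: "(\<lambda>z. (norm (case z of (s, w) \<Rightarrow> Z s w))\<^sup>2) \<in> borel_measurable (path_measure T)" by measurable
  have sec: "AE s in time_measure T. sqint M (Z s) \<and> (\<integral>w. (norm (Z s w))\<^sup>2 \<partial>M) \<le> (\<integral>w. (norm (X s w))\<^sup>2 \<partial>M)"
    using sqint_section[OF XT] AE_space by eventually_elim (use sqint_Z_section in simp)
  show "integrable (path_measure T) (\<lambda>z. (norm (case z of (s, w) \<Rightarrow> Z s w))\<^sup>2)"
  proof (rule Fubini_integrable[OF m])
    show "AE s in time_measure T. integrable M (\<lambda>w. (norm (case (s, w) of (s, w) \<Rightarrow> Z s w))\<^sup>2)"
      using sec by eventually_elim (simp add: sqint_integrable_sq)
    show "integrable (time_measure T) (\<lambda>s. \<integral>w. norm ((norm (case (s, w) of (s, w) \<Rightarrow> Z s w))\<^sup>2) \<partial>M)"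
    proof (rule Bochner_Integration.integrable_bound)
      show "integrable (time_measure T) (\<lambda>s. \<integral>w. (norm (X s w))\<^sup>2 \<partial>M)"
        using path_integral(2)[OF sqint_integrable_sq[OF XT]] by simp
      have "(\<lambda>(s, w). norm ((norm (Z s w))\<^sup>2)) \<in> borel_measurable (path_measure T)" using m by (simp add: case_prod_unfold)
      then show "(\<lambda>s. \<integral>w. norm ((norm (case (s, w) of (s, w) \<Rightarrow> Z s w))\<^sup>2) \<partial>M) \<in> borel_measurable (time_measure T)"
        using borel_measurable_lebesgue_integral by simp
      show "AE s in time_measure T. norm (\<integral>w. norm ((norm (case (s, w) of (s, w) \<Rightarrow> Z s w))\<^sup>2) \<partial>M)
        \<le> norm (\<integral>w. (norm (X s w))\<^sup>2 \<partial>M)"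
        using sec by eventually_elim simp
    qed
  qed
qed

definition drift :: "real \<Rightarrow> 'w \<Rightarrow> real^'n" where
  "drift t w = cA d *v X t w + cAb d *v Z t w + cB d *v u t w + cb d"
definition diff :: "real \<Rightarrow> 'w \<Rightarrow> real^'n" where
  "diff t w = cC d *v X t w + cCb d *v Z t w + cD d *v u t w + csigma d"
definition diff0 :: "real \<Rightarrow> 'w \<Rightarrow> real^'n" where
  "diff0 t w = cG d *v X t w + cGb d *v Z t w + cgamma d"
text \<open>The projection of \<open>drift\<close> onto the common noise: the fluctuation drops out,
  and a coefficient and its barred companion add up to the hatted one.\<close>

definition mdrift :: "real \<Rightarrow> 'w \<Rightarrow> real^'n" where
  "mdrift t w = hatA d *v Z t w + cB d *v (\<Theta>b t *v Z t w + \<theta> t) + cb d"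
definition mdiff0 :: "real \<Rightarrow> 'w \<Rightarrow> real^'n" where
  "mdiff0 t w = hatG d *v Z t w + cgamma d"

lemma sqint_path_const_vec: "sqint (path_measure T) (\<lambda>z. c)"
  using finite_measure.sqint_const[OF finite_path_measure] .

lemma drift_path: "sqint (path_measure T) (\<lambda>(s, w). drift s w)"
  using sqint_add[OF sqint_add[OF sqint_add[OF sqint_mult_mat[OF XT] sqint_mult_mat[OF ZT]] sqint_mult_mat[OF uT]] sqint_path_const_vec]
  by (simp add: drift_def case_prod_unfold)

lemma mdiff0_path: "sqint (path_measure T) (\<lambda>(s, w). mdiff0 s w)"
  using sqint_add[OF sqint_mult_mat[OF ZT] sqint_path_const_vec] by (simp add: mdiff0_def case_prod_unfold)

lemma l2_ito_X: "l2_ito T \<xi> drift diff diff0 X"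
  unfolding l2_ito_def
proof (intro conjI ballI XT drift_path L4_F0_sqint(2)[OF \<xi>])
  show "\<xi> \<in> borel_measurable (flt 0)"
    by (rule measurable_mono_sets[OF L4_F0_sqint(1)[OF \<xi>] F0_flt]) (simp add: space_F0)
  show "drift s \<in> borel_measurable (flt s)" if "s \<in> {0<..T}" for s
    unfolding drift_def[abs_def]
    by (intro borel_measurable_add measurable_const_matrix_mult X_flt Z_flt u_flt borel_measurable_const) (use that in auto)
  fix t assume t: "t \<in> {0..T}"
  obtain J J0 where J: "has_ito_integral W diff t J" "has_ito_integral W0 diff0 t J0"
    "AE w in M. set_integrable lborel {0..t} (\<lambda>s. drift s w) \<and>
             X t w = \<xi> w + (LBINT s:{0..t}. drift s w) + J w + J0 w"
    using eq in_I[OF t] unfolding mf_state_equation_def ito_process_def drift_def[abs_def] diff_def[abs_def] diff0_def[abs_def]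
    by blast
  have t0: "0 \<le> t" "t \<le> T" using t by auto
  have Ji: "ito_int W diff t J" "ito_int W0 diff0 t J0"
    by (rule ito_of_has_ito_integral[OF _ t0(1) J(1)], simp, rule ito_of_has_ito_integral[OF _ t0(1) J(2)], simp)
  have e: "AE w in M. X t w = \<xi> w + (\<integral>s. drift s w \<partial>time_measure t) + J w + J0 w"
    using J(3) by eventually_elim (simp add: integral_time_measure(1))
  then show "\<exists>J J0. ito_int W diff t J \<and> ito_int W0 diff0 t J0 \<and>
      (AE w in M. X t w = \<xi> w + (\<integral>s. drift s w \<partial>time_measure t) + J w + J0 w)"
    using Ji by blast
  have sq: "sqint M (\<lambda>w. \<xi> w + (\<integral>s. drift s w \<partial>time_measure t) + J w + J0 w)"
    by (intro sqint_add L4_F0_sqint(2)[OF \<xi>] sqint_time_integral(1)[OF sqint_path_restrict(1)[OF drift_path t0(2)] t0(1)]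
        ito_sqint(1)[OF Ji(1)] ito_sqint(1)[OF Ji(2)])
  have "X t \<in> borel_measurable M" by (rule measurable_from_subalg[OF subalg_flt X_flt[OF t]])
  moreover have "AE w in M. \<xi> w + (\<integral>s. drift s w \<partial>time_measure t) + J w + J0 w = X t w"
    using e by eventually_elim simp
  ultimately show "sqint M (X t)" by (rule sqint_cong_AE[OF sq])
qed

lemma sqint_X: "t \<in> {0..T} \<Longrightarrow> sqint M (X t)"
  using l2_ito_X by (simp add: l2_ito_def)

lemma sqint_Z: "t \<in> {0..T} \<Longrightarrow> sqint M (Z t)"
  using sqint_Z_section(1) sqint_X by blast

lemma fluctuation_orthogonal:
  assumes t: "t \<in> {0..T}" and f: "sqint M f" "f \<in> borel_measurable (flt0 t)"
  shows "(\<integral>w. f w \<bullet> (X t w - Z t w) \<partial>M) = 0"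
proof -
  interpret F: finite_measure_subalgebra M "flt0 t" by (rule finite_subalgebra[OF subalg_flt0])
  have "(\<integral>w. f w \<bullet> Z t w \<partial>M) = (\<integral>w. f w \<bullet> vec_cond_exp M (flt0 t) (X t) w \<partial>M)"
  proof (rule integral_cong_AE)
    show "(\<lambda>w. f w \<bullet> Z t w) \<in> borel_measurable M" by (intro borel_measurable_inner sqint_measurable f sqint_Z t)
    show "(\<lambda>w. f w \<bullet> vec_cond_exp M (flt0 t) (X t) w) \<in> borel_measurable M"
      by (intro borel_measurable_inner sqint_measurable f F.sqint_vec_cond_exp sqint_X t)
    show "AE w in M. f w \<bullet> Z t w = f w \<bullet> vec_cond_exp M (flt0 t) (X t) w"
      using path(5)[OF in_I[OF t]] by eventually_elim simp
  qed
  also have "\<dots> = (\<integral>w. f w \<bullet> X t w \<partial>M)" by (rule F.vec_cond_exp_inner[OF sqint_X[OF t] f])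
  finally show ?thesis
    using sqint_inner[OF f(1) sqint_X[OF t]] sqint_inner[OF f(1) sqint_Z[OF t]] by (simp add: inner_diff_right)
qed

lemma vec_cond_exp_fluctuation:
  fixes f g :: "'w \<Rightarrow> real^'n" and A :: "real^'n^'n"
  assumes t: "t \<in> {0..T}" and f: "sqint M f" and g: "sqint M g" "g \<in> borel_measurable (flt0 t)"
    and eq: "AE w in M. f w = A *v (X t w - Z t w) + g w"
  shows "AE w in M. vec_cond_exp M (flt0 t) f w = g w"
proof (rule finite_measure_subalgebra.vec_cond_exp_charact[OF finite_subalgebra[OF subalg_flt0] f g])
  fix \<zeta> :: "'w \<Rightarrow> real^'n" assume \<zeta>: "sqint M \<zeta>" "\<zeta> \<in> borel_measurable (flt0 t)"
  note XZ = sqint_diff[OF sqint_X[OF t] sqint_Z[OF t]]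
  have "(\<integral>w. \<zeta> w \<bullet> f w \<partial>M) = (\<integral>w. (transpose A *v \<zeta> w) \<bullet> (X t w - Z t w) + \<zeta> w \<bullet> g w \<partial>M)"
  proof (rule integral_cong_AE)
    show "(\<lambda>w. \<zeta> w \<bullet> f w) \<in> borel_measurable M" by (intro borel_measurable_inner sqint_measurable f \<zeta>)
    show "(\<lambda>w. (transpose A *v \<zeta> w) \<bullet> (X t w - Z t w) + \<zeta> w \<bullet> g w) \<in> borel_measurable M"
      by (intro borel_measurable_add borel_measurable_inner sqint_measurable sqint_mult_mat \<zeta> g XZ)
    show "AE w in M. \<zeta> w \<bullet> f w = (transpose A *v \<zeta> w) \<bullet> (X t w - Z t w) + \<zeta> w \<bullet> g w"
      using eq
    proof eventually_elim
      case (elim w)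
      have "(transpose A *v \<zeta> w) \<bullet> (X t w - Z t w) = \<zeta> w \<bullet> (A *v (X t w - Z t w))"
        using inner_transpose_mult[of "X t w - Z t w" A "\<zeta> w"] by (simp only: inner_commute)
      then show ?case by (simp only: elim inner_add_right)
    qed
  qed
  also have "\<dots> = (\<integral>w. (transpose A *v \<zeta> w) \<bullet> (X t w - Z t w) \<partial>M) + (\<integral>w. \<zeta> w \<bullet> g w \<partial>M)"
    by (intro Bochner_Integration.integral_add sqint_inner sqint_mult_mat \<zeta> g XZ)
  also have "(\<integral>w. (transpose A *v \<zeta> w) \<bullet> (X t w - Z t w) \<partial>M) = 0"
    by (intro fluctuation_orthogonal[OF t] sqint_mult_mat measurable_const_matrix_mult \<zeta>)
  finally show "(\<integral>w. \<zeta> w \<bullet> g w \<partial>M) = (\<integral>w. \<zeta> w \<bullet> f w \<partial>M)" by simp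
qed

text \<open>Being adapted to \<open>flt\<close> still allows a look into the immediate future,
  whereas \<open>vec_cond_exp_later\<close> needs a variable known at the time itself. Path
  continuity makes the state an almost sure limit of earlier values, each of which is known to
  \<open>raw_flt t\<close>.\<close>

lemma X_raw_flt:
  assumes t: "t \<in> {0<..T}"
  shows "X t \<in> borel_measurable (raw_flt t)"
proof -
  define s where "s n = t - t / (real n + 2)" for n
  have pos: "0 < t / (real n + 2)" "t / (real n + 2) \<le> t" for n
    using t by (auto simp: field_simps)
  have s: "0 \<le> s n" "s n < t" "s n \<in> {0..T}" for n
    using pos[of n] t by (auto simp: s_def)
  have lim: "s \<longlonglongrightarrow> t"
  proof -
    have "(\<lambda>n. t / (real n + 2)) \<longlonglongrightarrow> 0" by real_asymp
    from tendsto_diff[OF tendsto_const[of t] this] show ?thesis by (simp add: s_def[abs_def])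
  qed
  have "X (s n) \<in> borel_measurable (raw_flt t)" for n
    by (rule measurable_mono_sets[OF X_flt[OF s(3)] flt_raw_flt[OF s(2)]]) simp
  then have m: "(\<lambda>w. lim (\<lambda>n. X (s n) w)) \<in> borel_measurable (raw_flt t)"
    by (rule borel_measurable_lim_metric)
  show ?thesis
  proof (rule AE_equal_measurable_raw_flt[OF m])
    show "AE w in M. X t w = lim (\<lambda>n. X (s n) w)"
      using path(3)
    proof eventually_elim
      case (elim w)
      have "(\<lambda>n. X (s n) w) \<longlonglongrightarrow> X t w"
        by (rule continuous_on_tendsto_compose[OF elim lim]) (use t in_I s(3) in \<open>auto intro!: always_eventually\<close>)
      then show ?case by (simp add: limI)
    qed
  qed
qed

lemma drift_eq:
  assumes "t \<in> {0..T}"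
  shows "AE w in M. drift t w = (cA d + cB d ** \<Theta> t) *v (X t w - Z t w) + mdrift t w"
  using feedback[OF in_I[OF assms]]
  by eventually_elim
     (simp only: drift_def mdrift_def, simp add: hatA_def matrix_vector_mul_assoc[symmetric] algebra_simps)

lemma diff_eq:
  assumes "t \<in> {0..T}"
  shows "AE w in M. diff t w = (cC d + cD d ** \<Theta> t) *v (X t w - Z t w)
    + (hatC d *v Z t w + cD d *v (\<Theta>b t *v Z t w + \<theta> t) + csigma d)"
  using feedback[OF in_I[OF assms]]
  by eventually_elim
     (simp only: diff_def, simp add: hatC_def matrix_vector_mul_assoc[symmetric] algebra_simps)

lemma diff0_eq: "diff0 t w = cG d *v (X t w - Z t w) + mdiff0 t w"
  by (simp add: diff0_def mdiff0_def hatG_def algebra_simps)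

lemma drift_enlarged:
  assumes t: "t \<in> {0<..T}"
  shows "drift t \<in> borel_measurable (enlarged t)"
proof -
  have t': "t \<in> {0..T}" using t by auto
  have "drift t \<in> borel_measurable (raw_flt t)"
  proof (rule AE_equal_measurable_raw_flt[OF _ drift_eq[OF t']])
    show "(\<lambda>w. (cA d + cB d ** \<Theta> t) *v (X t w - Z t w) + mdrift t w) \<in> borel_measurable (raw_flt t)"
      unfolding mdrift_def
      by (intro borel_measurable_add borel_measurable_diff measurable_const_matrix_mult X_raw_flt[OF t] Z_raw_flt[OF t'] borel_measurable_const)
  qed
  then show ?thesis by (rule measurable_mono_sets[OF _ raw_flt_enlarged]) simp
qed

lemma mdrift_measurable:
  assumes t: "t \<le> T" and N: "space N = space M" "(\<lambda>(s, w). Z s w) \<in> borel_measurable (time_measure t \<Otimes>\<^sub>M N)"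
  shows "(\<lambda>(s, w). mdrift s w) \<in> borel_measurable (time_measure t \<Otimes>\<^sub>M N)"
proof -
  have c: "continuous_on {0..t} \<Theta>b" "continuous_on {0..t} \<theta>"
    using cont t by (auto elim: continuous_on_subset)
  have 1: "(\<lambda>z. \<Theta>b (fst z)) \<in> borel_measurable (time_measure t \<Otimes>\<^sub>M N)" "(\<lambda>z. \<theta> (fst z)) \<in> borel_measurable (time_measure t \<Otimes>\<^sub>M N)"
    by (rule measurable_compose[OF measurable_fst continuous_time_measurable[OF c(1)]],
        rule measurable_compose[OF measurable_fst continuous_time_measurable[OF c(2)]])
  have 2: "(\<lambda>z. Z (fst z) (snd z)) \<in> borel_measurable (time_measure t \<Otimes>\<^sub>M N)" using N(2) by (simp add: case_prod_unfold)
  show ?thesis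
    unfolding mdrift_def case_prod_unfold
    by (intro borel_measurable_add measurable_const_matrix_mult measurable_matrix_vector_mult 1 2 borel_measurable_const)
qed

lemma mdrift_path: "sqint (path_measure T) (\<lambda>(s, w). mdrift s w)"
proof -
  obtain kk where kk: "kk > 0" "\<And>(A::real^'n^'m) x. norm (A *v x) \<le> norm A * norm x * kk"
    using bounded_bilinear.pos_bounded[OF bounded_bilinear_matrix_vector_mult] by metis
  obtain k1 where k1: "k1 > 0" "\<And>t. t \<in> {0..T} \<Longrightarrow> norm (\<Theta>b t) \<le> k1"
    using compact_imp_bounded[OF compact_continuous_image[OF cont(1) compact_Icc]]
    unfolding bounded_pos by (metis imageI)
  obtain k2 where k2: "k2 > 0" "\<And>t. t \<in> {0..T} \<Longrightarrow> norm (\<theta> t) \<le> k2"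
    using compact_imp_bounded[OF compact_continuous_image[OF cont(2) compact_Icc]]
    unfolding bounded_pos by (metis imageI)
  have 1: "(\<lambda>z. \<Theta>b (fst z)) \<in> borel_measurable (path_measure T)" "(\<lambda>z. \<theta> (fst z)) \<in> borel_measurable (path_measure T)"
    by (rule measurable_compose[OF measurable_fst continuous_time_measurable[OF cont(1)]],
        rule measurable_compose[OF measurable_fst continuous_time_measurable[OF cont(2)]])
  have 2: "(\<lambda>z. Z (fst z) (snd z)) \<in> borel_measurable (path_measure T)" using Z_path_measurable by (simp add: case_prod_unfold)
  have Zs: "sqint (path_measure T) (\<lambda>z. Z (fst z) (snd z))" using ZT by (simp add: case_prod_unfold)
  have tb: "sqint (path_measure T) (\<lambda>z. \<Theta>b (fst z) *v Z (fst z) (snd z))"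
  proof (rule sqint_bound)
    show "(\<lambda>z. \<Theta>b (fst z) *v Z (fst z) (snd z)) \<in> borel_measurable (path_measure T)"
      by (rule measurable_matrix_vector_mult[OF 1(1) 2])
    show "integrable (path_measure T) (\<lambda>z. (k1 * kk)\<^sup>2 * (norm (Z (fst z) (snd z)))\<^sup>2)"
      using sqint_integrable_sq[OF Zs] by simp
    show "AE z in path_measure T. (norm (\<Theta>b (fst z) *v Z (fst z) (snd z)))\<^sup>2 \<le> (k1 * kk)\<^sup>2 * (norm (Z (fst z) (snd z)))\<^sup>2"
    proof (rule AE_I2)
      fix z assume "z \<in> space (path_measure T)"
      then have "fst z \<in> {0..T}" by (auto simp: space_pair_measure)
      then have "norm (\<Theta>b (fst z)) * norm (Z (fst z) (snd z)) * kk \<le> k1 * norm (Z (fst z) (snd z)) * kk"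
        using k1 kk(1) by (intro mult_right_mono) auto
      then have "norm (\<Theta>b (fst z) *v Z (fst z) (snd z)) \<le> (k1 * kk) * norm (Z (fst z) (snd z))"
        using kk(2)[of "\<Theta>b (fst z)" "Z (fst z) (snd z)"] by (simp add: mult_ac)
      from power_mono[OF this norm_ge_zero, of 2]
      show "(norm (\<Theta>b (fst z) *v Z (fst z) (snd z)))\<^sup>2 \<le> (k1 * kk)\<^sup>2 * (norm (Z (fst z) (snd z)))\<^sup>2"
        by (simp add: power_mult_distrib)
    qed
  qed
  interpret P: finite_measure "path_measure T" by (rule finite_path_measure)
  have t\<theta>: "sqint (path_measure T) (\<lambda>z. \<theta> (fst z))"
  proof (rule sqint_bound[OF 1(2)])
    show "integrable (path_measure T) (\<lambda>z. k2\<^sup>2)" by simp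
    show "AE z in path_measure T. (norm (\<theta> (fst z)))\<^sup>2 \<le> k2\<^sup>2"
      by (rule AE_I2) (use k2 in \<open>auto simp: space_pair_measure intro!: power_mono\<close>)
  qed
  show ?thesis
    using sqint_add[OF sqint_add[OF sqint_mult_mat[OF Zs] sqint_mult_mat[OF sqint_add[OF tb t\<theta>]]] sqint_path_const_vec]
    by (simp add: mdrift_def case_prod_unfold)
qed

lemma mdrift_flt0: "t \<in> {0..T} \<Longrightarrow> mdrift t \<in> borel_measurable (flt0 t)"
  unfolding mdrift_def[abs_def]
  by (intro borel_measurable_add measurable_const_matrix_mult Z_flt0 borel_measurable_const)

lemma sqint_mdrift: "t \<in> {0..T} \<Longrightarrow> sqint M (mdrift t)"
  unfolding mdrift_def[abs_def] by (intro sqint_add sqint_mult_mat sqint_Z sqint_const)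

lemma mdiff0_flt0: "t \<in> {0..T} \<Longrightarrow> mdiff0 t \<in> borel_measurable (flt0 t)"
  unfolding mdiff0_def[abs_def] by (intro borel_measurable_add measurable_const_matrix_mult Z_flt0 borel_measurable_const)

lemma sqint_mdiff0: "t \<in> {0..T} \<Longrightarrow> sqint M (mdiff0 t)"
  unfolding mdiff0_def[abs_def] by (intro sqint_add sqint_mult_mat sqint_Z sqint_const)

text \<open>Conditioning on the common noise up to \<open>t\<close> acts on the drift at
  \<open>s\<close> like conditioning up to \<open>s\<close>, where only \<open>mdrift\<close>
  remains; testing against known variables and exchanging integrals gives the claim for the time
  integral.\<close>

lemma vec_cond_exp_drift_integral:
  assumes t: "t \<in> {0..T}"
  shows "AE w in M. vec_cond_exp M (flt0 t) (\<lambda>w. \<integral>s. drift s w \<partial>time_measure t) w = (\<integral>s. mdrift s w \<partial>time_measure t)"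
proof -
  interpret F: finite_measure_subalgebra M "flt0 t" by (rule finite_subalgebra[OF subalg_flt0])
  interpret tt: pair_sigma_finite "time_measure t" M by (rule pair_time)
  have t0: "0 \<le> t" "t \<le> T" using t by auto
  note \<beta> = sqint_path_restrict(1)[OF drift_path t0(2)] and m\<beta> = sqint_path_restrict(1)[OF mdrift_path t0(2)]
  show ?thesis
  proof (rule F.vec_cond_exp_charact[OF sqint_time_integral(1)[OF \<beta> t0(1)] sqint_time_integral(1)[OF m\<beta> t0(1)]])
    \<comment> \<open>Progressive measurability with respect to \<open>flt0\<close> is essential
      here: it makes the time integral up to \<open>t\<close> measurable for
      \<open>flt0 t\<close>.\<close>
    have "(\<lambda>(s, w). Z s w) \<in> borel_measurable (restrict_space borel {0..t} \<Otimes>\<^sub>M flt0 t)"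
      using path(4) in_I[OF t] by (simp add: progressive_def)
    then have "(\<lambda>(s, w). Z s w) \<in> borel_measurable (time_measure t \<Otimes>\<^sub>M flt0 t)"
      using measurable_cong_sets[OF sets_pair_measure_cong[OF sets_time_measure refl] refl] by blast
    from measurable_pair_swap[OF mdrift_measurable[OF t0(2) _ this]]
    have "(\<lambda>(w, s). mdrift s w) \<in> borel_measurable (flt0 t \<Otimes>\<^sub>M time_measure t)" by (simp add: case_prod_unfold)
    then show "(\<lambda>w. \<integral>s. mdrift s w \<partial>time_measure t) \<in> borel_measurable (flt0 t)"
      by (rule tt.M1.borel_measurable_lebesgue_integral)
    fix \<zeta> :: "'w \<Rightarrow> real^'n" assume \<zeta>: "sqint M \<zeta>" "\<zeta> \<in> borel_measurable (flt0 t)"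
    have "(\<integral>s. (\<integral>w. \<zeta> w \<bullet> mdrift s w \<partial>M) \<partial>time_measure t) = (\<integral>s. (\<integral>w. \<zeta> w \<bullet> drift s w \<partial>M) \<partial>time_measure t)"
    proof (rule integral_cong_AE)
      show "(\<lambda>s. \<integral>w. \<zeta> w \<bullet> mdrift s w \<partial>M) \<in> borel_measurable (time_measure t)"
        "(\<lambda>s. \<integral>w. \<zeta> w \<bullet> drift s w \<partial>M) \<in> borel_measurable (time_measure t)"
        using time_integral_inner(2)[OF \<zeta>(1) m\<beta> t0(1)] time_integral_inner(2)[OF \<zeta>(1) \<beta> t0(1)] by simp_all
      have pos: "AE s in time_measure t. 0 < s \<and> s \<le> t" by (rule AE_time_measure_pos) simp
      show "AE s in time_measure t. (\<integral>w. \<zeta> w \<bullet> mdrift s w \<partial>M) = (\<integral>w. \<zeta> w \<bullet> drift s w \<partial>M)"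
        using pos sqint_section[OF \<beta>]
      proof eventually_elim
        case (elim s)
        then have s: "s \<in> {0<..T}" "s \<in> {0..T}" "s \<le> t" and b: "sqint M (drift s)" using t0 by auto
        have "AE w in M. mdrift s w = vec_cond_exp M (flt0 t) (drift s) w"
          using vec_cond_exp_later[OF b drift_enlarged[OF s(1)] s(3)]
            vec_cond_exp_fluctuation[OF s(2) b sqint_mdrift[OF s(2)] mdrift_flt0[OF s(2)] drift_eq[OF s(2)]]
          by eventually_elim simp
        then have "(\<integral>w. \<zeta> w \<bullet> mdrift s w \<partial>M) = (\<integral>w. \<zeta> w \<bullet> vec_cond_exp M (flt0 t) (drift s) w \<partial>M)"
          by (intro integral_cong_AE borel_measurable_inner sqint_measurable \<zeta> sqint_mdrift[OF s(2)] F.sqint_vec_cond_exp b)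
             (auto elim!: eventually_mono)
        then show ?case using F.vec_cond_exp_inner[OF b \<zeta>] by simp
      qed
    qed
    then show "(\<integral>w. \<zeta> w \<bullet> (\<integral>s. mdrift s w \<partial>time_measure t) \<partial>M) = (\<integral>w. \<zeta> w \<bullet> (\<integral>s. drift s w \<partial>time_measure t) \<partial>M)"
      by (simp add: time_integral_inner(1)[OF \<zeta>(1) m\<beta> t0(1)] time_integral_inner(1)[OF \<zeta>(1) \<beta> t0(1)])
  qed
qed

text \<open>The state equation is projected term by term: the initial state becomes its mean, the
  drift integral that of \<open>mdrift\<close>, the integral against \<open>W\<close> disappears,
  and the one against \<open>W0\<close> keeps its form with projected integrand.\<close>

lemma l2_ito_Z: "l2_ito T (\<lambda>w. \<integral>w. \<xi> w \<partial>M) mdrift (\<lambda>s w. 0) mdiff0 Z"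
  unfolding l2_ito_def
proof (intro conjI ballI mdrift_path ZT sqint_const sqint_Z)
  show "mdrift s \<in> borel_measurable (flt s)" if "s \<in> {0<..T}" for s
    by (rule measurable_mono_sets[OF mdrift_flt0 order_trans[OF flt0_raw_flt raw_flt_flt]]) (use that in auto)
  fix t assume t: "t \<in> {0..T}"
  then have t0: "0 \<le> t" "t \<le> T" by auto
  interpret F: finite_measure_subalgebra M "flt0 t" by (rule finite_subalgebra[OF subalg_flt0])
  obtain J J0 where J: "ito_int W diff t J" "ito_int W0 diff0 t J0"
    "AE w in M. X t w = \<xi> w + (\<integral>s. drift s w \<partial>time_measure t) + J w + J0 w"
    using l2_ito_X t unfolding l2_ito_def by blast
  have sI: "sqint M (\<lambda>w. \<integral>s. drift s w \<partial>time_measure t)"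
    by (rule sqint_time_integral(1)[OF sqint_path_restrict(1)[OF drift_path t0(2)] t0(1)])
  note s\<xi> = L4_F0_sqint(2)[OF \<xi>] and sJ = ito_sqint(1)[OF J(1)] and sJ0 = ito_sqint(1)[OF J(2)]
  have K: "ito_int W0 mdiff0 t (vec_cond_exp M (flt0 t) J0)"
  proof (rule ito_projection[OF J(2) t0(1) sqint_path_restrict(1)[OF mdiff0_path t0(2)]])
    fix s assume "0 < s" "s \<le> t"
    then have s: "s \<in> {0..T}" using t0 by auto
    have "sqint M (diff0 s)"
      unfolding diff0_def[abs_def] by (intro sqint_add sqint_mult_mat sqint_X sqint_Z s sqint_const)
    from vec_cond_exp_fluctuation[OF s this sqint_mdiff0[OF s] mdiff0_flt0[OF s] AE_I2[OF diff0_eq]]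
    show "AE w in M. mdiff0 s w = vec_cond_exp M (flt0 s) (diff0 s) w" by eventually_elim simp
  qed
  have J0z: "AE w in M. vec_cond_exp M (flt0 t) J w = 0"
    by (rule F.vec_cond_exp_charact[OF sJ]) (simp_all add: ito_orthogonal_flt0[OF J(1) t0(1)])
  have c: "AE w in M. vec_cond_exp M (flt0 t) (X t) w
      = vec_cond_exp M (flt0 t) (\<lambda>w. \<xi> w + (\<integral>s. drift s w \<partial>time_measure t) + J w + J0 w) w"
    by (rule F.vec_cond_exp_cong[OF J(3)]) (intro sqint_measurable sqint_X[OF t] sqint_add s\<xi> sI sJ sJ0)+
  have "AE w in M. Z t w = (\<integral>w. \<xi> w \<partial>M) + (\<integral>s. mdrift s w \<partial>time_measure t) + 0 + vec_cond_exp M (flt0 t) J0 w"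
    using path(5)[OF in_I[OF t]] c F.vec_cond_exp_add[OF sqint_add[OF sqint_add[OF s\<xi> sI] sJ] sJ0]
      F.vec_cond_exp_add[OF sqint_add[OF s\<xi> sI] sJ] F.vec_cond_exp_add[OF s\<xi> sI]
      vec_cond_exp_F0[OF L4_F0_sqint[OF \<xi>], of t] vec_cond_exp_drift_integral[OF t] J0z
    by eventually_elim simp
  then show "\<exists>J J0. ito_int W (\<lambda>s w. 0) t J \<and> ito_int W0 mdiff0 t J0 \<and>
      (AE w in M. Z t w = (\<integral>w. \<xi> w \<partial>M) + (\<integral>s. mdrift s w \<partial>time_measure t) + J w + J0 w)"
    using K ito_zero[of W t] by blast
qed simp_all

end

section \<open>Energy estimates\<close>

lemma young_inner_bound:
  fixes u w :: "'a::real_inner" and x :: "'b::real_normed_vector" and y :: "'c::real_normed_vector"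
  assumes u: "norm u \<le> a * norm x" and w: "norm w \<le> b * norm y" and pos: "0 \<le> a" "0 \<le> b" "0 < \<eta>"
  shows "2 * (u \<bullet> w) \<le> \<eta> * (norm x)\<^sup>2 + (a * b)\<^sup>2 / \<eta> * (norm y)\<^sup>2"
proof -
  have "u \<bullet> w \<le> norm u * norm w" by (rule norm_cauchy_schwarz)
  also have "\<dots> \<le> (a * norm x) * (b * norm y)" using u w pos by (intro mult_mono) auto
  finally have 1: "u \<bullet> w \<le> norm x * (a * b * norm y)" by (simp add: mult_ac)
  have "0 \<le> (\<eta> * norm x - a * b * norm y)\<^sup>2 / \<eta>" using pos by simp
  also have "\<dots> = \<eta> * (norm x)\<^sup>2 + (a * b)\<^sup>2 / \<eta> * (norm y)\<^sup>2 - 2 * (norm x * (a * b * norm y))"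
    using pos by (simp add: power2_eq_square field_simps)
  finally show ?thesis using 1 by linarith
qed

text \<open>Each of the three cross terms is split by Young's inequality with weight
  \<open>\<epsilon> / 6\<close>, so half of the dissipation survives.\<close>

lemma perturbed_lyapunov:
  fixes N P F G H :: "real^'n^'n"
  assumes sym: "symmetric_mat N" "symmetric_mat P" and \<epsilon>: "\<epsilon> > 0"
    and base: "\<And>x. 2 * ((N *v x) \<bullet> (F *v x)) + (H *v x) \<bullet> (P *v (H *v x)) + (G *v x) \<bullet> (N *v (G *v x))
      \<le> - \<epsilon> * (norm x)\<^sup>2"
  shows "\<exists>k>0. \<forall>x r1 r2 r3. 2 * ((N *v x) \<bullet> (F *v x + r1)) + (H *v x + r2) \<bullet> (P *v (H *v x + r2))
      + (G *v x + r3) \<bullet> (N *v (G *v x + r3)) \<le> - (\<epsilon> / 2) * (norm x)\<^sup>2 + k * ((norm r1)\<^sup>2 + (norm r2)\<^sup>2 + (norm r3)\<^sup>2)"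
proof -
  obtain kn where kn: "kn > 0" "\<And>x. norm (N *v x) \<le> kn * norm x" using matrix_bound[of N] by blast
  obtain kp where kp: "kp > 0" "\<And>x. norm (P *v x) \<le> kp * norm x" using matrix_bound[of P] by blast
  obtain kh where kh: "kh > 0" "\<And>x. norm (H *v x) \<le> kh * norm x" using matrix_bound[of H] by blast
  obtain kg where kg: "kg > 0" "\<And>x. norm (G *v x) \<le> kg * norm x" using matrix_bound[of G] by blast
  define k1 where "k1 = (kn * 1)\<^sup>2 / (\<epsilon> / 6)"
  define k2 where "k2 = (kh * kp)\<^sup>2 / (\<epsilon> / 6) + kp"
  define k3 where "k3 = (kg * kn)\<^sup>2 / (\<epsilon> / 6) + kn"
  have pos: "0 < k1" "0 < k2" "0 < k3" using kn kp kh kg \<epsilon> by (auto simp: k1_def k2_def k3_def intro!: add_nonneg_pos)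
  show ?thesis
  proof (intro exI[of _ "k1 + k2 + k3"] conjI allI)
    show "0 < k1 + k2 + k3" using pos by simp
    fix x r1 r2 r3
    have q: "r \<bullet> (V *v r) \<le> k * (norm r)\<^sup>2" if "norm (V *v r) \<le> k * norm r" for V :: "real^'n^'n" and r k
    proof -
      have "r \<bullet> (V *v r) \<le> norm r * norm (V *v r)" by (rule norm_cauchy_schwarz)
      also have "\<dots> \<le> norm r * (k * norm r)" by (intro mult_left_mono that) simp
      finally show ?thesis by (simp add: power2_eq_square mult_ac)
    qed
    have e: "2 * ((N *v x) \<bullet> r1) \<le> \<epsilon> / 6 * (norm x)\<^sup>2 + k1 * (norm r1)\<^sup>2"
      "2 * ((H *v x) \<bullet> (P *v r2)) \<le> \<epsilon> / 6 * (norm x)\<^sup>2 + (kh * kp)\<^sup>2 / (\<epsilon> / 6) * (norm r2)\<^sup>2"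
      "2 * ((G *v x) \<bullet> (N *v r3)) \<le> \<epsilon> / 6 * (norm x)\<^sup>2 + (kg * kn)\<^sup>2 / (\<epsilon> / 6) * (norm r3)\<^sup>2"
      unfolding k1_def using kn kp kh kg \<epsilon> by (intro young_inner_bound; simp)+
    have "k1 * (norm r1)\<^sup>2 \<le> (k1 + k2 + k3) * (norm r1)\<^sup>2" "k2 * (norm r2)\<^sup>2 \<le> (k1 + k2 + k3) * (norm r2)\<^sup>2"
      "k3 * (norm r3)\<^sup>2 \<le> (k1 + k2 + k3) * (norm r3)\<^sup>2"
      using pos by (intro mult_right_mono; simp)+
    moreover have "2 * ((N *v x) \<bullet> (F *v x + r1)) + (H *v x + r2) \<bullet> (P *v (H *v x + r2)) + (G *v x + r3) \<bullet> (N *v (G *v x + r3))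
       = (2 * ((N *v x) \<bullet> (F *v x)) + (H *v x) \<bullet> (P *v (H *v x)) + (G *v x) \<bullet> (N *v (G *v x)))
       + 2 * ((N *v x) \<bullet> r1) + 2 * ((H *v x) \<bullet> (P *v r2)) + 2 * ((G *v x) \<bullet> (N *v r3)) + r2 \<bullet> (P *v r2) + r3 \<bullet> (N *v r3)"
      using symmetric_mat_inner[OF sym(2), of "H *v x" r2] symmetric_mat_inner[OF sym(1), of "G *v x" r3]
      by (simp add: matrix_vector_right_distrib inner_add_left inner_add_right inner_commute[of r2] inner_commute[of r3])
    ultimately show "2 * ((N *v x) \<bullet> (F *v x + r1)) + (H *v x + r2) \<bullet> (P *v (H *v x + r2)) + (G *v x + r3) \<bullet> (N *v (G *v x + r3))
       \<le> - (\<epsilon> / 2) * (norm x)\<^sup>2 + (k1 + k2 + k3) * ((norm r1)\<^sup>2 + (norm r2)\<^sup>2 + (norm r3)\<^sup>2)"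
      using base[of x] e q[OF kp(2), of r2] q[OF kn(2), of r3]
      by (simp add: distrib_left k2_def[symmetric] k3_def[symmetric]) (simp add: k2_def k3_def distrib_right)
  qed
qed

text \<open>The forward counterpart of \<open>decaying_forcing\<close>: the perturbation grows
  towards \<open>T\<close>. The constant is fixed before \<open>T\<close> and \<open>v0\<close>, and
  \<open>v0\<close> enters only through the decaying term.\<close>

lemma closing_forcing:
  fixes a c K :: real
  assumes pos: "a > 0" "c > 0" "K > 0"
  shows "\<exists>k>0. \<forall>T v g v0. 0 \<le> v0 \<longrightarrow> (\<forall>t\<in>{0..T}. (g has_integral (v t - v 0)) {0..t}) \<longrightarrow>
     (\<forall>t\<in>{0<..T}. g t \<le> (- a + K * exp (- c * (T - t))) * v t + K * exp (- c * (T - t))) \<longrightarrow> v 0 \<le> v0 \<longrightarrow>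
     (\<forall>t\<in>{0..T}. v t \<le> k * (v0 * exp (- a * t) + exp (- c * (T - t))))"
proof -
  \<comment> \<open>The term \<open>k' * e s\<close> grows at rate \<open>c\<close>, which produces
    \<open>(K + 1) * e s\<close> and strictly beats the additive forcing.\<close>
  define k' where "k' = (K + 1) / c"
  define k where "k = (1 + k') * exp (K / c)"
  have k': "k' > 0" using pos by (simp add: k'_def)
  show ?thesis
  proof (intro exI[of _ k] conjI allI impI ballI)
    show "k > 0" using k' by (simp add: k_def)
    fix T v0 t :: real and v g :: "real \<Rightarrow> real"
    assume v0: "0 \<le> v0" and int: "\<forall>t\<in>{0..T}. (g has_integral (v t - v 0)) {0..t}"
      and le: "\<forall>t\<in>{0<..T}. g t \<le> (- a + K * exp (- c * (T - t))) * v t + K * exp (- c * (T - t))"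
      and init: "v 0 \<le> v0" and t: "t \<in> {0..T}"
    define e where "e s = exp (- c * (T - s))" for s
    \<comment> \<open>An integrating factor with logarithmic derivative \<open>K * e s\<close>. It
      stays between 1 and \<open>exp (K / c)\<close> on the horizon, whatever \<open>T\<close>
      is.\<close>
    define m where "m s = exp (K / c * e s)" for s
    define w where "w s = m s * (v0 * exp (- a * s) + k' * e s)" for s
    define w' where "w' s = K * e s * w s + m s * (- a * v0 * exp (- a * s) + c * k' * e s)" for s
    have e: "0 < e s" for s by (simp add: e_def)
    have m: "1 \<le> m s" for s using pos e[of s] by (simp add: m_def)
    have "v t < w t"
    proof (rule scalar_comparison[where g = g and w' = w' and \<phi> = "\<lambda>s. - a + K * e s" and \<psi> = "\<lambda>s. K * e s", OF _ _ _ _ _ _ _ _ t])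
      show "(g has_integral (v s - v 0)) {0..s}" if "s \<in> {0..T}" for s using int that by blast
      show "(w has_real_derivative w' s) (at s within {0..T})" for s
        unfolding w_def[abs_def] w'_def m_def e_def
        by (rule derivative_eq_intros refl | simp)+ (use pos in \<open>simp add: field_simps\<close>)
      show "continuous_on {0..T} w'" "continuous_on {0..T} (\<lambda>s. - a + K * e s)" "continuous_on {0..T} (\<lambda>s. K * e s)"
        unfolding w'_def[abs_def] w_def m_def e_def by (intro continuous_intros)+
      show "g s \<le> (- a + K * e s) * v s + K * e s" if "s \<in> {0<..T}" for s using le that by (simp add: e_def)
      show "(- a + K * e s) * w s + K * e s < w' s" for s
      proof -
        have "K * e s < (K + 1) * e s" using e[of s] by simp
        also have "\<dots> = 1 * (c * k' * e s)" using pos by (simp add: k'_def)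
        also have "\<dots> \<le> m s * ((a + c) * k' * e s)"
          using m[of s] pos k' e[of s] by (intro mult_mono) (auto intro: mult_right_mono)
        finally have "K * e s < m s * ((a + c) * k' * e s)" .
        then show ?thesis by (simp add: w'_def w_def algebra_simps)
      qed
      have "v0 < v0 + k' * e 0" using k' e by simp
      also have "\<dots> \<le> m 0 * (v0 + k' * e 0)"
        using mult_right_mono[OF m[of 0], of "v0 + k' * e 0"] v0 k' e[of 0] by simp
      finally show "v 0 < w 0" using init by (simp add: w_def)
    qed
    also have "w t \<le> exp (K / c) * ((1 + k') * (v0 * exp (- a * t) + e t))"
      unfolding w_def
    proof (rule mult_mono)
      have "e t \<le> 1" using t pos by (simp add: e_def)
      then have "K / c * e t \<le> K / c * 1" using pos by (intro mult_left_mono) auto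
      then show "m t \<le> exp (K / c)" by (simp add: m_def)
      have "0 \<le> v0 * exp (- a * t)" "0 \<le> k' * (v0 * exp (- a * t))" "0 < e t" using v0 k' e by auto
      then show "v0 * exp (- a * t) + k' * e t \<le> (1 + k') * (v0 * exp (- a * t) + e t)"
        "0 \<le> v0 * exp (- a * t) + k' * e t"
        using k' by (simp_all add: distrib_left distrib_right)
    qed simp
    finally show "v t \<le> k * (v0 * exp (- a * t) + exp (- c * (T - t)))"
      by (simp add: k_def e_def mult_ac)
  qed
qed

text \<open>The dissipation is re-expressed through the form of \<open>Pib\<close>, so that the
  energy identity becomes a scalar differential inequality for the energy itself.\<close>

lemma closed_loop_constants:
  fixes d :: "('n::finite, 'm::finite) lq_data"
  assumes R: "pd_mat (cR d)" and P: "psd_mat P" and Pib: "pd_mat Pib" and alg: "Psi2 d P Pib = 0"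
    and Q: "pd_mat (hatQ d - transpose (cS d) ** matrix_inv (cR d) ** cS d)"
  defines "\<Theta>b \<equiv> Theta_bar d P Pib"
  shows "\<exists>\<kappa>>0. \<exists>k>0. \<forall>x r1 r2 r3. 2 * ((Pib *v x) \<bullet> ((hatA d + cB d ** \<Theta>b) *v x + r1))
      + ((hatC d + cD d ** \<Theta>b) *v x + r2) \<bullet> (P *v ((hatC d + cD d ** \<Theta>b) *v x + r2))
      + (hatG d *v x + r3) \<bullet> (Pib *v (hatG d *v x + r3))
      \<le> - \<kappa> * (x \<bullet> (Pib *v x)) + k * ((norm r1)\<^sup>2 + (norm r2)\<^sup>2 + (norm r3)\<^sup>2)"
proof -
  have pib: "psd_mat Pib" "symmetric_mat Pib" "symmetric_mat P" using Pib P by auto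
  obtain \<epsilon> where \<epsilon>: "\<epsilon> > 0" "\<And>x. 2 * ((Pib *v x) \<bullet> (hatA d *v x + cB d *v (\<Theta>b *v x)))
     + (hatC d *v x + cD d *v (\<Theta>b *v x)) \<bullet> (P *v (hatC d *v x + cD d *v (\<Theta>b *v x)))
     + (hatG d *v x) \<bullet> (Pib *v (hatG d *v x)) \<le> - \<epsilon> * (norm x)\<^sup>2"
    using closed_loop_lyapunov[OF R P pib(1) alg Q] unfolding \<Theta>b_def by metis
  have base: "2 * ((Pib *v x) \<bullet> ((hatA d + cB d ** \<Theta>b) *v x)) + ((hatC d + cD d ** \<Theta>b) *v x) \<bullet> (P *v ((hatC d + cD d ** \<Theta>b) *v x))
     + (hatG d *v x) \<bullet> (Pib *v (hatG d *v x)) \<le> - \<epsilon> * (norm x)\<^sup>2" for x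
    using \<epsilon>(2)[of x] by (simp add: matrix_vector_mult_add_rdistrib matrix_vector_mul_assoc)
  obtain k where k: "k > 0" "\<And>x r1 r2 r3. 2 * ((Pib *v x) \<bullet> ((hatA d + cB d ** \<Theta>b) *v x + r1))
      + ((hatC d + cD d ** \<Theta>b) *v x + r2) \<bullet> (P *v ((hatC d + cD d ** \<Theta>b) *v x + r2))
      + (hatG d *v x + r3) \<bullet> (Pib *v (hatG d *v x + r3))
      \<le> - (\<epsilon> / 2) * (norm x)\<^sup>2 + k * ((norm r1)\<^sup>2 + (norm r2)\<^sup>2 + (norm r3)\<^sup>2)"
    using perturbed_lyapunov[OF pib(2,3) \<epsilon>(1) base] by metis
  obtain l where l: "l > 0" "\<And>x. norm (Pib *v x) \<le> l * norm x" using matrix_bound[of Pib] by blast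
  have up: "\<epsilon> / 2 / l * (x \<bullet> (Pib *v x)) \<le> \<epsilon> / 2 * (norm x)\<^sup>2" for x
  proof -
    have "x \<bullet> (Pib *v x) \<le> norm x * norm (Pib *v x)" by (rule norm_cauchy_schwarz)
    also have "\<dots> \<le> norm x * (l * norm x)" by (intro mult_left_mono l) simp
    finally have "x \<bullet> (Pib *v x) \<le> l * (norm x)\<^sup>2" by (simp add: power2_eq_square mult_ac)
    then have "\<epsilon> / 2 / l * (x \<bullet> (Pib *v x)) \<le> \<epsilon> / 2 / l * (l * (norm x)\<^sup>2)"
      using \<epsilon>(1) l(1) by (intro mult_left_mono) auto
    then show ?thesis using l(1) by simp
  qed
  show ?thesis
  proof (rule exI[of _ "\<epsilon> / 2 / l"], intro conjI exI[of _ k] allI)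
    show "0 < \<epsilon> / 2 / l" using \<epsilon>(1) l(1) by simp
    fix x r1 r2 r3
    show "2 * ((Pib *v x) \<bullet> ((hatA d + cB d ** \<Theta>b) *v x + r1))
      + ((hatC d + cD d ** \<Theta>b) *v x + r2) \<bullet> (P *v ((hatC d + cD d ** \<Theta>b) *v x + r2))
      + (hatG d *v x + r3) \<bullet> (Pib *v (hatG d *v x + r3))
      \<le> - (\<epsilon> / 2 / l) * (x \<bullet> (Pib *v x)) + k * ((norm r1)\<^sup>2 + (norm r2)\<^sup>2 + (norm r3)\<^sup>2)"
      using k(2)[of x r1 r2 r3] up[of x] by linarith
  qed (rule k)
qed

section \<open>Orthogonal splitting into known part and fluctuation\<close>

context brownian_basis
begin

abbreviation mean_sq :: "('w \<Rightarrow> 'b::euclidean_space) \<Rightarrow> real" where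
  "mean_sq f \<equiv> (\<integral>w. (norm (f w))\<^sup>2 \<partial>M)"

lemma mean_sq_add:
  "sqint M f \<Longrightarrow> sqint M g \<Longrightarrow> mean_sq (\<lambda>w. f w + g w) \<le> 2 * mean_sq f + 2 * mean_sq g"
  using integral_mono[of M "\<lambda>w. (norm (f w + g w))\<^sup>2" "\<lambda>w. 2 * (norm (f w))\<^sup>2 + 2 * (norm (g w))\<^sup>2"]
  by (simp add: sqint_integrable_sq sqint_add norm_add_sq_le)

lemma mean_sq_mono:
  assumes "sqint M f" "sqint M g" "\<And>w. (norm (f w))\<^sup>2 \<le> k * (norm (g w))\<^sup>2"
  shows "mean_sq f \<le> k * mean_sq g"
  using integral_mono[of M "\<lambda>w. (norm (f w))\<^sup>2" "\<lambda>w. k * (norm (g w))\<^sup>2"] assms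
  by (simp add: sqint_integrable_sq)

definition known :: "'w measure \<Rightarrow> ('w \<Rightarrow> 'b::euclidean_space) \<Rightarrow> bool" where
  "known N f \<longleftrightarrow> sqint M f \<and> f \<in> borel_measurable N"

text \<open>The orthogonal complement of the known variables in mean square. It is stable under
  constant matrices, so every quadratic form in expectation splits into two parts.\<close>

definition fluctuation :: "'w measure \<Rightarrow> ('w \<Rightarrow> 'b::euclidean_space) \<Rightarrow> bool" where
  "fluctuation N f \<longleftrightarrow> sqint M f \<and> (\<forall>g. known N g \<longrightarrow> (\<integral>w. g w \<bullet> f w \<partial>M) = 0)"

lemma known_sqint: "known N f \<Longrightarrow> sqint M f"
  and fluctuation_sqint: "fluctuation N f \<Longrightarrow> sqint M f"
  by (simp_all add: known_def fluctuation_def)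

lemma known_const: "known N (\<lambda>w. c)"
  by (simp add: known_def)

lemma known_add: "known N f \<Longrightarrow> known N g \<Longrightarrow> known N (\<lambda>w. f w + g w)"
  by (auto simp: known_def intro: sqint_add)

lemma known_diff: "known N f \<Longrightarrow> known N g \<Longrightarrow> known N (\<lambda>w. f w - g w)"
  by (auto simp: known_def intro: sqint_diff)

lemma known_mult: "known N f \<Longrightarrow> known N (\<lambda>w. A *v f w)" for A :: "real^'k^'l"
  by (simp add: known_def sqint_mult_mat measurable_const_matrix_mult)

lemma fluctuation_add: "fluctuation N f \<Longrightarrow> fluctuation N g \<Longrightarrow> fluctuation N (\<lambda>w. f w + g w)"
  by (simp add: fluctuation_def sqint_add inner_add_right sqint_inner known_sqint)

lemma fluctuation_diff: "fluctuation N f \<Longrightarrow> fluctuation N g \<Longrightarrow> fluctuation N (\<lambda>w. f w - g w)"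
  by (simp add: fluctuation_def sqint_diff inner_diff_right sqint_inner known_sqint)

lemma fluctuation_mult:
  fixes A :: "real^'k^'l"
  assumes "fluctuation N f"
  shows "fluctuation N (\<lambda>w. A *v f w)"
  unfolding fluctuation_def
proof (intro conjI allI impI)
  show "sqint M (\<lambda>w. A *v f w)" by (rule sqint_mult_mat[OF fluctuation_sqint[OF assms]])
  fix g :: "'w \<Rightarrow> real^'l" assume "known N g"
  from known_mult[OF this] have "(\<integral>w. (transpose A *v g w) \<bullet> f w \<partial>M) = 0"
    using assms unfolding fluctuation_def by blast
  moreover have "(transpose A *v g w) \<bullet> f w = g w \<bullet> (A *v f w)" for w
    using inner_transpose_mult[of "f w" A "g w"] by (simp only: inner_commute)
  ultimately show "(\<integral>w. g w \<bullet> (A *v f w) \<partial>M) = 0" by simp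
qed

lemma fluctuation_known_cross:
  fixes V :: "real^'k^'k"
  assumes f: "fluctuation N f" "fluctuation N f'" and g: "known N g" "known N g'"
    and u: "AE w in M. u w = f w + g w" "AE w in M. u' w = f' w + g' w"
    and m: "u \<in> borel_measurable M" "u' \<in> borel_measurable M"
  shows "(\<integral>w. u w \<bullet> (V *v u' w) \<partial>M) = (\<integral>w. f w \<bullet> (V *v f' w) \<partial>M) + (\<integral>w. g w \<bullet> (V *v g' w) \<partial>M)"
proof -
  note s = f[THEN fluctuation_sqint] g[THEN known_sqint]
  note sv = s[THEN sqint_mult_mat[where A = V]]
  have z: "(\<integral>w. f w \<bullet> (V *v g' w) \<partial>M) = 0" "(\<integral>w. g w \<bullet> (V *v f' w) \<partial>M) = 0"
    using f(1) known_mult[OF g(2), of V] fluctuation_mult[OF f(2), of V] g(1)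
    by (auto simp: fluctuation_def inner_commute[of "f _"])
  have "(\<integral>w. u w \<bullet> (V *v u' w) \<partial>M) = (\<integral>w. (f w + g w) \<bullet> (V *v f' w + V *v g' w) \<partial>M)"
  proof (rule integral_cong_AE)
    show "(\<lambda>w. u w \<bullet> (V *v u' w)) \<in> borel_measurable M"
      by (intro borel_measurable_inner measurable_const_matrix_mult m)
    show "(\<lambda>w. (f w + g w) \<bullet> (V *v f' w + V *v g' w)) \<in> borel_measurable M"
      by (intro borel_measurable_inner sqint_measurable sqint_add s sv)
    show "AE w in M. u w \<bullet> (V *v u' w) = (f w + g w) \<bullet> (V *v f' w + V *v g' w)"
      using u by eventually_elim (simp add: matrix_vector_right_distrib)
  qed
  then show ?thesis
    by (simp add: inner_add_left inner_add_right sqint_inner s sv z)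
qed

text \<open>\<open>P\<close> acts on the full process and \<open>Pib - P\<close> on its known part,
  leaving \<open>P\<close> for fluctuations and \<open>Pib\<close> for means. The known part has no
  diffusion along \<open>W\<close>, so \<open>a'\<close> keeps the weight \<open>P\<close>; this
  matches the term with \<open>hatC\<close> in \<open>mapQ_hat\<close>.\<close>

lemma product_rate:
  fixes P Pib :: "real^'k^'k"
  assumes sym: "symmetric_mat P" "symmetric_mat Pib"
    and fl: "fluctuation N y" "fluctuation N b" "fluctuation N a" "fluctuation N c"
    and kn: "known N z" "known N b'" "known N a'" "known N c'"
    and AE: "AE w in M. U w = y w + z w" "AE w in M. \<beta> w = b w + b' w"
      "AE w in M. \<alpha> w = a w + a' w" "AE w in M. \<alpha>0 w = c w + c' w"
    and m: "U \<in> borel_measurable M" "\<beta> \<in> borel_measurable M" "\<alpha> \<in> borel_measurable M" "\<alpha>0 \<in> borel_measurable M"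
  shows "(\<integral>w. U w \<bullet> (P *v \<beta> w) \<partial>M) + (\<integral>w. \<beta> w \<bullet> (P *v U w) \<partial>M) + (\<integral>w. \<alpha> w \<bullet> (P *v \<alpha> w) \<partial>M)
      + (\<integral>w. \<alpha>0 w \<bullet> (P *v \<alpha>0 w) \<partial>M)
      + ((\<integral>w. z w \<bullet> ((Pib - P) *v b' w) \<partial>M) + (\<integral>w. b' w \<bullet> ((Pib - P) *v z w) \<partial>M)
      + (\<integral>w. c' w \<bullet> ((Pib - P) *v c' w) \<partial>M))
    = (\<integral>w. 2 * ((P *v y w) \<bullet> b w) + a w \<bullet> (P *v a w) + c w \<bullet> (P *v c w) \<partial>M)
      + (\<integral>w. 2 * ((Pib *v z w) \<bullet> b' w) + a' w \<bullet> (P *v a' w) + c' w \<bullet> (Pib *v c' w) \<partial>M)"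
proof -
  note s = fl[THEN fluctuation_sqint] kn[THEN known_sqint]
  note sv = s[THEN sqint_mult_mat[where A = P]] s[THEN sqint_mult_mat[where A = Pib]]
  have d: "(\<integral>w. f w \<bullet> ((Pib - P) *v g w) \<partial>M) = (\<integral>w. f w \<bullet> (Pib *v g w) \<partial>M) - (\<integral>w. f w \<bullet> (P *v g w) \<partial>M)"
    if "sqint M f" "sqint M g" for f g
    using that by (simp add: matrix_vector_mult_diff_rdistrib inner_diff_right sqint_inner sqint_mult_mat)
  have 2: "2 * ((P *v y w) \<bullet> b w) = y w \<bullet> (P *v b w) + b w \<bullet> (P *v y w)"
    "2 * ((Pib *v z w) \<bullet> b' w) = z w \<bullet> (Pib *v b' w) + b' w \<bullet> (Pib *v z w)" for w
    using symmetric_mat_inner[OF sym(1), of "y w" "b w"] symmetric_mat_inner[OF sym(2), of "z w" "b' w"]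
    by (simp_all add: inner_commute)
  show ?thesis
    unfolding fluctuation_known_cross[OF fl(1,2) kn(1,2) AE(1,2) m(1,2)] fluctuation_known_cross[OF fl(2,1) kn(2,1) AE(2,1) m(2,1)]
      fluctuation_known_cross[OF fl(3,3) kn(3,3) AE(3,3) m(3,3)] fluctuation_known_cross[OF fl(4,4) kn(4,4) AE(4,4) m(4,4)]
      d[OF s(5,6)] d[OF s(6,5)] d[OF s(8,8)] 2
    by (simp add: sqint_inner s sv)
qed

end

context mean_field_solution
begin

lemma fluctuation_state: "t \<in> {0..T} \<Longrightarrow> fluctuation (flt0 t) (\<lambda>w. X t w - Z t w)"
  by (simp add: fluctuation_def known_def sqint_diff sqint_X sqint_Z fluctuation_orthogonal)

lemma known_mean: "t \<in> {0..T} \<Longrightarrow> known (flt0 t) (Z t)"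
  by (simp add: known_def sqint_Z Z_flt0)

lemma sqint_u:
  assumes "t \<in> {0..T}"
  shows "sqint M (u t)"
proof (rule sqint_cong_AE)
  show "sqint M (\<lambda>w. \<Theta> t *v (X t w - Z t w) + \<Theta>b t *v Z t w + \<theta> t)"
    by (intro sqint_add sqint_mult_mat sqint_diff sqint_X sqint_Z assms sqint_const)
  show "u t \<in> borel_measurable M" by (rule measurable_from_subalg[OF subalg_flt u_flt[OF assms]])
  show "AE w in M. \<Theta> t *v (X t w - Z t w) + \<Theta>b t *v Z t w + \<theta> t = u t w"
    using feedback[OF in_I[OF assms]] by eventually_elim simp
qed

lemma coefficients_measurable:
  assumes "t \<in> {0..T}"
  shows "drift t \<in> borel_measurable M" "diff t \<in> borel_measurable M" "diff0 t \<in> borel_measurable M"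
  unfolding drift_def[abs_def] diff_def[abs_def] diff0_def[abs_def]
  by (intro sqint_measurable sqint_add sqint_mult_mat sqint_X sqint_Z sqint_u assms sqint_const)+

end

text \<open>The two inequalities are the Lyapunov estimates for fluctuation and mean, with room for
  a perturbation of the control and for known forcing terms. A single \<open>K\<close> dominates all
  bounds to keep the later arithmetic short.\<close>

locale closed_loop = brownian_basis M W W0 F0
  for M :: "'w measure" and W W0 F0 +
  fixes d :: "('n::finite, 'm::finite) lq_data" and P Pib :: "real^'n^'n" and \<Theta> \<Theta>b :: "real^'n^'m"
    and \<kappa> K :: real
  assumes \<kappa>: "\<kappa> > 0" and K: "K > 0" and P: "pd_mat P" and Pib: "pd_mat Pib"
    and dissipative: "\<And>x v. 2 * ((P *v x) \<bullet> ((cA d + cB d ** \<Theta>) *v x + cB d *v v))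
        + ((cC d + cD d ** \<Theta>) *v x + cD d *v v) \<bullet> (P *v ((cC d + cD d ** \<Theta>) *v x + cD d *v v))
        + (cG d *v x) \<bullet> (P *v (cG d *v x)) \<le> - \<kappa> * (x \<bullet> (P *v x)) + K * (norm v)\<^sup>2"
      "\<And>x r1 r2 r3. 2 * ((Pib *v x) \<bullet> ((hatA d + cB d ** \<Theta>b) *v x + r1))
        + ((hatC d + cD d ** \<Theta>b) *v x + r2) \<bullet> (P *v ((hatC d + cD d ** \<Theta>b) *v x + r2))
        + (hatG d *v x + r3) \<bullet> (Pib *v (hatG d *v x + r3))
        \<le> - \<kappa> * (x \<bullet> (Pib *v x)) + K * ((norm r1)\<^sup>2 + (norm r2)\<^sup>2 + (norm r3)\<^sup>2)"
    and coercive: "\<And>x. (norm x)\<^sup>2 \<le> K * (x \<bullet> (P *v x))" "\<And>x. (norm x)\<^sup>2 \<le> K * (x \<bullet> (Pib *v x))"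
    and gain: "\<And>x. (norm (\<Theta> *v x))\<^sup>2 \<le> K * (norm x)\<^sup>2" "\<And>x. (norm (\<Theta>b *v x))\<^sup>2 \<le> K * (norm x)\<^sup>2"
      "\<And>v. (norm (cB d *v v))\<^sup>2 \<le> K * (norm v)\<^sup>2" "\<And>v. (norm (cD d *v v))\<^sup>2 \<le> K * (norm v)\<^sup>2"
begin

text \<open>Stated in \<open>U\<close> rather than in the fluctuation \<open>U - Z\<close>, because the product rule applies to \<open>U\<close>; the orthogonality of the two parts makes both forms agree.\<close>

definition energy :: "(real \<Rightarrow> 'w \<Rightarrow> real^'n) \<Rightarrow> (real \<Rightarrow> 'w \<Rightarrow> real^'n) \<Rightarrow> real \<Rightarrow> real" where
  "energy U Z t = (\<integral>w. U t w \<bullet> (P *v U t w) \<partial>M) + (\<integral>w. Z t w \<bullet> ((Pib - P) *v Z t w) \<partial>M)"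

lemma sym: "symmetric_mat P" "symmetric_mat Pib" "psd_mat P" "psd_mat Pib"
  using P Pib by auto

lemma energy_eq:
  assumes y: "fluctuation (flt0 t) (\<lambda>w. U t w - Z t w)" and z: "known (flt0 t) (Z t)" and m: "U t \<in> borel_measurable M"
  shows "energy U Z t = (\<integral>w. (U t w - Z t w) \<bullet> (P *v (U t w - Z t w)) \<partial>M) + (\<integral>w. Z t w \<bullet> (Pib *v Z t w) \<partial>M)"
proof -
  note s = known_sqint[OF z]
  show ?thesis
    unfolding energy_def fluctuation_known_cross[OF y y z z AE_I2 AE_I2 m m, of P, simplified]
    using sqint_inner[OF s sqint_mult_mat[OF s, of P]] sqint_inner[OF s sqint_mult_mat[OF s, of Pib]]
    by (simp add: matrix_vector_mult_diff_rdistrib inner_diff_right)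
qed

lemma energy_bounds:
  assumes y: "fluctuation (flt0 t) (\<lambda>w. U t w - Z t w)" and z: "known (flt0 t) (Z t)" and m: "U t \<in> borel_measurable M"
  shows "0 \<le> energy U Z t" "mean_sq (\<lambda>w. U t w - Z t w) + mean_sq (Z t) \<le> K * energy U Z t"
proof -
  note s = fluctuation_sqint[OF y] known_sqint[OF z]
  note i = sqint_inner[OF s(1) sqint_mult_mat[OF s(1), of P]] sqint_inner[OF s(2) sqint_mult_mat[OF s(2), of Pib]]
  show "0 \<le> energy U Z t"
    unfolding energy_eq[of t U Z, OF assms]
    by (intro add_nonneg_nonneg Bochner_Integration.integral_nonneg psd_mat_nonneg sym)
  have "mean_sq (\<lambda>w. U t w - Z t w) \<le> (\<integral>w. K * ((U t w - Z t w) \<bullet> (P *v (U t w - Z t w))) \<partial>M)"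
    by (intro integral_mono integrable_mult_right i sqint_integrable_sq s coercive)
  moreover have "mean_sq (Z t) \<le> (\<integral>w. K * (Z t w \<bullet> (Pib *v Z t w)) \<partial>M)"
    by (intro integral_mono integrable_mult_right i sqint_integrable_sq s coercive)
  ultimately show "mean_sq (\<lambda>w. U t w - Z t w) + mean_sq (Z t) \<le> K * energy U Z t"
    unfolding energy_eq[of t U Z, OF assms] by (simp add: distrib_left)
qed

text \<open>Abstract because it is used twice: for the ergodic state, where \<open>r1\<close>,
  \<open>r2\<close>, \<open>r3\<close> are constant affine terms, and for the difference of two
  states, where \<open>v\<close>, \<open>r1\<close>, \<open>r2\<close> carry the gain error.\<close>

lemma energy_rate:
  assumes U: "l2_ito T x0 \<beta> \<alpha> \<alpha>0 U" and Z: "l2_ito T z0 \<beta>' (\<lambda>s w. 0) \<alpha>0' Z"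
    and y: "\<And>s. s \<in> {0..T} \<Longrightarrow> fluctuation (flt0 s) (\<lambda>w. U s w - Z s w)"
    and v: "\<And>s. s \<in> {0..T} \<Longrightarrow> fluctuation (flt0 s) (v s)"
    and z: "\<And>s. s \<in> {0..T} \<Longrightarrow> known (flt0 s) (Z s)"
    and r: "\<And>s. s \<in> {0..T} \<Longrightarrow> known (flt0 s) (r1 s)" "\<And>s. s \<in> {0..T} \<Longrightarrow> known (flt0 s) (r2 s)"
      "\<And>s. s \<in> {0..T} \<Longrightarrow> known (flt0 s) (r3 s)"
    and m: "\<And>s. s \<in> {0..T} \<Longrightarrow> \<beta> s \<in> borel_measurable M" "\<And>s. s \<in> {0..T} \<Longrightarrow> \<alpha> s \<in> borel_measurable M"
      "\<And>s. s \<in> {0..T} \<Longrightarrow> \<alpha>0 s \<in> borel_measurable M"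
    and \<beta>: "\<And>s. s \<in> {0..T} \<Longrightarrow> AE w in M. \<beta> s w = ((cA d + cB d ** \<Theta>) *v (U s w - Z s w) + cB d *v v s w) + \<beta>' s w"
    and \<alpha>: "\<And>s. s \<in> {0..T} \<Longrightarrow> AE w in M. \<alpha> s w = ((cC d + cD d ** \<Theta>) *v (U s w - Z s w) + cD d *v v s w)
        + ((hatC d + cD d ** \<Theta>b) *v Z s w + r2 s w)"
    and \<alpha>0: "\<And>s w. s \<in> {0..T} \<Longrightarrow> \<alpha>0 s w = cG d *v (U s w - Z s w) + \<alpha>0' s w"
    and \<beta>': "\<And>s w. s \<in> {0..T} \<Longrightarrow> \<beta>' s w = (hatA d + cB d ** \<Theta>b) *v Z s w + r1 s w"
    and \<alpha>0': "\<And>s w. s \<in> {0..T} \<Longrightarrow> \<alpha>0' s w = hatG d *v Z s w + r3 s w"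
  obtains g where "\<And>t. t \<in> {0..T} \<Longrightarrow> (g has_integral (energy U Z t - energy U Z 0)) {0..t}"
    "\<And>s. s \<in> {0..T} \<Longrightarrow> g s \<le> - \<kappa> * energy U Z s
        + K * (mean_sq (v s) + mean_sq (r1 s) + mean_sq (r2 s) + mean_sq (r3 s))"
    "0 \<le> T \<Longrightarrow> energy U Z 0 = (\<integral>w. x0 w \<bullet> (P *v x0 w) \<partial>M) + (\<integral>w. z0 w \<bullet> ((Pib - P) *v z0 w) \<partial>M)"
proof -
  note PU = l2_ito_bounded_linear[OF U matrix_vector_mul_bounded_linear[of P]]
  note PZ = l2_ito_bounded_linear[OF Z matrix_vector_mul_bounded_linear[of "Pib - P"]]
  define g1 where "g1 s = (\<integral>w. U s w \<bullet> (P *v \<beta> s w) \<partial>M) + (\<integral>w. \<beta> s w \<bullet> (P *v U s w) \<partial>M) + (\<integral>w. \<alpha> s w \<bullet> (P *v \<alpha> s w) \<partial>M)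
      + (\<integral>w. \<alpha>0 s w \<bullet> (P *v \<alpha>0 s w) \<partial>M)" for s
  define g2 where "g2 s = (\<integral>w. Z s w \<bullet> ((Pib - P) *v \<beta>' s w) \<partial>M) + (\<integral>w. \<beta>' s w \<bullet> ((Pib - P) *v Z s w) \<partial>M)
      + (\<integral>w. \<alpha>0' s w \<bullet> ((Pib - P) *v \<alpha>0' s w) \<partial>M)" for s
  define E0 where "E0 = (\<integral>w. x0 w \<bullet> (P *v x0 w) \<partial>M) + (\<integral>w. z0 w \<bullet> ((Pib - P) *v z0 w) \<partial>M)"
  have i1: "integrable (time_measure t) g1" and i2: "integrable (time_measure t) g2" if "t \<in> {0..T}" for t
    using l2_ito_product(2)[OF U PU that] l2_ito_product(2)[OF Z PZ that] by (simp_all add: g1_def[abs_def] g2_def[abs_def])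
  have hi: "((\<lambda>s. g1 s + g2 s) has_integral (energy U Z t - E0)) {0..t}" if t: "t \<in> {0..T}" for t
  proof -
    have "energy U Z t - E0 = (\<integral>s. g1 s \<partial>time_measure t) + (\<integral>s. g2 s \<partial>time_measure t)"
      using l2_ito_product(1)[OF U PU t] l2_ito_product(1)[OF Z PZ t]
      by (simp add: g1_def[abs_def] g2_def[abs_def] energy_def E0_def)
    also have "\<dots> = (LBINT s:{0..t}. g1 s + g2 s)"
      using i1[OF t] i2[OF t] by (simp flip: integral_time_measure(1))
    finally have "energy U Z t - E0 = (LBINT s:{0..t}. g1 s + g2 s)" .
    moreover have "set_integrable lborel {0..t} (\<lambda>s. g1 s + g2 s)"
      using i1[OF t] i2[OF t] by (simp flip: integral_time_measure(2))
    ultimately show ?thesis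
      using set_borel_integral_eq_integral[of "{0..t}" "\<lambda>s. g1 s + g2 s"] by (simp add: has_integral_iff)
  qed
  \<comment> \<open>States agree with their initial data only almost surely; at \<open>t = 0\<close>
    the integral over a point is zero, and its uniqueness identifies the two energies.\<close>
  have E0: "energy U Z 0 = E0" if "0 \<le> T"
    using has_integral_unique[OF hi[of 0, simplified] has_integral_refl(2)] that by simp
  have rate: "g1 s + g2 s \<le> - \<kappa> * energy U Z s
      + K * (mean_sq (v s) + mean_sq (r1 s) + mean_sq (r2 s) + mean_sq (r3 s))" if s: "s \<in> {0..T}" for s
  proof -
    define Y where "Y w = U s w - Z s w" for w
    note y' = y[OF s, folded Y_def]
    note fy = fluctuation_mult[OF y']
    have fl: "fluctuation (flt0 s) (\<lambda>w. (cA d + cB d ** \<Theta>) *v Y w + cB d *v v s w)"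
      "fluctuation (flt0 s) (\<lambda>w. (cC d + cD d ** \<Theta>) *v Y w + cD d *v v s w)"
      "fluctuation (flt0 s) (\<lambda>w. cG d *v Y w)"
      by (intro fluctuation_add fluctuation_mult y' v s)+
    have kn: "known (flt0 s) (\<lambda>w. (hatA d + cB d ** \<Theta>b) *v Z s w + r1 s w)"
      "known (flt0 s) (\<lambda>w. (hatC d + cD d ** \<Theta>b) *v Z s w + r2 s w)"
      "known (flt0 s) (\<lambda>w. hatG d *v Z s w + r3 s w)"
      by (intro known_add known_mult z r s)+
    have Um: "U s \<in> borel_measurable M" using U s by (auto simp: l2_ito_def)
    have UY: "AE w in M. U s w = Y w + Z s w" by (simp add: Y_def)
    note \<beta>s = \<beta>[OF s, folded Y_def, unfolded \<beta>'[OF s]]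
    have \<alpha>0s: "AE w in M. \<alpha>0 s w = cG d *v Y w + (hatG d *v Z s w + r3 s w)" by (simp add: Y_def \<alpha>0[OF s] \<alpha>0'[OF s])
    note sq = fluctuation_sqint[OF y'] known_sqint[OF z[OF s]] fluctuation_sqint[OF fl(1)] fluctuation_sqint[OF fl(2)]
      fluctuation_sqint[OF fl(3)] known_sqint[OF kn(1)] known_sqint[OF kn(2)] known_sqint[OF kn(3)]
      fluctuation_sqint[OF v[OF s]] known_sqint[OF r(1)[OF s]] known_sqint[OF r(2)[OF s]] known_sqint[OF r(3)[OF s]]
    have "g1 s + g2 s
      = (\<integral>w. 2 * ((P *v Y w) \<bullet> ((cA d + cB d ** \<Theta>) *v Y w + cB d *v v s w))
        + ((cC d + cD d ** \<Theta>) *v Y w + cD d *v v s w) \<bullet> (P *v ((cC d + cD d ** \<Theta>) *v Y w + cD d *v v s w))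
        + (cG d *v Y w) \<bullet> (P *v (cG d *v Y w)) \<partial>M)
      + (\<integral>w. 2 * ((Pib *v Z s w) \<bullet> ((hatA d + cB d ** \<Theta>b) *v Z s w + r1 s w))
        + ((hatC d + cD d ** \<Theta>b) *v Z s w + r2 s w) \<bullet> (P *v ((hatC d + cD d ** \<Theta>b) *v Z s w + r2 s w))
        + (hatG d *v Z s w + r3 s w) \<bullet> (Pib *v (hatG d *v Z s w + r3 s w)) \<partial>M)"
      using product_rate[OF sym(1,2) y' fl z[OF s] kn UY \<beta>s \<alpha>[OF s, folded Y_def] \<alpha>0s Um m[OF s]]
      unfolding g1_def g2_def \<beta>'[OF s] \<alpha>0'[OF s] .
    also have "\<dots> \<le> (\<integral>w. - \<kappa> * (Y w \<bullet> (P *v Y w)) + K * (norm (v s w))\<^sup>2 \<partial>M)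
      + (\<integral>w. - \<kappa> * (Z s w \<bullet> (Pib *v Z s w)) + K * ((norm (r1 s w))\<^sup>2 + (norm (r2 s w))\<^sup>2 + (norm (r3 s w))\<^sup>2) \<partial>M)"
      by (intro add_mono integral_mono dissipative Bochner_Integration.integrable_add integrable_mult_right sqint_inner
          sqint_mult_mat sq sqint_integrable_sq)
    also have "\<dots> = - \<kappa> * energy U Z s + K * (mean_sq (v s) + mean_sq (r1 s) + mean_sq (r2 s) + mean_sq (r3 s))"
      unfolding energy_eq[of s U Z, OF y[OF s] z[OF s] Um] Y_def[symmetric]
      using sqint_inner[OF sq(1) sqint_mult_mat[OF sq(1), of P]] sqint_inner[OF sq(2) sqint_mult_mat[OF sq(2), of Pib]]
        sqint_integrable_sq[OF sq(9)] sqint_integrable_sq[OF sq(10)] sqint_integrable_sq[OF sq(11)] sqint_integrable_sq[OF sq(12)]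
      by (simp add: distrib_left)
    finally show ?thesis .
  qed
  show thesis
    by (rule that[of "\<lambda>s. g1 s + g2 s"]) (use hi E0 rate in \<open>auto simp: E0_def\<close>)
qed

text \<open>Constant forcing against exponential dissipation: the energy stays below its initial
  value plus the equilibrium level, a number free of \<open>t\<close> and \<open>T\<close>.\<close>

lemma energy_bounded:
  assumes S: "mean_field_solution M W W0 F0 d I T \<xi> (\<lambda>s. \<Theta>) (\<lambda>s. \<Theta>b) (\<lambda>s. \<theta>) X Z u" and t: "t \<in> {0..T}"
  shows "energy X Z t \<le> (\<integral>w. \<xi> w \<bullet> (P *v \<xi> w) \<partial>M) + (\<integral>w. \<xi> w \<partial>M) \<bullet> ((Pib - P) *v (\<integral>w. \<xi> w \<partial>M)) + 1
    + K / \<kappa> * ((norm (cB d *v \<theta> + cb d))\<^sup>2 + (norm (cD d *v \<theta> + csigma d))\<^sup>2 + (norm (cgamma d))\<^sup>2)"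
proof -
  interpret S: mean_field_solution M W W0 F0 d I T \<xi> "\<lambda>s. \<Theta>" "\<lambda>s. \<Theta>b" "\<lambda>s. \<theta>" X Z u by (rule S)
  define B where "B = (norm (cB d *v \<theta> + cb d))\<^sup>2 + (norm (cD d *v \<theta> + csigma d))\<^sup>2 + (norm (cgamma d))\<^sup>2"
  have B: "0 \<le> B" by (simp add: B_def)
  have T: "0 \<le> T" using t by auto
  obtain g where g: "\<And>t. t \<in> {0..T} \<Longrightarrow> (g has_integral (energy X Z t - energy X Z 0)) {0..t}"
    "\<And>s. s \<in> {0..T} \<Longrightarrow> g s \<le> - \<kappa> * energy X Z s + K * B"
    "energy X Z 0 = (\<integral>w. \<xi> w \<bullet> (P *v \<xi> w) \<partial>M) + (\<integral>w. \<xi> w \<partial>M) \<bullet> ((Pib - P) *v (\<integral>w. \<xi> w \<partial>M))"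
  proof (rule energy_rate[OF S.l2_ito_X S.l2_ito_Z, where v = "\<lambda>s w. 0 :: real^'m" and ?r1.0 = "\<lambda>s w. cB d *v \<theta> + cb d"
        and ?r2.0 = "\<lambda>s w. cD d *v \<theta> + csigma d" and ?r3.0 = "\<lambda>s w. cgamma d"])
    fix s assume s: "s \<in> {0..T}"
    show "fluctuation (flt0 s) (\<lambda>w. X s w - Z s w)" "known (flt0 s) (Z s)" "S.drift s \<in> borel_measurable M"
      "S.diff s \<in> borel_measurable M" "S.diff0 s \<in> borel_measurable M"
      by (rule S.fluctuation_state[OF s] S.known_mean[OF s] S.coefficients_measurable[OF s])+
    show "fluctuation (flt0 s) (\<lambda>w. 0 :: real^'m)" by (simp add: fluctuation_def)
    show "known (flt0 s) (\<lambda>w. cB d *v \<theta> + cb d)" "known (flt0 s) (\<lambda>w. cD d *v \<theta> + csigma d)" "known (flt0 s) (\<lambda>w. cgamma d)"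
      by (rule known_const)+
    show "AE w in M. S.drift s w = (cA d + cB d ** \<Theta>) *v (X s w - Z s w) + cB d *v 0 + S.mdrift s w"
      using S.drift_eq[OF s] by simp
    show "AE w in M. S.diff s w = (cC d + cD d ** \<Theta>) *v (X s w - Z s w) + cD d *v 0
        + ((hatC d + cD d ** \<Theta>b) *v Z s w + (cD d *v \<theta> + csigma d))"
      using S.diff_eq[OF s]
      by eventually_elim (simp add: matrix_vector_mult_add_rdistrib matrix_vector_right_distrib matrix_vector_mul_assoc add_ac)
    show "S.diff0 s w = cG d *v (X s w - Z s w) + S.mdiff0 s w" for w by (rule S.diff0_eq)
    show "S.mdrift s w = (hatA d + cB d ** \<Theta>b) *v Z s w + (cB d *v \<theta> + cb d)" for w
      by (simp add: S.mdrift_def matrix_vector_mult_add_rdistrib matrix_vector_right_distrib matrix_vector_mul_assoc add_ac)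
    show "S.mdiff0 s w = hatG d *v Z s w + cgamma d" for w by (simp add: S.mdiff0_def)
  next
    fix g assume "\<And>t. t \<in> {0..T} \<Longrightarrow> (g has_integral (energy X Z t - energy X Z 0)) {0..t}"
      "\<And>s. s \<in> {0..T} \<Longrightarrow> g s \<le> - \<kappa> * energy X Z s + K * (mean_sq (\<lambda>w. 0 :: real^'m)
        + mean_sq (\<lambda>w. cB d *v \<theta> + cb d) + mean_sq (\<lambda>w. cD d *v \<theta> + csigma d) + mean_sq (\<lambda>w. cgamma d))"
      "0 \<le> T \<Longrightarrow> energy X Z 0 = (\<integral>w. \<xi> w \<bullet> (P *v \<xi> w) \<partial>M)
        + (\<integral>w. (\<integral>w. \<xi> w \<partial>M) \<bullet> ((Pib - P) *v (\<integral>w. \<xi> w \<partial>M)) \<partial>M)"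
    then show thesis using that[of g] T by (simp add: B_def prob_space)
  qed
  have E0: "0 \<le> energy X Z 0"
    by (rule energy_bounds(1)) (use T in \<open>auto intro!: S.fluctuation_state S.known_mean sqint_measurable S.sqint_X\<close>)
  \<comment> \<open>A constant comparison function: dissipation at the level
    \<open>K / \<kappa> * B\<close> balances the forcing, and the 1 makes both inequalities
    strict.\<close>
  have "energy X Z t < energy X Z 0 + 1 + K / \<kappa> * B"
  proof (rule scalar_comparison[where g = g and w' = "\<lambda>s. 0" and \<phi> = "\<lambda>s. - \<kappa>" and \<psi> = "\<lambda>s. K * B", OF g(1) _ _ _ _ _ _ _ t])
    show "- \<kappa> * (energy X Z 0 + 1 + K / \<kappa> * B) + K * B < 0"
    proof -
      have "- \<kappa> * (energy X Z 0 + 1 + K / \<kappa> * B) + K * B = - \<kappa> * (energy X Z 0 + 1)" using \<kappa> by (simp add: field_simps)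
      also have "\<dots> < 0" using \<kappa> E0 by (simp add: mult_neg_pos)
      finally show ?thesis .
    qed
    have "0 \<le> K / \<kappa> * B" using \<kappa> K B by simp
    then show "energy X Z 0 < energy X Z 0 + 1 + K / \<kappa> * B" by linarith
  qed (use g(2) in \<open>auto intro!: derivative_eq_intros\<close>)
  then show ?thesis unfolding g(3) B_def by simp
qed

text \<open>The difference solves the ergodic closed-loop equation with the gain error as forcing.
  That error multiplies the perturbed state, which is the difference plus a state of energy at most
  \<open>b\<close>; hence the factor \<open>v s + 1\<close>.\<close>

lemma energy_difference:
  assumes S: "mean_field_solution M W W0 F0 d I T \<xi> \<Theta>' \<Theta>b' \<theta>' X Z u"
    and Sb: "mean_field_solution M W W0 F0 d Ib T \<xi>b (\<lambda>s. \<Theta>) (\<lambda>s. \<Theta>b) (\<lambda>s. \<theta>) Xb Zb ub"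
    and near: "\<And>s x. s \<in> {0..T} \<Longrightarrow> (norm ((\<Theta>' s - \<Theta>) *v x))\<^sup>2 \<le> q s * (norm x)\<^sup>2"
      "\<And>s x. s \<in> {0..T} \<Longrightarrow> (norm ((\<Theta>b' s - \<Theta>b) *v x))\<^sup>2 \<le> q s * (norm x)\<^sup>2"
      "\<And>s. s \<in> {0..T} \<Longrightarrow> (norm (\<theta>' s - \<theta>))\<^sup>2 \<le> q s"
    and bounded: "\<And>s. s \<in> {0..T} \<Longrightarrow> energy Xb Zb s \<le> b" and b: "0 \<le> b"
  defines "v \<equiv> energy (\<lambda>s w. X s w - Xb s w) (\<lambda>s w. Z s w - Zb s w)"
    and "h \<equiv> 2 * (2 * K + 2 * K * b + 1)"
  obtains g where "\<forall>t\<in>{0..T}. (g has_integral (v t - v 0)) {0..t}"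
    "\<forall>s\<in>{0..T}. g s \<le> - \<kappa> * v s + K * (1 + 2 * K) * h * q s * (v s + 1)"
    "\<forall>s\<in>{0..T}. 0 \<le> v s"
    "\<forall>s\<in>{0..T}. sq_deviation X Xb u ub s \<le> ennreal ((2 * K + 4 * K * K) * v s + 4 * h * q s * (v s + 1))"
    "0 \<le> T \<longrightarrow> v 0 = (\<integral>w. (\<xi> w - \<xi>b w) \<bullet> (P *v (\<xi> w - \<xi>b w)) \<partial>M)
       + (\<integral>w. \<xi> w - \<xi>b w \<partial>M) \<bullet> ((Pib - P) *v (\<integral>w. \<xi> w - \<xi>b w \<partial>M))"
proof -
  interpret S: mean_field_solution M W W0 F0 d I T \<xi> \<Theta>' \<Theta>b' \<theta>' X Z u by (rule S)
  interpret Sb: mean_field_solution M W W0 F0 d Ib T \<xi>b "\<lambda>s. \<Theta>" "\<lambda>s. \<Theta>b" "\<lambda>s. \<theta>" Xb Zb ub by (rule Sb)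
  \<comment> \<open>\<open>V\<close> and \<open>Vb\<close> are the fluctuating and known parts of
    the control error caused by the gains; what remains of the control difference is the unperturbed
    feedback applied to the state difference.\<close>
  define V where "V s w = (\<Theta>' s - \<Theta>) *v (X s w - Z s w)" for s w
  define Vb where "Vb s w = (\<Theta>b' s - \<Theta>b) *v Z s w + (\<theta>' s - \<theta>)" for s w
  define Y where "Y s w = (X s w - Xb s w) - (Z s w - Zb s w)" for s w
  have Y: "Y s w = (X s w - Z s w) - (Xb s w - Zb s w)" for s w by (simp add: Y_def)
  have fY: "fluctuation (flt0 s) (Y s)" and fV: "fluctuation (flt0 s) (V s)" and kZ: "known (flt0 s) (\<lambda>w. Z s w - Zb s w)"
    and kV: "known (flt0 s) (Vb s)" if "s \<in> {0..T}" for s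
    unfolding Y[abs_def] V_def[abs_def] Vb_def[abs_def]
    by (intro fluctuation_diff fluctuation_mult known_add known_diff known_mult S.fluctuation_state Sb.fluctuation_state
        S.known_mean Sb.known_mean known_const that)+
  have XX: "sqint M (\<lambda>w. X s w - Xb s w)" if "s \<in> {0..T}" for s
    by (intro sqint_diff S.sqint_X Sb.sqint_X that)
  note vb = energy_bounds[of _ "\<lambda>s w. X s w - Xb s w" "\<lambda>s w. Z s w - Zb s w", OF fY[unfolded Y_def[abs_def]] kZ sqint_measurable[OF XX],
      folded v_def Y_def]
  have v0: "0 \<le> v s" if "s \<in> {0..T}" for s using vb(1) that by blast
  have q0: "0 \<le> q s" if "s \<in> {0..T}" for s using order_trans[OF zero_le_power2 near(3)[OF that]] .
  have VV: "mean_sq (V s) + mean_sq (Vb s) \<le> h * q s * (v s + 1)" if s: "s \<in> {0..T}" for s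
  proof -
    have b1: "mean_sq (Y s) + mean_sq (\<lambda>w. Z s w - Zb s w) \<le> K * v s" using vb(2)[OF s s s] .
    have "mean_sq (\<lambda>w. Xb s w - Zb s w) + mean_sq (Zb s) \<le> K * energy Xb Zb s"
      by (rule energy_bounds(2)[of s Xb Zb, OF Sb.fluctuation_state[OF s] Sb.known_mean[OF s] sqint_measurable[OF Sb.sqint_X[OF s]]])
    also have "\<dots> \<le> K * b" using bounded[OF s] K by simp
    finally have b2: "mean_sq (\<lambda>w. Xb s w - Zb s w) + mean_sq (Zb s) \<le> K * b" .
    have "mean_sq (\<lambda>w. X s w - Z s w) = mean_sq (\<lambda>w. Y s w + (Xb s w - Zb s w))" by (simp add: Y)
    also have "\<dots> \<le> 2 * mean_sq (Y s) + 2 * mean_sq (\<lambda>w. Xb s w - Zb s w)"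
      by (intro mean_sq_add fluctuation_sqint[OF fY[OF s]] fluctuation_sqint[OF Sb.fluctuation_state[OF s]])
    finally have b3: "mean_sq (\<lambda>w. X s w - Z s w) \<le> 2 * mean_sq (Y s) + 2 * mean_sq (\<lambda>w. Xb s w - Zb s w)" .
    have "mean_sq (Z s) = mean_sq (\<lambda>w. (Z s w - Zb s w) + Zb s w)" by simp
    also have "\<dots> \<le> 2 * mean_sq (\<lambda>w. Z s w - Zb s w) + 2 * mean_sq (Zb s)"
      by (intro mean_sq_add known_sqint[OF kZ[OF s]] Sb.sqint_Z s)
    finally have b4: "mean_sq (Z s) \<le> 2 * mean_sq (\<lambda>w. Z s w - Zb s w) + 2 * mean_sq (Zb s)" .
    have V1: "mean_sq (V s) \<le> q s * mean_sq (\<lambda>w. X s w - Z s w)"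
      by (rule mean_sq_mono[OF fluctuation_sqint[OF fV[OF s]] fluctuation_sqint[OF S.fluctuation_state[OF s]]])
         (simp add: V_def near(1)[OF s])
    \<comment> \<open>Here \<open>y\<close>, \<open>z'\<close> belong to the difference,
      \<open>y'\<close>, \<open>z''\<close> to the reference state, and \<open>x\<close>,
      \<open>z\<close> to the perturbed state; the shape of the bound is the origin of
      \<open>h\<close>.\<close>
    have arith: "x + 2 * z + 2 \<le> 2 * (2 * A + 2 * B + 1)"
      if "0 \<le> y" "0 \<le> y'" "y + z' \<le> A" "y' + z'' \<le> B" "x \<le> 2 * y + 2 * y'" "z \<le> 2 * z' + 2 * z''"
      for x y y' z z' z'' A B :: real
    proof -
      have "2 * z \<le> 4 * z' + 4 * z''" "4 * y + 4 * z' \<le> 4 * A" "4 * y' + 4 * z'' \<le> 4 * B" using that by simp_all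
      then show ?thesis using that(1,2,5) by simp
    qed
    have "mean_sq (Vb s) \<le> 2 * mean_sq (\<lambda>w. (\<Theta>b' s - \<Theta>b) *v Z s w) + 2 * mean_sq (\<lambda>w. \<theta>' s - \<theta>)"
      unfolding Vb_def by (intro mean_sq_add sqint_mult_mat S.sqint_Z s sqint_const)
    also have "\<dots> \<le> 2 * (q s * mean_sq (Z s)) + 2 * q s"
      by (intro add_mono mult_left_mono mean_sq_mono sqint_mult_mat S.sqint_Z s near(2)) (simp_all add: prob_space near(3)[OF s])
    finally have "mean_sq (V s) + mean_sq (Vb s) \<le> q s * (mean_sq (\<lambda>w. X s w - Z s w) + 2 * mean_sq (Z s) + 2)"
      using V1 by (simp add: algebra_simps)
    also have "\<dots> \<le> q s * (2 * (2 * (K * v s) + 2 * (K * b) + 1))"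
    proof (intro mult_left_mono q0 s)
      have "0 \<le> mean_sq (Y s)" "0 \<le> mean_sq (\<lambda>w. Xb s w - Zb s w)" by simp_all
      then show "mean_sq (\<lambda>w. X s w - Z s w) + 2 * mean_sq (Z s) + 2 \<le> 2 * (2 * (K * v s) + 2 * (K * b) + 1)"
        by (rule arith[OF _ _ b1 b2 b3 b4])
    qed
    also have "\<dots> \<le> q s * (h * (v s + 1))"
    proof (intro mult_left_mono q0 s)
      have "0 \<le> K * b * v s" using K b v0[OF s] by simp
      then show "2 * (2 * (K * v s) + 2 * (K * b) + 1) \<le> h * (v s + 1)"
        using v0[OF s] K by (simp add: h_def algebra_simps)
    qed
    finally show ?thesis by (simp add: mult_ac)
  qed
  have dev: "sq_deviation X Xb u ub s \<le> ennreal ((2 * K + 4 * K * K) * v s + 4 * h * q s * (v s + 1))" if s: "s \<in> {0..T}" for s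
  proof -
    note sY = fluctuation_sqint[OF fY[OF s]] and sZ = known_sqint[OF kZ[OF s]]
      and sV = fluctuation_sqint[OF fV[OF s]] and sVb = known_sqint[OF kV[OF s]]
    note b1 = vb(2)[OF s s s]
    have su: "sqint M (\<lambda>w. u s w - ub s w)" by (intro sqint_diff S.sqint_u Sb.sqint_u s)
    have "mean_sq (\<lambda>w. X s w - Xb s w) = mean_sq (\<lambda>w. Y s w + (Z s w - Zb s w))" by (simp add: Y_def)
    also have "\<dots> \<le> 2 * mean_sq (Y s) + 2 * mean_sq (\<lambda>w. Z s w - Zb s w)" by (rule mean_sq_add[OF sY sZ])
    finally have dX: "mean_sq (\<lambda>w. X s w - Xb s w) \<le> 2 * (K * v s)" using b1 by linarith
    define w1 where "w1 w = \<Theta> *v Y s w + \<Theta>b *v (Z s w - Zb s w)" for w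
    define w2 where "w2 w = V s w + Vb s w" for w
    have w: "sqint M w1" "sqint M w2" unfolding w1_def[abs_def] w2_def[abs_def] by (intro sqint_add sqint_mult_mat sY sZ sV sVb)+
    have "mean_sq (\<lambda>w. u s w - ub s w) = mean_sq (\<lambda>w. w1 w + w2 w)"
    proof (rule integral_cong_AE)
      show "(\<lambda>w. (norm (u s w - ub s w))\<^sup>2) \<in> borel_measurable M" "(\<lambda>w. (norm (w1 w + w2 w))\<^sup>2) \<in> borel_measurable M"
        using sqint_integrable_sq[OF su] sqint_integrable_sq[OF sqint_add[OF w]] by auto
      show "AE w in M. (norm (u s w - ub s w))\<^sup>2 = (norm (w1 w + w2 w))\<^sup>2"
        using S.feedback[OF S.in_I[OF s]] Sb.feedback[OF Sb.in_I[OF s]]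
      proof eventually_elim
        case (elim w)
        have "u s w - ub s w = w1 w + w2 w"
          unfolding elim w1_def w2_def V_def Vb_def Y
          by (simp add: matrix_vector_mult_diff_rdistrib matrix_vector_mult_diff_distrib)
        then show ?case by simp
      qed
    qed
    also have "\<dots> \<le> 2 * mean_sq w1 + 2 * mean_sq w2" by (rule mean_sq_add[OF w])
    also have "mean_sq w1 \<le> 2 * mean_sq (\<lambda>w. \<Theta> *v Y s w) + 2 * mean_sq (\<lambda>w. \<Theta>b *v (Z s w - Zb s w))"
      unfolding w1_def by (intro mean_sq_add sqint_mult_mat sY sZ)
    also have "\<dots> \<le> 2 * (K * mean_sq (Y s)) + 2 * (K * mean_sq (\<lambda>w. Z s w - Zb s w))"
      by (intro add_mono mult_left_mono mean_sq_mono sqint_mult_mat sY sZ gain) simp_all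
    also have "\<dots> = 2 * K * (mean_sq (Y s) + mean_sq (\<lambda>w. Z s w - Zb s w))" by (simp add: algebra_simps)
    also have "\<dots> \<le> 2 * K * (K * v s)" using b1 K by (intro mult_left_mono) auto
    also have "mean_sq w2 \<le> 2 * mean_sq (V s) + 2 * mean_sq (Vb s)" unfolding w2_def by (rule mean_sq_add[OF sV sVb])
    finally have "mean_sq (\<lambda>w. u s w - ub s w) \<le> 4 * (K * (K * v s)) + 4 * (mean_sq (V s) + mean_sq (Vb s))" by simp
    with dX VV[OF s] have le: "mean_sq (\<lambda>w. X s w - Xb s w) + mean_sq (\<lambda>w. u s w - ub s w)
        \<le> (2 * K + 4 * K * K) * v s + 4 * h * q s * (v s + 1)" by (simp add: algebra_simps)
    have "sq_deviation X Xb u ub s = ennreal (\<integral>w. (norm (X s w - Xb s w))\<^sup>2 + (norm (u s w - ub s w))\<^sup>2 \<partial>M)"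
      unfolding sq_deviation_def
      by (rule nn_integral_eq_integral)
         (simp_all add: sqint_integrable_sq[OF XX[OF s]] sqint_integrable_sq[OF su])
    also have "\<dots> = ennreal (mean_sq (\<lambda>w. X s w - Xb s w) + mean_sq (\<lambda>w. u s w - ub s w))"
      by (simp add: sqint_integrable_sq[OF XX[OF s]] sqint_integrable_sq[OF su])
    finally show ?thesis by (rule ord_eq_le_trans[OF _ ennreal_leI[OF le]])
  qed
  have mean: "(\<integral>w. \<xi> w \<partial>M) - (\<integral>w. \<xi>b w \<partial>M) = (\<integral>w. \<xi> w - \<xi>b w \<partial>M)"
    using sqint_integrable[OF L4_F0_sqint(2)[OF S.\<xi>]] sqint_integrable[OF L4_F0_sqint(2)[OF Sb.\<xi>]] by simp
  note lX = l2_ito_diff[OF S.l2_ito_X Sb.l2_ito_X]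
  have lZ: "l2_ito T (\<lambda>w. (\<integral>w. \<xi> w \<partial>M) - (\<integral>w. \<xi>b w \<partial>M)) (\<lambda>s w. S.mdrift s w - Sb.mdrift s w) (\<lambda>s w. 0)
      (\<lambda>s w. S.mdiff0 s w - Sb.mdiff0 s w) (\<lambda>s w. Z s w - Zb s w)"
    using l2_ito_diff[OF S.l2_ito_Z Sb.l2_ito_Z] by simp
  note lin = matrix_vector_mult_add_rdistrib matrix_vector_right_distrib matrix_vector_mul_assoc
    matrix_vector_mult_diff_rdistrib matrix_vector_mult_diff_distrib
  show thesis
  proof (rule energy_rate[OF lX lZ, where v = V and ?r1.0 = "\<lambda>s w. cB d *v Vb s w"
        and ?r2.0 = "\<lambda>s w. cD d *v Vb s w" and ?r3.0 = "\<lambda>s w. 0"])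
    fix s assume s: "s \<in> {0..T}"
    show "fluctuation (flt0 s) (\<lambda>w. (X s w - Xb s w) - (Z s w - Zb s w))" using fY[OF s] by (simp add: Y_def[abs_def])
    show "fluctuation (flt0 s) (V s)" "known (flt0 s) (\<lambda>w. Z s w - Zb s w)" by (rule fV[OF s] kZ[OF s])+
    show "known (flt0 s) (\<lambda>w. cB d *v Vb s w)" "known (flt0 s) (\<lambda>w. cD d *v Vb s w)"
      by (rule known_mult[OF kV[OF s]])+
    show "known (flt0 s) (\<lambda>w. 0 :: real^'n)" by (rule known_const)
    show "(\<lambda>w. S.drift s w - Sb.drift s w) \<in> borel_measurable M" "(\<lambda>w. S.diff s w - Sb.diff s w) \<in> borel_measurable M"
      "(\<lambda>w. S.diff0 s w - Sb.diff0 s w) \<in> borel_measurable M"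
      by (intro borel_measurable_diff S.coefficients_measurable Sb.coefficients_measurable s)+
    show "AE w in M. S.drift s w - Sb.drift s w
        = ((cA d + cB d ** \<Theta>) *v ((X s w - Xb s w) - (Z s w - Zb s w)) + cB d *v V s w) + (S.mdrift s w - Sb.mdrift s w)"
      using S.drift_eq[OF s] Sb.drift_eq[OF s]
      by eventually_elim (simp add: V_def lin)
    show "AE w in M. S.diff s w - Sb.diff s w
        = ((cC d + cD d ** \<Theta>) *v ((X s w - Xb s w) - (Z s w - Zb s w)) + cD d *v V s w)
          + ((hatC d + cD d ** \<Theta>b) *v (Z s w - Zb s w) + cD d *v Vb s w)"
      using S.diff_eq[OF s] Sb.diff_eq[OF s]
      by eventually_elim (simp add: V_def Vb_def lin)
    show "S.diff0 s w - Sb.diff0 s w = cG d *v ((X s w - Xb s w) - (Z s w - Zb s w)) + (S.mdiff0 s w - Sb.mdiff0 s w)" for w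
      by (simp add: S.diff0_eq Sb.diff0_eq lin)
    show "S.mdrift s w - Sb.mdrift s w = (hatA d + cB d ** \<Theta>b) *v (Z s w - Zb s w) + cB d *v Vb s w" for w
      by (simp add: S.mdrift_def Sb.mdrift_def Vb_def lin)
    show "S.mdiff0 s w - Sb.mdiff0 s w = hatG d *v (Z s w - Zb s w) + 0" for w
      by (simp add: S.mdiff0_def Sb.mdiff0_def lin)
  next
    fix g assume g: "\<And>t. t \<in> {0..T} \<Longrightarrow> (g has_integral (energy (\<lambda>s w. X s w - Xb s w) (\<lambda>s w. Z s w - Zb s w) t
          - energy (\<lambda>s w. X s w - Xb s w) (\<lambda>s w. Z s w - Zb s w) 0)) {0..t}"
      "\<And>s. s \<in> {0..T} \<Longrightarrow> g s \<le> - \<kappa> * energy (\<lambda>s w. X s w - Xb s w) (\<lambda>s w. Z s w - Zb s w) s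
        + K * (mean_sq (V s) + mean_sq (\<lambda>w. cB d *v Vb s w) + mean_sq (\<lambda>w. cD d *v Vb s w) + mean_sq (\<lambda>w. 0 :: real^'n))"
      "0 \<le> T \<Longrightarrow> energy (\<lambda>s w. X s w - Xb s w) (\<lambda>s w. Z s w - Zb s w) 0 = (\<integral>w. (\<xi> w - \<xi>b w) \<bullet> (P *v (\<xi> w - \<xi>b w)) \<partial>M)
        + (\<integral>w. ((\<integral>w. \<xi> w \<partial>M) - (\<integral>w. \<xi>b w \<partial>M)) \<bullet> ((Pib - P) *v ((\<integral>w. \<xi> w \<partial>M) - (\<integral>w. \<xi>b w \<partial>M))) \<partial>M)"
    note g = g[folded v_def]
    have rate: "g s \<le> - \<kappa> * v s + K * (1 + 2 * K) * h * q s * (v s + 1)" if s: "s \<in> {0..T}" for s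
    proof -
      note sVb = known_sqint[OF kV[OF s]]
      have "mean_sq (\<lambda>w. cB d *v Vb s w) \<le> K * mean_sq (Vb s)" "mean_sq (\<lambda>w. cD d *v Vb s w) \<le> K * mean_sq (Vb s)"
        by (intro mean_sq_mono sqint_mult_mat sVb gain)+
      moreover have zero_sq: "mean_sq (\<lambda>w. 0 :: real^'n) = 0" by simp
      moreover have "0 \<le> K * mean_sq (V s)" "0 \<le> mean_sq (Vb s)" using K by simp_all
      \<comment> \<open>The extra multiple of \<open>mean_sq (V s)\<close> is slack, added so that
        the right-hand side factors.\<close>
      ultimately have "mean_sq (V s) + mean_sq (\<lambda>w. cB d *v Vb s w) + mean_sq (\<lambda>w. cD d *v Vb s w) + mean_sq (\<lambda>w. 0 :: real^'n)
          \<le> mean_sq (V s) + mean_sq (Vb s) + 2 * (K * mean_sq (V s)) + 2 * (K * mean_sq (Vb s))"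
        using zero_sq by linarith
      also have "\<dots> = (1 + 2 * K) * (mean_sq (V s) + mean_sq (Vb s))" by (simp add: algebra_simps)
      also have "\<dots> \<le> (1 + 2 * K) * (h * q s * (v s + 1))" using VV[OF s] K by (intro mult_left_mono) auto
      finally have "K * (mean_sq (V s) + mean_sq (\<lambda>w. cB d *v Vb s w) + mean_sq (\<lambda>w. cD d *v Vb s w) + mean_sq (\<lambda>w. 0 :: real^'n))
          \<le> K * ((1 + 2 * K) * (h * q s * (v s + 1)))" using K by (intro mult_left_mono) auto
      with g(2)[OF s] show ?thesis by (simp add: mult.assoc)
    qed
    show thesis
      by (rule that[of g], intro ballI g(1), assumption, intro ballI rate, assumption, intro ballI v0, assumption,
          intro ballI dev, assumption) (use g(3) in \<open>simp add: mean prob_space\<close>)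
  qed
qed

end

text \<open>The fluctuation inequality is \<open>closed_loop_constants\<close> for the stripped
  data, the mean inequality the same lemma for \<open>d\<close>. The rate is the smaller of the two,
  and \<open>K\<close> is a sum that dominates every constant.\<close>

lemma closed_loop_exists:
  fixes d :: "('n::finite, 'm::finite) lq_data"
  assumes basis: "brownian_basis M W W0 F0" and R: "pd_mat (cR d)"
    and Q: "pd_mat (cQ d - transpose (cS d) ** matrix_inv (cR d) ** cS d)"
    and Qhat: "pd_mat (cQ d + cQb d - transpose (cS d) ** matrix_inv (cR d) ** cS d)"
    and alg: "algebraic_riccati_system d P Pib p"
  shows "\<exists>\<kappa> K. closed_loop M W W0 F0 d P Pib (Theta d P) (Theta_bar d P Pib) \<kappa> K"
proof -
  have P: "pd_mat P" "psd_mat P" and Pib: "pd_mat Pib" and e: "Psi2 (strip_bars d) P P = 0" "Psi2 d P Pib = 0"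
    using alg by (auto simp: algebraic_riccati_system_def strip_bars)
  have Q': "pd_mat (hatQ (strip_bars d) - transpose (cS (strip_bars d)) ** matrix_inv (cR (strip_bars d)) ** cS (strip_bars d))"
    "pd_mat (hatQ d - transpose (cS d) ** matrix_inv (cR d) ** cS d)"
    using Q Qhat unfolding strip_bars by (simp_all add: hatQ_def)
  obtain \<kappa>1 k1 where 1: "\<kappa>1 > 0" "k1 > 0" "\<And>x r1 r2 r3. 2 * ((P *v x) \<bullet> ((cA d + cB d ** Theta d P) *v x + r1))
      + ((cC d + cD d ** Theta d P) *v x + r2) \<bullet> (P *v ((cC d + cD d ** Theta d P) *v x + r2))
      + (cG d *v x + r3) \<bullet> (P *v (cG d *v x + r3))
      \<le> - \<kappa>1 * (x \<bullet> (P *v x)) + k1 * ((norm r1)\<^sup>2 + (norm r2)\<^sup>2 + (norm r3)\<^sup>2)"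
    using closed_loop_constants[of "strip_bars d" P P] R P e(1) Q'(1) unfolding strip_bars by metis
  obtain \<kappa>2 k2 where 2: "\<kappa>2 > 0" "k2 > 0" "\<And>x r1 r2 r3. 2 * ((Pib *v x) \<bullet> ((hatA d + cB d ** Theta_bar d P Pib) *v x + r1))
      + ((hatC d + cD d ** Theta_bar d P Pib) *v x + r2) \<bullet> (P *v ((hatC d + cD d ** Theta_bar d P Pib) *v x + r2))
      + (hatG d *v x + r3) \<bullet> (Pib *v (hatG d *v x + r3))
      \<le> - \<kappa>2 * (x \<bullet> (Pib *v x)) + k2 * ((norm r1)\<^sup>2 + (norm r2)\<^sup>2 + (norm r3)\<^sup>2)"
    using closed_loop_constants[OF R P(2) Pib e(2) Q'(2)] by metis
  have gain: "\<exists>l>0. \<forall>x. (norm (A *v x))\<^sup>2 \<le> l * (norm x)\<^sup>2" for A :: "real^'k^'l"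
  proof -
    obtain l where l: "l > 0" "\<And>x. norm (A *v x) \<le> l * norm x" using matrix_bound[of A] by blast
    have "(norm (A *v x))\<^sup>2 \<le> l\<^sup>2 * (norm x)\<^sup>2" for x
      using power_mono[OF l(2) norm_ge_zero, of x 2] by (simp add: power_mult_distrib)
    then show ?thesis using l(1) by (intro exI[of _ "l\<^sup>2"]) auto
  qed
  obtain l1 where l1: "l1 > 0" "\<And>x. (norm (Theta d P *v x))\<^sup>2 \<le> l1 * (norm x)\<^sup>2" using gain by blast
  obtain l2 where l2: "l2 > 0" "\<And>x. (norm (Theta_bar d P Pib *v x))\<^sup>2 \<le> l2 * (norm x)\<^sup>2" using gain by blast
  obtain l3 where l3: "l3 > 0" "\<And>x. (norm (cB d *v x))\<^sup>2 \<le> l3 * (norm x)\<^sup>2" using gain by blast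
  obtain l4 where l4: "l4 > 0" "\<And>x. (norm (cD d *v x))\<^sup>2 \<le> l4 * (norm x)\<^sup>2" using gain by blast
  obtain c1 where c1: "c1 > 0" "\<And>x. c1 * (norm x)\<^sup>2 \<le> x \<bullet> (P *v x)" using pd_mat_coercive[OF P(1)] by metis
  obtain c2 where c2: "c2 > 0" "\<And>x. c2 * (norm x)\<^sup>2 \<le> x \<bullet> (Pib *v x)" using pd_mat_coercive[OF Pib] by metis
  define K where "K = k1 * (l3 + l4) + k2 + 1 / c1 + 1 / c2 + l1 + l2 + l3 + l4"
  have "0 < k1 * (l3 + l4)" "0 < 1 / c1" "0 < 1 / c2" using 1 l3 l4 c1 c2 by simp_all
  then have K: "0 < K" "k1 * (l3 + l4) \<le> K" "k2 \<le> K" "1 / c1 \<le> K" "1 / c2 \<le> K" "l1 \<le> K" "l2 \<le> K" "l3 \<le> K" "l4 \<le> K"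
    using 2(2) l1(1) l2(1) l3(1) l4(1) unfolding K_def by linarith+
  have up: "a \<le> K * y" if "a \<le> k * y" "k \<le> K" "0 \<le> y" for a k y :: real
    using order_trans[OF that(1) mult_right_mono[OF that(2,3)]] .
  have inv: "a \<le> 1 / c * y" if "c * a \<le> y" "c > 0" for a c y :: real
    using that by (simp add: field_simps)
  define \<kappa> where "\<kappa> = min \<kappa>1 \<kappa>2"
  have \<kappa>: "0 < \<kappa>" "\<kappa> \<le> \<kappa>1" "\<kappa> \<le> \<kappa>2" using 1 2 by (simp_all add: \<kappa>_def)
  have pos: "0 \<le> x \<bullet> (P *v x)" "0 \<le> x \<bullet> (Pib *v x)" for x
    using psd_mat_nonneg[OF P(2)] psd_mat_nonneg[OF pd_mat_imp_psd[OF Pib]] by blast+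
  have "closed_loop M W W0 F0 d P Pib (Theta d P) (Theta_bar d P Pib) \<kappa> K"
  proof (intro closed_loop.intro basis closed_loop_axioms.intro \<kappa>(1) K(1) P(1) Pib)
    fix x :: "real^'n" and v :: "real^'m" and r1 r2 r3 :: "real^'n"
    have "(norm (cB d *v v))\<^sup>2 + (norm (cD d *v v))\<^sup>2 \<le> (l3 + l4) * (norm v)\<^sup>2"
      using l3(2)[of v] l4(2)[of v] by (simp add: distrib_right)
    then have "k1 * ((norm (cB d *v v))\<^sup>2 + (norm (cD d *v v))\<^sup>2) \<le> k1 * (l3 + l4) * (norm v)\<^sup>2"
      using 1(2) by (simp add: mult.assoc)
    from up[OF this K(2)] have "k1 * ((norm (cB d *v v))\<^sup>2 + (norm (cD d *v v))\<^sup>2) \<le> K * (norm v)\<^sup>2" by simp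
    moreover have "\<kappa> * (x \<bullet> (P *v x)) \<le> \<kappa>1 * (x \<bullet> (P *v x))" using \<kappa>(2) pos(1) by (rule mult_right_mono)
    ultimately show "2 * ((P *v x) \<bullet> ((cA d + cB d ** Theta d P) *v x + cB d *v v))
        + ((cC d + cD d ** Theta d P) *v x + cD d *v v) \<bullet> (P *v ((cC d + cD d ** Theta d P) *v x + cD d *v v))
        + (cG d *v x) \<bullet> (P *v (cG d *v x)) \<le> - \<kappa> * (x \<bullet> (P *v x)) + K * (norm v)\<^sup>2"
      using 1(3)[of x "cB d *v v" "cD d *v v" 0] by simp
    have "k2 * ((norm r1)\<^sup>2 + (norm r2)\<^sup>2 + (norm r3)\<^sup>2) \<le> K * ((norm r1)\<^sup>2 + (norm r2)\<^sup>2 + (norm r3)\<^sup>2)"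
      by (rule up[OF order_refl K(3)]) simp
    moreover have "\<kappa> * (x \<bullet> (Pib *v x)) \<le> \<kappa>2 * (x \<bullet> (Pib *v x))" using \<kappa>(3) pos(2) by (rule mult_right_mono)
    ultimately show "2 * ((Pib *v x) \<bullet> ((hatA d + cB d ** Theta_bar d P Pib) *v x + r1))
        + ((hatC d + cD d ** Theta_bar d P Pib) *v x + r2) \<bullet> (P *v ((hatC d + cD d ** Theta_bar d P Pib) *v x + r2))
        + (hatG d *v x + r3) \<bullet> (Pib *v (hatG d *v x + r3))
        \<le> - \<kappa> * (x \<bullet> (Pib *v x)) + K * ((norm r1)\<^sup>2 + (norm r2)\<^sup>2 + (norm r3)\<^sup>2)"
      using 2(3)[of x r1 r2 r3] by linarith
    show "(norm x)\<^sup>2 \<le> K * (x \<bullet> (P *v x))" by (rule up[OF inv[OF c1(2,1)] K(4) pos(1)])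
    show "(norm x)\<^sup>2 \<le> K * (x \<bullet> (Pib *v x))" by (rule up[OF inv[OF c2(2,1)] K(5) pos(2)])
    show "(norm (Theta d P *v x))\<^sup>2 \<le> K * (norm x)\<^sup>2" by (rule up[OF l1(2) K(6)]) simp
    show "(norm (Theta_bar d P Pib *v x))\<^sup>2 \<le> K * (norm x)\<^sup>2" by (rule up[OF l2(2) K(7)]) simp
    show "(norm (cB d *v v))\<^sup>2 \<le> K * (norm v)\<^sup>2" by (rule up[OF l3(2) K(8)]) simp
    show "(norm (cD d *v v))\<^sup>2 \<le> K * (norm v)\<^sup>2" by (rule up[OF l4(2) K(9)]) simp
  qed
  then show ?thesis by blast
qed

text \<open>The order of quantifiers matters: one version of the conditional mean is fixed for all
  horizons, so its energy can be bounded for all times.\<close>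

lemma (in brownian_basis) mean_field_solution_of_closed_loop_pair:
  assumes "closed_loop_pair d I \<xi> \<Theta> \<Theta>b \<theta> X u" "L4_F0 \<xi>"
  shows "\<exists>Z. \<forall>T. {0..T} \<subseteq> I \<longrightarrow> 0 \<le> T \<longrightarrow> continuous_on {0..T} \<Theta>b \<longrightarrow> continuous_on {0..T} \<theta>
    \<longrightarrow> mean_field_solution M W W0 F0 d I T \<xi> \<Theta> \<Theta>b \<theta> X Z u"
proof -
  obtain Z where Z: "progressive flt I u" "locally_sq_integrable I u" "mf_state_equation d I \<xi> X Z u"
    "\<forall>t\<in>I. AE w in M. u t w = \<Theta> t *v (X t w - Z t w) + \<Theta>b t *v Z t w + \<theta> t"
    using assms(1) unfolding closed_loop_pair_def by blast
  show ?thesis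
  proof (rule exI[of _ Z], intro allI impI mean_field_solution.intro mean_field_solution_axioms.intro)
    show "brownian_basis M W W0 F0" ..
  qed (use Z assms(2) in auto)
qed

section \<open>Choice of the constants and assembly of the two bounds\<close>

theorem theorem6p3:
  fixes M :: "'w measure" and W W0 :: "real \<Rightarrow> 'w \<Rightarrow> real" and F0 :: "'w measure"
    and d :: "('n::finite, 'm::finite) lq_data"
    and \<mu>0 :: "(real^'n) measure"
    and \<xi> \<xi>b :: "'w \<Rightarrow> real^'n"
    and Xb :: "real \<Rightarrow> 'w \<Rightarrow> real^'n" and ub :: "real \<Rightarrow> 'w \<Rightarrow> real^'m"
  assumes basis: "brownian_basis M W W0 F0"
    and Q_sym: "symmetric_mat (cQ d)" and Qb_sym: "symmetric_mat (cQb d)"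
    and R_pd: "pd_mat (cR d)"
    and Q_pd: "pd_mat (cQ d - transpose (cS d) ** matrix_inv (cR d) ** cS d)"
    and Qhat_pd: "pd_mat (cQ d + cQb d - transpose (cS d) ** matrix_inv (cR d) ** cS d)"
    and stab0: "brownian_basis.L2_stabilizable0 M W W0 F0 (cA d + cAb d) (cG d + cGb d) (cB d)"
    and stab: "brownian_basis.L2_stabilizable M W W0 F0 (cA d) (cC d) (cG d) (cB d) (cD d)"
    and \<mu>0: "P4 \<mu>0"
    and \<xi>: "brownian_basis.L4_F0 M F0 \<xi>" "distr M borel \<xi> = \<mu>0"
      "brownian_basis.independent_of_noise M W W0 \<xi>"
    and \<xi>b: "brownian_basis.L4_F0 M F0 \<xi>b" "distr M borel \<xi>b = \<mu>0"
      "brownian_basis.independent_of_noise M W W0 \<xi>b"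
    and ergodic: "brownian_basis.ergodic_optimal_pair M W W0 F0 d \<xi>b Xb ub"
  shows "\<exists>K>0. \<exists>\<rho>>0. \<forall>T>0. \<forall>X u.
    brownian_basis.finite_horizon_optimal_pair M W W0 F0 d T \<xi> X u \<longrightarrow>
      (\<forall>t\<in>{0..T}. brownian_basis.sq_deviation M X Xb u ub t
          \<le> ennreal (K * (exp (- \<rho> * t) + exp (- \<rho> * (T - t)))))
      \<and> ((AE \<omega> in M. \<xi> \<omega> = \<xi>b \<omega>) \<longrightarrow>
          (\<forall>t\<in>{0..T}. brownian_basis.sq_deviation M X Xb u ub t
            \<le> ennreal (K * exp (- \<rho> * (T - t)))))"
proof -
  interpret brownian_basis M W W0 F0 by (rule basis)
  obtain P Pib p where alg: "algebraic_riccati_system d P Pib p"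
    and erg: "closed_loop_pair d {0..} \<xi>b (\<lambda>t. Theta d P) (\<lambda>t. Theta_bar d P Pib) (\<lambda>t. theta d p P) Xb ub"
    using ergodic unfolding ergodic_optimal_pair_def by blast
  obtain \<kappa> K where cl: "closed_loop M W W0 F0 d P Pib (Theta d P) (Theta_bar d P Pib) \<kappa> K"
    using closed_loop_exists[OF basis R_pd Q_pd Qhat_pd alg] by blast
  interpret closed_loop M W W0 F0 d P Pib "Theta d P" "Theta_bar d P Pib" \<kappa> K by (rule cl)
  obtain Zb where Zb': "\<forall>T. {0..T} \<subseteq> {0..} \<longrightarrow> 0 \<le> T \<longrightarrow> continuous_on {0..T} (\<lambda>t. Theta_bar d P Pib)
      \<longrightarrow> continuous_on {0..T} (\<lambda>t. theta d p P) \<longrightarrow>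
      mean_field_solution M W W0 F0 d {0..} T \<xi>b (\<lambda>t. Theta d P) (\<lambda>t. Theta_bar d P Pib) (\<lambda>t. theta d p P) Xb Zb ub"
    using mean_field_solution_of_closed_loop_pair[OF erg \<xi>b(1)] by blast
  have Zb: "\<And>T. 0 \<le> T \<Longrightarrow> mean_field_solution M W W0 F0 d {0..} T \<xi>b (\<lambda>t. Theta d P) (\<lambda>t. Theta_bar d P Pib) (\<lambda>t. theta d p P) Xb Zb ub"
    by (rule Zb'[rule_format]) (auto intro: continuous_on_const)
  \<comment> \<open>Each time is taken as its own horizon; the bound does not mention the horizon
    and so holds for all times.\<close>
  note eb = energy_bounded[where t = t and T = t for t, OF Zb]
  have "\<exists>b. \<forall>t\<ge>0. energy Xb Zb t \<le> b" by (rule exI, intro allI impI, rule eb) auto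
  then obtain b' where b': "\<forall>t\<ge>0. energy Xb Zb t \<le> b'" by blast
  define b where "b = max 0 b'"
  have b: "0 \<le> b" "energy Xb Zb t \<le> b" if "0 \<le> t" for t
    using b' that by (simp_all add: b_def le_max_iff_disj)
  obtain L c where L: "L > 0" "c > 0" and near: "\<forall>T PT PibT pT. riccati_system d T PT PibT pT \<longrightarrow> (\<forall>t\<in>{0..T}.
      (\<forall>x. norm ((Theta d (PT t) - Theta d P) *v x) \<le> L * exp (- c * (T - t)) * norm x)
      \<and> (\<forall>x. norm ((Theta_bar d (PT t) (PibT t) - Theta_bar d P Pib) *v x) \<le> L * exp (- c * (T - t)) * norm x)
      \<and> norm (theta d (pT t) (PT t) - theta d p P) \<le> L * exp (- c * (T - t)))"
    using riccati_turnpike[OF R_pd Q_pd Qhat_pd alg] by blast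
  define h where "h = 2 * (2 * K + 2 * K * b + 1)"
  have h: "0 < h" using K b(1)[of 0] by (simp add: h_def add_nonneg_pos)
  \<comment> \<open>The forcing coefficient of \<open>energy_difference\<close> when the squared
    gain error is \<open>L\<^sup>2\<close> times an exponential.\<close>
  define J where "J = K * (1 + 2 * K) * h * L\<^sup>2"
  have J: "0 < J" using K h L by (simp add: J_def add_pos_pos)
  \<comment> \<open>The gain error enters squared, which doubles the Riccati rate.\<close>
  have "0 < 2 * c" using L by simp
  then obtain k where k: "k > 0" and forcing: "\<forall>T v g v0. 0 \<le> v0 \<longrightarrow> (\<forall>t\<in>{0..T}. (g has_integral (v t - v 0)) {0..t}) \<longrightarrow>
     (\<forall>t\<in>{0<..T}. g t \<le> (- \<kappa> + J * exp (- (2 * c) * (T - t))) * v t + J * exp (- (2 * c) * (T - t))) \<longrightarrow> v 0 \<le> v0 \<longrightarrow>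
     (\<forall>t\<in>{0..T}. v t \<le> k * (v0 * exp (- \<kappa> * t) + exp (- (2 * c) * (T - t))))"
    using closing_forcing[OF \<kappa> _ J] by blast
  \<comment> \<open>The initial energy of the difference, depending on the initial states alone; the
    absolute value makes its sign evident before any solution is chosen.\<close>
  define v0 where "v0 = \<bar>(\<integral>w. (\<xi> w - \<xi>b w) \<bullet> (P *v (\<xi> w - \<xi>b w)) \<partial>M)
       + (\<integral>w. \<xi> w - \<xi>b w \<partial>M) \<bullet> ((Pib - P) *v (\<integral>w. \<xi> w - \<xi>b w \<partial>M))\<bar>"
  define N where "N = (2 * K + 4 * K * K + 4 * h * L\<^sup>2) * k + 4 * h * L\<^sup>2"
  have N: "0 < N" using K h L k by (simp add: N_def add_pos_pos)
  define \<rho> where "\<rho> = min \<kappa> (2 * c)"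
  have \<rho>: "0 < \<rho>" "\<rho> \<le> \<kappa>" "\<rho> \<le> 2 * c" using \<kappa> L by (simp_all add: \<rho>_def)
  have main: "sq_deviation X Xb u ub t \<le> ennreal (N * (v0 * exp (- \<kappa> * t) + exp (- (2 * c) * (T - t))))"
    if T: "0 < T" and opt: "finite_horizon_optimal_pair d T \<xi> X u" and t: "t \<in> {0..T}" for T X u t
  proof -
    obtain PT PibT pT where ric: "riccati_system d T PT PibT pT"
      and fin: "closed_loop_pair d {0..T} \<xi> (\<lambda>t. Theta d (PT t)) (\<lambda>t. Theta_bar d (PT t) (PibT t)) (\<lambda>t. theta d (pT t) (PT t)) X u"
      using opt unfolding finite_horizon_optimal_pair_def by blast
    have psd: "\<And>t. t \<in> {0..T} \<Longrightarrow> psd_mat (PT t)" and cont: "continuous_on {0..T} PT" "continuous_on {0..T} PibT" "continuous_on {0..T} pT"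
      using ric unfolding riccati_system_def by (auto intro!: continuous_on_has_vector_derivative)
    obtain Z where Z': "\<forall>S. {0..S} \<subseteq> {0..T} \<longrightarrow> 0 \<le> S \<longrightarrow> continuous_on {0..S} (\<lambda>t. Theta_bar d (PT t) (PibT t))
        \<longrightarrow> continuous_on {0..S} (\<lambda>t. theta d (pT t) (PT t))
        \<longrightarrow> mean_field_solution M W W0 F0 d {0..T} S \<xi> (\<lambda>t. Theta d (PT t)) (\<lambda>t. Theta_bar d (PT t) (PibT t))
        (\<lambda>t. theta d (pT t) (PT t)) X Z u"
      using mean_field_solution_of_closed_loop_pair[OF fin \<xi>(1)] by blast
    have T0: "0 \<le> T" using T by simp
    note Z = Z'[rule_format, OF order.refl T0 continuous_on_Theta_bar[OF R_pd psd cont(1,2)] continuous_on_theta[OF R_pd psd cont(1,3)]]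
    define e where "e s = exp (- (2 * c) * (T - s))" for s
    have e: "0 < e s" "(exp (- c * (T - s)))\<^sup>2 = e s" for s
      by (simp_all add: e_def power2_eq_square mult.assoc flip: exp_add)
    have near': "(norm ((Theta d (PT s) - Theta d P) *v x))\<^sup>2 \<le> L\<^sup>2 * e s * (norm x)\<^sup>2"
      "(norm ((Theta_bar d (PT s) (PibT s) - Theta_bar d P Pib) *v x))\<^sup>2 \<le> L\<^sup>2 * e s * (norm x)\<^sup>2"
      "(norm (theta d (pT s) (PT s) - theta d p P))\<^sup>2 \<le> L\<^sup>2 * e s" if "s \<in> {0..T}" for s x
    proof -
      note n = near[rule_format, OF ric that]
      show "(norm ((Theta d (PT s) - Theta d P) *v x))\<^sup>2 \<le> L\<^sup>2 * e s * (norm x)\<^sup>2"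
        using power_mono[OF n[THEN conjunct1, rule_format, of x] norm_ge_zero, of 2] by (simp only: power_mult_distrib e(2))
      show "(norm ((Theta_bar d (PT s) (PibT s) - Theta_bar d P Pib) *v x))\<^sup>2 \<le> L\<^sup>2 * e s * (norm x)\<^sup>2"
        using power_mono[OF n[THEN conjunct2, THEN conjunct1, rule_format, of x] norm_ge_zero, of 2] by (simp only: power_mult_distrib e(2))
      show "(norm (theta d (pT s) (PT s) - theta d p P))\<^sup>2 \<le> L\<^sup>2 * e s"
        using power_mono[OF n[THEN conjunct2, THEN conjunct2] norm_ge_zero, of 2] by (simp only: power_mult_distrib e(2))
    qed
    define v where "v = energy (\<lambda>s w. X s w - Xb s w) (\<lambda>s w. Z s w - Zb s w)"
    have bs: "energy Xb Zb s \<le> b" if "s \<in> {0..T}" for s using b(2)[of s] that by simp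
    obtain g where g': "\<forall>t\<in>{0..T}. (g has_integral (v t - v 0)) {0..t}"
      "\<forall>s\<in>{0..T}. g s \<le> - \<kappa> * v s + K * (1 + 2 * K) * h * (L\<^sup>2 * e s) * (v s + 1)"
      "\<forall>s\<in>{0..T}. 0 \<le> v s"
      "\<forall>s\<in>{0..T}. sq_deviation X Xb u ub s \<le> ennreal ((2 * K + 4 * K * K) * v s + 4 * h * (L\<^sup>2 * e s) * (v s + 1))"
      "0 \<le> T \<longrightarrow> v 0 = (\<integral>w. (\<xi> w - \<xi>b w) \<bullet> (P *v (\<xi> w - \<xi>b w)) \<partial>M)
       + (\<integral>w. \<xi> w - \<xi>b w \<partial>M) \<bullet> ((Pib - P) *v (\<integral>w. \<xi> w - \<xi>b w \<partial>M))"
      unfolding v_def h_def by (rule energy_difference[OF Z Zb[OF T0] near' bs b(1)[OF T0]])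
    note g = g'[rule_format]
    have "v t \<le> k * (v0 * exp (- \<kappa> * t) + e t)"
      unfolding e_def
    proof (rule forcing[rule_format, where g = g and T = T and v = v, OF _ g(1) _ _ t])
      show "0 \<le> v0" "v 0 \<le> v0" using g(5)[OF T0] by (simp_all add: v0_def)
      show "g s \<le> (- \<kappa> + J * exp (- (2 * c) * (T - s))) * v s + J * exp (- (2 * c) * (T - s))" if "s \<in> {0<..T}" for s
      proof -
        have "K * (1 + 2 * K) * h * (L\<^sup>2 * e s) * (v s + 1) = J * e s * v s + J * e s"
          unfolding J_def by (simp add: algebra_simps)
        then have "g s \<le> - \<kappa> * v s + (J * e s * v s + J * e s)" using g(2)[of s] that by simp
        also have "\<dots> = (- \<kappa> + J * e s) * v s + J * e s" by (simp only: distrib_right add.assoc)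
        finally show ?thesis unfolding e_def .
      qed
    qed
    moreover have "(2 * K + 4 * K * K) * v t + 4 * h * (L\<^sup>2 * e t) * (v t + 1) \<le> (2 * K + 4 * K * K + 4 * h * L\<^sup>2) * v t + 4 * h * L\<^sup>2 * e t"
    proof -
      \<comment> \<open>Lets the product of forcing and energy in the deviation bound be absorbed
        into the linear term.\<close>
      have "e t \<le> 1" using t L by (simp add: e_def)
      then have "4 * h * L\<^sup>2 * v t * e t \<le> 4 * h * L\<^sup>2 * v t * 1" using h g(3)[OF t] by (intro mult_left_mono) auto
      then show ?thesis by (simp add: algebra_simps)
    qed
    moreover have "\<dots> \<le> (2 * K + 4 * K * K + 4 * h * L\<^sup>2) * (k * (v0 * exp (- \<kappa> * t) + e t)) + 4 * h * L\<^sup>2 * (v0 * exp (- \<kappa> * t) + e t)"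
      using calculation(1) K h by (intro add_mono mult_left_mono) (auto simp: v0_def)
    ultimately have "(2 * K + 4 * K * K) * v t + 4 * h * (L\<^sup>2 * e t) * (v t + 1) \<le> N * (v0 * exp (- \<kappa> * t) + e t)"
      by (simp add: N_def distrib_right mult.assoc)
    then show ?thesis using order_trans[OF g(4)[OF t] ennreal_leI] by (simp add: e_def)
  qed
  have exp_le: "exp (- \<kappa> * t) \<le> exp (- \<rho> * t)" "exp (- (2 * c) * (T - t)) \<le> exp (- \<rho> * (T - t))" if "t \<in> {0..T}" for t T
    using that \<rho> by (auto intro: mult_right_mono)
  show ?thesis
  \<comment> \<open>One constant for both claims: \<open>v0 + 1\<close> dominates both the factor
    \<open>v0\<close> of the initial layer and the factor 1 of the terminal layer.\<close>
  proof (rule exI[of _ "N * (v0 + 1)"], rule conjI, goal_cases)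
    case 1
    show ?case using N by (simp add: v0_def add_nonneg_pos)
  next
    case 2
    show ?case
    proof (rule exI[of _ \<rho>], intro conjI \<rho>(1) allI impI ballI)
      fix T :: real and X :: "real \<Rightarrow> 'w \<Rightarrow> real^'n" and u :: "real \<Rightarrow> 'w \<Rightarrow> real^'m" and t
      assume T: "0 < T" and opt: "finite_horizon_optimal_pair d T \<xi> X u" and t: "t \<in> {0..T}"
      have v0: "0 \<le> v0" by (simp add: v0_def)
      show "sq_deviation X Xb u ub t \<le> ennreal (N * (v0 + 1) * (exp (- \<rho> * t) + exp (- \<rho> * (T - t))))"
      proof (rule order_trans[OF main[OF T opt t] ennreal_leI])
        have le: "v0 * exp (- \<kappa> * t) + exp (- (2 * c) * (T - t)) \<le> (v0 + 1) * exp (- \<rho> * t) + (v0 + 1) * exp (- \<rho> * (T - t))"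
          using exp_le[OF t] v0 by (intro add_mono mult_mono mult_mono[of 1 _ "exp _", simplified]) auto
        have eq: "N * (v0 + 1) * (x + y) = N * ((v0 + 1) * x + (v0 + 1) * y)" for x y :: real
          by (simp add: algebra_simps)
        show "N * (v0 * exp (- \<kappa> * t) + exp (- (2 * c) * (T - t))) \<le> N * (v0 + 1) * (exp (- \<rho> * t) + exp (- \<rho> * (T - t)))"
          unfolding eq by (rule mult_left_mono[OF le]) (use N in simp)
      qed
      assume eq: "AE w in M. \<xi> w = \<xi>b w"
      \<comment> \<open>Almost surely equal initial states make the initial energy vanish, and with
        it the whole term decaying in \<open>t\<close>.\<close>
      have "(\<integral>w. (\<xi> w - \<xi>b w) \<bullet> (P *v (\<xi> w - \<xi>b w)) \<partial>M) = 0" "(\<integral>w. \<xi> w - \<xi>b w \<partial>M) = 0"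
        by (rule integral_eq_zero_AE, use eq in eventually_elim, simp)+
      then have "v0 = 0" by (simp add: v0_def)
      then show "sq_deviation X Xb u ub t \<le> ennreal (N * (v0 + 1) * exp (- \<rho> * (T - t)))"
        using order_trans[OF main[OF T opt t] ennreal_leI] exp_le(2)[OF t] N by simp
    qed
  qed
qed

end
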